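(* Let $n\ge 3$. The map $\Phi=\phi\circ f$ is a homomorphism $PB_n\to G^2_{n(n-1)}$, where $f\colon PB_n\to {}'G_n^3$ is the map that reads off, along a good and stable representative of a pure braid, the generators corresponding to its critical moments, and $\phi\colon {}'G_n^3\to G^2_{n(n-1)}$ is the map given by $\phi(a'_{ijk})=a_{ij,ik}\,a_{kj,ki}$.
   Context: Let $n\ge 3$. The group ${}'G_n^3$ is given by a presentation with $3\binom{n}{3}$ generators $a'_{ijk}$ indexed by ordered triples of pairwise distinct numbers $i,j,k\in\{1,\dots,n\}$ up to reversal of the order, i.e. $a'_{ijk}=a'_{kji}$ (so $a'_{123}=a'_{321}\ne a'_{132}$), and relations: (1) $(a'_{ijk})^2=1$ for all pairwise distinct $i,j,k$; (2) $a'_{ijk}a'_{pqr}=a'_{pqr}a'_{ijk}$ for all triples of pairwise distinct numbers $i,j,k$ and $p,q,r$ with $|\{i,j,k\}\cap\{p,q,r\}|<2$; (3) $(a'_{ijk}a'_{ijl}a'_{ikl}a'_{jkl})^2=1$ for every quadruple of pairwise distinct $i,j,k,l\in\{1,\dots,n\}$. The group $G^2_{n(n-1)}$: let $P$ be the set of the $n(n-1)$ ordered pairs $ij$ of distinct elements $i,j\in\{1,\dots,n\}$. The generators are $a_{p,q}=a_{q,p}$, one for each unordered pair of distinct elements $p,q\in P$ (for example $a_{12,34}$, $a_{12,31}$). The relations are: $a_{p,q}^2=1$ for each generator; $a_{p,q}a_{r,s}=a_{r,s}a_{p,q}$ for pairwise distinct $p,q,r,s\in P$; $(a_{p,q}a_{p,r}a_{q,r})^2=1$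 for pairwise distinct $p,q,r\in P$. Braids. Fix the base points $z_j=\exp(2\pi \sqrt{-1}\,j/n)$, $j=1,\dots,n$, uniformly distributed on the unit circle. A (pure) braid is a collection of smooth functions $\beta(t)=(z_1(t),\dots,z_n(t))$, $t\in[0,1]$, with values in $\mathbb{C}=\mathbb{R}^2$, such that $z_j(0)=z_j(1)=z_j$ for all $j$ and $z_1(t),\dots,z_n(t)$ are pairwise distinct for every $t$. The pure braid group $PB_n$ is the group of isotopy classes of such braids, the product being concatenation. A critical moment of $\beta$ is a value $t$ for which there are three distinct indices $i,j,k$ such that $z_i(t),z_j(t),z_k(t)$ are collinear. A braid is good and stable if: (i) its set of critical moments is finite; (ii) for each critical moment $t$ there is exactly one triple of indices $\{i,j,k\}$ for which $z_i(t),z_j(t),z_k(t)$ are collinear; (iii) any small perturbation of the braid does not change the number of critical moments. Any braid can be made good and stable by a small perturbation, so every element of $PB_n$ has a good and stable representative. The map $f$. Let $\beta$ be a good and stable pure braid with critical moments $t_1<t_2<\dots<t_m$. With $t_l$ one associates the generator $a'_{i_lj_lk_l}$, where $z_{i_l}(t_l),z_{j_l}(t_l),z_{k_l}(t_l)$ are the three collinear points and $z_{j_l}(t_l)$ is the one lying between the other two. Then $f(\beta)=a'_{i_1j_1k_1}a'_{i_2j_2k_2}\cdots a'_{i_mj_mk_m}\in {}'G_n^3$. The map $\phi$ is defined on generators by $\phi(a'_{ijk})=a_{ij,ik}\,a_{kj,ki}$ for pairwise distinct $i,j,k$. *)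

theory Defs
  imports "HOL-Analysis.Analysis" "HOL-Algebra.Group"
begin

section \<open>Groups given by generators and relations\<close>

text \<open>A letter \<open>(True, x)\<close> stands for the generator \<open>x\<close>, a letter \<open>(False, x)\<close> for its
  formal inverse. A relation \<open>l = r\<close> is the pair of words \<open>(l, r)\<close>.\<close>

type_synonym 'a gword = "(bool \<times> 'a) list"

definition gwords :: "'a set \<Rightarrow> 'a gword set" where
  "gwords S = lists (UNIV \<times> S)"

inductive pres_eq :: "'a set \<Rightarrow> ('a gword \<times> 'a gword) set \<Rightarrow> 'a gword \<Rightarrow> 'a gword \<Rightarrow> bool"
  for S R where
  refl: "w \<in> gwords S \<Longrightarrow> pres_eq S R w w"
| sym: "pres_eq S R v w \<Longrightarrow> pres_eq S R w v"
| trans: "pres_eq S R u v \<Longrightarrow> pres_eq S R v w \<Longrightarrow> pres_eq S R u w"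
| cancel: "u \<in> gwords S \<Longrightarrow> v \<in> gwords S \<Longrightarrow> x \<in> S \<Longrightarrow>
    pres_eq S R (u @ [(b, x), (\<not> b, x)] @ v) (u @ v)"
| rel: "u \<in> gwords S \<Longrightarrow> v \<in> gwords S \<Longrightarrow> (l, r) \<in> R \<Longrightarrow> l \<in> gwords S \<Longrightarrow> r \<in> gwords S \<Longrightarrow>
    pres_eq S R (u @ l @ v) (u @ r @ v)"

definition pres_class :: "'a set \<Rightarrow> ('a gword \<times> 'a gword) set \<Rightarrow> 'a gword \<Rightarrow> 'a gword set" where
  "pres_class S R w = {v. pres_eq S R w v}"

definition presented_group :: "'a set \<Rightarrow> ('a gword \<times> 'a gword) set \<Rightarrow> 'a gword set monoid" where
  "presented_group S R =
    \<lparr>carrier = pres_class S R ` gwords S,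
     mult = (\<lambda>A B. \<Union>a\<in>A. \<Union>b\<in>B. pres_class S R (a @ b)),
     one = pres_class S R []\<rparr>"

text \<open>Words without inverse letters.\<close>

definition pos_word :: "'a list \<Rightarrow> 'a gword" where
  "pos_word xs = map (Pair True) xs"

abbreviation pos_rel :: "'a list \<Rightarrow> 'a list \<Rightarrow> 'a gword \<times> 'a gword" where
  "pos_rel xs ys \<equiv> (pos_word xs, pos_word ys)"


section \<open>The group \<open>'G\<^sub>n\<^sup>3\<close>\<close>

text \<open>The generator \<open>a'\<^sub>i\<^sub>j\<^sub>k = a'\<^sub>k\<^sub>j\<^sub>i\<close> is encoded by its middle index together with the
  unordered pair of its outer indices.\<close>

type_synonym gen3 = "nat \<times> nat set"

definition a3 :: "nat \<Rightarrow> nat \<Rightarrow> nat \<Rightarrow> gen3" where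
  "a3 i j k = (j, {i, k})"

definition gens3 :: "nat \<Rightarrow> gen3 set" where
  "gens3 n = {a3 i j k | i j k. {i, j, k} \<subseteq> {1..n} \<and> distinct [i, j, k]}"

definition rels3 :: "nat \<Rightarrow> (gen3 gword \<times> gen3 gword) set" where
  "rels3 n =
    {pos_rel [a3 i j k, a3 i j k] [] | i j k.
       {i, j, k} \<subseteq> {1..n} \<and> distinct [i, j, k]} \<union>
    {pos_rel [a3 i j k, a3 p q r] [a3 p q r, a3 i j k] | i j k p q r.
       {i, j, k, p, q, r} \<subseteq> {1..n} \<and> distinct [i, j, k] \<and> distinct [p, q, r] \<and>
       card ({i, j, k} \<inter> {p, q, r}) < 2} \<union>
    {pos_rel [a3 i j k, a3 i j l, a3 i k l, a3 j k l, a3 i j k, a3 i j l, a3 i k l, a3 j k l] [] |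
       i j k l. {i, j, k, l} \<subseteq> {1..n} \<and> distinct [i, j, k, l]}"

definition G3 :: "nat \<Rightarrow> gen3 gword set monoid" where
  "G3 n = presented_group (gens3 n) (rels3 n)"

definition G3_class :: "nat \<Rightarrow> gen3 list \<Rightarrow> gen3 gword set" where
  "G3_class n xs = pres_class (gens3 n) (rels3 n) (pos_word xs)"


section \<open>The group \<open>G\<^sup>2\<close> on \<open>n(n - 1)\<close> strands\<close>

type_synonym gen2 = "(nat \<times> nat) set"

definition strands2 :: "nat \<Rightarrow> (nat \<times> nat) set" where
  "strands2 n = {(i, j). i \<in> {1..n} \<and> j \<in> {1..n} \<and> i \<noteq> j}"

definition a2 :: "nat \<times> nat \<Rightarrow> nat \<times> nat \<Rightarrow> gen2" where
  "a2 p q = {p, q}"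

definition gens2 :: "nat \<Rightarrow> gen2 set" where
  "gens2 n = {a2 p q | p q. {p, q} \<subseteq> strands2 n \<and> p \<noteq> q}"

definition rels2 :: "nat \<Rightarrow> (gen2 gword \<times> gen2 gword) set" where
  "rels2 n =
    {pos_rel [a2 p q, a2 p q] [] | p q. {p, q} \<subseteq> strands2 n \<and> p \<noteq> q} \<union>
    {pos_rel [a2 p q, a2 r s] [a2 r s, a2 p q] | p q r s.
       {p, q, r, s} \<subseteq> strands2 n \<and> distinct [p, q, r, s]} \<union>
    {pos_rel [a2 p q, a2 p r, a2 q r, a2 p q, a2 p r, a2 q r] [] | p q r.
       {p, q, r} \<subseteq> strands2 n \<and> distinct [p, q, r]}"

definition G2 :: "nat \<Rightarrow> gen2 gword set monoid" where
  "G2 n = presented_group (gens2 n) (rels2 n)"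

definition G2_class :: "nat \<Rightarrow> gen2 list \<Rightarrow> gen2 gword set" where
  "G2_class n xs = pres_class (gens2 n) (rels2 n) (pos_word xs)"


section \<open>Pure braids\<close>

text \<open>Points of \<open>\<complex>\<^sup>n\<close> are functions on \<open>{1..n}\<close>, made unique by the value \<open>undefined\<close>
  elsewhere; the topology is the product topology.\<close>

definition conf :: "nat \<Rightarrow> (nat \<Rightarrow> complex) set" where
  "conf n = {z. z \<in> extensional {1..n} \<and> inj_on z {1..n}}"

definition base_pt :: "nat \<Rightarrow> nat \<Rightarrow> complex" where
  "base_pt n = (\<lambda>j\<in>{1..n}. exp (2 * of_real pi * \<i> * of_nat j / of_nat n))"

definition deriv01 :: "(real \<Rightarrow> complex) \<Rightarrow> real \<Rightarrow> complex" where
  "deriv01 g t = vector_derivative g (at t within {0..1})"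

definition smooth01 :: "(real \<Rightarrow> complex) \<Rightarrow> bool" where
  "smooth01 g \<longleftrightarrow> (\<forall>k. (deriv01 ^^ k) g differentiable_on {0..1})"

text \<open>Only the restriction of a braid to \<open>{0..1}\<close> matters.\<close>

definition pure_braid :: "nat \<Rightarrow> (real \<Rightarrow> nat \<Rightarrow> complex) \<Rightarrow> bool" where
  "pure_braid n \<beta> \<longleftrightarrow>
     (\<forall>j\<in>{1..n}. smooth01 (\<lambda>t. \<beta> t j)) \<and>
     (\<forall>t\<in>{0..1}. \<beta> t \<in> conf n) \<and>
     pathstart \<beta> = base_pt n \<and> pathfinish \<beta> = base_pt n"

definition braid_class :: "nat \<Rightarrow> (real \<Rightarrow> nat \<Rightarrow> complex) \<Rightarrow> (real \<Rightarrow> nat \<Rightarrow> complex) set" where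
  "braid_class n \<alpha> = {\<beta>. pure_braid n \<beta> \<and> homotopic_paths (conf n) \<alpha> \<beta>}"

text \<open>A concatenation \<open>\<alpha> +++ \<beta>\<close> of smooth braids may fail to be smooth at the junction;
  \<^const>\<open>braid_class\<close> then collects the smooth braids that are isotopic to it.\<close>

definition PB :: "nat \<Rightarrow> (real \<Rightarrow> nat \<Rightarrow> complex) set monoid" where
  "PB n =
    \<lparr>carrier = braid_class n ` {\<beta>. pure_braid n \<beta>},
     mult = (\<lambda>A B. \<Union>\<alpha>\<in>A. \<Union>\<beta>\<in>B. braid_class n (\<alpha> +++ \<beta>)),
     one = braid_class n (\<lambda>t. base_pt n)\<rparr>"


section \<open>Good and stable braids and the word read off from them\<close>

definition critical_moments :: "nat \<Rightarrow> (real \<Rightarrow> nat \<Rightarrow> complex) \<Rightarrow> real set" where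
  "critical_moments n \<beta> =
    {t \<in> {0..1}. \<exists>i j k. {i, j, k} \<subseteq> {1..n} \<and> distinct [i, j, k] \<and>
       collinear {\<beta> t i, \<beta> t j, \<beta> t k}}"

text \<open>Closeness in the C-infinity topology. Closeness of values alone would be too coarse: a
  perturbation small in that sense can always create new critical moments next to a given one.\<close>

definition braid_close :: "nat \<Rightarrow> nat \<Rightarrow> real \<Rightarrow>
    (real \<Rightarrow> nat \<Rightarrow> complex) \<Rightarrow> (real \<Rightarrow> nat \<Rightarrow> complex) \<Rightarrow> bool" where
  "braid_close n r \<epsilon> \<beta> \<gamma> \<longleftrightarrow>
    (\<forall>m\<le>r. \<forall>j\<in>{1..n}. \<forall>t\<in>{0..1}.
       cmod ((deriv01 ^^ m) (\<lambda>u. \<gamma> u j) t - (deriv01 ^^ m) (\<lambda>u. \<beta> u j) t) < \<epsilon>)"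

definition good_stable :: "nat \<Rightarrow> (real \<Rightarrow> nat \<Rightarrow> complex) \<Rightarrow> bool" where
  "good_stable n \<beta> \<longleftrightarrow>
     pure_braid n \<beta> \<and>
     finite (critical_moments n \<beta>) \<and>
     (\<forall>t\<in>critical_moments n \<beta>. \<exists>!T. T \<subseteq> {1..n} \<and> card T = 3 \<and> collinear (\<beta> t ` T)) \<and>
     (\<exists>r. \<exists>\<epsilon>>0. \<forall>\<gamma>. pure_braid n \<gamma> \<and> braid_close n r \<epsilon> \<beta> \<gamma> \<longrightarrow>
        finite (critical_moments n \<gamma>) \<and>
        card (critical_moments n \<gamma>) = card (critical_moments n \<beta>))"

text \<open>For a good braid and a critical moment, the generator below is unique.\<close>

definition critical_gen :: "nat \<Rightarrow> (real \<Rightarrow> nat \<Rightarrow> complex) \<Rightarrow> real \<Rightarrow> gen3" where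
  "critical_gen n \<beta> t =
    (THE g. \<exists>i j k. {i, j, k} \<subseteq> {1..n} \<and> distinct [i, j, k] \<and>
       between (\<beta> t i, \<beta> t k) (\<beta> t j) \<and> g = a3 i j k)"

definition braid_reading :: "nat \<Rightarrow> (real \<Rightarrow> nat \<Rightarrow> complex) \<Rightarrow> gen3 gword set" where
  "braid_reading n \<beta> =
    G3_class n (map (critical_gen n \<beta>) (sorted_list_of_set (critical_moments n \<beta>)))"

text \<open>The maps \<open>f\<close> and \<open>\<phi>\<close>. Each predicate determines the values of the map on the carrier of
  its source.\<close>

definition is_reading_map ::
    "nat \<Rightarrow> ((real \<Rightarrow> nat \<Rightarrow> complex) set \<Rightarrow> gen3 gword set) \<Rightarrow> bool" where
  "is_reading_map n f \<longleftrightarrow>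
     f \<in> carrier (PB n) \<rightarrow> carrier (G3 n) \<and>
     (\<forall>C\<in>carrier (PB n).
        (\<exists>\<beta>\<in>C. good_stable n \<beta>) \<and> (\<forall>\<beta>\<in>C. good_stable n \<beta> \<longrightarrow> f C = braid_reading n \<beta>))"

definition is_phi :: "nat \<Rightarrow> (gen3 gword set \<Rightarrow> gen2 gword set) \<Rightarrow> bool" where
  "is_phi n \<phi> \<longleftrightarrow>
     group_hom (G3 n) (G2 n) \<phi> \<and>
     (\<forall>i j k. {i, j, k} \<subseteq> {1..n} \<and> distinct [i, j, k] \<longrightarrow>
        \<phi> (G3_class n [a3 i j k]) = G2_class n [a2 (i, j) (i, k), a2 (k, j) (k, i)])"

end

theory Submission
  imports Defs
begin

text \<open>
  The reading of a concatenation is the product of the readings, so \<open>f\<close> is a homomorphism as soon as it is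
  well defined on isotopy classes. The map \<open>\<phi>\<close> exists by the universal property of \<open>'G\<^sub>n\<^sup>3\<close>; the only
  relation that needs work is the tetrahedron relation, whose image splits into two triangle words and
  two squares because letters at different starting points commute (\<open>is_phi_exists\<close>).

  That \<open>f\<close> is well defined could be seen by a study of the singularities of codimension two that occur
  in a generic isotopy. The proof below avoids general position for isotopies. Its central object is a
  potential: a function on generic configurations that is multiplied from the right by \<open>a'\<^sub>i\<^sub>j\<^sub>k\<close>
  when the configuration crosses the wall on which \<open>i\<close>, \<open>j\<close>, \<open>k\<close> are collinear with \<open>j\<close> in the
  middle. Potentials exist locally. For points with increasing real parts, list for each point \<open>P\<^sub>l\<close> the lines
  through two points to its left that pass above \<open>P\<^sub>l\<close>, from the highest to the lowest; read a line through
  \<open>P\<^sub>a\<close> and \<open>P\<^sub>b\<close> as \<open>a'\<^sub>a\<^sub>b\<^sub>l\<close>, and multiply the words for all \<open>l\<close>. When \<open>P\<^sub>i\<close>, \<open>P\<^sub>j\<close>, \<open>P\<^sub>k\<close>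
  become collinear, the word of \<open>P\<^sub>k\<close> gains or loses its last letter \<open>a'\<^sub>i\<^sub>j\<^sub>k\<close>, and in the words of later
  points above which the common line passes three neighbouring letters are reversed. The tetrahedron
  relation says that moving \<open>a'\<^sub>i\<^sub>j\<^sub>k\<close> to the right end compensates for these reversals (\<open>potential_wall\<close>).
  After a rotation and a relabelling this gives potentials on charts that cover the space of
  configurations (\<open>is_potential_chart\<close>, \<open>potentials_cover\<close>).

  The quotient of two potentials does not change across a single wall. Configurations with two collinear
  triples have codimension two and can be avoided by moving one point at a time, so on a box
  contained in two charts two potentials differ by a constant (\<open>potentials_agree\<close>). Along a path that
  crosses walls one at a time, with a sign change each time, the potential changes by the reading
  (\<open>potential_reading\<close>). A subdivision of the square of a homotopy then shows that the reading is
  invariant (\<open>reading_homotopy_invariant\<close>).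

  Two facts relate this to good and stable braids. Stability forces a sign change at every critical
  moment, since otherwise a small perturbation would increase the number of critical moments
  (\<open>good_stable_imp_tame\<close>). Conversely every braid, and even every concatenation of two braids, which may fail to
  be smooth at the junction, is isotopic to a good and stable one: polynomial strands in general position
  have one simple collinear triple at a time, and such transversal crossings persist under perturbations
  that are small with their first derivatives (\<open>transversal_imp_good_stable\<close>, \<open>good_stable_dense\<close>).
\<close>


section \<open>Presented groups\<close>

lemma gwords_append [simp]: "u @ v \<in> gwords S \<longleftrightarrow> u \<in> gwords S \<and> v \<in> gwords S"
  by (auto simp: gwords_def)

lemma gwords_Nil [simp]: "[] \<in> gwords S"
  by (simp add: gwords_def)

lemma gwords_Cons [simp]: "(b, x) # v \<in> gwords S \<longleftrightarrow> x \<in> S \<and> v \<in> gwords S"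
  by (auto simp: gwords_def)

lemma pos_word_in_gwords [simp]: "pos_word xs \<in> gwords S \<longleftrightarrow> set xs \<subseteq> S"
  by (induction xs) (auto simp: pos_word_def)

lemma pos_word_append [simp]: "pos_word (xs @ ys) = pos_word xs @ pos_word ys"
  by (simp add: pos_word_def)

lemma pos_word_Nil [simp]: "pos_word [] = []"
  by (simp add: pos_word_def)

lemma pres_eq_gwords: "pres_eq S R v w \<Longrightarrow> v \<in> gwords S \<and> w \<in> gwords S"
  by (induction rule: pres_eq.induct) auto

text \<open>This makes \<^const>\<open>pres_eq\<close> a congruence, so that the product of two classes in
  \<^const>\<open>presented_group\<close>, a union over all representatives, is the class of a single word.\<close>

lemma pres_eq_context:
  assumes "pres_eq S R v w" "a \<in> gwords S" "b \<in> gwords S"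
  shows "pres_eq S R (a @ v @ b) (a @ w @ b)"
  using assms
proof (induction rule: pres_eq.induct)
  case (refl w)
  then show ?case by (auto intro: pres_eq.refl)
next
  case (sym v w)
  then show ?case by (auto intro: pres_eq.sym)
next
  case (trans u v w)
  then show ?case by (blast intro: pres_eq.trans)
next
  case (cancel u v x b')
  then show ?case
    using pres_eq.cancel[of "a @ u" S "v @ b" x R b'] by simp
next
  case (rel u v l r)
  then show ?case
    using pres_eq.rel[of "a @ u" S "v @ b" l r R] by simp
qed

lemma pres_eq_append:
  assumes "pres_eq S R u u'" "pres_eq S R v v'"
  shows "pres_eq S R (u @ v) (u' @ v')"
proof (rule pres_eq.trans)
  show "pres_eq S R (u @ v) (u' @ v)"
    using pres_eq_context[OF assms(1), of "[]" v] pres_eq_gwords[OF assms(2)] by simp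
  show "pres_eq S R (u' @ v) (u' @ v')"
    using pres_eq_context[OF assms(2), of u' "[]"] pres_eq_gwords[OF assms(1)] by simp
qed

lemma pres_class_eq_iff:
  assumes "v \<in> gwords S"
  shows "pres_class S R v = pres_class S R w \<longleftrightarrow> pres_eq S R v w"
  using assms unfolding pres_class_def
  by (blast intro: pres_eq.refl pres_eq.sym pres_eq.trans)

lemma presented_group_simps:
  "carrier (presented_group S R) = pres_class S R ` gwords S"
  "one (presented_group S R) = pres_class S R []"
  by (simp_all add: presented_group_def)

lemma presented_mult:
  assumes "u \<in> gwords S" "v \<in> gwords S"
  shows "pres_class S R u \<otimes>\<^bsub>presented_group S R\<^esub> pres_class S R v = pres_class S R (u @ v)"
proof -
  have "pres_class S R (a @ b) = pres_class S R (u @ v)"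
    if "a \<in> pres_class S R u" "b \<in> pres_class S R v" for a b
  proof -
    have "pres_eq S R (u @ v) (a @ b)"
      using that by (intro pres_eq_append) (simp_all add: pres_class_def)
    moreover have "u @ v \<in> gwords S" using assms by simp
    ultimately have "pres_class S R (u @ v) = pres_class S R (a @ b)"
      by (simp add: pres_class_eq_iff)
    then show ?thesis ..
  qed
  then have "(\<Union>a\<in>pres_class S R u. \<Union>b\<in>pres_class S R v. pres_class S R (a @ b))
      = (\<Union>a\<in>pres_class S R u. \<Union>b\<in>pres_class S R v. pres_class S R (u @ v))"
    by (intro SUP_cong HOL.refl)
  also have "\<dots> = pres_class S R (u @ v)"
  proof -
    have "u \<in> pres_class S R u" "v \<in> pres_class S R v"
      using assms by (simp_all add: pres_class_def pres_eq.refl)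
    then have "pres_class S R u \<noteq> {}" "pres_class S R v \<noteq> {}" by blast+
    then show ?thesis by simp
  qed
  finally show ?thesis by (simp add: presented_group_def)
qed

definition inv_word :: "'a gword \<Rightarrow> 'a gword" where
  "inv_word w = rev (map (\<lambda>(b, x). (\<not> b, x)) w)"

lemma inv_word_in_gwords: "w \<in> gwords S \<Longrightarrow> inv_word w \<in> gwords S"
  by (auto simp: inv_word_def gwords_def lists_eq_set)

lemma pres_eq_inv_word:
  assumes "w \<in> gwords S"
  shows "pres_eq S R (inv_word w @ w) []"
  using assms
proof (induction w)
  case Nil
  then show ?case by (auto simp: inv_word_def intro: pres_eq.refl)
next
  case (Cons a w)
  obtain b x where a: "a = (b, x)" by force
  have "pres_eq S R (inv_word w @ [(\<not> b, x), (\<not> \<not> b, x)] @ w) (inv_word w @ w)"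
    using Cons.prems a inv_word_in_gwords[of w] by (intro pres_eq.cancel) auto
  moreover have "pres_eq S R (inv_word w @ w) []"
    using Cons.prems a by (intro Cons.IH) auto
  ultimately show ?case
    by (auto simp: a inv_word_def intro: pres_eq.trans)
qed

lemma group_presented_group: "group (presented_group S R)"
proof (rule groupI)
  fix A B C
  assume "A \<in> carrier (presented_group S R)" "B \<in> carrier (presented_group S R)"
    "C \<in> carrier (presented_group S R)"
  then show "A \<otimes>\<^bsub>presented_group S R\<^esub> B \<otimes>\<^bsub>presented_group S R\<^esub> C
      = A \<otimes>\<^bsub>presented_group S R\<^esub> (B \<otimes>\<^bsub>presented_group S R\<^esub> C)"
    by (auto simp: presented_group_simps presented_mult)
next
  fix A assume "A \<in> carrier (presented_group S R)"
  then obtain w where w: "w \<in> gwords S" "A = pres_class S R w"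
    by (auto simp: presented_group_simps)
  then have "pres_class S R (inv_word w) \<otimes>\<^bsub>presented_group S R\<^esub> A = \<one>\<^bsub>presented_group S R\<^esub>"
    using pres_eq_inv_word[of w S R] inv_word_in_gwords[of w S]
    by (simp add: presented_mult presented_group_simps pres_class_eq_iff)
  then show "\<exists>B\<in>carrier (presented_group S R). B \<otimes>\<^bsub>presented_group S R\<^esub> A = \<one>\<^bsub>presented_group S R\<^esub>"
    using w inv_word_in_gwords[of w S] by (auto simp: presented_group_simps)
qed (auto simp: presented_group_simps presented_mult)

definition (in monoid) list_prod :: "('i \<Rightarrow> 'a) \<Rightarrow> 'i list \<Rightarrow> 'a" where
  "list_prod f xs = foldr (\<lambda>x y. f x \<otimes> y) xs \<one>"

context monoid
begin

lemma list_prod_simps [simp]: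
  "list_prod f [] = \<one>"
  "list_prod f (x # xs) = f x \<otimes> list_prod f xs"
  by (simp_all add: list_prod_def)

lemma list_prod_closed: "f ` set xs \<subseteq> carrier G \<Longrightarrow> list_prod f xs \<in> carrier G"
  by (induction xs) auto

lemma list_prod_append:
  assumes "f ` set xs \<subseteq> carrier G" "f ` set ys \<subseteq> carrier G"
  shows "list_prod f (xs @ ys) = list_prod f xs \<otimes> list_prod f ys"
  using assms by (induction xs) (auto simp: list_prod_closed m_assoc)

lemma list_prod_cong: "(\<And>x. x \<in> set xs \<Longrightarrow> f x = f' x) \<Longrightarrow> list_prod f xs = list_prod f' xs"
  by (induction xs) auto

lemma list_prod_commute:
  assumes "f ` set xs \<subseteq> carrier G" "a \<in> carrier G" "\<And>x. x \<in> set xs \<Longrightarrow> f x \<otimes> a = a \<otimes> f x"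
  shows "list_prod f xs \<otimes> a = a \<otimes> list_prod f xs"
  using assms
proof (induction xs)
  case (Cons x xs)
  then have "f x \<in> carrier G" "list_prod f xs \<in> carrier G" by (auto intro!: list_prod_closed)
  moreover have "list_prod f xs \<otimes> a = a \<otimes> list_prod f xs" "f x \<otimes> a = a \<otimes> f x"
    using Cons by auto
  ultimately show ?case using Cons.prems(2) by (simp add: m_assoc) (metis m_assoc)
qed auto

end

definition (in group) letter_value :: "('i \<Rightarrow> 'a) \<Rightarrow> bool \<times> 'i \<Rightarrow> 'a" where
  "letter_value h = (\<lambda>(b, x). if b then h x else inv h x)"

text \<open>The value of a word does not change under the elementary steps that generate
  \<^const>\<open>pres_eq\<close>, so it descends to the classes: this is the universal property of the presentation.\<close>

lemma presented_group_hom_ext: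
  fixes S :: "'a set" and H :: "('c, 'd) monoid_scheme" and h :: "'a \<Rightarrow> 'c"
  assumes "group H"
    and h: "\<And>x. x \<in> S \<Longrightarrow> h x \<in> carrier H"
    and rels: "\<And>l r. (l, r) \<in> R \<Longrightarrow> l \<in> gwords S \<Longrightarrow> r \<in> gwords S \<Longrightarrow>
      monoid.list_prod H (group.letter_value H h) l = monoid.list_prod H (group.letter_value H h) r"
  obtains \<phi> where "group_hom (presented_group S R) H \<phi>"
    and "\<And>x. x \<in> S \<Longrightarrow> \<phi> (pres_class S R (pos_word [x])) = h x"
proof -
  interpret H: group H by fact
  let ?E = "H.list_prod (H.letter_value h)"
  have letters: "H.letter_value h ` set w \<subseteq> carrier H" if "w \<in> gwords S" for w
    using that h by (force simp: H.letter_value_def gwords_def)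
  have E_closed: "?E w \<in> carrier H" if "w \<in> gwords S" for w
    using letters[OF that] by (rule H.list_prod_closed)
  have E_append: "?E (u @ v) = ?E u \<otimes>\<^bsub>H\<^esub> ?E v" if "u \<in> gwords S" "v \<in> gwords S" for u v
    using that letters by (intro H.list_prod_append) auto
  have E_eq: "?E v = ?E w" if "pres_eq S R v w" for v w
    using that
  proof (induction rule: pres_eq.induct)
    case (cancel u v x b)
    have "?E [(b, x), (\<not> b, x)] = \<one>\<^bsub>H\<^esub>"
      using cancel h by (cases b) (auto simp: H.letter_value_def)
    moreover have "?E (u @ [(b, x), (\<not> b, x)] @ v) = ?E u \<otimes>\<^bsub>H\<^esub> (?E [(b, x), (\<not> b, x)] \<otimes>\<^bsub>H\<^esub> ?E v)"
      using cancel by (subst E_append, simp, simp, subst E_append) auto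
    ultimately show ?case
      using cancel E_closed by (simp add: E_append del: H.list_prod_simps)
  next
    case (rel u v l r)
    have "?E l = ?E r" using rel by (intro rels)
    then show ?case using rel by (simp add: E_append)
  qed auto
  define \<phi> where "\<phi> A = ?E (SOME w. w \<in> A)" for A
  have \<phi>_class: "\<phi> (pres_class S R w) = ?E w" if "w \<in> gwords S" for w
  proof -
    have "w \<in> pres_class S R w" using that by (auto simp: pres_class_def intro: pres_eq.refl)
    then have "(SOME v. v \<in> pres_class S R w) \<in> pres_class S R w" by (rule someI)
    then show ?thesis unfolding \<phi>_def pres_class_def using E_eq by auto
  qed
  show ?thesis
  proof
    show "group_hom (presented_group S R) H \<phi>"
      unfolding group_hom_def group_hom_axioms_def
      by (auto simp: group_presented_group assms(1) hom_def presented_group_simps \<phi>_class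
          presented_mult E_closed E_append)
    show "\<phi> (pres_class S R (pos_word [x])) = h x" if "x \<in> S" for x
    proof -
      have "pos_word [x] \<in> gwords S" using that by simp
      then show ?thesis using that h by (subst \<phi>_class) (auto simp: pos_word_def H.letter_value_def)
    qed
  qed
qed

lemma presented_relation:
  assumes "(pos_word xs, pos_word ys) \<in> R" "set xs \<subseteq> S" "set ys \<subseteq> S"
  shows "pres_class S R (pos_word xs) = pres_class S R (pos_word ys)"
  using pres_eq.rel[of "[]" S "[]" "pos_word xs" "pos_word ys" R] assms
  by (simp add: pres_class_eq_iff)

lemma (in group) list_prod_letter_value_pos_word:
  "list_prod (letter_value h) (pos_word xs) = list_prod h xs"
  by (induction xs) (simp_all add: pos_word_def letter_value_def)


section \<open>The two groups and the map between them\<close>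

lemma group_G3: "group (G3 n)" and group_G2: "group (G2 n)"
  by (simp_all add: G3_def G2_def group_presented_group)

lemma a3_rev: "a3 k j i = a3 i j k"
  by (auto simp: a3_def)

lemma a2_commute: "a2 q p = a2 p q"
  by (auto simp: a2_def)

lemma a3_in_gens3: "{i, j, k} \<subseteq> {1..n} \<Longrightarrow> distinct [i, j, k] \<Longrightarrow> a3 i j k \<in> gens3 n"
  unfolding gens3_def by blast

lemma a2_in_gens2: "{p, q} \<subseteq> strands2 n \<Longrightarrow> p \<noteq> q \<Longrightarrow> a2 p q \<in> gens2 n"
  unfolding gens2_def by blast

lemma G3_class_closed: "set xs \<subseteq> gens3 n \<Longrightarrow> G3_class n xs \<in> carrier (G3 n)"
  by (simp add: G3_class_def G3_def presented_group_simps)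

lemma G3_class_append:
  "set xs \<subseteq> gens3 n \<Longrightarrow> set ys \<subseteq> gens3 n \<Longrightarrow>
    G3_class n (xs @ ys) = G3_class n xs \<otimes>\<^bsub>G3 n\<^esub> G3_class n ys"
  by (simp add: G3_class_def G3_def presented_mult)

lemma G3_class_Nil: "G3_class n [] = \<one>\<^bsub>G3 n\<^esub>"
  by (simp add: G3_class_def G3_def presented_group_simps)

lemma G2_class_closed: "set xs \<subseteq> gens2 n \<Longrightarrow> G2_class n xs \<in> carrier (G2 n)"
  by (simp add: G2_class_def G2_def presented_group_simps)

lemma G2_class_append:
  "set xs \<subseteq> gens2 n \<Longrightarrow> set ys \<subseteq> gens2 n \<Longrightarrow>
    G2_class n (xs @ ys) = G2_class n xs \<otimes>\<^bsub>G2 n\<^esub> G2_class n ys"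
  by (simp add: G2_class_def G2_def presented_mult)

lemma G2_class_Nil: "G2_class n [] = \<one>\<^bsub>G2 n\<^esub>"
  by (simp add: G2_class_def G2_def presented_group_simps)

lemma G3_relation:
  assumes "pos_rel xs ys \<in> rels3 n" "set xs \<subseteq> gens3 n" "set ys \<subseteq> gens3 n"
  shows "G3_class n xs = G3_class n ys"
  unfolding G3_class_def by (rule presented_relation[OF assms])

lemma G2_relation:
  assumes "pos_rel xs ys \<in> rels2 n" "set xs \<subseteq> gens2 n" "set ys \<subseteq> gens2 n"
  shows "G2_class n xs = G2_class n ys"
  unfolding G2_class_def by (rule presented_relation[OF assms])

abbreviation b2 :: "nat \<Rightarrow> nat \<times> nat \<Rightarrow> nat \<times> nat \<Rightarrow> gen2 gword set" where
  "b2 n p q \<equiv> G2_class n [a2 p q]"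

lemma b2_closed: "{p, q} \<subseteq> strands2 n \<Longrightarrow> p \<noteq> q \<Longrightarrow> b2 n p q \<in> carrier (G2 n)"
  by (intro G2_class_closed) (auto intro!: a2_in_gens2)

lemma b2_square:
  assumes "{p, q} \<subseteq> strands2 n" "p \<noteq> q"
  shows "b2 n p q \<otimes>\<^bsub>G2 n\<^esub> b2 n p q = \<one>\<^bsub>G2 n\<^esub>"
proof -
  have "pos_rel [a2 p q, a2 p q] [] \<in> rels2 n"
    unfolding rels2_def using assms by blast
  then have "G2_class n ([a2 p q] @ [a2 p q]) = G2_class n []"
    using assms a2_in_gens2 by (intro G2_relation) auto
  then show ?thesis
    using assms a2_in_gens2[of p q n] by (subst (asm) G2_class_append) (auto simp: G2_class_Nil)
qed

lemma b2_commute: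
  assumes "{p, q, r, s} \<subseteq> strands2 n" "distinct [p, q, r, s]"
  shows "b2 n p q \<otimes>\<^bsub>G2 n\<^esub> b2 n r s = b2 n r s \<otimes>\<^bsub>G2 n\<^esub> b2 n p q"
proof -
  have gens: "a2 p q \<in> gens2 n" "a2 r s \<in> gens2 n"
    using assms by (auto intro!: a2_in_gens2)
  have "pos_rel [a2 p q, a2 r s] [a2 r s, a2 p q] \<in> rels2 n"
    unfolding rels2_def using assms by blast
  then have "G2_class n ([a2 p q] @ [a2 r s]) = G2_class n ([a2 r s] @ [a2 p q])"
    using gens by (intro G2_relation) auto
  then show ?thesis
    using gens by (simp only: G2_class_append set_simps subset_empty empty_subsetI insert_subset simp_thms)
qed

lemma b2_triangle:
  assumes "{p, q, r} \<subseteq> strands2 n" "distinct [p, q, r]"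
  shows "b2 n p q \<otimes>\<^bsub>G2 n\<^esub> (b2 n p r \<otimes>\<^bsub>G2 n\<^esub> (b2 n q r \<otimes>\<^bsub>G2 n\<^esub>
    (b2 n p q \<otimes>\<^bsub>G2 n\<^esub> (b2 n p r \<otimes>\<^bsub>G2 n\<^esub> b2 n q r)))) = \<one>\<^bsub>G2 n\<^esub>"
proof -
  have gens: "a2 p q \<in> gens2 n" "a2 p r \<in> gens2 n" "a2 q r \<in> gens2 n"
    using assms by (auto intro!: a2_in_gens2)
  have "pos_rel [a2 p q, a2 p r, a2 q r, a2 p q, a2 p r, a2 q r] [] \<in> rels2 n"
    unfolding rels2_def using assms by blast
  then have "G2_class n ([a2 p q] @ [a2 p r] @ [a2 q r] @ [a2 p q] @ [a2 p r] @ [a2 q r]) = G2_class n []"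
    using gens by (intro G2_relation) auto
  then show ?thesis
    using gens
    by (simp only: G2_class_append G2_class_Nil set_append set_simps Un_subset_iff empty_subsetI
        insert_subset simp_thms)
qed

definition phi_gen :: "nat \<Rightarrow> nat \<Rightarrow> nat \<Rightarrow> nat \<Rightarrow> gen2 gword set" where
  "phi_gen n i j k = b2 n (i, j) (i, k) \<otimes>\<^bsub>G2 n\<^esub> b2 n (k, j) (k, i)"

lemma strands2_iff [simp]: "(i, j) \<in> strands2 n \<longleftrightarrow> i \<in> {1..n} \<and> j \<in> {1..n} \<and> i \<noteq> j"
  by (auto simp: strands2_def)

lemma phi_gen_closed:
  "{i, j, k} \<subseteq> {1..n} \<Longrightarrow> distinct [i, j, k] \<Longrightarrow> phi_gen n i j k \<in> carrier (G2 n)"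
  unfolding phi_gen_def
  by (intro monoid.m_closed group.is_monoid group_G2 b2_closed) auto

lemma phi_gen_rev:
  assumes "{i, j, k} \<subseteq> {1..n}" "distinct [i, j, k]"
  shows "phi_gen n k j i = phi_gen n i j k"
  unfolding phi_gen_def by (rule b2_commute) (use assms in auto)

text \<open>The four strands \<open>ij\<close>, \<open>ik\<close>, \<open>kj\<close>, \<open>ki\<close> are distinct, so the image is a product of two
  commuting involutions. For the same reason it does not change when \<open>i\<close> and \<open>k\<close> are exchanged.\<close>

lemma phi_gen_square:
  assumes "{i, j, k} \<subseteq> {1..n}" "distinct [i, j, k]"
  shows "phi_gen n i j k \<otimes>\<^bsub>G2 n\<^esub> phi_gen n i j k = \<one>\<^bsub>G2 n\<^esub>"
proof -
  interpret group "G2 n" by (rule group_G2)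
  define x where "x = b2 n (i, j) (i, k)"
  define y where "y = b2 n (k, j) (k, i)"
  have c: "x \<in> carrier (G2 n)" "y \<in> carrier (G2 n)"
    unfolding x_def y_def using assms by (intro b2_closed; auto)+
  have "x \<otimes>\<^bsub>G2 n\<^esub> y = y \<otimes>\<^bsub>G2 n\<^esub> x"
    unfolding x_def y_def using assms by (intro b2_commute) auto
  moreover have "x \<otimes>\<^bsub>G2 n\<^esub> x = \<one>\<^bsub>G2 n\<^esub>" "y \<otimes>\<^bsub>G2 n\<^esub> y = \<one>\<^bsub>G2 n\<^esub>"
    unfolding x_def y_def using assms by (intro b2_square; auto)+
  ultimately show ?thesis
    unfolding phi_gen_def x_def[symmetric] y_def[symmetric]
    using c by (metis m_assoc m_closed r_one)
qed

lemma commute_prod: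
  assumes "group G" "a \<in> carrier G" "b \<in> carrier G" "c \<in> carrier G"
    and "a \<otimes>\<^bsub>G\<^esub> c = c \<otimes>\<^bsub>G\<^esub> a" "b \<otimes>\<^bsub>G\<^esub> c = c \<otimes>\<^bsub>G\<^esub> b"
  shows "(a \<otimes>\<^bsub>G\<^esub> b) \<otimes>\<^bsub>G\<^esub> c = c \<otimes>\<^bsub>G\<^esub> (a \<otimes>\<^bsub>G\<^esub> b)"
proof -
  interpret group G by fact
  show ?thesis using assms(2-) by (metis m_assoc)
qed

lemma card_Int_less_2D:
  assumes "card (A \<inter> B) < 2" "finite A" "x \<in> A" "x \<in> B" "y \<in> A" "y \<in> B"
  shows "x = y"
proof (rule ccontr)
  assume "x \<noteq> y"
  then have "card {x, y} = 2" by simp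
  moreover have "card {x, y} \<le> card (A \<inter> B)" using assms by (intro card_mono) auto
  ultimately show False using assms(1) by simp
qed

text \<open>A strand that occurs in both images contributes two common indices to the two triples. If they
  share at most one index, then the strands are distinct and all letters commute.\<close>

lemma phi_gen_commute:
  assumes "{i, j, k, p, q, r} \<subseteq> {1..n}" "distinct [i, j, k]" "distinct [p, q, r]"
    and "card ({i, j, k} \<inter> {p, q, r}) < 2"
  shows "phi_gen n i j k \<otimes>\<^bsub>G2 n\<^esub> phi_gen n p q r = phi_gen n p q r \<otimes>\<^bsub>G2 n\<^esub> phi_gen n i j k"
proof -
  have pairs: "\<not> ({x, y} \<subseteq> {i, j, k} \<and> {x, y} \<subseteq> {p, q, r} \<and> x \<noteq> y)" for x y
    using card_Int_less_2D[OF assms(4), of x y] by auto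
  have disj: "P \<noteq> Q" if "P \<in> strands2 n" "{fst P, snd P} \<subseteq> {i, j, k}" "{fst Q, snd Q} \<subseteq> {p, q, r}" for P Q
    using that pairs[of "fst P" "snd P"] by (auto simp: strands2_def)
  have b: "b2 n P Q \<otimes>\<^bsub>G2 n\<^esub> b2 n P' Q' = b2 n P' Q' \<otimes>\<^bsub>G2 n\<^esub> b2 n P Q"
    if "{P, Q, P', Q'} \<subseteq> strands2 n" "P \<noteq> Q" "P' \<noteq> Q'"
      "{fst P, snd P, fst Q, snd Q} \<subseteq> {i, j, k}" "{fst P', snd P', fst Q', snd Q'} \<subseteq> {p, q, r}" for P Q P' Q'
    using that disj[of P P'] disj[of P Q'] disj[of Q P'] disj[of Q Q'] by (intro b2_commute) auto
  have c: "b2 n (i, j) (i, k) \<in> carrier (G2 n)" "b2 n (k, j) (k, i) \<in> carrier (G2 n)"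
    "b2 n (p, q) (p, r) \<in> carrier (G2 n)" "b2 n (r, q) (r, p) \<in> carrier (G2 n)"
    using assms by (intro b2_closed; auto)+
  note G = group_G2[of n]
  have 1: "b2 n P Q \<otimes>\<^bsub>G2 n\<^esub> phi_gen n p q r = phi_gen n p q r \<otimes>\<^bsub>G2 n\<^esub> b2 n P Q"
    if "{P, Q} \<subseteq> strands2 n" "P \<noteq> Q" "{fst P, snd P, fst Q, snd Q} \<subseteq> {i, j, k}" for P Q
    unfolding phi_gen_def using that assms
    by (intro commute_prod[OF G c(3,4) b2_closed, symmetric] b[symmetric]) auto
  show ?thesis
    unfolding phi_gen_def[of n i j k]
    by (intro commute_prod[OF G c(1,2) phi_gen_closed] 1) (use assms in auto)
qed

lemma (in group) commute_left:
  assumes "x \<otimes> y = y \<otimes> x" "x \<in> carrier G" "y \<in> carrier G" "z \<in> carrier G"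
  shows "x \<otimes> (y \<otimes> z) = y \<otimes> (x \<otimes> z)"
  using assms by (simp flip: m_assoc)

lemma (in group) square_prod:
  assumes "x \<otimes> y = y \<otimes> x" "x \<in> carrier G" "y \<in> carrier G" "x \<otimes> x = \<one>" "y \<otimes> y = \<one>"
  shows "(x \<otimes> y) \<otimes> (x \<otimes> y) = \<one>"
proof -
  have "(x \<otimes> y) \<otimes> (x \<otimes> y) = x \<otimes> (x \<otimes> y \<otimes> y)"
    using assms(1-3) by (simp add: m_assoc commute_left[of y x])
  also have "\<dots> = \<one>" using assms(2-) by (simp add: m_assoc)
  finally show ?thesis .
qed

text \<open>In the image of the tetrahedron word, letters whose strands start at different points
  commute. What remains is one triangle word at \<open>i\<close>, one at \<open>l\<close>, and the two involutions at
  \<open>j\<close> and \<open>k\<close>.\<close>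

lemma phi_gen_tetrahedron:
  assumes ijkl: "{i, j, k, l} \<subseteq> {1..n}" "distinct [i, j, k, l]"
  defines "w \<equiv> phi_gen n i j k \<otimes>\<^bsub>G2 n\<^esub> (phi_gen n i j l \<otimes>\<^bsub>G2 n\<^esub> (phi_gen n i k l \<otimes>\<^bsub>G2 n\<^esub> phi_gen n j k l))"
  shows "w \<otimes>\<^bsub>G2 n\<^esub> w = \<one>\<^bsub>G2 n\<^esub>"
proof -
  interpret group "G2 n" by (rule group_G2)
  let ?mult = "\<lambda>x y. x \<otimes>\<^bsub>G2 n\<^esub> y"
  define i1 where "i1 = b2 n (i, j) (i, k)"
  define i2 where "i2 = b2 n (i, j) (i, l)"
  define i3 where "i3 = b2 n (i, k) (i, l)"
  define l1 where "l1 = b2 n (l, j) (l, i)"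
  define l2 where "l2 = b2 n (l, k) (l, i)"
  define l3 where "l3 = b2 n (l, k) (l, j)"
  define k1 where "k1 = b2 n (k, j) (k, i)"
  define j1 where "j1 = b2 n (j, k) (j, l)"
  note d = i1_def i2_def i3_def l1_def l2_def l3_def k1_def j1_def
  have I: "i \<in> {1..n}" "j \<in> {1..n}" "k \<in> {1..n}" "l \<in> {1..n}"
    and ne: "i \<noteq> j" "i \<noteq> k" "i \<noteq> l" "j \<noteq> k" "j \<noteq> l" "k \<noteq> l"
    using ijkl by auto
  note ne = ne ne[symmetric]
  have cl: "b2 n (a, b) (a, c) \<in> carrier (G2 n)"
    if "a \<in> {1..n}" "b \<in> {1..n}" "c \<in> {1..n}" "a \<noteq> b" "a \<noteq> c" "b \<noteq> c" for a b c
    using that by (intro b2_closed) auto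
  have "i1 \<in> carrier (G2 n)" "i2 \<in> carrier (G2 n)" "i3 \<in> carrier (G2 n)"
     "l1 \<in> carrier (G2 n)" "l2 \<in> carrier (G2 n)" "l3 \<in> carrier (G2 n)"
     "k1 \<in> carrier (G2 n)" "j1 \<in> carrier (G2 n)"
    unfolding d by (intro cl I ne)+
  note c = this
  have comm: "b2 n (a, b) (a, c) \<otimes>\<^bsub>G2 n\<^esub> b2 n (d, e) (d, f) = b2 n (d, e) (d, f) \<otimes>\<^bsub>G2 n\<^esub> b2 n (a, b) (a, c)"
    if "a \<in> {1..n}" "b \<in> {1..n}" "c \<in> {1..n}" "a \<noteq> b" "a \<noteq> c" "b \<noteq> c"
      "d \<in> {1..n}" "e \<in> {1..n}" "f \<in> {1..n}" "d \<noteq> e" "d \<noteq> f" "e \<noteq> f" "a \<noteq> d" for a b c d e f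
    using that by (intro b2_commute) auto
  have k: "?mult k1 i2 = ?mult i2 k1" "?mult k1 l1 = ?mult l1 k1" "?mult k1 i3 = ?mult i3 k1"
      "?mult k1 l2 = ?mult l2 k1" "?mult k1 j1 = ?mult j1 k1" "?mult k1 l3 = ?mult l3 k1"
      "?mult k1 i1 = ?mult i1 k1"
    unfolding d by (intro comm I ne)+
  have li: "?mult l1 i1 = ?mult i1 l1" "?mult l1 i2 = ?mult i2 l1" "?mult l1 i3 = ?mult i3 l1"
      "?mult l2 i1 = ?mult i1 l2" "?mult l2 i2 = ?mult i2 l2" "?mult l2 i3 = ?mult i3 l2"
      "?mult l3 i1 = ?mult i1 l3" "?mult l3 i2 = ?mult i2 l3" "?mult l3 i3 = ?mult i3 l3"
    unfolding d by (intro comm I ne)+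
  have jl: "?mult j1 l1 = ?mult l1 j1" "?mult j1 l2 = ?mult l2 j1" "?mult j1 l3 = ?mult l3 j1"
      "?mult j1 i1 = ?mult i1 j1" "?mult j1 i2 = ?mult i2 j1" "?mult j1 i3 = ?mult i3 j1"
    unfolding d by (intro comm I ne)+
  define X where "X = ?mult (?mult i1 i2) i3"
  define Y where "Y = ?mult (?mult l1 l2) l3"
  have cX: "X \<in> carrier (G2 n)" and cY: "Y \<in> carrier (G2 n)"
    unfolding X_def Y_def by (intro m_closed c)+
  have "w = ?mult i1 (?mult k1 (?mult i2 (?mult l1 (?mult i3 (?mult l2 (?mult j1 l3))))))"
    unfolding w_def phi_gen_def d[symmetric] using c by (simp add: m_assoc)
  also have "\<dots> = ?mult i1 (?mult i2 (?mult l1 (?mult i3 (?mult l2 (?mult j1 (?mult l3 k1))))))"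
    using c by (simp add: k commute_left[OF k(1)] commute_left[OF k(2)] commute_left[OF k(3)]
        commute_left[OF k(4)] commute_left[OF k(5)])
  also have "\<dots> = ?mult i1 (?mult i2 (?mult i3 (?mult l1 (?mult l2 (?mult l3 (?mult j1 k1))))))"
    using c by (simp add: commute_left[OF li(3)] commute_left[OF jl(3)])
  also have "\<dots> = ?mult X (?mult Y (?mult j1 k1))"
    unfolding X_def Y_def using c by (simp add: m_assoc)
  finally have w: "w = ?mult X (?mult Y (?mult j1 k1))" .
  have "?mult i1 (?mult i2 (?mult i3 (?mult i1 (?mult i2 i3)))) = \<one>\<^bsub>G2 n\<^esub>"
    unfolding d using ijkl by (intro b2_triangle) auto
  then have X2: "?mult X X = \<one>\<^bsub>G2 n\<^esub>" unfolding X_def using c by (simp add: m_assoc)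
  have "?mult l1 (?mult l2 (?mult l3 (?mult l1 (?mult l2 l3)))) = \<one>\<^bsub>G2 n\<^esub>"
    using b2_triangle[of "(l, i)" "(l, j)" "(l, k)" n] ijkl
    unfolding d by (simp add: a2_commute[of "(l, i)"] a2_commute[of "(l, j)" "(l, k)"])
  then have Y2: "?mult Y Y = \<one>\<^bsub>G2 n\<^esub>" unfolding Y_def using c by (simp add: m_assoc)
  have kj2: "?mult k1 k1 = \<one>\<^bsub>G2 n\<^esub>" "?mult j1 j1 = \<one>\<^bsub>G2 n\<^esub>"
    unfolding d using ijkl by (intro b2_square; simp; fail)+
  have commX: "?mult X x = ?mult x X"
    if "x \<in> carrier (G2 n)" "?mult x i1 = ?mult i1 x" "?mult x i2 = ?mult i2 x" "?mult x i3 = ?mult i3 x" for x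
    unfolding X_def using that c by (intro commute_prod group_G2 m_closed) auto
  have commY: "?mult Y x = ?mult x Y"
    if "x \<in> carrier (G2 n)" "?mult l1 x = ?mult x l1" "?mult l2 x = ?mult x l2" "?mult l3 x = ?mult x l3" for x
    unfolding Y_def using that c by (intro commute_prod group_G2 m_closed) auto
  have jk: "?mult (?mult j1 k1) (?mult j1 k1) = \<one>\<^bsub>G2 n\<^esub>"
    using c k kj2 by (intro square_prod) auto
  have YX: "?mult Y X = ?mult X Y"
    using cX c commX li by (intro commY) auto
  have Yjk: "?mult Y (?mult j1 k1) = ?mult (?mult j1 k1) Y"
    using c cY commY[of j1] commY[of k1] jl k by (intro commute_prod[symmetric] group_G2) auto
  have Xjk: "?mult X (?mult j1 k1) = ?mult (?mult j1 k1) X"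
    using c cX commX[of j1] commX[of k1] jl k by (intro commute_prod[symmetric] group_G2) auto
  have jk_closed: "?mult j1 k1 \<in> carrier (G2 n)" using c by auto
  show ?thesis
    unfolding w
  proof (rule square_prod)
    show "?mult X (?mult Y (?mult j1 k1)) = ?mult (?mult Y (?mult j1 k1)) X"
      using YX Xjk cX cY jk_closed by (intro commute_prod[symmetric] group_G2) auto
    show "?mult (?mult Y (?mult j1 k1)) (?mult Y (?mult j1 k1)) = \<one>\<^bsub>G2 n\<^esub>"
      using Yjk cY jk_closed Y2 jk by (rule square_prod)
  qed (use cX cY jk_closed X2 in auto)
qed

theorem is_phi_exists: "\<exists>\<phi>. is_phi n \<phi>"
proof -
  interpret group "G2 n" by (rule group_G2)
  \<comment> \<open>The generator only knows the set of its outer indices; \<open>Min\<close> and \<open>Max\<close> order it.\<close>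
  define h where "h g = phi_gen n (Min (snd g)) (fst g) (Max (snd g))" for g
  have h: "h (a3 i j k) = phi_gen n i j k" if "{i, j, k} \<subseteq> {1..n}" "distinct [i, j, k]" for i j k
  proof (cases "i < k")
    case True
    then have "Min {i, k} = i" "Max {i, k} = k" by auto
    then show ?thesis unfolding h_def a3_def fst_conv snd_conv by (simp only:)
  next
    case False
    then have "Min {i, k} = k" "Max {i, k} = i" by auto
    then show ?thesis
      using phi_gen_rev[OF that] unfolding h_def a3_def fst_conv snd_conv by (simp only:)
  qed
  obtain \<phi> where \<phi>: "group_hom (G3 n) (G2 n) \<phi>"
    "\<And>x. x \<in> gens3 n \<Longrightarrow> \<phi> (pres_class (gens3 n) (rels3 n) (pos_word [x])) = h x"
  proof (rule presented_group_hom_ext[OF group_G2, of "gens3 n" h n "rels3 n"])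
    fix \<phi>
    assume "group_hom (presented_group (gens3 n) (rels3 n)) (G2 n) \<phi>"
      "\<And>x. x \<in> gens3 n \<Longrightarrow> \<phi> (pres_class (gens3 n) (rels3 n) (pos_word [x])) = h x"
    then show thesis using that unfolding G3_def by blast
  next
    show "h x \<in> carrier (G2 n)" if "x \<in> gens3 n" for x
      using that by (auto simp: gens3_def h intro!: phi_gen_closed)
  next
    fix l r assume "(l, r) \<in> rels3 n"
    then consider (sq) i j k where "(l, r) = pos_rel [a3 i j k, a3 i j k] []" "{i, j, k} \<subseteq> {1..n}" "distinct [i, j, k]"
      | (comm) i j k p q s where "(l, r) = pos_rel [a3 i j k, a3 p q s] [a3 p q s, a3 i j k]"
         "{i, j, k, p, q, s} \<subseteq> {1..n}" "distinct [i, j, k]" "distinct [p, q, s]" "card ({i, j, k} \<inter> {p, q, s}) < 2"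
      | (tetra) i j k m where "(l, r) = pos_rel [a3 i j k, a3 i j m, a3 i k m, a3 j k m, a3 i j k, a3 i j m, a3 i k m, a3 j k m] []"
         "{i, j, k, m} \<subseteq> {1..n}" "distinct [i, j, k, m]"
      unfolding rels3_def
    proof (elim UnE CollectE exE conjE)
      fix i j k
      assume "(l, r) = pos_rel [a3 i j k, a3 i j k] []" "{i, j, k} \<subseteq> {1..n}" "distinct [i, j, k]"
      then show ?thesis by (rule that(1))
    next
      fix i j k p q s
      assume "(l, r) = pos_rel [a3 i j k, a3 p q s] [a3 p q s, a3 i j k]"
         "{i, j, k, p, q, s} \<subseteq> {1..n}" "distinct [i, j, k]" "distinct [p, q, s]" "card ({i, j, k} \<inter> {p, q, s}) < 2"
      then show ?thesis by (rule that(2))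
    next
      fix i j k m
      assume "(l, r) = pos_rel [a3 i j k, a3 i j m, a3 i k m, a3 j k m, a3 i j k, a3 i j m, a3 i k m, a3 j k m] []"
         "{i, j, k, m} \<subseteq> {1..n}" "distinct [i, j, k, m]"
      then show ?thesis by (rule that(3))
    qed
    then show "list_prod (letter_value h) l = list_prod (letter_value h) r"
    proof cases
      case sq
      then show ?thesis
        using phi_gen_square[OF sq(2,3)] phi_gen_closed[OF sq(2,3)]
        by (simp add: list_prod_letter_value_pos_word h)
    next
      case comm
      have "phi_gen n i j k \<in> carrier (G2 n)" "phi_gen n p q s \<in> carrier (G2 n)"
        using comm by (intro phi_gen_closed; auto)+
      then show ?thesis
        using phi_gen_commute[OF comm(2-5)] comm
        by (simp add: list_prod_letter_value_pos_word h)
    next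
      case tetra
      have "phi_gen n i j k \<in> carrier (G2 n)" "phi_gen n i j m \<in> carrier (G2 n)"
        "phi_gen n i k m \<in> carrier (G2 n)" "phi_gen n j k m \<in> carrier (G2 n)"
        using tetra by (intro phi_gen_closed; auto)+
      then show ?thesis
        using phi_gen_tetrahedron[OF tetra(2,3)] tetra
        by (simp add: list_prod_letter_value_pos_word h m_assoc)
    qed
  qed
  have "\<phi> (G3_class n [a3 i j k]) = G2_class n [a2 (i, j) (i, k), a2 (k, j) (k, i)]"
    if "{i, j, k} \<subseteq> {1..n}" "distinct [i, j, k]" for i j k
  proof -
    have "G2_class n ([a2 (i, j) (i, k)] @ [a2 (k, j) (k, i)]) = phi_gen n i j k"
      unfolding phi_gen_def using that by (intro G2_class_append) (auto intro!: a2_in_gens2)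
    then show ?thesis
      using \<phi>(2)[OF a3_in_gens3[OF that]] h[OF that] by (simp add: G3_class_def)
  qed
  with \<phi>(1) show ?thesis unfolding is_phi_def by blast
qed


section \<open>A potential for walls of collinearity\<close>

definition orient :: "complex \<Rightarrow> complex \<Rightarrow> complex \<Rightarrow> real" where
  "orient a b c = (Re b - Re a) * (Im c - Im a) - (Im b - Im a) * (Re c - Re a)"

text \<open>Words that differ only in the order of commuting letters: if both lists are sorted by the
  same relation \<open>Q\<close>, then two letters that appear in different orders are related both ways.\<close>

lemma (in monoid) list_prod_sorted_unique:
  assumes "distinct xs" "distinct ys" "set xs = set ys" "sorted_wrt Q xs" "sorted_wrt Q ys"
    and "f ` set xs \<subseteq> carrier G"
    and "\<And>a b. a \<in> set xs \<Longrightarrow> b \<in> set xs \<Longrightarrow> a \<noteq> b \<Longrightarrow> Q a b \<Longrightarrow> Q b a \<Longrightarrow> f a \<otimes> f b = f b \<otimes> f a"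
  shows "list_prod f xs = list_prod f ys"
  using assms
proof (induction xs arbitrary: ys)
  case Nil
  then show ?case by simp
next
  case (Cons x xs)
  then obtain ys1 ys2 where ys: "ys = ys1 @ x # ys2"
    by (metis list.set_intros(1) split_list)
  have sets: "set xs = set (ys1 @ ys2)" "x \<notin> set ys1"
    using Cons.prems(1-3) ys by auto
  have f: "f x \<in> carrier G" "f ` set ys1 \<subseteq> carrier G" "f ` set ys2 \<subseteq> carrier G"
    using Cons.prems(3,6) ys by auto
  have IH: "list_prod f xs = list_prod f (ys1 @ ys2)"
  proof (rule Cons.IH)
    show "sorted_wrt Q (ys1 @ ys2)" using Cons.prems(5) ys by (auto simp: sorted_wrt_append)
  qed (use Cons.prems ys sets in auto)
  have "f y \<otimes> f x = f x \<otimes> f y" if "y \<in> set ys1" for y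
  proof (rule Cons.prems(7))
    show "Q y x" using Cons.prems(5) that ys by (auto simp: sorted_wrt_append)
    show "Q x y" using Cons.prems(4) that sets by auto
  qed (use that sets Cons.prems(3) ys in auto)
  then have "list_prod f ys1 \<otimes> f x = f x \<otimes> list_prod f ys1"
    using f by (intro list_prod_commute) auto
  then have "list_prod f ys = f x \<otimes> (list_prod f ys1 \<otimes> list_prod f ys2)"
    using f list_prod_closed[of f ys1] list_prod_closed[of f ys2] unfolding ys
    by (subst list_prod_append) (auto simp flip: m_assoc)
  then show ?case using IH f by (simp add: list_prod_append)
qed

text \<open>The height of the line through \<open>P a\<close> and \<open>P b\<close> above the point \<open>P l\<close>.\<close>

definition ht :: "(nat \<Rightarrow> complex) \<Rightarrow> nat \<times> nat \<Rightarrow> nat \<Rightarrow> real" where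
  "ht P p l = - orient (P (fst p)) (P (snd p)) (P l) / (Re (P (snd p)) - Re (P (fst p)))"

lemma ht_diff:
  assumes "Re (P a) < Re (P b)" "Re (P b) < Re (P c)"
  shows "ht P (a, c) l - ht P (a, b) l
      = (Re (P l) - Re (P a)) * orient (P a) (P b) (P c) / ((Re (P b) - Re (P a)) * (Re (P c) - Re (P a)))"
    and "ht P (b, c) l - ht P (a, c) l
      = (Re (P l) - Re (P c)) * orient (P a) (P b) (P c) / ((Re (P c) - Re (P b)) * (Re (P c) - Re (P a)))"
    and "ht P (b, c) l - ht P (a, b) l
      = (Re (P l) - Re (P b)) * orient (P a) (P b) (P c) / ((Re (P c) - Re (P b)) * (Re (P b) - Re (P a)))"
proof -
  define x where "x = Re (P b) - Re (P a)"
  define y where "y = Re (P c) - Re (P b)"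
  have pos: "x \<noteq> 0" "y \<noteq> 0" "x + y \<noteq> 0" using assms by (auto simp: x_def y_def)
  have e: "Re (P b) = Re (P a) + x" "Re (P c) = Re (P a) + x + y" by (auto simp: x_def y_def)
  show "ht P (a, c) l - ht P (a, b) l
      = (Re (P l) - Re (P a)) * orient (P a) (P b) (P c) / ((Re (P b) - Re (P a)) * (Re (P c) - Re (P a)))"
    unfolding ht_def orient_def fst_conv snd_conv e using pos by (simp add: field_simps)
  show "ht P (b, c) l - ht P (a, c) l
      = (Re (P l) - Re (P c)) * orient (P a) (P b) (P c) / ((Re (P c) - Re (P b)) * (Re (P c) - Re (P a)))"
    unfolding ht_def orient_def fst_conv snd_conv e using pos by (simp add: field_simps)
  show "ht P (b, c) l - ht P (a, b) l
      = (Re (P l) - Re (P b)) * orient (P a) (P b) (P c) / ((Re (P c) - Re (P b)) * (Re (P b) - Re (P a)))"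
    unfolding ht_def orient_def fst_conv snd_conv e using pos by (simp add: field_simps)
qed

lemma ht_less_iff:
  assumes "Re (P a) < Re (P b)" "Re (P b) < Re (P c)" "Re (P c) < Re (P l)"
  shows "ht P (a, b) l < ht P (a, c) l \<longleftrightarrow> 0 < orient (P a) (P b) (P c)"
    and "ht P (a, c) l < ht P (b, c) l \<longleftrightarrow> 0 < orient (P a) (P b) (P c)"
    and "ht P (a, b) l < ht P (b, c) l \<longleftrightarrow> 0 < orient (P a) (P b) (P c)"
    and "ht P (a, b) l = ht P (a, c) l \<longleftrightarrow> orient (P a) (P b) (P c) = 0"
    and "ht P (a, c) l = ht P (b, c) l \<longleftrightarrow> orient (P a) (P b) (P c) = 0"
    and "ht P (a, b) l = ht P (b, c) l \<longleftrightarrow> orient (P a) (P b) (P c) = 0"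
proof -
  have pos: "0 < u * r / (v * w) \<longleftrightarrow> 0 < r" "u * r / (v * w) = 0 \<longleftrightarrow> r = 0"
    if "0 < u" "0 < v" "0 < w" for u v w r :: real
    using that by (auto simp: pos_less_divide_eq zero_less_mult_iff)
  note d = ht_diff[OF assms(1,2), of l]
  have p: "0 < Re (P l) - Re (P a)" "0 < Re (P l) - Re (P b)" "0 < Re (P l) - Re (P c)"
      "0 < Re (P b) - Re (P a)" "0 < Re (P c) - Re (P a)" "0 < Re (P c) - Re (P b)"
    using assms by auto
  show "ht P (a, b) l < ht P (a, c) l \<longleftrightarrow> 0 < orient (P a) (P b) (P c)"
    "ht P (a, b) l = ht P (a, c) l \<longleftrightarrow> orient (P a) (P b) (P c) = 0"
    using d(1) pos[OF p(1,4,5), of "orient (P a) (P b) (P c)"] by linarith+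
  show "ht P (a, c) l < ht P (b, c) l \<longleftrightarrow> 0 < orient (P a) (P b) (P c)"
    "ht P (a, c) l = ht P (b, c) l \<longleftrightarrow> orient (P a) (P b) (P c) = 0"
    using d(2) pos[OF p(3,6,5), of "orient (P a) (P b) (P c)"] by linarith+
  show "ht P (a, b) l < ht P (b, c) l \<longleftrightarrow> 0 < orient (P a) (P b) (P c)"
    "ht P (a, b) l = ht P (b, c) l \<longleftrightarrow> orient (P a) (P b) (P c) = 0"
    using d(3) pos[OF p(2,6,4), of "orient (P a) (P b) (P c)"] by linarith+
qed

definition pairs_below :: "nat \<Rightarrow> (nat \<times> nat) set" where
  "pairs_below l = {(a, b). a < b \<and> b < l}"

text \<open>The word attached to the point \<open>P l\<close>: the lines through two earlier points that pass above it,
  from the highest to the lowest. The order is chosen such that a line that sweeps over \<open>P l\<close>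
  appears or disappears at the end of the word.\<close>

definition lines_above :: "(nat \<Rightarrow> complex) \<Rightarrow> nat \<Rightarrow> (nat \<times> nat) list" where
  "lines_above P l = sort_key (\<lambda>p. - ht P p l)
     (filter (\<lambda>p. p \<in> pairs_below l \<and> 0 < ht P p l) (List.product [0..<l] [0..<l]))"

lemma set_lines_above: "set (lines_above P l) = {p \<in> pairs_below l. 0 < ht P p l}"
  by (auto simp: lines_above_def pairs_below_def)

lemma distinct_lines_above: "distinct (lines_above P l)"
  by (simp add: lines_above_def distinct_product)

lemma sorted_lines_above: "sorted_wrt (\<lambda>p q. ht P q l \<le> ht P p l) (lines_above P l)"
proof -
  have "sorted (map (\<lambda>p. - ht P p l) (lines_above P l))" by (simp add: lines_above_def)
  then show ?thesis by (simp add: sorted_wrt_map)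
qed

lemma finite_pairs_below: "finite (pairs_below l)"
  by (rule finite_subset[of _ "{..<l} \<times> {..<l}"]) (auto simp: pairs_below_def)

text \<open>A family indexed by increasing triples that satisfies the relations of the generators
  \<open>a'\<close> of collinear triples. The last relation is the tetrahedron relation in the form in which it
  is used.\<close>

locale triple_group = group G for G (structure) +
  fixes n :: nat and g :: "nat \<Rightarrow> nat \<Rightarrow> nat \<Rightarrow> 'a"
  assumes g_closed: "a < b \<Longrightarrow> b < c \<Longrightarrow> c < n \<Longrightarrow> g a b c \<in> carrier G"
    and g_square: "a < b \<Longrightarrow> b < c \<Longrightarrow> c < n \<Longrightarrow> g a b c \<otimes> g a b c = \<one>"
    and g_commute: "a < b \<Longrightarrow> b < c \<Longrightarrow> c < n \<Longrightarrow> a' < b' \<Longrightarrow> b' < c' \<Longrightarrow> c' < n \<Longrightarrow>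
      card ({a, b, c} \<inter> {a', b', c'}) < 2 \<Longrightarrow> g a b c \<otimes> g a' b' c' = g a' b' c' \<otimes> g a b c"
    and g_tetra: "a < b \<Longrightarrow> b < c \<Longrightarrow> c < d \<Longrightarrow> d < n \<Longrightarrow>
      g a b c \<otimes> (g b c d \<otimes> (g a c d \<otimes> g a b d)) = (g a b d \<otimes> (g a c d \<otimes> g b c d)) \<otimes> g a b c"
begin

definition letter :: "nat \<Rightarrow> nat \<times> nat \<Rightarrow> 'a" where
  "letter l p = g (fst p) (snd p) l"

lemma letter_closed: "p \<in> pairs_below l \<Longrightarrow> l < n \<Longrightarrow> letter l p \<in> carrier G"
  by (auto simp: letter_def pairs_below_def g_closed)

lemma letter_commute:
  assumes "p \<in> pairs_below l" "q \<in> pairs_below l" "l < n" "{fst p, snd p} \<inter> {fst q, snd q} = {}"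
  shows "letter l p \<otimes> letter l q = letter l q \<otimes> letter l p"
proof -
  obtain a b c d where pq: "p = (a, b)" "q = (c, d)" by (metis surj_pair)
  have "{a, b, l} \<inter> {c, d, l} = {l}" using assms by (auto simp: pq pairs_below_def)
  then have "card ({a, b, l} \<inter> {c, d, l}) < 2" by simp
  then show ?thesis using assms unfolding pq letter_def fst_conv snd_conv
    by (intro g_commute) (auto simp: pairs_below_def)
qed

text \<open>The product of the words of all points, from left to right. For real parts that increase with
  the index it changes by exactly one generator whenever three points become collinear.\<close>

primrec potential :: "(nat \<Rightarrow> complex) \<Rightarrow> nat \<Rightarrow> 'a" where
  "potential P 0 = \<one>"
| "potential P (Suc l) = potential P l \<otimes> list_prod (letter l) (lines_above P l)"

lemma lines_above_closed: "l < n \<Longrightarrow> list_prod (letter l) (lines_above P l) \<in> carrier G"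
  by (rule list_prod_closed) (auto simp: set_lines_above letter_closed)

lemma potential_closed: "m \<le> n \<Longrightarrow> potential P m \<in> carrier G"
  by (induction m) (auto simp: lines_above_closed)

end

text \<open>A configuration \<open>P0\<close> with at most one collinear triple \<open>(i, j, k)\<close>. The case of no
  collinear triple at all is covered by a \<open>k\<close> beyond the range of indices.\<close>

locale near_generic = triple_group G n g for G (structure) and n and g +
  fixes P0 :: "nat \<Rightarrow> complex" and i j k :: nat
  assumes incr: "\<And>a b. a < b \<Longrightarrow> b < n \<Longrightarrow> Re (P0 a) < Re (P0 b)"
    and ij: "i < j" and jk: "j < k"
    and single: "\<And>a b c. a < b \<Longrightarrow> b < c \<Longrightarrow> c < n \<Longrightarrow> (a, b, c) \<noteq> (i, j, k) \<Longrightarrow>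
      orient (P0 a) (P0 b) (P0 c) \<noteq> 0"
begin

abbreviation "h0 \<equiv> \<lambda>l p. ht P0 p l"

definition mid :: "(nat \<times> nat) set" where
  "mid = {(i, j), (i, k), (j, k)}"

text \<open>The configurations near \<open>P0\<close> in the only sense that matters for the words: all strict inequalities
  between heights at \<open>P0\<close> persist.\<close>

definition near_wall :: "(nat \<Rightarrow> complex) \<Rightarrow> bool" where
  "near_wall P \<longleftrightarrow>
     (\<forall>a b. a < b \<and> b < n \<longrightarrow> Re (P a) < Re (P b)) \<and>
     (\<forall>l<n. \<forall>p\<in>pairs_below l. (0 < h0 l p \<longrightarrow> 0 < ht P p l) \<and> (h0 l p < 0 \<longrightarrow> ht P p l < 0) \<and>
        (\<forall>q\<in>pairs_below l. h0 l p < h0 l q \<longrightarrow> ht P p l < ht P q l))"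

lemma eventually_near_wall:
  assumes "\<And>a. a < n \<Longrightarrow> ((\<lambda>s. P s a) \<longlongrightarrow> P0 a) F"
  shows "eventually (\<lambda>s. near_wall (P s)) F"
proof -
  have ht_lim: "((\<lambda>s. ht (P s) p l) \<longlongrightarrow> h0 l p) F" if "p \<in> pairs_below l" "l < n" for p l
  proof -
    have "Re (P0 (fst p)) < Re (P0 (snd p))" using that incr by (auto simp: pairs_below_def)
    moreover have "((\<lambda>s. P s (fst p)) \<longlongrightarrow> P0 (fst p)) F" "((\<lambda>s. P s (snd p)) \<longlongrightarrow> P0 (snd p)) F"
      "((\<lambda>s. P s l) \<longlongrightarrow> P0 l) F"
      using that by (auto intro!: assms simp: pairs_below_def)
    ultimately show ?thesis unfolding ht_def orient_def by (intro tendsto_intros) auto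
  qed
  have "eventually (\<lambda>s. a < b \<longrightarrow> Re (P s a) < Re (P s b)) F" if "a < n" "b < n" for a b
  proof (cases "a < b")
    case True
    then show ?thesis
      using order_tendstoD(1)[OF tendsto_diff[OF tendsto_Re tendsto_Re, OF assms[OF \<open>b < n\<close>] assms[OF \<open>a < n\<close>]], of 0]
        incr[OF True \<open>b < n\<close>] by (auto elim!: eventually_mono)
  qed auto
  then have "eventually (\<lambda>s. \<forall>a\<in>{..<n}. \<forall>b\<in>{..<n}. a < b \<longrightarrow> Re (P s a) < Re (P s b)) F"
    by (intro eventually_ball_finite ballI) auto
  moreover have "eventually (\<lambda>s. \<forall>l\<in>{..<n}. \<forall>p\<in>pairs_below l. 0 < h0 l p \<longrightarrow> 0 < ht (P s) p l) F"
    by (intro eventually_ball_finite ballI finite_pairs_below finite_lessThan)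
      (use order_tendstoD(1)[OF ht_lim] in \<open>force elim: eventually_mono intro: eventuallyI\<close>)
  moreover have "eventually (\<lambda>s. \<forall>l\<in>{..<n}. \<forall>p\<in>pairs_below l. h0 l p < 0 \<longrightarrow> ht (P s) p l < 0) F"
    by (intro eventually_ball_finite ballI finite_pairs_below finite_lessThan)
      (use order_tendstoD(2)[OF ht_lim] in \<open>force elim: eventually_mono intro: eventuallyI\<close>)
  moreover have "eventually (\<lambda>s. \<forall>l\<in>{..<n}. \<forall>p\<in>pairs_below l. \<forall>q\<in>pairs_below l.
      h0 l p < h0 l q \<longrightarrow> ht (P s) p l < ht (P s) q l) F"
  proof (intro eventually_ball_finite ballI finite_pairs_below finite_lessThan)
    fix l p q assume *: "l \<in> {..<n}" "p \<in> pairs_below l" "q \<in> pairs_below l"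
    have "((\<lambda>s. ht (P s) q l - ht (P s) p l) \<longlongrightarrow> h0 l q - h0 l p) F"
      using * by (intro tendsto_diff ht_lim) auto
    from order_tendstoD(1)[OF this, of 0]
    show "eventually (\<lambda>s. h0 l p < h0 l q \<longrightarrow> ht (P s) p l < ht (P s) q l) F"
      by (cases "h0 l p < h0 l q") auto
  qed
  ultimately show ?thesis
    by eventually_elim (auto simp: near_wall_def)
qed

text \<open>At \<open>P0\<close> two lines that share one of their two points have the same height over a later point only if they are
  the same line, that is, if both join two of the three collinear points. Lines without a shared point
  may well have equal heights, but then their letters commute.\<close>

lemma same_height:
  assumes "p \<in> pairs_below l" "q \<in> pairs_below l" "l < n" "p \<noteq> q"
    and "{fst p, snd p} \<inter> {fst q, snd q} \<noteq> {}" "h0 l p = h0 l q"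
  shows "p \<in> mid \<and> q \<in> mid \<and> k < l"
proof -
  obtain a b c d where pq: "p = (a, b)" "q = (c, d)" by (metis surj_pair)
  have lt: "a < b" "b < l" "c < d" "d < l" using assms by (auto simp: pq pairs_below_def)
  have tri: "(x, y, z) = (i, j, k)"
    if "x < y" "y < z" "z < l" "h0 l (x, y) = h0 l (x, z) \<or> h0 l (x, z) = h0 l (y, z) \<or> h0 l (x, y) = h0 l (y, z)"
    for x y z
  proof (rule ccontr)
    assume "(x, y, z) \<noteq> (i, j, k)"
    then have "orient (P0 x) (P0 y) (P0 z) \<noteq> 0" using that \<open>l < n\<close> by (intro single) auto
    moreover have "Re (P0 x) < Re (P0 y)" "Re (P0 y) < Re (P0 z)" "Re (P0 z) < Re (P0 l)"
      using that \<open>l < n\<close> by (auto intro!: incr)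
    ultimately show False using that(4) ht_less_iff(4-6)[of P0 x y z l] by auto
  qed
  have e: "h0 l (a, b) = h0 l (c, d)" using assms pq by simp
  consider "a = c" "b < d" | "a = c" "d < b" | "a = d" | "b = c" | "b = d" "a < c" | "b = d" "c < a"
    using assms(4,5) pq linorder_less_linear[of a c] linorder_less_linear[of b d] by auto
  then show ?thesis
  proof cases
    case 1 then show ?thesis using tri[of a b d] lt e by (auto simp: pq mid_def)
  next
    case 2 then show ?thesis using tri[of a d b] lt e by (auto simp: pq mid_def)
  next
    case 3 then show ?thesis using tri[of c a b] lt e by (auto simp: pq mid_def)
  next
    case 4 then show ?thesis using tri[of a b d] lt e by (auto simp: pq mid_def)
  next
    case 5 then show ?thesis using tri[of a c b] lt e by (auto simp: pq mid_def)
  next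
    case 6 then show ?thesis using tri[of c a b] lt e by (auto simp: pq mid_def)
  qed
qed

lemma h0_nonzero:
  assumes "p \<in> pairs_below l" "l < n" "(fst p, snd p, l) \<noteq> (i, j, k)"
  shows "h0 l p \<noteq> 0"
  using single[of "fst p" "snd p" l] assms incr[of "fst p" "snd p"]
  by (auto simp: ht_def pairs_below_def)

lemma lines_above_sorted_h0:
  assumes "near_wall P" "l < n"
  shows "sorted_wrt (\<lambda>p q. h0 l q \<le> h0 l p) (lines_above P l)"
proof (rule sorted_wrt_mono_rel[OF _ sorted_lines_above])
  fix p q assume "p \<in> set (lines_above P l)" "q \<in> set (lines_above P l)" "ht P q l \<le> ht P p l"
  then show "h0 l q \<le> h0 l p"
    using assms unfolding near_wall_def set_lines_above by (metis (no_types, lifting) mem_Collect_eq not_le)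
qed

lemma lines_above_below_wall:
  assumes "near_wall P" "l < k" "l < n"
  shows "list_prod (letter l) (lines_above P l) = list_prod (letter l) (lines_above P0 l)"
proof (rule list_prod_sorted_unique[OF distinct_lines_above distinct_lines_above _
      lines_above_sorted_h0 sorted_lines_above])
  show "set (lines_above P l) = set (lines_above P0 l)"
    using assms h0_nonzero[of _ l] unfolding near_wall_def set_lines_above
    by (auto, metis linorder_neqE_linordered_idom order_less_asym order_less_trans)
  show "letter l ` set (lines_above P l) \<subseteq> carrier G"
    using assms by (auto simp: set_lines_above letter_closed)
  fix p q
  assume "p \<in> set (lines_above P l)" "q \<in> set (lines_above P l)" "p \<noteq> q" "h0 l q \<le> h0 l p" "h0 l p \<le> h0 l q"
  then show "letter l p \<otimes> letter l q = letter l q \<otimes> letter l p"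
    using same_height[of p l q] assms by (intro letter_commute) (auto simp: set_lines_above)
qed (use assms in auto)

lemma potential_below_wall:
  assumes "near_wall P" "m \<le> k" "m \<le> n"
  shows "potential P m = potential P0 m"
  using assms(2,3) by (induction m) (auto simp: lines_above_below_wall[OF assms(1)])

end

locale wall_config = near_generic +
  assumes kn: "k < n" and wall: "orient (P0 i) (P0 j) (P0 k) = 0"
begin

lemmas ijk = ij jk kn

lemma h0_wall: "h0 k (i, j) = 0"
  using wall by (simp add: ht_def)

text \<open>The line through \<open>P i\<close> and \<open>P j\<close> sweeps over \<open>P k\<close>. Among the lines above \<open>P k\<close> it is the lowest,
  so its letter is the last one.\<close>

lemma lines_above_at_wall:
  assumes "near_wall P" "orient (P i) (P j) (P k) \<noteq> 0"
  shows "list_prod (letter k) (lines_above P k) = (if 0 < orient (P i) (P j) (P k)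
     then list_prod (letter k) (lines_above P0 k) else list_prod (letter k) (lines_above P0 k) \<otimes> g i j k)"
proof -
  let ?o = "orient (P i) (P j) (P k)"
  have P: "Re (P i) < Re (P j)" using assms(1) ijk by (auto simp: near_wall_def)
  have hij: "0 < ht P (i, j) k \<longleftrightarrow> \<not> 0 < ?o"
    using P assms(2) by (auto simp: ht_def zero_less_divide_iff divide_less_0_iff not_less)
  have ij_below: "(i, j) \<in> pairs_below k" using ijk by (simp add: pairs_below_def)
  define ys where "ys = lines_above P0 k @ (if 0 < ?o then [] else [(i, j)])"
  have notin: "(i, j) \<notin> set (lines_above P0 k)" using h0_wall by (simp add: set_lines_above)
  have other: "0 < ht P p k \<longleftrightarrow> 0 < h0 k p" if "p \<in> pairs_below k" "p \<noteq> (i, j)" for p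
  proof -
    have "h0 k p \<noteq> 0" using that ijk by (intro h0_nonzero) auto
    then show ?thesis
      using assms(1) that ijk unfolding near_wall_def by (metis linorder_neqE_linordered_idom order_less_asym)
  qed
  have "list_prod (letter k) (lines_above P k) = list_prod (letter k) ys"
  proof (rule list_prod_sorted_unique[OF distinct_lines_above _ _ lines_above_sorted_h0])
    show "distinct ys" using notin by (simp add: ys_def distinct_lines_above)
    have "p \<in> set (lines_above P k) \<longleftrightarrow> p \<in> set ys" for p
    proof (cases "p = (i, j)")
      case True
      then show ?thesis using hij ij_below notin by (auto simp: set_lines_above ys_def)
    next
      case False
      then show ?thesis using other[of p] by (auto simp: set_lines_above ys_def)
    qed
    then show "set (lines_above P k) = set ys" by blast
    show "sorted_wrt (\<lambda>p q. h0 k q \<le> h0 k p) ys"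
      unfolding ys_def by (auto simp: sorted_wrt_append sorted_lines_above h0_wall set_lines_above)
    show "letter k ` set (lines_above P k) \<subseteq> carrier G"
      using assms ijk by (auto simp: set_lines_above letter_closed)
    fix p q
    assume "p \<in> set (lines_above P k)" "q \<in> set (lines_above P k)" "p \<noteq> q" "h0 k q \<le> h0 k p" "h0 k p \<le> h0 k q"
    then show "letter k p \<otimes> letter k q = letter k q \<otimes> letter k p"
      using same_height[of p k q] assms ijk by (intro letter_commute) (auto simp: set_lines_above)
  qed (use assms ijk in auto)
  also have "\<dots> = (if 0 < ?o then list_prod (letter k) (lines_above P0 k) else list_prod (letter k) (lines_above P0 k) \<otimes> g i j k)"
  proof -
    have "list_prod (letter k) (lines_above P0 k @ [(i, j)])
        = list_prod (letter k) (lines_above P0 k) \<otimes> list_prod (letter k) [(i, j)]"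
      using ijk ij_below by (intro list_prod_append) (auto simp: set_lines_above letter_closed)
    then show ?thesis using g_closed[OF ijk] by (simp add: ys_def letter_def)
  qed
  finally show ?thesis .
qed

text \<open>Beyond the wall triple, the three lines through its points are neighbours in the column, up
  to commutation, and crossing the wall reverses their order.\<close>

definition upper :: "nat \<Rightarrow> (nat \<times> nat) list" where
  "upper l = filter (\<lambda>p. p \<notin> mid \<and> h0 l (i, j) \<le> h0 l p) (lines_above P0 l)"

definition lower :: "nat \<Rightarrow> (nat \<times> nat) list" where
  "lower l = filter (\<lambda>p. p \<notin> mid \<and> h0 l p < h0 l (i, j)) (lines_above P0 l)"

definition middle :: "bool \<Rightarrow> nat \<Rightarrow> (nat \<times> nat) list" where
  "middle s l = (if 0 < h0 l (i, j) then (if s then [(j, k), (i, k), (i, j)] else [(i, j), (i, k), (j, k)]) else [])"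

lemma mid_heights:
  assumes "k < l" "l < n"
  shows "h0 l (i, k) = h0 l (i, j)" "h0 l (j, k) = h0 l (i, j)"
  using ht_less_iff(4,6)[of P0 i j k l] wall incr[of i j] incr[of j k] incr[of k l] ijk assms by auto

lemma mid_pairs_below: "k < l \<Longrightarrow> mid \<subseteq> pairs_below l"
  using ijk by (auto simp: mid_def pairs_below_def)

lemma lines_above_above_wall:
  assumes near: "near_wall P" and o: "orient (P i) (P j) (P k) \<noteq> 0" and l: "k < l" "l < n"
  shows "list_prod (letter l) (lines_above P l)
    = list_prod (letter l) (upper l @ middle (0 < orient (P i) (P j) (P k)) l @ lower l)"
proof -
  let ?o = "orient (P i) (P j) (P k)"
  define H where "H = h0 l (i, j)"
  have H: "h0 l p = H" if "p \<in> mid" for p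
    using that mid_heights[OF l] by (auto simp: mid_def H_def)
  have P: "Re (P i) < Re (P j)" "Re (P j) < Re (P k)" "Re (P k) < Re (P l)"
    using near ijk l by (auto simp: near_wall_def)
  have pos: "0 < ht P p l \<longleftrightarrow> 0 < h0 l p" if "p \<in> pairs_below l" for p
  proof -
    have "h0 l p \<noteq> 0" using that l by (intro h0_nonzero) auto
    then show ?thesis
      using near that l unfolding near_wall_def by (metis linorder_neqE_linordered_idom order_less_asym)
  qed
  define Q where "Q p q \<longleftrightarrow> h0 l q \<le> h0 l p \<and> (p \<in> mid \<and> q \<in> mid \<longrightarrow> ht P q l \<le> ht P p l)" for p q
  have mid_ne: "(i, j) \<noteq> (i, k)" "(i, k) \<noteq> (j, k)" "(i, j) \<noteq> (j, k)" using ijk by auto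
  have mid_order: "sorted_wrt (\<lambda>p q. ht P q l < ht P p l) (middle (0 < ?o) l)"
    using ht_less_iff[OF P] o
    by (auto simp: middle_def)
  have set_mid: "set (middle s l) = (if 0 < H then mid else {})" for s
    by (auto simp: middle_def mid_def H_def)
  have set_lo: "set (upper l) = {p \<in> pairs_below l. p \<notin> mid \<and> 0 < h0 l p \<and> H \<le> h0 l p}"
    "set (lower l) = {p \<in> pairs_below l. p \<notin> mid \<and> 0 < h0 l p \<and> h0 l p < H}"
    by (auto simp: upper_def lower_def set_lines_above H_def)
  show ?thesis
  proof (rule list_prod_sorted_unique[OF distinct_lines_above, where Q = Q])
    have "distinct (upper l)" "distinct (lower l)"
      unfolding upper_def lower_def by (simp_all add: distinct_lines_above)
    moreover have "distinct (middle (0 < ?o) l)"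
      unfolding middle_def using mid_ne by simp
    ultimately show "distinct (upper l @ middle (0 < ?o) l @ lower l)"
      unfolding distinct_append set_append set_lo set_mid by (auto split: if_splits)
    have "p \<in> set (lines_above P l) \<longleftrightarrow> p \<in> set (upper l @ middle (0 < ?o) l @ lower l)" for p
    proof (cases "p \<in> mid")
      case True
      then have "p \<in> pairs_below l" "h0 l p = H" using mid_pairs_below[OF l(1)] H by auto
      then show ?thesis using True pos[of p] by (simp add: set_lo set_mid set_lines_above)
    next
      case False
      then show ?thesis
        using pos[of p] by (auto simp: set_lo set_mid set_lines_above split: if_splits)
    qed
    then show "set (lines_above P l) = set (upper l @ middle (0 < ?o) l @ lower l)" by blast
    show "sorted_wrt Q (lines_above P l)"
    proof (rule sorted_wrt_mono_rel)
      show "sorted_wrt (\<lambda>p q. ht P q l \<le> ht P p l) (lines_above P l)" by (rule sorted_lines_above)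
      fix p q assume "p \<in> set (lines_above P l)" "q \<in> set (lines_above P l)" "ht P q l \<le> ht P p l"
      then show "Q p q"
        using near l unfolding near_wall_def set_lines_above Q_def by (metis (no_types, lifting) mem_Collect_eq not_le)
    qed
    have "sorted_wrt Q (upper l)" "sorted_wrt Q (lower l)"
      unfolding upper_def lower_def
      by (rule sorted_wrt_mono_rel[OF _ sorted_wrt_filter[OF sorted_lines_above[of P0 l]]]; auto simp: Q_def)+
    moreover have "sorted_wrt Q (middle (0 < ?o) l)"
      by (rule sorted_wrt_mono_rel[OF _ mid_order]) (use H set_mid in \<open>auto simp: Q_def split: if_splits\<close>)
    ultimately show "sorted_wrt Q (upper l @ middle (0 < ?o) l @ lower l)"
      using H by (auto simp: sorted_wrt_append set_lo set_mid Q_def)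
    show "letter l ` set (lines_above P l) \<subseteq> carrier G"
      using l by (auto simp: set_lines_above letter_closed)
    fix p q assume pq: "p \<in> set (lines_above P l)" "q \<in> set (lines_above P l)" "p \<noteq> q" "Q p q" "Q q p"
    have "\<not> (p \<in> mid \<and> q \<in> mid)"
    proof
      assume m: "p \<in> mid \<and> q \<in> mid"
      then have "ht P p l = ht P q l" using pq by (auto simp: Q_def)
      then show False using m \<open>p \<noteq> q\<close> ht_less_iff(4-6)[OF P] o by (auto simp: mid_def)
    qed
    then have "{fst p, snd p} \<inter> {fst q, snd q} = {}"
      using same_height[of p l q] pq l by (auto simp: set_lines_above Q_def)
    then show "letter l p \<otimes> letter l q = letter l q \<otimes> letter l p"
      using pq l by (intro letter_commute) (auto simp: set_lines_above)
  qed
qed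

lemma g_commute_off_mid:
  assumes "p \<in> pairs_below l" "p \<notin> mid" "k < l" "l < n"
  shows "letter l p \<otimes> g i j k = g i j k \<otimes> letter l p"
proof -
  obtain a b where p: "p = (a, b)" by force
  have ab: "a < b" "b < l" using assms by (auto simp: p pairs_below_def)
  have "card ({a, b, l} \<inter> {i, j, k}) < 2"
  proof (rule ccontr)
    assume "\<not> ?thesis"
    moreover have sub: "{a, b, l} \<inter> {i, j, k} \<subseteq> {a, b}" using assms ijk by auto
    moreover have "card {a, b} = 2" using ab by simp
    ultimately have "{a, b, l} \<inter> {i, j, k} = {a, b}"
      by (intro card_subset_eq) (use card_mono[OF _ sub] in auto)
    then have "a \<in> {i, j, k}" "b \<in> {i, j, k}" by blast+
    then show False using assms(2) ab ijk by (auto simp: p mid_def)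
  qed
  then show ?thesis
    unfolding p letter_def fst_conv snd_conv using ab assms ijk by (intro g_commute) auto
qed

text \<open>The generator of the wall commutes with all letters of a later column except the three that
  belong to the wall, and these are reversed by the tetrahedron relation.\<close>

lemma wall_column:
  assumes "k < l" "l < n"
  shows "g i j k \<otimes> list_prod (letter l) (upper l @ middle False l @ lower l)
    = list_prod (letter l) (upper l @ middle True l @ lower l) \<otimes> g i j k"
proof -
  have gc: "g i j k \<in> carrier G" using ijk g_closed by blast
  have sets: "set (upper l) \<subseteq> pairs_below l - mid" "set (lower l) \<subseteq> pairs_below l - mid"
    "set (middle s l) \<subseteq> pairs_below l" for s
    using mid_pairs_below[OF assms(1)] by (auto simp: upper_def lower_def middle_def set_lines_above mid_def)
  then have letters: "letter l ` set (upper l) \<subseteq> carrier G" "letter l ` set (lower l) \<subseteq> carrier G"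
    "letter l ` set (middle s l) \<subseteq> carrier G" for s
    using assms letter_closed by (blast+)
  define u where "u = list_prod (letter l) (upper l)"
  define v where "v = list_prod (letter l) (lower l)"
  define m where "m s = list_prod (letter l) (middle s l)" for s
  have cl: "u \<in> carrier G" "v \<in> carrier G" "m s \<in> carrier G" for s
    unfolding u_def v_def m_def by (intro list_prod_closed letters)+
  have lp: "list_prod (letter l) (upper l @ middle s l @ lower l) = u \<otimes> (m s \<otimes> v)" for s
    unfolding u_def v_def m_def using letters by (simp add: list_prod_append image_Un)
  have uv: "u \<otimes> g i j k = g i j k \<otimes> u" "v \<otimes> g i j k = g i j k \<otimes> v"
    unfolding u_def v_def using letters gc sets assms
    by (intro list_prod_commute; auto intro!: g_commute_off_mid)+
  have "g i j k \<otimes> m True = m False \<otimes> g i j k"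
  proof (cases "0 < h0 l (i, j)")
    case True
    have "g j k l \<in> carrier G" "g i k l \<in> carrier G" "g i j l \<in> carrier G"
      using ijk assms by (auto intro!: g_closed)
    then show ?thesis
      using True g_tetra[of i j k l] ijk assms by (simp add: m_def middle_def letter_def)
  next
    case False
    then show ?thesis using gc by (simp add: m_def middle_def)
  qed
  then have "g i j k \<otimes> (g i j k \<otimes> m True) \<otimes> g i j k = g i j k \<otimes> (m False \<otimes> g i j k) \<otimes> g i j k"
    by simp
  moreover have "g i j k \<otimes> (g i j k \<otimes> m True) \<otimes> g i j k = m True \<otimes> g i j k"
    using gc cl g_square[OF ijk] by (simp flip: m_assoc)
  moreover have "g i j k \<otimes> (m False \<otimes> g i j k) \<otimes> g i j k = g i j k \<otimes> m False"
    using gc cl g_square[OF ijk] by (simp add: m_assoc)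
  ultimately have mm: "g i j k \<otimes> m False = m True \<otimes> g i j k" by simp
  have "g i j k \<otimes> (u \<otimes> (m False \<otimes> v)) = u \<otimes> ((g i j k \<otimes> m False) \<otimes> v)"
    using cl gc uv by (simp add: m_assoc commute_left[OF uv(1)[symmetric]])
  also have "\<dots> = u \<otimes> (m True \<otimes> v) \<otimes> g i j k"
    unfolding mm using cl gc uv(2) by (simp add: m_assoc)
  finally show ?thesis by (simp only: lp)
qed

text \<open>Crossing the wall adds the letter \<open>g i j k\<close> at the end of column \<open>k\<close> and reverses three neighbouring
  letters in the later columns. Pushing the new letter through the later columns to the right end undoes
  these reversals, so that the total effect is a multiplication from the right.\<close>

lemma potential_wall:
  obtains v where "v \<in> carrier G"
    and "\<And>P. near_wall P \<Longrightarrow> orient (P i) (P j) (P k) \<noteq> 0 \<Longrightarrow>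
      potential P n = (if 0 < orient (P i) (P j) (P k) then v else v \<otimes> g i j k)"
proof -
  have gc: "g i j k \<in> carrier G" using ijk g_closed by blast
  define C where "C l = (if l \<le> k then lines_above P0 l else upper l @ middle True l @ lower l)" for l
  define v where "v m = list_prod (\<lambda>l. list_prod (letter l) (C l)) [0..<m]" for m
  have C_closed: "list_prod (letter l) (C l) \<in> carrier G" if "l < n" for l
  proof (rule list_prod_closed)
    have "set (C l) \<subseteq> pairs_below l"
      using mid_pairs_below[of l]
      by (auto simp: C_def upper_def lower_def middle_def set_lines_above mid_def)
    then show "letter l ` set (C l) \<subseteq> carrier G" using letter_closed that by blast
  qed
  have v_closed: "v m \<in> carrier G" if "m \<le> n" for m
    unfolding v_def using that C_closed by (intro list_prod_closed) auto
  have v_Suc: "v (Suc m) = v m \<otimes> list_prod (letter m) (C m)" if "m < n" for m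
    unfolding v_def using that C_closed by (simp add: list_prod_append image_subset_iff)
  have v0: "v 0 = \<one>" by (simp add: v_def)
  have main: "potential P m = (if 0 < orient (P i) (P j) (P k) \<or> m \<le> k then v m else v m \<otimes> g i j k)"
    if P: "near_wall P" "orient (P i) (P j) (P k) \<noteq> 0" and "m \<le> n" for P m
    using \<open>m \<le> n\<close>
  proof (induction m)
    case 0
    then show ?case by (simp add: v0)
  next
    case (Suc l)
    let ?col = "list_prod (letter l) (lines_above P l)"
    have l: "l < n" "l \<le> n" using Suc.prems by auto
    note cl = v_closed[OF l(2)] C_closed[OF l(1)] lines_above_closed[OF l(1), of P] gc
    consider "l < k" | "l = k" | "k < l" by linarith
    then show ?case
    proof cases
      case 1
      then have "?col = list_prod (letter l) (C l)" using lines_above_below_wall[OF P(1) _ l(1)] by (simp add: C_def)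
      then show ?thesis using Suc.IH 1 l v_Suc[OF l(1)] by auto
    next
      case 2
      then have "?col = (if 0 < orient (P i) (P j) (P k) then list_prod (letter l) (C l)
          else list_prod (letter l) (C l) \<otimes> g i j k)"
        using lines_above_at_wall[OF P] by (simp add: C_def)
      then show ?thesis using Suc.IH 2 l v_Suc[OF l(1)] cl by (auto simp: m_assoc)
    next
      case 3
      note c = lines_above_above_wall[OF P 3 l(1)]
      show ?thesis
      proof (cases "0 < orient (P i) (P j) (P k)")
        case True
        then show ?thesis using c Suc.IH l v_Suc[OF l(1)] 3 by (simp add: C_def)
      next
        case False
        then have "g i j k \<otimes> ?col = list_prod (letter l) (C l) \<otimes> g i j k"
          using c wall_column[OF 3 l(1)] 3 by (simp add: C_def)
        then show ?thesis using False Suc.IH l v_Suc[OF l(1)] 3 cl by (auto simp: m_assoc)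
      qed
    qed
  qed
  show ?thesis
    using that[OF v_closed[OF order_refl]] main[OF _ _ order_refl] ijk by auto
qed

end


section \<open>Generic configurations\<close>

lemma orient_same [simp]: "orient a a c = 0" "orient a b b = 0" "orient a b a = 0"
  by (simp_all add: orient_def)

lemma orient_mult: "orient (u * a) (u * b) (u * c) = (cmod u)\<^sup>2 * orient a b c"
  unfolding orient_def cmod_power2 by (simp add: algebra_simps power2_eq_square)

lemma orient_inner: "orient a b c = (\<i> * (b - a)) \<bullet> (c - a)"
  by (simp add: orient_def inner_complex_def algebra_simps)

lemma orient_zero_perm:
  "orient b a c = 0 \<longleftrightarrow> orient a b c = 0" "orient a c b = 0 \<longleftrightarrow> orient a b c = 0"
  "orient c b a = 0 \<longleftrightarrow> orient a b c = 0" "orient b c a = 0 \<longleftrightarrow> orient a b c = 0"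
  "orient c a b = 0 \<longleftrightarrow> orient a b c = 0"
  by (auto simp: orient_def algebra_simps)

lemma orient_eq_0_iff_collinear: "orient a b c = 0 \<longleftrightarrow> collinear {a, b, c}"
proof -
  have "collinear {a, b, c} \<longleftrightarrow> collinear {0, c - b, a - b}"
    using collinear_3[of a b c] by (simp add: NO_MATCH_def insert_commute)
  also have "\<dots> \<longleftrightarrow> orient a b c = 0"
  proof (cases "c = b")
    case True
    then show ?thesis by simp
  next
    case False
    define z where "z = c - b"
    define w where "w = a - b"
    have "z \<noteq> 0" using False by (simp add: z_def)
    have o: "orient a b c = Im w * Re z - Re w * Im z"
      by (simp add: orient_def z_def w_def algebra_simps)
    have "Im (w / z) = (Im w * Re z - Re w * Im z) / (cmod z)\<^sup>2"
      by (simp add: Im_divide cmod_power2)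
    then have "w / z \<in> \<real> \<longleftrightarrow> orient a b c = 0"
      using \<open>z \<noteq> 0\<close> by (auto simp: complex_is_Real_iff o)
    then show ?thesis by (simp add: collinear_iff_Reals z_def w_def)
  qed
  finally show ?thesis by simp
qed

lemma between_imp_orient_eq_0: "between (a, c) b \<Longrightarrow> orient a b c = 0"
  by (simp add: orient_eq_0_iff_collinear between_imp_collinear)

definition generic :: "nat \<Rightarrow> (nat \<Rightarrow> complex) \<Rightarrow> bool" where
  "generic n c \<longleftrightarrow> (\<forall>i j k. {i, j, k} \<subseteq> {1..n} \<longrightarrow> distinct [i, j, k] \<longrightarrow> orient (c i) (c j) (c k) \<noteq> 0)"

text \<open>The triple \<open>T\<close> itself may or may not be collinear, so \<open>T = {}\<close> describes generic configurations.\<close>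

definition only_wall :: "nat \<Rightarrow> (nat \<Rightarrow> complex) \<Rightarrow> nat set \<Rightarrow> bool" where
  "only_wall n c T \<longleftrightarrow> (\<forall>i j k. {i, j, k} \<subseteq> {1..n} \<longrightarrow> distinct [i, j, k] \<longrightarrow> {i, j, k} \<noteq> T \<longrightarrow>
     orient (c i) (c j) (c k) \<noteq> 0)"

lemma genericD: "generic n c \<Longrightarrow> {i, j, k} \<subseteq> {1..n} \<Longrightarrow> distinct [i, j, k] \<Longrightarrow> orient (c i) (c j) (c k) \<noteq> 0"
  unfolding generic_def by blast

lemma only_wallD:
  "only_wall n c T \<Longrightarrow> {i, j, k} \<subseteq> {1..n} \<Longrightarrow> distinct [i, j, k] \<Longrightarrow> {i, j, k} \<noteq> T \<Longrightarrow>
    orient (c i) (c j) (c k) \<noteq> 0"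
  unfolding only_wall_def by blast

text \<open>Only the indices \<open>1, \<dots>, n\<close> count, which makes the filter coarser than the neighbourhoods in
  the product topology on functions and spares side conditions about the other values.\<close>

definition near :: "nat \<Rightarrow> (nat \<Rightarrow> complex) \<Rightarrow> (nat \<Rightarrow> complex) filter" where
  "near n c0 = (INF e\<in>{0<..}. principal {c. \<forall>i\<in>{1..n}. dist (c i) (c0 i) < e})"

lemma eventually_near:
  "eventually P (near n c0) \<longleftrightarrow> (\<exists>e>0. \<forall>c. (\<forall>i\<in>{1..n}. dist (c i) (c0 i) < e) \<longrightarrow> P c)"
proof -
  have "eventually P (near n c0) \<longleftrightarrow>
      (\<exists>e\<in>{0<..}. eventually P (principal {c. \<forall>i\<in>{1..n}. dist (c i) (c0 i) < e}))"
    unfolding near_def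
  proof (rule eventually_INF_base)
    show "\<exists>x\<in>{0<..}. principal {c. \<forall>i\<in>{1..n}. dist (c i) (c0 i) < x}
        \<le> inf (principal {c. \<forall>i\<in>{1..n}. dist (c i) (c0 i) < a}) (principal {c. \<forall>i\<in>{1..n}. dist (c i) (c0 i) < b})"
      if "a \<in> {0<..}" "b \<in> {0<..}" for a b :: real
      using that by (intro bexI[of _ "min a b"]) auto
  qed auto
  then show ?thesis by (auto simp: eventually_principal)
qed

lemma tendsto_near:
  assumes "i \<in> {1..n}"
  shows "((\<lambda>c. c i) \<longlongrightarrow> c0 i) (near n c0)"
  unfolding tendsto_iff eventually_near using assms by blast

lemma filterlim_near:
  assumes "\<And>i. i \<in> {1..n} \<Longrightarrow> ((\<lambda>s. c s i) \<longlongrightarrow> c0 i) F"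
  shows "filterlim c (near n c0) F"
proof -
  have "eventually (\<lambda>s. \<forall>i\<in>{1..n}. dist (c s i) (c0 i) < e) F" if "e > 0" for e
    using assms that by (intro eventually_ball_finite ballI) (auto simp: tendsto_iff)
  then show ?thesis
    by (auto simp: near_def filterlim_INF filterlim_principal)
qed

lemma tendsto_orient:
  assumes "(a \<longlongrightarrow> a0) F" "(b \<longlongrightarrow> b0) F" "(c \<longlongrightarrow> c0) F"
  shows "((\<lambda>s. orient (a s) (b s) (c s)) \<longlongrightarrow> orient a0 b0 c0) F"
  unfolding orient_def using assms by (intro tendsto_intros)


section \<open>Negligible sets of parameters\<close>

lemma exists_near_not_negligible:
  fixes N :: "complex set"
  assumes "negligible N" "e > 0"
  obtains b where "dist b d < e" "b \<notin> N"
proof -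
  have "\<not> ball d e \<subseteq> N"
    using open_not_negligible[of "ball d e"] negligible_subset[OF assms(1)] \<open>e > 0\<close> by auto
  then obtain b where "b \<in> ball d e" "b \<notin> N" by blast
  then show ?thesis using that[of b] by (simp add: dist_commute)
qed

lemma negligible_UN_finite:
  assumes "finite I" "\<And>i. i \<in> I \<Longrightarrow> negligible (f i)"
  shows "negligible (\<Union>i\<in>I. f i)"
  by (rule negligible_Union) (use assms in auto)

lemma negligible_line:
  fixes B :: complex
  assumes "B \<noteq> 0"
  shows "negligible {c. B \<bullet> c = A}"
  using assms by (intro negligible_hyperplane) auto

text \<open>Two moving lines meet in a moving point, as long as they are not parallel. By Cramer's rule
  this point describes a differentiable curve, which is negligible in the plane.\<close>

lemma negligible_moving_lines:
  fixes A1 A2 :: "real \<Rightarrow> real" and B1 B2 :: "real \<Rightarrow> complex"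
  assumes A: "A1 differentiable_on S" "A2 differentiable_on S"
    and B: "B1 differentiable_on S" "B2 differentiable_on S"
  shows "negligible {c. \<exists>t\<in>S. Re (B1 t) * Im (B2 t) - Im (B1 t) * Re (B2 t) \<noteq> 0 \<and>
    B1 t \<bullet> c = A1 t \<and> B2 t \<bullet> c = A2 t}"
proof -
  define D where "D t = Re (B1 t) * Im (B2 t) - Im (B1 t) * Re (B2 t)" for t
  define S' where "S' = {t \<in> S. D t \<noteq> 0}"
  define f where "f t = complex_of_real ((A1 t * Im (B2 t) - A2 t * Im (B1 t)) / D t)
     + \<i> * complex_of_real ((Re (B1 t) * A2 t - Re (B2 t) * A1 t) / D t)" for t
  have "S' \<subseteq> S" by (auto simp: S'_def)
  note A' = A[THEN differentiable_on_subset, OF this]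
  note B' = B[THEN differentiable_on_subset, OF \<open>S' \<subseteq> S\<close>]
  have re: "(\<lambda>t. Re (h t)) differentiable F" "(\<lambda>t. Im (h t)) differentiable F"
    if "h differentiable F" for h :: "real \<Rightarrow> complex" and F
    using that unfolding differentiable_def
    by (blast intro: bounded_linear.has_derivative[OF bounded_linear_Re]
        bounded_linear.has_derivative[OF bounded_linear_Im])+
  have of_real: "(\<lambda>t. complex_of_real (h t)) differentiable F"
    if "h differentiable F" for h :: "real \<Rightarrow> real" and F
    using that unfolding differentiable_def
    by (blast intro: bounded_linear.has_derivative[OF bounded_linear_of_real])
  have "f differentiable_on S'"
    unfolding differentiable_on_def
  proof
    fix t assume t: "t \<in> S'"
    have "A1 differentiable at t within S'" "A2 differentiable at t within S'"
      "B1 differentiable at t within S'" "B2 differentiable at t within S'"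
      using A' B' t by (auto simp: differentiable_on_def)
    then show "f differentiable at t within S'"
      unfolding f_def using t
      by (intro differentiable_add differentiable_mult differentiable_const of_real
          differentiable_divide differentiable_diff re) (auto simp: S'_def D_def intro!: differentiable_diff differentiable_mult re)
  qed
  then have "negligible (f ` S')"
    by (rule negligible_differentiable_image_lowdim[rotated]) simp
  moreover have "{c. \<exists>t\<in>S. D t \<noteq> 0 \<and> B1 t \<bullet> c = A1 t \<and> B2 t \<bullet> c = A2 t} \<subseteq> f ` S'"
  proof safe
    fix c t assume t: "t \<in> S" "D t \<noteq> 0" "B1 t \<bullet> c = A1 t" "B2 t \<bullet> c = A2 t"
    have "Re c * D t = A1 t * Im (B2 t) - A2 t * Im (B1 t)"
      "Im c * D t = Re (B1 t) * A2 t - Re (B2 t) * A1 t"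
      unfolding t(3,4)[symmetric] D_def inner_complex_def by (simp_all add: algebra_simps)
    then have "c = f t"
      using t(2) by (simp add: f_def complex_eq_iff eq_divide_eq)
    then show "c \<in> f ` S'" using t by (auto simp: S'_def)
  qed
  ultimately show ?thesis
    unfolding D_def by (rule negligible_subset)
qed

text \<open>The points are chosen one after the other, outside the finitely many lines through earlier points.\<close>

lemma generic_dense:
  assumes "e > 0"
  obtains c' where "generic n c'" "\<And>i. i \<in> {1..n} \<Longrightarrow> dist (c' i) (c i) < e"
proof -
  have "\<exists>c'. generic m c' \<and> inj_on c' {1..m} \<and> (\<forall>i\<in>{1..m}. dist (c' i) (c i) < e)" for m
  proof (induction m)
    case 0
    then show ?case by (intro exI[of _ c]) (auto simp: generic_def)
  next
    case (Suc m)
    then obtain c' where c': "generic m c'" "inj_on c' {1..m}" "\<And>i. i \<in> {1..m} \<Longrightarrow> dist (c' i) (c i) < e"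
      by blast
    define N where "N = c' ` {1..m} \<union> (\<Union>i\<in>{1..m}. \<Union>j\<in>{1..m} - {i}. {b. orient (c' i) (c' j) b = 0})"
    have "negligible {b. orient (c' i) (c' j) b = 0}" if "i \<in> {1..m}" "j \<in> {1..m} - {i}" for i j
    proof -
      have "c' j \<noteq> c' i" using inj_on_eq_iff[OF c'(2), of j i] that by blast
      then have "c' j - c' i \<noteq> 0" by simp
      then have "negligible {b. (\<i> * (c' j - c' i)) \<bullet> b = (\<i> * (c' j - c' i)) \<bullet> c' i}"
        by (intro negligible_line) simp
      then show ?thesis by (simp add: orient_inner inner_diff_right)
    qed
    note line = this
    have "negligible N" unfolding N_def
    proof (rule negligible_Un)
      show "negligible (c' ` {1..m})" by (rule negligible_finite) simp
      show "negligible (\<Union>i\<in>{1..m}. \<Union>j\<in>{1..m} - {i}. {b. orient (c' i) (c' j) b = 0})"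
        by (intro negligible_UN_finite line finite_Diff finite_atLeastAtMost)
    qed
    then obtain b where b: "dist b (c (Suc m)) < e" "b \<notin> N"
      using exists_near_not_negligible[OF _ assms] by metis
    define c'' where "c'' = c'(Suc m := b)"
    have old: "c'' i = c' i" if "i \<in> {1..m}" for i using that by (simp add: c''_def)
    have new: "orient (c' i) (c' j) b \<noteq> 0" if "i \<in> {1..m}" "j \<in> {1..m}" "i \<noteq> j" for i j
      using b(2) that by (auto simp: N_def)
    have "generic (Suc m) c''"
      unfolding generic_def
    proof (intro allI impI)
      fix i j k assume *: "{i, j, k} \<subseteq> {1..Suc m}" "distinct [i, j, k]"
      have m: "x \<in> {1..m}" if "x \<in> {i, j, k}" "x \<noteq> Suc m" for x
        using that *(1) by (metis atLeastAtMostSuc_conv insert_iff le_add1 plus_1_eq_Suc subset_iff)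
      consider "i = Suc m" | "j = Suc m" | "k = Suc m" | "i \<noteq> Suc m" "j \<noteq> Suc m" "k \<noteq> Suc m" by blast
      then show "orient (c'' i) (c'' j) (c'' k) \<noteq> 0"
      proof cases
        case 1
        then have "j \<in> {1..m}" "k \<in> {1..m}" "j \<noteq> k" using * m by auto
        then show ?thesis using 1 new[of j k] old by (simp add: c''_def orient_zero_perm)
      next
        case 2
        then have "i \<in> {1..m}" "k \<in> {1..m}" "i \<noteq> k" using * m by auto
        then show ?thesis using 2 new[of i k] old by (simp add: c''_def orient_zero_perm)
      next
        case 3
        then have "i \<in> {1..m}" "j \<in> {1..m}" "i \<noteq> j" using * m by auto
        then show ?thesis using 3 new[of i j] old by (simp add: c''_def orient_zero_perm)
      next
        case 4
        then have "{i, j, k} \<subseteq> {1..m}" using m by blast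
        then show ?thesis using genericD[OF c'(1) _ *(2)] old by simp
      qed
    qed
    moreover have "inj_on c'' {1..Suc m}"
    proof -
      have "b \<notin> c' ` {1..m}" using b(2) by (simp add: N_def)
      moreover have "c'' ` {1..m} = c' ` {1..m}" using old by (intro image_cong) auto
      moreover have "inj_on c'' {1..m}" using c'(2) inj_on_cong[of "{1..m}" c'' c'] old by blast
      moreover have "c'' (Suc m) = b" "{1..m} - {Suc m} = {1..m}" by (auto simp: c''_def)
      ultimately have "inj_on c'' (insert (Suc m) {1..m})"
        unfolding inj_on_insert by simp
      then show ?thesis by (simp add: atLeastAtMostSuc_conv)
    qed
    moreover have "\<forall>i\<in>{1..Suc m}. dist (c'' i) (c i) < e"
    proof
      fix i assume "i \<in> {1..Suc m}"
      then have "i = Suc m \<or> i \<in> {1..m}" by auto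
      then show "dist (c'' i) (c i) < e" using b(1) c'(3) old by (auto simp: c''_def)
    qed
    ultimately show ?case by blast
  qed
  then show ?thesis using that by blast
qed

text \<open>A cross product \<open>v \<times> y\<close> vanishes if both \<open>v\<close> and \<open>y\<close> are parallel to \<open>w \<noteq> 0\<close>.\<close>

lemma cross_zero_trans:
  fixes vx :: real
  assumes "vx * wy - vy * wx = 0" "wx * yy - wy * yx = 0" "wx \<noteq> 0 \<or> wy \<noteq> 0"
  shows "vx * yy - vy * yx = 0"
proof -
  have "wx * (vx * yy - vy * yx) = vx * (wx * yy - wy * yx) + yx * (vx * wy - vy * wx)"
    "wy * (vx * yy - vy * yx) = vy * (wx * yy - wy * yx) + yy * (vx * wy - vy * wx)"
    by (simp_all add: algebra_simps)
  then show ?thesis using assms by auto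
qed

text \<open>Parallel lines with a common point \<open>z\<close> coincide.\<close>

lemma parallel_lines_meet:
  assumes par: "(Re b - Re a) * (Im d - Im c) - (Im b - Im a) * (Re d - Re c) = 0"
    and "c \<noteq> d" "orient a b z = 0" "orient c d z = 0"
  shows "orient a b c = 0"
proof -
  have "Re d - Re c \<noteq> 0 \<or> Im d - Im c \<noteq> 0" using \<open>c \<noteq> d\<close> by (auto simp: complex_eq_iff)
  then have "(Re b - Re a) * (Im z - Im c) - (Im b - Im a) * (Re z - Re c) = 0"
    using cross_zero_trans[OF par, of "Im z - Im c" "Re z - Re c"] assms(4) by (simp add: orient_def)
  then show ?thesis using assms(3) by (simp add: orient_def algebra_simps)
qed

text \<open>The bad targets are those on a line through two other points, and those whose segment passes
  through an intersection of two such lines. The latter lie on finitely many rays, so both are negligible.\<close>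

lemma generic_move:
  assumes gen: "generic n c" and p: "p \<in> {1..n}" and "e > 0"
  obtains b where "dist b d < e" "generic n (c(p := b))"
    "\<And>t. t \<in> {0..1} \<Longrightarrow> \<exists>T. only_wall n (c(p := (1 - t) *\<^sub>R c p + t *\<^sub>R b)) T"
proof -
  define I where "I = {(i, j). i \<in> {1..n} - {p} \<and> j \<in> {1..n} - {p} \<and> i \<noteq> j}"
  have finI: "finite I"
    by (rule finite_subset[of _ "{1..n} \<times> {1..n}"]) (auto simp: I_def)
  define v where "v = (\<lambda>(i, j). \<i> * (c j - c i))"
  have orient_v: "orient (c i) (c j) z = v (i, j) \<bullet> z - v (i, j) \<bullet> c i" for i j z
    by (simp add: orient_inner v_def inner_diff_right)
  have v_nz: "v q \<noteq> 0" and ne: "c (fst q) \<noteq> c (snd q)" if "q \<in> I" for q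
  proof -
    have "orient (c (fst q)) (c (snd q)) (c p) \<noteq> 0"
      using that p by (intro genericD[OF gen]) (auto simp: I_def)
    then show "c (fst q) \<noteq> c (snd q)" by auto
    then show "v q \<noteq> 0" by (auto simp: v_def split: prod.split)
  qed
  define L where "L q = {b. orient (c (fst q)) (c (snd q)) b = 0}" for q
  have L: "negligible (L q)" if "q \<in> I" for q
    using negligible_line[OF v_nz[OF that], of "v q \<bullet> c (fst q)"]
    by (simp add: L_def orient_inner v_def inner_diff_right case_prod_beta)
  \<comment> \<open>At time \<open>t\<close> the moving point lies on the line \<open>q\<close> if and only if \<open>B q t \<bullet> b = A q t\<close>. The targets in \<open>M q r\<close>
    lead through the intersection point of the lines \<open>q\<close> and \<open>r\<close>.\<close>
  define A where "A q t = v q \<bullet> c (fst q) - (1 - t) * (v q \<bullet> c p)" for q t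
  define B where "B q t = of_real t * v q" for q t
  define M where "M q r = {b. \<exists>t\<in>UNIV. Re (B q t) * Im (B r t) - Im (B q t) * Re (B r t) \<noteq> 0 \<and>
      B q t \<bullet> b = A q t \<and> B r t \<bullet> b = A r t}" for q r
  have M: "negligible (M q r)" for q r
    unfolding M_def
  proof (rule negligible_moving_lines)
    have "(\<lambda>t. complex_of_real t * z) differentiable_on UNIV" for z
      unfolding differentiable_on_def differentiable_def
      by (blast intro: bounded_linear_imp_has_derivative bounded_linear_mult_const bounded_linear_of_real
          bounded_linear_compose)
    then show "B q differentiable_on UNIV" "B r differentiable_on UNIV"
      unfolding B_def by blast+
    show "A q differentiable_on UNIV" "A r differentiable_on UNIV"
      unfolding A_def by (intro derivative_intros differentiable_on_diff differentiable_on_mult differentiable_on_const differentiable_on_id differentiable_on_ident)+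
  qed
  have "negligible ((\<Union>q\<in>I. L q) \<union> (\<Union>q\<in>I. \<Union>r\<in>I. M q r))"
    by (intro negligible_Un negligible_UN_finite L M finI)
  then obtain b where b: "dist b d < e" "b \<notin> (\<Union>q\<in>I. L q) \<union> (\<Union>q\<in>I. \<Union>r\<in>I. M q r)"
    using exists_near_not_negligible[OF _ \<open>e > 0\<close>] by metis
  let ?c = "\<lambda>t. c(p := (1 - t) *\<^sub>R c p + t *\<^sub>R b)"
  \<comment> \<open>A collinear triple of a configuration that differs from \<open>c\<close> at \<open>p\<close> only contains \<open>p\<close>.\<close>
  have tri: "\<exists>q\<in>I. {i, j, k} = {fst q, snd q, p} \<and> orient (c (fst q)) (c (snd q)) z = 0"
    if "{i, j, k} \<subseteq> {1..n}" "distinct [i, j, k]"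
      "orient ((c(p := z)) i) ((c(p := z)) j) ((c(p := z)) k) = 0" for i j k z
  proof -
    consider "i = p" | "j = p" | "k = p" | "p \<notin> {i, j, k}" by blast
    then show ?thesis
    proof cases
      case 1
      then show ?thesis using that
        by (intro bexI[of _ "(j, k)"]) (auto simp: I_def orient_zero_perm)
    next
      case 2
      then show ?thesis using that
        by (intro bexI[of _ "(i, k)"]) (auto simp: I_def orient_zero_perm)
    next
      case 3
      then show ?thesis using that
        by (intro bexI[of _ "(i, j)"]) (auto simp: I_def orient_zero_perm)
    next
      case 4
      then show ?thesis using genericD[OF gen that(1,2)] that(3) by auto
    qed
  qed
  show ?thesis
  proof
    show "dist b d < e" by fact
    show "generic n (c(p := b))"
      unfolding generic_def
    proof (intro allI impI notI)
      fix i j k assume "{i, j, k} \<subseteq> {1..n}" "distinct [i, j, k]"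
        "orient ((c(p := b)) i) ((c(p := b)) j) ((c(p := b)) k) = 0"
      from tri[OF this] show False using b(2) by (auto simp: L_def)
    qed
    fix t :: real assume t: "t \<in> {0..1}"
    let ?z = "(1 - t) *\<^sub>R c p + t *\<^sub>R b"
    have uniq: "{fst q, snd q} = {fst r, snd r}"
      if q: "q \<in> I" "orient (c (fst q)) (c (snd q)) ?z = 0" and r: "r \<in> I" "orient (c (fst r)) (c (snd r)) ?z = 0" for q r
    proof (rule ccontr)
      assume neq: "{fst q, snd q} \<noteq> {fst r, snd r}"
      have "t \<noteq> 0"
      proof
        assume "t = 0"
        then have "orient (c (fst q)) (c (snd q)) (c p) = 0" using q by simp
        moreover have "orient (c (fst q)) (c (snd q)) (c p) \<noteq> 0"
          using q p by (intro genericD[OF gen]) (auto simp: I_def)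
        ultimately show False by blast
      qed
      have eq: "B s t \<bullet> b = A s t" if "orient (c (fst s)) (c (snd s)) ?z = 0" for s
        using that orient_v[of "fst s" "snd s" ?z]
        by (simp add: B_def A_def inner_add_right scaleR_conv_of_real[symmetric] algebra_simps)
      have "b \<notin> M q r" using b(2) q(1) r(1) by blast
      then have "Re (B q t) * Im (B r t) - Im (B q t) * Re (B r t) = 0"
        using eq[OF q(2)] eq[OF r(2)] by (auto simp: M_def)
      then have "t * (t * (Re (v q) * Im (v r) - Im (v q) * Re (v r))) = 0"
        by (simp add: B_def algebra_simps)
      then have par: "Re (v q) * Im (v r) - Im (v q) * Re (v r) = 0" using \<open>t \<noteq> 0\<close> by simp
      have par': "(Re (c (snd q)) - Re (c (fst q))) * (Im (c y) - Im (c x)) - (Im (c (snd q)) - Im (c (fst q))) * (Re (c y) - Re (c x)) = 0"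
        if "(x, y) = (fst r, snd r) \<or> (x, y) = (snd r, fst r)" for x y
        using par that by (auto simp: v_def case_prod_beta algebra_simps)
      obtain x y where xy: "(x, y) = (fst r, snd r) \<or> (x, y) = (snd r, fst r)" "x \<notin> {fst q, snd q}"
      proof -
        have "\<not> {fst r, snd r} \<subseteq> {fst q, snd q}"
        proof
          assume "{fst r, snd r} \<subseteq> {fst q, snd q}"
          moreover have "card {fst r, snd r} = card {fst q, snd q}" using q(1) r(1) by (auto simp: I_def)
          ultimately have "{fst r, snd r} = {fst q, snd q}" by (intro card_subset_eq) auto
          then show False using neq by simp
        qed
        then consider "fst r \<notin> {fst q, snd q}" | "snd r \<notin> {fst q, snd q}" by blast
        then show ?thesis using that by cases blast+
      qed
      have "orient (c (fst q)) (c (snd q)) (c x) = 0"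
        by (rule parallel_lines_meet[OF par'[OF xy(1)] _ q(2)])
          (use xy(1) ne[OF r(1)] r(2) in \<open>auto simp: orient_zero_perm\<close>)
      moreover have "orient (c (fst q)) (c (snd q)) (c x) \<noteq> 0"
        using q r xy by (intro genericD[OF gen]) (auto simp: I_def)
      ultimately show False by blast
    qed
    show "\<exists>T. only_wall n (?c t) T"
    proof (cases "generic n (?c t)")
      case True
      then show ?thesis by (auto simp: generic_def only_wall_def)
    next
      case False
      then obtain i j k where *: "{i, j, k} \<subseteq> {1..n}" "distinct [i, j, k]"
        "orient (?c t i) (?c t j) (?c t k) = 0" unfolding generic_def by blast
      from tri[OF this] obtain q where q: "q \<in> I" "{i, j, k} = {fst q, snd q, p}"
        "orient (c (fst q)) (c (snd q)) ?z = 0" by blast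
      have "only_wall n (?c t) {i, j, k}"
        unfolding only_wall_def
      proof (intro allI impI notI)
        fix i' j' k' assume **: "{i', j', k'} \<subseteq> {1..n}" "distinct [i', j', k']" "{i', j', k'} \<noteq> {i, j, k}"
          "orient (?c t i') (?c t j') (?c t k') = 0"
        from tri[OF **(1,2,4)] obtain r where r: "r \<in> I" "{i', j', k'} = {fst r, snd r, p}"
          "orient (c (fst r)) (c (snd r)) ?z = 0" by blast
        have "{fst r, snd r} = {fst q, snd q}" using uniq[OF r(1,3) q(1,3)] .
        then have "{i', j', k'} = {i, j, k}" unfolding r(2) q(2) by (metis insert_commute insert_is_Un Un_insert_left)
        then show False using **(3) by blast
      qed
      then show ?thesis ..
    qed
  qed
qed


section \<open>Potentials on charts\<close>

abbreviation w3 :: "nat \<Rightarrow> nat \<Rightarrow> nat \<Rightarrow> nat \<Rightarrow> gen3 gword set" where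
  "w3 n i j k \<equiv> G3_class n [a3 i j k]"

lemma w3_closed: "{i, j, k} \<subseteq> {1..n} \<Longrightarrow> distinct [i, j, k] \<Longrightarrow> w3 n i j k \<in> carrier (G3 n)"
  by (intro G3_class_closed) (use a3_in_gens3 in simp)

lemma w3_square:
  assumes "{i, j, k} \<subseteq> {1..n}" "distinct [i, j, k]"
  shows "w3 n i j k \<otimes>\<^bsub>G3 n\<^esub> w3 n i j k = \<one>\<^bsub>G3 n\<^esub>"
proof -
  note g = a3_in_gens3[OF assms]
  have "pos_rel [a3 i j k, a3 i j k] [] \<in> rels3 n"
    unfolding rels3_def using assms by blast
  then have "G3_class n ([a3 i j k] @ [a3 i j k]) = G3_class n []"
    using g by (intro G3_relation) auto
  then show ?thesis
    using g by (subst (asm) G3_class_append) (auto simp: G3_class_Nil)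
qed

lemma w3_commute:
  assumes "{i, j, k, p, q, r} \<subseteq> {1..n}" "distinct [i, j, k]" "distinct [p, q, r]"
    and "card ({i, j, k} \<inter> {p, q, r}) < 2"
  shows "w3 n i j k \<otimes>\<^bsub>G3 n\<^esub> w3 n p q r = w3 n p q r \<otimes>\<^bsub>G3 n\<^esub> w3 n i j k"
proof -
  have g: "a3 i j k \<in> gens3 n" "a3 p q r \<in> gens3 n" using assms by (auto intro!: a3_in_gens3)
  have "pos_rel [a3 i j k, a3 p q r] [a3 p q r, a3 i j k] \<in> rels3 n"
    unfolding rels3_def by (rule UnI1, rule UnI2) (use assms in blast)
  then have "G3_class n ([a3 i j k] @ [a3 p q r]) = G3_class n ([a3 p q r] @ [a3 i j k])"
    using g by (intro G3_relation) auto
  then show ?thesis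
    using g by (simp only: G3_class_append set_simps subset_empty empty_subsetI insert_subset simp_thms)
qed

text \<open>A product of four involutions that is itself an involution equals its reverse. Conjugation with
  the first letter gives the form in which the relation is used for the potential.\<close>

lemma w3_tetra:
  assumes "{i, j, k, l} \<subseteq> {1..n}" "distinct [i, j, k, l]"
  shows "w3 n i j k \<otimes>\<^bsub>G3 n\<^esub> (w3 n j k l \<otimes>\<^bsub>G3 n\<^esub> (w3 n i k l \<otimes>\<^bsub>G3 n\<^esub> w3 n i j l))
    = (w3 n i j l \<otimes>\<^bsub>G3 n\<^esub> (w3 n i k l \<otimes>\<^bsub>G3 n\<^esub> w3 n j k l)) \<otimes>\<^bsub>G3 n\<^esub> w3 n i j k"
proof -
  interpret group "G3 n" by (rule group_G3)
  have g: "a3 i j k \<in> gens3 n" "a3 i j l \<in> gens3 n" "a3 i k l \<in> gens3 n" "a3 j k l \<in> gens3 n"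
    using assms by (auto intro!: a3_in_gens3)
  define x where "x = w3 n i j k"
  define y where "y = w3 n i j l"
  define z where "z = w3 n i k l"
  define w where "w = w3 n j k l"
  note d = x_def y_def z_def w_def
  have c: "x \<in> carrier (G3 n)" "y \<in> carrier (G3 n)" "z \<in> carrier (G3 n)" "w \<in> carrier (G3 n)"
    unfolding d using g by (intro G3_class_closed; simp)+
  have "x \<otimes>\<^bsub>G3 n\<^esub> x = \<one>\<^bsub>G3 n\<^esub>" "y \<otimes>\<^bsub>G3 n\<^esub> y = \<one>\<^bsub>G3 n\<^esub>" "z \<otimes>\<^bsub>G3 n\<^esub> z = \<one>\<^bsub>G3 n\<^esub>" "w \<otimes>\<^bsub>G3 n\<^esub> w = \<one>\<^bsub>G3 n\<^esub>"
    unfolding d using assms by (intro w3_square; simp)+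
  note sq = this
  have i: "inv\<^bsub>G3 n\<^esub> x = x" "inv\<^bsub>G3 n\<^esub> y = y" "inv\<^bsub>G3 n\<^esub> z = z" "inv\<^bsub>G3 n\<^esub> w = w"
    by (intro inv_equality sq c)+
  have "pos_rel [a3 i j k, a3 i j l, a3 i k l, a3 j k l, a3 i j k, a3 i j l, a3 i k l, a3 j k l] [] \<in> rels3 n"
    unfolding rels3_def by (rule UnI2) (use assms in blast)
  then have "G3_class n ([a3 i j k] @ [a3 i j l] @ [a3 i k l] @ [a3 j k l] @
      [a3 i j k] @ [a3 i j l] @ [a3 i k l] @ [a3 j k l]) = G3_class n []"
    using g by (intro G3_relation) auto
  then have "x \<otimes>\<^bsub>G3 n\<^esub> (y \<otimes>\<^bsub>G3 n\<^esub> (z \<otimes>\<^bsub>G3 n\<^esub> (w \<otimes>\<^bsub>G3 n\<^esub> (x \<otimes>\<^bsub>G3 n\<^esub> (y \<otimes>\<^bsub>G3 n\<^esub> (z \<otimes>\<^bsub>G3 n\<^esub> w)))))) = \<one>\<^bsub>G3 n\<^esub>"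
    using g unfolding d
    by (simp only: G3_class_append G3_class_Nil set_append set_simps Un_subset_iff empty_subsetI
        insert_subset simp_thms)
  then have "(x \<otimes>\<^bsub>G3 n\<^esub> (y \<otimes>\<^bsub>G3 n\<^esub> (z \<otimes>\<^bsub>G3 n\<^esub> w))) \<otimes>\<^bsub>G3 n\<^esub> (x \<otimes>\<^bsub>G3 n\<^esub> (y \<otimes>\<^bsub>G3 n\<^esub> (z \<otimes>\<^bsub>G3 n\<^esub> w))) = \<one>\<^bsub>G3 n\<^esub>"
    using c by (simp add: m_assoc)
  then have "inv\<^bsub>G3 n\<^esub> (x \<otimes>\<^bsub>G3 n\<^esub> (y \<otimes>\<^bsub>G3 n\<^esub> (z \<otimes>\<^bsub>G3 n\<^esub> w))) = x \<otimes>\<^bsub>G3 n\<^esub> (y \<otimes>\<^bsub>G3 n\<^esub> (z \<otimes>\<^bsub>G3 n\<^esub> w))"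
    using c by (intro inv_equality) auto
  then have e: "w \<otimes>\<^bsub>G3 n\<^esub> (z \<otimes>\<^bsub>G3 n\<^esub> (y \<otimes>\<^bsub>G3 n\<^esub> x)) = x \<otimes>\<^bsub>G3 n\<^esub> (y \<otimes>\<^bsub>G3 n\<^esub> (z \<otimes>\<^bsub>G3 n\<^esub> w))"
    using c by (simp add: inv_mult_group i m_assoc)
  have "x \<otimes>\<^bsub>G3 n\<^esub> (w \<otimes>\<^bsub>G3 n\<^esub> (z \<otimes>\<^bsub>G3 n\<^esub> y)) = x \<otimes>\<^bsub>G3 n\<^esub> (w \<otimes>\<^bsub>G3 n\<^esub> (z \<otimes>\<^bsub>G3 n\<^esub> (y \<otimes>\<^bsub>G3 n\<^esub> x))) \<otimes>\<^bsub>G3 n\<^esub> x"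
    using c sq by (simp add: m_assoc)
  also have "\<dots> = (x \<otimes>\<^bsub>G3 n\<^esub> x) \<otimes>\<^bsub>G3 n\<^esub> (y \<otimes>\<^bsub>G3 n\<^esub> (z \<otimes>\<^bsub>G3 n\<^esub> w)) \<otimes>\<^bsub>G3 n\<^esub> x"
    unfolding e using c by (simp add: m_assoc)
  also have "\<dots> = (y \<otimes>\<^bsub>G3 n\<^esub> (z \<otimes>\<^bsub>G3 n\<^esub> w)) \<otimes>\<^bsub>G3 n\<^esub> x"
    using c by (simp add: sq)
  finally show ?thesis by (simp only: d)
qed

text \<open>A potential on an open set \<open>U\<close> of configurations is a function of generic configurations
  that is multiplied by a generator when the configuration crosses the corresponding wall. No
  condition is imposed at configurations with several collinear triples, which have codimension two.\<close>

definition is_potential :: "nat \<Rightarrow> (nat \<Rightarrow> complex) set \<Rightarrow> ((nat \<Rightarrow> complex) \<Rightarrow> gen3 gword set) \<Rightarrow> bool" where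
  "is_potential n U W \<longleftrightarrow>
    (\<forall>c. W c \<in> carrier (G3 n)) \<and>
    (\<forall>c0\<in>U. generic n c0 \<longrightarrow> eventually (\<lambda>c. W c = W c0) (near n c0)) \<and>
    (\<forall>c0\<in>U. \<forall>i j k. {i, j, k} \<subseteq> {1..n} \<longrightarrow> distinct [i, j, k] \<longrightarrow> between (c0 i, c0 k) (c0 j) \<longrightarrow>
       only_wall n c0 {i, j, k} \<longrightarrow>
       (\<exists>v\<in>carrier (G3 n). eventually (\<lambda>c. orient (c i) (c j) (c k) \<noteq> 0 \<longrightarrow>
          W c = (if 0 < orient (c i) (c j) (c k) then v else v \<otimes>\<^bsub>G3 n\<^esub> w3 n i j k)) (near n c0)))"

text \<open>A chart rotates the plane by \<open>u\<close> and lists the indices in the order \<open>xs\<close> of increasing real parts,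
  so that positions in \<open>xs\<close>, which start at \<open>0\<close>, replace the indices \<open>1, \<dots>, n\<close>.\<close>

definition chart_coords :: "complex \<Rightarrow> nat list \<Rightarrow> (nat \<Rightarrow> complex) \<Rightarrow> nat \<Rightarrow> complex" where
  "chart_coords u xs c = (\<lambda>a. u * c (xs ! a))"

definition chart_dom :: "nat \<Rightarrow> complex \<Rightarrow> nat list \<Rightarrow> (nat \<Rightarrow> complex) set" where
  "chart_dom n u xs = {c. \<forall>a b. a < b \<longrightarrow> b < n \<longrightarrow> Re (chart_coords u xs c a) < Re (chart_coords u xs c b)}"

definition chart_potential :: "nat \<Rightarrow> complex \<Rightarrow> nat list \<Rightarrow> (nat \<Rightarrow> complex) \<Rightarrow> gen3 gword set" where
  "chart_potential n u xs c =
    triple_group.potential (G3 n) (\<lambda>a b d. w3 n (xs ! a) (xs ! b) (xs ! d)) (chart_coords u xs c) n"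

lemma triple_group_G3:
  assumes xs: "distinct xs" "set xs = {1..n}"
  shows "triple_group (G3 n) n (\<lambda>a b c. w3 n (xs ! a) (xs ! b) (xs ! c))"
proof -
  have len: "length xs = n" using distinct_card[OF xs(1)] xs(2) by simp
  have inj: "xs ! a = xs ! b \<longleftrightarrow> a = b" if "a < n" "b < n" for a b
    using that xs(1) len by (simp add: nth_eq_iff_index_eq)
  have mem: "xs ! a \<in> {1..n}" if "a < n" for a using that xs(2) len nth_mem by metis
  show ?thesis
    unfolding triple_group_def triple_group_axioms_def
  proof (intro conjI allI impI group_G3)
    fix a b c assume "a < b" "b < c" "c < n"
    then have "{xs ! a, xs ! b, xs ! c} \<subseteq> {1..n}" "distinct [xs ! a, xs ! b, xs ! c]"
      using mem by (simp_all add: inj del: atLeastAtMost_iff)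
    note t = this
    show "w3 n (xs ! a) (xs ! b) (xs ! c) \<in> carrier (G3 n)" by (rule w3_closed[OF t])
    show "w3 n (xs ! a) (xs ! b) (xs ! c) \<otimes>\<^bsub>G3 n\<^esub> w3 n (xs ! a) (xs ! b) (xs ! c) = \<one>\<^bsub>G3 n\<^esub>"
      by (rule w3_square[OF t])
  next
    fix a b c a' b' c'
    assume *: "a < b" "b < c" "c < n" "a' < b'" "b' < c'" "c' < n" "card ({a, b, c} \<inter> {a', b', c'}) < 2"
    have inj': "inj_on ((!) xs) {..<n}" using inj by (auto simp: inj_on_def)
    have "{xs ! a, xs ! b, xs ! c} \<inter> {xs ! a', xs ! b', xs ! c'} = (!) xs ` ({a, b, c} \<inter> {a', b', c'})"
      using inj_on_image_Int[OF inj', of "{a, b, c}" "{a', b', c'}"] * by auto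
    then have "card ({xs ! a, xs ! b, xs ! c} \<inter> {xs ! a', xs ! b', xs ! c'}) < 2"
      using card_image_le[of "{a, b, c} \<inter> {a', b', c'}" "(!) xs"] *(7) by simp
    then show "w3 n (xs ! a) (xs ! b) (xs ! c) \<otimes>\<^bsub>G3 n\<^esub> w3 n (xs ! a') (xs ! b') (xs ! c')
        = w3 n (xs ! a') (xs ! b') (xs ! c') \<otimes>\<^bsub>G3 n\<^esub> w3 n (xs ! a) (xs ! b) (xs ! c)"
      using * mem by (intro w3_commute) (simp_all add: inj del: atLeastAtMost_iff)
  next
    fix a b c d assume "a < b" "b < c" "c < d" "d < n"
    then show "w3 n (xs ! a) (xs ! b) (xs ! c) \<otimes>\<^bsub>G3 n\<^esub> (w3 n (xs ! b) (xs ! c) (xs ! d) \<otimes>\<^bsub>G3 n\<^esub>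
        (w3 n (xs ! a) (xs ! c) (xs ! d) \<otimes>\<^bsub>G3 n\<^esub> w3 n (xs ! a) (xs ! b) (xs ! d)))
      = w3 n (xs ! a) (xs ! b) (xs ! d) \<otimes>\<^bsub>G3 n\<^esub> (w3 n (xs ! a) (xs ! c) (xs ! d) \<otimes>\<^bsub>G3 n\<^esub>
        w3 n (xs ! b) (xs ! c) (xs ! d)) \<otimes>\<^bsub>G3 n\<^esub> w3 n (xs ! a) (xs ! b) (xs ! c)"
      using mem by (intro w3_tetra) (simp_all add: inj del: atLeastAtMost_iff)
  qed
qed

lemma orient_zero_triple:
  assumes "orient (f i) (f j) (f k) = 0" "{i', j', k'} = {i, j, k}" "distinct [i, j, k]" "distinct [i', j', k']"
  shows "orient (f i') (f j') (f k') = 0"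
proof -
  have "i' \<in> {i, j, k}" "j' \<in> {i, j, k}" "k' \<in> {i, j, k}" using assms(2) by blast+
  then show ?thesis using assms(1,4) by (auto simp: orient_zero_perm)
qed

text \<open>The increasing order of the three indices of a wall in the chart is the order of their points on
  the common line, since the real part is monotone along it. So the letter of the wall has the middle point
  in the middle. Reversing the three indices changes the sign of the orientation but not the generator,
  and exchanging the two sides of a wall is harmless because the generator is an involution.\<close>

lemma is_potential_chart:
  assumes xs: "distinct xs" "set xs = {1..n}" and u: "u \<noteq> 0"
  shows "is_potential n (chart_dom n u xs) (chart_potential n u xs)"
proof -
  let ?g = "\<lambda>a b d. w3 n (xs ! a) (xs ! b) (xs ! d)"
  interpret T: triple_group "G3 n" n ?g by (rule triple_group_G3[OF xs])
  have len: "length xs = n" using distinct_card[OF xs(1)] xs(2) by simp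
  have inj: "xs ! a = xs ! b \<longleftrightarrow> a = b" if "a < n" "b < n" for a b
    using that xs(1) len by (simp add: nth_eq_iff_index_eq)
  have mem: "xs ! a \<in> {1..n}" if "a < n" for a using that xs(2) len nth_mem by metis
  have pot: "chart_potential n u xs c = T.potential (chart_coords u xs c) n" for c
    by (simp add: chart_potential_def)
  have o: "orient (chart_coords u xs c a) (chart_coords u xs c b) (chart_coords u xs c d)
      = (cmod u)\<^sup>2 * orient (c (xs ! a)) (c (xs ! b)) (c (xs ! d))" for c a b d
    by (simp add: chart_coords_def orient_mult)
  have u2: "(cmod u)\<^sup>2 > 0" using u by simp
  have trip: "{xs ! a, xs ! b, xs ! d} \<subseteq> {1..n}" "distinct [xs ! a, xs ! b, xs ! d]" if "a < b" "b < d" "d < n" for a b d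
    using that mem by (simp_all add: inj del: atLeastAtMost_iff)
  have lim: "((\<lambda>c. chart_coords u xs c a) \<longlongrightarrow> chart_coords u xs c0 a) (near n c0)" if "a < n" for a c0
    unfolding chart_coords_def by (intro tendsto_mult tendsto_const tendsto_near mem that)
  have closed: "chart_potential n u xs c \<in> carrier (G3 n)" for c
    unfolding pot by (rule T.potential_closed) simp
  have const: "eventually (\<lambda>c. chart_potential n u xs c = chart_potential n u xs c0) (near n c0)"
    if c0: "c0 \<in> chart_dom n u xs" "generic n c0" for c0
  proof -
    interpret N: near_generic "G3 n" n ?g "chart_coords u xs c0" 0 1 "n + 2"
    proof
      fix a b d assume "a < b" "b < d" "d < n"
      then show "orient (chart_coords u xs c0 a) (chart_coords u xs c0 b) (chart_coords u xs c0 d) \<noteq> 0"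
        unfolding o using u2 genericD[OF c0(2) trip] by simp
    qed (use c0(1) in \<open>auto simp: chart_dom_def\<close>)
    have "eventually (\<lambda>c. N.near_wall (chart_coords u xs c)) (near n c0)"
      by (rule N.eventually_near_wall[OF lim])
    then show ?thesis
    proof (rule eventually_mono)
      fix c assume "N.near_wall (chart_coords u xs c)"
      then show "chart_potential n u xs c = chart_potential n u xs c0"
        unfolding pot by (rule N.potential_below_wall) simp_all
    qed
  qed
  have wall: "\<exists>v\<in>carrier (G3 n). eventually (\<lambda>c. orient (c i) (c j) (c k) \<noteq> 0 \<longrightarrow>
          chart_potential n u xs c = (if 0 < orient (c i) (c j) (c k) then v else v \<otimes>\<^bsub>G3 n\<^esub> w3 n i j k)) (near n c0)"
    if c0: "c0 \<in> chart_dom n u xs" "only_wall n c0 {i, j, k}" "orient (c0 i) (c0 j) (c0 k) = 0"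
      and abd: "i = xs ! a" "j = xs ! b" "k = xs ! d" "a < b" "b < d" "d < n" for c0 i j k a b d
  proof -
    have dist: "distinct [i, j, k]" using trip[OF abd(4-6)] by (simp add: abd)
    interpret N: wall_config "G3 n" n ?g "chart_coords u xs c0" a b d
    proof
      fix a' b' d' assume *: "a' < b'" "b' < d'" "d' < n" "(a', b', d') \<noteq> (a, b, d)"
      have "{xs ! a', xs ! b', xs ! d'} \<noteq> {i, j, k}"
      proof
        assume eq: "{xs ! a', xs ! b', xs ! d'} = {i, j, k}"
        have inj': "inj_on ((!) xs) {..<n}" using inj by (auto simp: inj_on_def)
        have "(!) xs ` {a', b', d'} = (!) xs ` {a, b, d}" using eq by (simp add: abd(1-3))
        then have eq: "{a', b', d'} = {a, b, d}"
          using inj_on_image_eq_iff[OF inj', of "{a', b', d'}" "{a, b, d}"] * abd(4-6) by simp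
        then have "a' \<in> {a, b, d}" "b' \<in> {a, b, d}" "d' \<in> {a, b, d}" by blast+
        then show False using * abd(4-6) by auto
      qed
      then show "orient (chart_coords u xs c0 a') (chart_coords u xs c0 b') (chart_coords u xs c0 d') \<noteq> 0"
        unfolding o using u2 only_wallD[OF c0(2) trip[OF *(1-3)]] by simp
    next
      show "orient (chart_coords u xs c0 a) (chart_coords u xs c0 b) (chart_coords u xs c0 d) = 0"
        unfolding o using c0(3) by (simp add: abd)
    qed (use c0(1) abd in \<open>auto simp: chart_dom_def\<close>)
    obtain v where v: "v \<in> carrier (G3 n)"
      "\<And>P. N.near_wall P \<Longrightarrow> orient (P a) (P b) (P d) \<noteq> 0 \<Longrightarrow>
        T.potential P n = (if 0 < orient (P a) (P b) (P d) then v else v \<otimes>\<^bsub>G3 n\<^esub> ?g a b d)"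
      using N.potential_wall by metis
    have "eventually (\<lambda>c. N.near_wall (chart_coords u xs c)) (near n c0)"
      by (rule N.eventually_near_wall[OF lim])
    then have "eventually (\<lambda>c. orient (c i) (c j) (c k) \<noteq> 0 \<longrightarrow>
          chart_potential n u xs c = (if 0 < orient (c i) (c j) (c k) then v else v \<otimes>\<^bsub>G3 n\<^esub> w3 n i j k)) (near n c0)"
    proof (rule eventually_mono, intro impI)
      fix c assume "N.near_wall (chart_coords u xs c)" "orient (c i) (c j) (c k) \<noteq> 0"
      then show "chart_potential n u xs c = (if 0 < orient (c i) (c j) (c k) then v else v \<otimes>\<^bsub>G3 n\<^esub> w3 n i j k)"
        using v(2)[of "chart_coords u xs c"] u2 by (simp add: pot o abd(1-3) zero_less_mult_iff)
    qed
    then show ?thesis using v(1) by blast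
  qed
  have wall': "\<exists>v\<in>carrier (G3 n). eventually (\<lambda>c. orient (c i) (c j) (c k) \<noteq> 0 \<longrightarrow>
          chart_potential n u xs c = (if 0 < orient (c i) (c j) (c k) then v else v \<otimes>\<^bsub>G3 n\<^esub> w3 n i j k)) (near n c0)"
    if c0: "c0 \<in> chart_dom n u xs" "{i, j, k} \<subseteq> {1..n}" "distinct [i, j, k]" "between (c0 i, c0 k) (c0 j)"
       "only_wall n c0 {i, j, k}" for c0 i j k
  proof -
    have ex: "\<exists>a<n. x = xs ! a" if "x \<in> {1..n}" for x
      using that xs(2) len by (metis in_set_conv_nth)
    obtain a where a: "a < n" "i = xs ! a" using ex[of i] c0(2) by auto
    obtain b where b: "b < n" "j = xs ! b" using ex[of j] c0(2) by auto
    obtain d where d: "d < n" "k = xs ! d" using ex[of k] c0(2) by auto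
    have ne: "a \<noteq> b" "a \<noteq> d" "b \<noteq> d" using c0(3) a b d by auto
    have o0: "orient (c0 i) (c0 j) (c0 k) = 0" using between_imp_orient_eq_0[OF c0(4)] .
    obtain s where s: "0 \<le> s" "s \<le> 1" "c0 j = (1 - s) *\<^sub>R c0 i + s *\<^sub>R c0 k"
      using c0(4) by (auto simp: between_mem_segment in_segment)
    let ?x = "\<lambda>a. Re (chart_coords u xs c0 a)"
    have xb: "?x b = (1 - s) * ?x a + s * ?x d"
    proof -
      have e: "c0 (xs ! b) = (1 - s) *\<^sub>R c0 (xs ! a) + s *\<^sub>R c0 (xs ! d)" using s(3) a(2) b(2) d(2) by simp
      show ?thesis unfolding chart_coords_def e by (simp add: algebra_simps)
    qed
    have mono: "?x p < ?x q \<longleftrightarrow> p < q" if "p < n" "q < n" for p q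
      using c0(1) that unfolding chart_dom_def mem_Collect_eq
      by (metis linorder_neqE_nat order_less_asym order_less_irrefl)
    have conv: "x \<le> (1 - s) * x + s * y" "(1 - s) * x + s * y \<le> y"
      "x \<le> (1 - s) * y + s * x" "(1 - s) * y + s * x \<le> y" if "x \<le> y" for x y :: real
    proof -
      have "0 \<le> s * (y - x)" "0 \<le> (1 - s) * (y - x)" using s that by simp_all
      then show "x \<le> (1 - s) * x + s * y" "(1 - s) * x + s * y \<le> y"
        "x \<le> (1 - s) * y + s * x" "(1 - s) * y + s * x \<le> y" by (simp_all add: algebra_simps)
    qed
    have le: "?x p \<le> ?x q \<longleftrightarrow> p \<le> q" if "p < n" "q < n" for p q
      using mono[OF that(2,1)] by (simp flip: not_less)
    show ?thesis
    proof (cases "a < d")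
      case True
      then have "?x a \<le> ?x d" using mono[OF a(1) d(1)] by simp
      then have "a \<le> b" "b \<le> d"
        using conv(1,2)[of "?x a" "?x d"] le[OF a(1) b(1)] le[OF b(1) d(1)] unfolding xb by simp_all
      then have "a < b" "b < d" using ne by simp_all
      then show ?thesis by (rule wall[OF c0(1,5) o0 a(2) b(2) d(2) _ _ d(1)])
    next
      case False
      then have "?x d \<le> ?x a" using le[OF d(1) a(1)] by simp
      then have "d \<le> b" "b \<le> a"
        using conv(3,4)[of "?x d" "?x a"] le[OF d(1) b(1)] le[OF b(1) a(1)] unfolding xb by simp_all
      then have ba: "d < b" "b < a" using ne by simp_all
      have "{k, j, i} = {i, j, k}" by blast
      then have ow: "only_wall n c0 {k, j, i}" using c0(5) by simp
      have oz: "orient (c0 k) (c0 j) (c0 i) = 0" using o0 by (simp add: orient_zero_perm)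
      obtain v where v: "v \<in> carrier (G3 n)"
        "eventually (\<lambda>c. orient (c k) (c j) (c i) \<noteq> 0 \<longrightarrow>
          chart_potential n u xs c = (if 0 < orient (c k) (c j) (c i) then v else v \<otimes>\<^bsub>G3 n\<^esub> w3 n k j i)) (near n c0)"
        using wall[OF c0(1) ow oz d(2) b(2) a(2) ba a(1)] by (elim bexE)
      let ?w = "w3 n i j k"
      have w: "w3 n k j i = ?w" by (simp add: a3_rev)
      have wc: "?w \<in> carrier (G3 n)" using w3_closed[OF c0(2,3)] .
      have vww: "v \<otimes>\<^bsub>G3 n\<^esub> ?w \<otimes>\<^bsub>G3 n\<^esub> ?w = v"
        using v(1) wc w3_square[OF c0(2,3)] by (simp add: T.m_assoc)
      have flip: "orient (c k) (c j) (c i) = - orient (c i) (c j) (c k)" for c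
        by (simp add: orient_def algebra_simps)
      show ?thesis
      proof (intro bexI)
        show "eventually (\<lambda>c. orient (c i) (c j) (c k) \<noteq> 0 \<longrightarrow>
          chart_potential n u xs c = (if 0 < orient (c i) (c j) (c k) then v \<otimes>\<^bsub>G3 n\<^esub> ?w else v \<otimes>\<^bsub>G3 n\<^esub> ?w \<otimes>\<^bsub>G3 n\<^esub> ?w)) (near n c0)"
          using v(2) by (rule eventually_mono) (simp add: flip w vww)
        show "v \<otimes>\<^bsub>G3 n\<^esub> ?w \<in> carrier (G3 n)" using v(1) wc by simp
      qed
    qed
  qed
  show ?thesis
    unfolding is_potential_def using closed const wall' by blast
qed

lemma chart_dom_open:
  assumes xs: "set xs = {1..n}" "length xs = n" and c0: "c0 \<in> chart_dom n u xs"
  shows "eventually (\<lambda>c. c \<in> chart_dom n u xs) (near n c0)"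
proof -
  have mem: "xs ! a \<in> {1..n}" if "a < n" for a using that xs nth_mem by metis
  have "eventually (\<lambda>c. a < b \<longrightarrow> Re (chart_coords u xs c a) < Re (chart_coords u xs c b)) (near n c0)"
    if "a < n" "b < n" for a b
  proof (cases "a < b")
    case True
    have "((\<lambda>c. Re (chart_coords u xs c b) - Re (chart_coords u xs c a)) \<longlongrightarrow>
        Re (chart_coords u xs c0 b) - Re (chart_coords u xs c0 a)) (near n c0)"
      unfolding chart_coords_def
      by (intro tendsto_diff tendsto_Re tendsto_mult tendsto_const tendsto_near mem that)
    from order_tendstoD(1)[OF this, of 0]
    show ?thesis using c0 True that by (auto simp: chart_dom_def)
  qed auto
  then have "eventually (\<lambda>c. \<forall>a\<in>{..<n}. \<forall>b\<in>{..<n}. a < b \<longrightarrow>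
      Re (chart_coords u xs c a) < Re (chart_coords u xs c b)) (near n c0)"
    by (intro eventually_ball_finite ballI) auto
  then show ?thesis
    by (rule eventually_mono) (auto simp: chart_dom_def)
qed

text \<open>Finitely many distinct points have distinct projections to almost every line, so the charts
  cover the configuration space.\<close>

lemma potentials_cover:
  assumes "inj_on c {1..n}"
  obtains U W where "is_potential n U W" "eventually (\<lambda>c'. c' \<in> U) (near n c)"
proof -
  define B where "B = (\<lambda>(i, j). Re (c i - c j) / Im (c i - c j)) ` ({1..n} \<times> {1..n})"
  have "finite B" by (simp add: B_def)
  then obtain s where s: "s \<notin> B" using ex_new_if_finite[OF infinite_UNIV_char_0] by blast
  define u where "u = Complex 1 s"
  have u: "u \<noteq> 0" by (simp add: u_def complex_eq_iff)
  define x where "x i = Re (u * c i)" for i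
  have x_ne: "x i \<noteq> x j" if "i \<in> {1..n}" "j \<in> {1..n}" "i \<noteq> j" for i j
  proof
    assume "x i = x j"
    then have e: "Re (c i - c j) = s * Im (c i - c j)" by (simp add: x_def u_def algebra_simps)
    have "c i \<noteq> c j" using inj_on_eq_iff[OF assms, of i j] that by blast
    then have "Im (c i - c j) \<noteq> 0" using e by (auto simp: complex_eq_iff)
    then have "s = Re (c i - c j) / Im (c i - c j)" using e by simp
    then have "s \<in> B" using that by (auto simp: B_def intro!: image_eqI[of _ _ "(i, j)"])
    then show False using s by blast
  qed
  define xs where "xs = sort_key x [1..<Suc n]"
  have xs: "distinct xs" "set xs = {1..n}" by (auto simp: xs_def)
  have len: "length xs = n" by (simp add: xs_def)
  have "c \<in> chart_dom n u xs"
    unfolding chart_dom_def chart_coords_def mem_Collect_eq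
  proof (intro allI impI)
    fix a b assume ab: "a < b" "b < n"
    have "map x xs ! a \<le> map x xs ! b"
      by (rule sorted_nth_mono) (use ab len in \<open>simp_all add: xs_def\<close>)
    then have "x (xs ! a) \<le> x (xs ! b)" using ab len by simp
    moreover have "xs ! a \<noteq> xs ! b" using ab xs(1) len by (simp add: nth_eq_iff_index_eq)
    moreover have "xs ! a \<in> {1..n}" "xs ! b \<in> {1..n}"
      using ab len xs(2) nth_mem[of a xs] nth_mem[of b xs] by simp_all
    ultimately show "Re (u * c (xs ! a)) < Re (u * c (xs ! b))"
      using x_ne[of "xs ! a" "xs ! b"] by (simp add: x_def)
  qed
  then show ?thesis
    using that[OF is_potential_chart[OF xs u]] chart_dom_open[OF xs(2) len] by blast
qed


section \<open>Two potentials differ by a constant\<close>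

text \<open>The limits from both sides at an exceptional point agree by hypothesis, so there the value can be
  corrected and the function becomes locally constant on a connected interval.\<close>

lemma locally_constant_off_finite:
  fixes h :: "real \<Rightarrow> 'b"
  assumes "a \<le> b" "finite F" "a \<notin> F" "b \<notin> F"
    and loc: "\<And>t0. t0 \<in> {a..b} \<Longrightarrow> \<exists>y. eventually (\<lambda>t. t \<in> {a..b} \<longrightarrow> t \<notin> F \<longrightarrow> h t = y) (nhds t0)"
  shows "h a = h b"
proof (cases "a < b")
  case False
  then show ?thesis using \<open>a \<le> b\<close> by simp
next
  case True
  show ?thesis
  proof (rule connected_equivalence_relation_gen[where S = "{a..b}" and P = "\<lambda>t. t \<notin> F" and R = "\<lambda>s t. h s = h t"])
    fix T x assume "openin (top_of_set {a..b}) T" "x \<in> T"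
    then obtain S where S: "open S" "T = {a..b} \<inter> S" unfolding openin_open by (elim exE conjE)
    then have xS: "x \<in> S" "x \<in> {a..b}" using \<open>x \<in> T\<close> by simp_all
    obtain e where e: "e > 0" "ball x e \<subseteq> S" using openE[OF S(1) xS(1)] .
    have "max a (x - e) < min b (x + e)" using xS(2) e(1) True by auto
    then have "infinite {max a (x - e)<..<min b (x + e)}" by (rule infinite_Ioo)
    then have "\<not> {max a (x - e)<..<min b (x + e)} \<subseteq> F" using \<open>finite F\<close> finite_subset by metis
    then obtain z where "z \<in> {max a (x - e)<..<min b (x + e)}" "z \<notin> F" by (meson subsetI)
    then show "\<exists>z. z \<in> T \<and> z \<notin> F"
      using e(2) by (intro exI[of _ z]) (auto simp: S(2) dist_real_def subset_iff)
  next
    fix x assume "x \<in> {a..b}"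
    from loc[OF this] obtain y S where S: "open S" "x \<in> S" "\<forall>t\<in>S. t \<in> {a..b} \<longrightarrow> t \<notin> F \<longrightarrow> h t = y"
      unfolding eventually_nhds by metis
    then show "\<exists>T. openin (top_of_set {a..b}) T \<and> x \<in> T \<and> (\<forall>x\<in>T. \<forall>y\<in>T. x \<notin> F \<and> y \<notin> F \<longrightarrow> h x = h y)"
      using \<open>x \<in> {a..b}\<close> by (intro exI[of _ "{a..b} \<inter> S"]) (auto simp: openin_open_Int)
  qed (use assms True in auto)
qed

lemma only_wall_between:
  assumes "only_wall n c0 T" "\<not> generic n c0"
  obtains i j k where "{i, j, k} \<subseteq> {1..n}" "distinct [i, j, k]" "between (c0 i, c0 k) (c0 j)"
    "only_wall n c0 {i, j, k}"
proof -
  obtain i j k where *: "{i, j, k} \<subseteq> {1..n}" "distinct [i, j, k]" "orient (c0 i) (c0 j) (c0 k) = 0"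
    using assms(2) unfolding generic_def by blast
  have T: "{i, j, k} = T"
    using only_wallD[OF assms(1) *(1,2)] *(3) by blast
  have "between (c0 j, c0 k) (c0 i) \<or> between (c0 k, c0 i) (c0 j) \<or> between (c0 i, c0 j) (c0 k)"
    using *(3) unfolding orient_eq_0_iff_collinear collinear_between_cases .
  then show ?thesis
  proof (elim disjE)
    assume "between (c0 j, c0 k) (c0 i)"
    then show ?thesis using that[of j i k] * assms(1) T by (simp add: insert_commute)
  next
    assume "between (c0 k, c0 i) (c0 j)"
    then show ?thesis using that[of k j i] * assms(1) T by (simp add: insert_commute)
  next
    assume "between (c0 i, c0 j) (c0 k)"
    then show ?thesis using that[of i k j] * assms(1) T by (simp add: insert_commute)
  qed
qed

lemma is_potential_closed: "is_potential n U W \<Longrightarrow> W c \<in> carrier (G3 n)"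
  unfolding is_potential_def by blast

lemma is_potential_const:
  "is_potential n U W \<Longrightarrow> c0 \<in> U \<Longrightarrow> generic n c0 \<Longrightarrow> eventually (\<lambda>c. W c = W c0) (near n c0)"
  unfolding is_potential_def by blast

lemma is_potential_wall:
  assumes "is_potential n U W" "c0 \<in> U" "{i, j, k} \<subseteq> {1..n}" "distinct [i, j, k]"
    "between (c0 i, c0 k) (c0 j)" "only_wall n c0 {i, j, k}"
  obtains v where "v \<in> carrier (G3 n)" "eventually (\<lambda>c. orient (c i) (c j) (c k) \<noteq> 0 \<longrightarrow>
    W c = (if 0 < orient (c i) (c j) (c k) then v else v \<otimes>\<^bsub>G3 n\<^esub> w3 n i j k)) (near n c0)"
  using assms unfolding is_potential_def by blast

definition transition :: "nat \<Rightarrow> ((nat \<Rightarrow> complex) \<Rightarrow> gen3 gword set) \<Rightarrow> ((nat \<Rightarrow> complex) \<Rightarrow> gen3 gword set) \<Rightarrow>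
    (nat \<Rightarrow> complex) \<Rightarrow> gen3 gword set" where
  "transition n W W' c = W c \<otimes>\<^bsub>G3 n\<^esub> inv\<^bsub>G3 n\<^esub> W' c"

text \<open>Both potentials are multiplied from the right by the same generator when a wall is crossed, and it
  cancels in the quotient.\<close>

lemma transition_locally_constant:
  assumes W: "is_potential n U W" and W': "is_potential n U' W'"
    and c0: "c0 \<in> U" "c0 \<in> U'" "only_wall n c0 T"
  shows "\<exists>y. eventually (\<lambda>c. generic n c \<longrightarrow> transition n W W' c = y) (near n c0)"
proof (cases "generic n c0")
  case True
  from is_potential_const[OF W c0(1) this] is_potential_const[OF W' c0(2) this]
  show ?thesis
    by (intro exI[of _ "transition n W W' c0"], eventually_elim) (simp add: transition_def)
next
  case False
  interpret group "G3 n" by (rule group_G3)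
  obtain i j k where ijk: "{i, j, k} \<subseteq> {1..n}" "distinct [i, j, k]" "between (c0 i, c0 k) (c0 j)"
    "only_wall n c0 {i, j, k}"
    using only_wall_between[OF c0(3) False] .
  obtain v where v: "v \<in> carrier (G3 n)" "eventually (\<lambda>c. orient (c i) (c j) (c k) \<noteq> 0 \<longrightarrow>
    W c = (if 0 < orient (c i) (c j) (c k) then v else v \<otimes>\<^bsub>G3 n\<^esub> w3 n i j k)) (near n c0)"
    using is_potential_wall[OF W c0(1) ijk] .
  obtain v' where v': "v' \<in> carrier (G3 n)" "eventually (\<lambda>c. orient (c i) (c j) (c k) \<noteq> 0 \<longrightarrow>
    W' c = (if 0 < orient (c i) (c j) (c k) then v' else v' \<otimes>\<^bsub>G3 n\<^esub> w3 n i j k)) (near n c0)"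
    using is_potential_wall[OF W' c0(2) ijk] .
  have w: "w3 n i j k \<in> carrier (G3 n)" by (rule w3_closed[OF ijk(1,2)])
  have "w3 n i j k \<otimes>\<^bsub>G3 n\<^esub> (inv\<^bsub>G3 n\<^esub> w3 n i j k \<otimes>\<^bsub>G3 n\<^esub> inv\<^bsub>G3 n\<^esub> v') = inv\<^bsub>G3 n\<^esub> v'"
    using v'(1) w by (simp flip: m_assoc)
  then have flip: "(v \<otimes>\<^bsub>G3 n\<^esub> w3 n i j k) \<otimes>\<^bsub>G3 n\<^esub> inv\<^bsub>G3 n\<^esub> (v' \<otimes>\<^bsub>G3 n\<^esub> w3 n i j k) = v \<otimes>\<^bsub>G3 n\<^esub> inv\<^bsub>G3 n\<^esub> v'"
    using v(1) v'(1) w by (simp add: inv_mult_group m_assoc)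
  from v(2) v'(2) show ?thesis
    by (intro exI[of _ "v \<otimes>\<^bsub>G3 n\<^esub> inv\<^bsub>G3 n\<^esub> v'"], eventually_elim)
      (use genericD[OF _ ijk(1,2)] in \<open>simp add: transition_def flip\<close>)
qed

lemma affine_zero:
  fixes x y t :: real
  assumes "x \<noteq> 0" "(1 - t) * x + t * y = 0"
  shows "t = x / (x - y)"
proof -
  have "t * (x - y) = x" using assms(2) by (simp add: algebra_simps)
  moreover from this have "x - y \<noteq> 0" using assms(1) by auto
  ultimately show ?thesis by (simp add: eq_divide_eq)
qed

text \<open>Any two generic configurations in a box can be joined, up to an arbitrarily small change of
  the end point, by moving the points one after the other. Along the way there is at most one
  collinear triple at a time.\<close>

lemma transition_constant:
  assumes W: "is_potential n U W" and W': "is_potential n U' W'"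
    and C: "\<And>i. i \<in> {1..n} \<Longrightarrow> open (C i) \<and> convex (C i)"
    and sub: "\<And>c. (\<And>i. i \<in> {1..n} \<Longrightarrow> c i \<in> C i) \<Longrightarrow> c \<in> U \<inter> U'"
    and c: "generic n c" "\<And>i. i \<in> {1..n} \<Longrightarrow> c i \<in> C i"
    and d: "generic n d" "\<And>i. i \<in> {1..n} \<Longrightarrow> d i \<in> C i"
  shows "transition n W W' c = transition n W W' d"
proof -
  let ?D = "transition n W W'"
  have "d \<in> U \<inter> U'" using sub d(2) by blast
  then have "eventually (\<lambda>c. ?D c = ?D d) (near n d)"
    using is_potential_const[OF W _ d(1)] is_potential_const[OF W' _ d(1)]
    by (auto simp: transition_def elim: eventually_elim2)
  moreover have "eventually (\<lambda>c. \<forall>i\<in>{1..n}. c i \<in> C i) (near n d)"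
    using topological_tendstoD[OF tendsto_near] C d(2) by (intro eventually_ball_finite ballI) auto
  ultimately have "eventually (\<lambda>c. ?D c = ?D d \<and> (\<forall>i\<in>{1..n}. c i \<in> C i)) (near n d)"
    by (rule eventually_conj)
  then obtain e where e: "e > 0"
    "\<And>c. (\<forall>i\<in>{1..n}. dist (c i) (d i) < e) \<Longrightarrow> ?D c = ?D d \<and> (\<forall>i\<in>{1..n}. c i \<in> C i)"
    unfolding eventually_near by blast
  have in_C: "b \<in> C p" if "p \<in> {1..n}" "dist b (d p) < e" for b p
  proof -
    have "\<forall>i\<in>{1..n}. dist ((d(p := b)) i) (d i) < e" using that e(1) by simp
    then have "(d(p := b)) p \<in> C p" using e(2) that(1) by blast
    then show ?thesis by simp
  qed
  have "\<exists>c'. generic n c' \<and> (\<forall>i\<in>{1..n}. c' i \<in> C i) \<and> ?D c' = ?D c \<and> (\<forall>i\<in>{1..m}. dist (c' i) (d i) < e)"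
    if "m \<le> n" for m
    using that
  proof (induction m)
    case 0
    then show ?case using c by (intro exI[of _ c]) auto
  next
    case (Suc m)
    then obtain c' where c': "generic n c'" "\<And>i. i \<in> {1..n} \<Longrightarrow> c' i \<in> C i" "?D c' = ?D c"
      "\<And>i. i \<in> {1..m} \<Longrightarrow> dist (c' i) (d i) < e" by auto
    let ?p = "Suc m"
    have p: "?p \<in> {1..n}" using Suc.prems by simp
    obtain b where b: "dist b (d ?p) < e" "generic n (c'(?p := b))"
      "\<And>t. t \<in> {0..1} \<Longrightarrow> \<exists>T. only_wall n (c'(?p := (1 - t) *\<^sub>R c' ?p + t *\<^sub>R b)) T"
      using generic_move[OF c'(1) p e(1)] by metis
    define f where "f t = c'(?p := (1 - t) *\<^sub>R c' ?p + t *\<^sub>R b)" for t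
    have f_C: "f t i \<in> C i" if "t \<in> {0..1}" "i \<in> {1..n}" for t i
    proof (cases "i = ?p")
      case True
      have "(1 - t) *\<^sub>R c' ?p + t *\<^sub>R b \<in> C ?p"
        using C[OF p] c'(2)[OF p] in_C[OF p b(1)] that(1) unfolding convex_alt by auto
      then show ?thesis using True by (simp add: f_def)
    next
      case False
      then show ?thesis using c'(2)[OF that(2)] by (simp add: f_def)
    qed
    have f0: "f 0 = c'" and f1: "f 1 = c'(?p := b)" by (auto simp: f_def)
    define F where "F = {t \<in> {0..1}. \<not> generic n (f t)}"
    have "finite F"
    proof -
      let ?Z = "\<lambda>(i, j, k). {t. orient (f t i) (f t j) (f t k) = 0}"
      define I where "I = {(i, j, k). {i, j, k} \<subseteq> {1..n} \<and> distinct [i, j, k]}"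
      have "finite I"
        by (rule finite_subset[of _ "{1..n} \<times> {1..n} \<times> {1..n}"]) (auto simp: I_def)
      moreover have "finite (?Z q)" if q: "q \<in> I" for q
      proof -
        obtain i j k where ijk: "q = (i, j, k)" "{i, j, k} \<subseteq> {1..n}" "distinct [i, j, k]"
          using q by (auto simp: I_def)
        have nz: "orient (f 0 i) (f 0 j) (f 0 k) \<noteq> 0" using genericD[OF c'(1) ijk(2,3)] f0 by simp
        have aff: "orient (f t i) (f t j) (f t k)
            = (1 - t) * orient (f 0 i) (f 0 j) (f 0 k) + t * orient (f 1 i) (f 1 j) (f 1 k)" for t
          using ijk(3) by (cases "i = ?p"; cases "j = ?p"; cases "k = ?p")
            (simp_all add: f_def orient_def algebra_simps)
        let ?x = "orient (f 0 i) (f 0 j) (f 0 k)" and ?y = "orient (f 1 i) (f 1 j) (f 1 k)"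
        have "?Z q \<subseteq> {?x / (?x - ?y)}"
        proof
          fix t assume "t \<in> ?Z q"
          then have "orient (f t i) (f t j) (f t k) = 0" by (simp add: ijk(1))
          then have "(1 - t) * ?x + t * ?y = 0" using aff[of t] by (simp only:)
          then show "t \<in> {?x / (?x - ?y)}" using affine_zero[OF nz] by (simp only: singleton_iff)
        qed
        then show ?thesis by (rule finite_subset) simp
      qed
      ultimately have "finite (\<Union>q\<in>I. ?Z q)" by blast
      moreover have "F \<subseteq> (\<Union>q\<in>I. ?Z q)"
      proof
        fix t assume "t \<in> F"
        then obtain i j k where "{i, j, k} \<subseteq> {1..n}" "distinct [i, j, k]" "orient (f t i) (f t j) (f t k) = 0"
          unfolding F_def generic_def by blast
        then show "t \<in> (\<Union>q\<in>I. ?Z q)" unfolding I_def by (intro UN_I[of "(i, j, k)"]) auto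
      qed
      ultimately show ?thesis by (rule finite_subset[rotated])
    qed
    have "?D (f 0) = ?D (f 1)"
    proof (rule locally_constant_off_finite[where h = "\<lambda>t. ?D (f t)"])
      fix t0 :: real assume t0: "t0 \<in> {0..1}"
      obtain T where "only_wall n (f t0) T" using b(3)[OF t0] unfolding f_def by blast
      moreover have "f t0 \<in> U \<inter> U'" by (rule sub) (use f_C t0 in auto)
      ultimately obtain y where y: "eventually (\<lambda>c. generic n c \<longrightarrow> ?D c = y) (near n (f t0))"
        using transition_locally_constant[OF W W', of "f t0" T] by blast
      have "((\<lambda>t. (1 - t) *\<^sub>R c' ?p + t *\<^sub>R b) \<longlongrightarrow> (1 - t0) *\<^sub>R c' ?p + t0 *\<^sub>R b) (nhds t0)"
        by (intro tendsto_intros filterlim_ident)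
      then have "filterlim f (near n (f t0)) (nhds t0)"
        by (intro filterlim_near) (auto simp: f_def)
      from eventually_compose_filterlim[OF y this]
      show "\<exists>y. eventually (\<lambda>t. t \<in> {0..1} \<longrightarrow> t \<notin> F \<longrightarrow> ?D (f t) = y) (nhds t0)"
        by (intro exI[of _ y]) (auto simp: F_def elim: eventually_mono)
    qed (use \<open>finite F\<close> c'(1) b(2) in \<open>auto simp: F_def f0 f1\<close>)
    then have "?D (c'(?p := b)) = ?D c" using c'(3) by (simp only: f0 f1)
    moreover have "\<forall>i\<in>{1..n}. (c'(?p := b)) i \<in> C i"
      using f_C[of 1] by (simp add: f1 del: fun_upd_apply)
    moreover have "\<forall>i\<in>{1..?p}. dist ((c'(?p := b)) i) (d i) < e"
      using b(1) c'(4) by (auto simp: le_Suc_eq)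
    ultimately show ?case using b(2) by blast
  qed
  then obtain c' where "?D c' = ?D c" "\<forall>i\<in>{1..n}. dist (c' i) (d i) < e" by blast
  then show ?thesis using e(2)[of c'] by simp
qed

lemma (in group) transition_eq:
  assumes "x \<in> carrier G" "y \<in> carrier G" "r \<in> carrier G" "s \<in> carrier G" "x \<otimes> inv r = y \<otimes> inv s"
  shows "inv x \<otimes> y = inv r \<otimes> s"
proof -
  have "inv x \<otimes> ((x \<otimes> inv r) \<otimes> s) = inv x \<otimes> ((y \<otimes> inv s) \<otimes> s)" using assms(5) by simp
  moreover have "inv x \<otimes> ((x \<otimes> inv r) \<otimes> s) = inv r \<otimes> s" using assms(1-4) by (simp flip: m_assoc)
  moreover have "inv x \<otimes> ((y \<otimes> inv s) \<otimes> s) = inv x \<otimes> y" using assms(1-4) by (simp add: m_assoc)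
  ultimately show ?thesis by simp
qed

lemma potentials_agree:
  assumes "is_potential n U W" "is_potential n U' W'"
    and "\<And>i. i \<in> {1..n} \<Longrightarrow> open (C i) \<and> convex (C i)"
    and "\<And>c. (\<And>i. i \<in> {1..n} \<Longrightarrow> c i \<in> C i) \<Longrightarrow> c \<in> U \<inter> U'"
    and "generic n c" "\<And>i. i \<in> {1..n} \<Longrightarrow> c i \<in> C i"
    and "generic n d" "\<And>i. i \<in> {1..n} \<Longrightarrow> d i \<in> C i"
  shows "inv\<^bsub>G3 n\<^esub> W c \<otimes>\<^bsub>G3 n\<^esub> W d = inv\<^bsub>G3 n\<^esub> W' c \<otimes>\<^bsub>G3 n\<^esub> W' d"
proof -
  interpret group "G3 n" by (rule group_G3)
  have cl: "W c \<in> carrier (G3 n)" "W d \<in> carrier (G3 n)" "W' c \<in> carrier (G3 n)" "W' d \<in> carrier (G3 n)"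
    using is_potential_closed assms(1,2) by blast+
  show ?thesis
    by (rule transition_eq[OF cl]) (use transition_constant[OF assms] in \<open>simp add: transition_def\<close>)
qed


section \<open>The reading of a path that crosses walls one at a time\<close>

lemma critical_moments_generic: "critical_moments n \<beta> = {t \<in> {0..1}. \<not> generic n (\<beta> t)}"
  unfolding critical_moments_def generic_def orient_eq_0_iff_collinear by blast

definition crosses :: "nat \<Rightarrow> (real \<Rightarrow> nat \<Rightarrow> complex) \<Rightarrow> real \<Rightarrow> nat \<Rightarrow> nat \<Rightarrow> nat \<Rightarrow> bool" where
  "crosses n \<beta> t i j k \<longleftrightarrow> {i, j, k} \<subseteq> {1..n} \<and> distinct [i, j, k] \<and> between (\<beta> t i, \<beta> t k) (\<beta> t j) \<and>
     only_wall n (\<beta> t) {i, j, k} \<and>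
     (\<exists>\<delta>>0. \<forall>s\<in>{t - \<delta><..<t} \<inter> {0..1}. \<forall>s'\<in>{t<..<t + \<delta>} \<inter> {0..1}.
        orient (\<beta> s i) (\<beta> s j) (\<beta> s k) * orient (\<beta> s' i) (\<beta> s' j) (\<beta> s' k) < 0)"

text \<open>What the reading needs of a good and stable braid. In contrast to smoothness, this property is
  inherited by concatenations.\<close>

definition tame :: "nat \<Rightarrow> (real \<Rightarrow> nat \<Rightarrow> complex) \<Rightarrow> bool" where
  "tame n \<beta> \<longleftrightarrow> (\<forall>j\<in>{1..n}. continuous_on {0..1} (\<lambda>t. \<beta> t j)) \<and> (\<forall>t\<in>{0..1}. inj_on (\<beta> t) {1..n}) \<and>
     generic n (\<beta> 0) \<and> generic n (\<beta> 1) \<and> finite (critical_moments n \<beta>) \<and>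
     (\<forall>t\<in>critical_moments n \<beta>. \<exists>i j k. crosses n \<beta> t i j k)"

definition reading_upto :: "nat \<Rightarrow> (real \<Rightarrow> nat \<Rightarrow> complex) \<Rightarrow> real \<Rightarrow> gen3 gword set" where
  "reading_upto n \<beta> t =
    G3_class n (map (critical_gen n \<beta>) (sorted_list_of_set (critical_moments n \<beta> \<inter> {..t})))"

lemma critical_gen_eq:
  assumes "{i, j, k} \<subseteq> {1..n}" "distinct [i, j, k]" "between (\<beta> t i, \<beta> t k) (\<beta> t j)"
    and "only_wall n (\<beta> t) {i, j, k}" "inj_on (\<beta> t) {1..n}"
  shows "critical_gen n \<beta> t = a3 i j k"
  unfolding critical_gen_def
proof (rule the_equality)
  show "\<exists>i' j' k'. {i', j', k'} \<subseteq> {1..n} \<and> distinct [i', j', k'] \<and> between (\<beta> t i', \<beta> t k') (\<beta> t j') \<and> a3 i j k = a3 i' j' k'"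
    using assms(1-3) by blast
next
  fix g assume "\<exists>i' j' k'. {i', j', k'} \<subseteq> {1..n} \<and> distinct [i', j', k'] \<and> between (\<beta> t i', \<beta> t k') (\<beta> t j') \<and> g = a3 i' j' k'"
  then obtain i' j' k' where *: "{i', j', k'} \<subseteq> {1..n}" "distinct [i', j', k']" "between (\<beta> t i', \<beta> t k') (\<beta> t j')" "g = a3 i' j' k'"
    by (elim exE conjE)
  have eq: "{i', j', k'} = {i, j, k}"
    using only_wallD[OF assms(4) *(1,2)] between_imp_orient_eq_0[OF *(3)] by blast
  have mem: "x \<in> {1..n}" if "x \<in> {i, j, k}" for x using assms(1) that by blast
  have inj: "\<beta> t x = \<beta> t y \<longleftrightarrow> x = y" if "x \<in> {i, j, k}" "y \<in> {i, j, k}" for x y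
    using inj_on_eq_iff[OF assms(5) mem[OF that(1)] mem[OF that(2)]] .
  \<comment> \<open>Of three distinct collinear points only one lies between the others.\<close>
  have anti: "x = y" if "between (\<beta> t x, \<beta> t z) (\<beta> t y)" "between (\<beta> t y, \<beta> t z) (\<beta> t x)" "x \<in> {i, j, k}" "y \<in> {i, j, k}" for x y z
    using between_antisym[OF that(2,1)] inj[OF that(3,4)] by simp
  have m: "i' \<in> {i, j, k}" "j' \<in> {i, j, k}" "k' \<in> {i, j, k}" using eq by blast+
  have "j' = j"
  proof (rule ccontr)
    assume "j' \<noteq> j"
    then have "j' = i \<or> j' = k" using m(2) by blast
    then consider "j' = i" "{i', k'} = {j, k}" | "j' = k" "{i', k'} = {i, j}"
    proof (elim disjE)
      assume "j' = i" then show ?thesis using that(1) m *(2) assms(2) by auto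
    next
      assume "j' = k" then show ?thesis using that(2) m *(2) assms(2) by auto
    qed
    then show False
    proof cases
      case 1
      then have "between (\<beta> t j, \<beta> t k) (\<beta> t i)"
        using *(3) by (auto simp: doubleton_eq_iff between_commute)
      then show False using anti[of i k j] assms(2,3) by simp
    next
      case 2
      then have "between (\<beta> t j, \<beta> t i) (\<beta> t k)"
        using *(3) by (auto simp: doubleton_eq_iff between_commute)
      moreover have "between (\<beta> t k, \<beta> t i) (\<beta> t j)" using assms(3) by (simp add: between_commute)
      ultimately show False using anti[of k i j] assms(2) by simp
    qed
  qed
  moreover have "{i', k'} = {i, k}" using eq \<open>j' = j\<close> *(2) assms(2) by auto
  ultimately show "g = a3 i j k" using *(4) by (simp add: a3_def)
qed

lemma sorted_list_of_set_insert_greatest: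
  fixes A :: "'a::linorder set"
  assumes "finite A" "\<And>x. x \<in> A \<Longrightarrow> x < m"
  shows "sorted_list_of_set (insert m A) = sorted_list_of_set A @ [m]"
proof -
  have "m \<notin> A" using assms(2) by blast
  then show ?thesis
    using assms by (subst sorted_list_of_set_unique[symmetric]) (auto simp: sorted_wrt_append)
qed

lemma tendsto_nhds_within:
  fixes f :: "'a::topological_space \<Rightarrow> 'b::metric_space"
  assumes "continuous_on S f" "x \<in> S"
  shows "(f \<longlongrightarrow> f x) (inf (nhds x) (principal S))"
proof (rule tendstoI)
  fix e :: real assume "e > 0"
  have "(f \<longlongrightarrow> f x) (at x within S)" using assms by (simp add: continuous_on_def)
  then have "eventually (\<lambda>y. dist (f y) (f x) < e) (at x within S)" using \<open>e > 0\<close> by (rule tendstoD)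
  then have "eventually (\<lambda>y. y \<noteq> x \<longrightarrow> y \<in> S \<longrightarrow> dist (f y) (f x) < e) (nhds x)"
    by (simp add: eventually_at_filter)
  then show "eventually (\<lambda>y. dist (f y) (f x) < e) (inf (nhds x) (principal S))"
    unfolding eventually_inf_principal by (rule eventually_mono) (use \<open>e > 0\<close> in auto)
qed

context
  fixes n :: nat and \<beta> :: "real \<Rightarrow> nat \<Rightarrow> complex"
  assumes tame: "tame n \<beta>"
begin

lemma tame_critical_gen:
  assumes "crosses n \<beta> t i j k" "t \<in> {0..1}"
  shows "critical_gen n \<beta> t = a3 i j k"
  using assms tame by (intro critical_gen_eq) (auto simp: crosses_def tame_def)

lemma tame_critical_gens: "critical_gen n \<beta> ` critical_moments n \<beta> \<subseteq> gens3 n"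
proof (rule image_subsetI)
  fix t assume t: "t \<in> critical_moments n \<beta>"
  then obtain i j k where c: "crosses n \<beta> t i j k" using tame unfolding tame_def by blast
  have "t \<in> {0..1}" using t by (simp add: critical_moments_generic)
  then show "critical_gen n \<beta> t \<in> gens3 n"
    using tame_critical_gen[OF c] c by (simp add: crosses_def a3_in_gens3)
qed

lemma reading_upto_closed: "reading_upto n \<beta> t \<in> carrier (G3 n)"
proof -
  have "finite (critical_moments n \<beta> \<inter> {..t})" using tame by (simp add: tame_def)
  then show ?thesis
    unfolding reading_upto_def using tame_critical_gens by (intro G3_class_closed) auto
qed

lemma reading_upto_0: "reading_upto n \<beta> 0 = \<one>\<^bsub>G3 n\<^esub>"
proof -
  have "critical_moments n \<beta> \<inter> {..0} = {}"
    using tame by (auto simp: critical_moments_generic tame_def dest: order_antisym)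
  then show ?thesis by (simp add: reading_upto_def G3_class_Nil)
qed

lemma reading_upto_1: "reading_upto n \<beta> 1 = braid_reading n \<beta>"
proof -
  have "critical_moments n \<beta> \<inter> {..1} = critical_moments n \<beta>"
    by (auto simp: critical_moments_generic)
  then show ?thesis by (simp add: reading_upto_def braid_reading_def)
qed

lemma tame_filterlim:
  assumes "t0 \<in> {0..1}"
  shows "filterlim \<beta> (near n (\<beta> t0)) (inf (nhds t0) (principal {0..1}))"
proof (rule filterlim_near)
  fix i assume "i \<in> {1..n}"
  then have "continuous_on {0..1} (\<lambda>t. \<beta> t i)" using tame by (simp add: tame_def)
  from tendsto_nhds_within[OF this assms]
  show "((\<lambda>t. \<beta> t i) \<longlongrightarrow> \<beta> t0 i) (inf (nhds t0) (principal {0..1}))" .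
qed

text \<open>The potential and the reading are constant between critical moments, and at a critical moment both
  are multiplied from the right by the same generator. So their quotient is constant along the path.\<close>

lemma potential_reading:
  assumes W: "is_potential n U W" and ab: "a \<le> b" "{a..b} \<subseteq> {0..1}"
    and gen: "generic n (\<beta> a)" "generic n (\<beta> b)" and U: "\<And>t. t \<in> {a..b} \<Longrightarrow> \<beta> t \<in> U"
  shows "inv\<^bsub>G3 n\<^esub> W (\<beta> a) \<otimes>\<^bsub>G3 n\<^esub> W (\<beta> b) = inv\<^bsub>G3 n\<^esub> reading_upto n \<beta> a \<otimes>\<^bsub>G3 n\<^esub> reading_upto n \<beta> b"
proof -
  interpret group "G3 n" by (rule group_G3)
  let ?K = "critical_moments n \<beta>"
  let ?r = "reading_upto n \<beta>"
  have fin: "finite ?K" using tame by (simp add: tame_def)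
  have closed: "W c \<in> carrier (G3 n)" for c by (rule is_potential_closed[OF W])
  have "W (\<beta> a) \<otimes>\<^bsub>G3 n\<^esub> inv\<^bsub>G3 n\<^esub> ?r a = W (\<beta> b) \<otimes>\<^bsub>G3 n\<^esub> inv\<^bsub>G3 n\<^esub> ?r b"
  proof (rule locally_constant_off_finite[OF ab(1) fin])
    show "a \<notin> ?K" "b \<notin> ?K" using gen by (simp_all add: critical_moments_generic)
  next
    fix t0 assume t0: "t0 \<in> {a..b}"
    then have t01: "t0 \<in> {0..1}" using ab(2) by blast
    have lift: "eventually (\<lambda>t. t \<in> {a..b} \<longrightarrow> P (\<beta> t)) (nhds t0)" if "eventually P (near n (\<beta> t0))" for P
      using eventually_compose_filterlim[OF that tame_filterlim[OF t01]]
      unfolding eventually_inf_principal by (rule eventually_mono) (use ab(2) in blast)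
    obtain d where d: "d > 0" "\<And>x. x \<in> ?K \<Longrightarrow> x \<noteq> t0 \<Longrightarrow> d \<le> dist t0 x"
      using finite_set_avoid[OF fin, of t0] by blast
    have "eventually (\<lambda>t. dist t t0 < d) (nhds t0)" using d(1) by (auto simp: eventually_nhds_metric)
    then have near_d: "eventually (\<lambda>t. \<bar>t - t0\<bar> < d) (nhds t0)" by (simp add: dist_real_def)
    have before: "?K \<inter> {..t} = ?K \<inter> {..<t0}" if "\<bar>t - t0\<bar> < d" "t < t0" for t
      using d(2) that by (force simp: dist_real_def)
    have after: "?K \<inter> {..t} = ?K \<inter> {..t0}" if "\<bar>t - t0\<bar> < d" "t0 \<le> t" for t
      using d(2) that by (force simp: dist_real_def)
    show "\<exists>y. eventually (\<lambda>t. t \<in> {a..b} \<longrightarrow> t \<notin> ?K \<longrightarrow> W (\<beta> t) \<otimes>\<^bsub>G3 n\<^esub> inv\<^bsub>G3 n\<^esub> ?r t = y) (nhds t0)"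
    proof (cases "t0 \<in> ?K")
      case False
      have "?K \<inter> {..<t0} = ?K \<inter> {..t0}" using False by (auto simp: order_le_less)
      then have r: "?r t = ?r t0" if "\<bar>t - t0\<bar> < d" for t
        unfolding reading_upto_def using before[OF that] after[OF that] by (cases "t < t0") auto
      have "generic n (\<beta> t0)" using False t01 by (simp add: critical_moments_generic)
      from lift[OF is_potential_const[OF W U[OF t0] this]] near_d
      have "eventually (\<lambda>t. t \<in> {a..b} \<longrightarrow> t \<notin> ?K \<longrightarrow> W (\<beta> t) \<otimes>\<^bsub>G3 n\<^esub> inv\<^bsub>G3 n\<^esub> ?r t
          = W (\<beta> t0) \<otimes>\<^bsub>G3 n\<^esub> inv\<^bsub>G3 n\<^esub> ?r t0) (nhds t0)"
      proof (eventually_elim, intro impI)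
        fix t assume *: "t \<in> {a..b} \<longrightarrow> W (\<beta> t) = W (\<beta> t0)" "\<bar>t - t0\<bar> < d" "t \<in> {a..b}"
        show "W (\<beta> t) \<otimes>\<^bsub>G3 n\<^esub> inv\<^bsub>G3 n\<^esub> ?r t = W (\<beta> t0) \<otimes>\<^bsub>G3 n\<^esub> inv\<^bsub>G3 n\<^esub> ?r t0"
          unfolding r[OF *(2)] using *(1,3) by simp
      qed
      then show ?thesis ..
    next
      case True
      then obtain i j k where cr: "crosses n \<beta> t0 i j k" using tame unfolding tame_def by blast
      then have ijk: "{i, j, k} \<subseteq> {1..n}" "distinct [i, j, k]" "between (\<beta> t0 i, \<beta> t0 k) (\<beta> t0 j)"
        "only_wall n (\<beta> t0) {i, j, k}" unfolding crosses_def by blast+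
      let ?o = "\<lambda>t. orient (\<beta> t i) (\<beta> t j) (\<beta> t k)"
      obtain \<delta> where \<delta>: "\<delta> > 0" "\<And>s s'. s \<in> {t0 - \<delta><..<t0} \<inter> {0..1} \<Longrightarrow> s' \<in> {t0<..<t0 + \<delta>} \<inter> {0..1} \<Longrightarrow> ?o s * ?o s' < 0"
        using cr unfolding crosses_def by blast
      obtain v where v: "v \<in> carrier (G3 n)" "eventually (\<lambda>c. orient (c i) (c j) (c k) \<noteq> 0 \<longrightarrow>
          W c = (if 0 < orient (c i) (c j) (c k) then v else v \<otimes>\<^bsub>G3 n\<^esub> w3 n i j k)) (near n (\<beta> t0))"
        using is_potential_wall[OF W U[OF t0] ijk] .
      define w where "w = w3 n i j k"
      have w: "w \<in> carrier (G3 n)" "w \<otimes>\<^bsub>G3 n\<^esub> w = \<one>\<^bsub>G3 n\<^esub>"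
        unfolding w_def by (rule w3_closed[OF ijk(1,2)], rule w3_square[OF ijk(1,2)])
      have inv_w: "inv\<^bsub>G3 n\<^esub> w = w" using inv_equality[OF w(2) w(1) w(1)] .
      have ends: "t0 \<noteq> 0" "t0 \<noteq> 1" using True tame by (auto simp: critical_moments_generic tame_def)
      then have t0_in: "0 < t0" "t0 < 1" using t01 by auto
      \<comment> \<open>sample moments that record the sign of the orientation on both sides of \<open>t0\<close>\<close>
      define s1 where "s1 = max (t0 / 2) (t0 - \<delta> / 2)"
      define s2 where "s2 = min ((1 + t0) / 2) (t0 + \<delta> / 2)"
      have s1: "s1 \<in> {t0 - \<delta><..<t0} \<inter> {0..1}" using t0_in \<delta>(1) by (auto simp: s1_def max_def)
      have s2: "s2 \<in> {t0<..<t0 + \<delta>} \<inter> {0..1}" using t0_in \<delta>(1) by (auto simp: s2_def min_def)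
      have left: "0 < ?o t \<longleftrightarrow> 0 < ?o s1" if "t \<in> {t0 - \<delta><..<t0} \<inter> {0..1}" for t
        using \<delta>(2)[OF that s2] \<delta>(2)[OF s1 s2] by (auto simp: mult_less_0_iff)
      have right: "0 < ?o t \<longleftrightarrow> \<not> 0 < ?o s1" if "t \<in> {t0<..<t0 + \<delta>} \<inter> {0..1}" for t
        using \<delta>(2)[OF s1 that] by (auto simp: mult_less_0_iff)
      define r0 where "r0 = G3_class n (map (critical_gen n \<beta>) (sorted_list_of_set (?K \<inter> {..<t0})))"
      have r_before: "?r t = r0" if "\<bar>t - t0\<bar> < d" "t < t0" for t
        unfolding reading_upto_def r0_def before[OF that] ..
      have gens: "critical_gen n \<beta> ` (?K \<inter> {..<t0}) \<subseteq> gens3 n" using tame_critical_gens by blast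
      have r0: "r0 \<in> carrier (G3 n)"
        unfolding r0_def using gens fin by (intro G3_class_closed) simp
      have r_after: "?r t = r0 \<otimes>\<^bsub>G3 n\<^esub> w" if "\<bar>t - t0\<bar> < d" "t0 \<le> t" for t
      proof -
        have "?K \<inter> {..t0} = insert t0 (?K \<inter> {..<t0})" using True by force
        then have "sorted_list_of_set (?K \<inter> {..t}) = sorted_list_of_set (?K \<inter> {..<t0}) @ [t0]"
          using after[OF that] fin sorted_list_of_set_insert_greatest[of "?K \<inter> {..<t0}" t0] by simp
        then show ?thesis
          unfolding reading_upto_def r0_def w_def
          using tame_critical_gen[OF cr t01] gens fin a3_in_gens3[OF ijk(1,2)]
          by (simp add: G3_class_append)
      qed
      define y where "y = (if 0 < ?o s1 then v else v \<otimes>\<^bsub>G3 n\<^esub> w) \<otimes>\<^bsub>G3 n\<^esub> inv\<^bsub>G3 n\<^esub> r0"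
      have "w \<otimes>\<^bsub>G3 n\<^esub> (w \<otimes>\<^bsub>G3 n\<^esub> inv\<^bsub>G3 n\<^esub> r0) = inv\<^bsub>G3 n\<^esub> r0"
        using w r0 by (simp flip: m_assoc)
      then have y': "(if 0 < ?o s1 then v \<otimes>\<^bsub>G3 n\<^esub> w else v) \<otimes>\<^bsub>G3 n\<^esub> inv\<^bsub>G3 n\<^esub> (r0 \<otimes>\<^bsub>G3 n\<^esub> w) = y"
        unfolding y_def using v(1) w r0 by (simp add: inv_mult_group m_assoc inv_w)
      have "eventually (\<lambda>t. \<bar>t - t0\<bar> < \<delta>) (nhds t0)"
        using \<delta>(1) by (auto simp: eventually_nhds_metric dist_real_def)
      with lift[OF v(2)] near_d
      have "eventually (\<lambda>t. t \<in> {a..b} \<longrightarrow> t \<notin> ?K \<longrightarrow> W (\<beta> t) \<otimes>\<^bsub>G3 n\<^esub> inv\<^bsub>G3 n\<^esub> ?r t = y) (nhds t0)"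
      proof (eventually_elim, intro impI)
        fix t assume *: "t \<in> {a..b} \<longrightarrow> ?o t \<noteq> 0 \<longrightarrow> W (\<beta> t) = (if 0 < ?o t then v else v \<otimes>\<^bsub>G3 n\<^esub> w3 n i j k)"
          "\<bar>t - t0\<bar> < d" "\<bar>t - t0\<bar> < \<delta>" "t \<in> {a..b}" "t \<notin> ?K"
        have t01': "t \<in> {0..1}" using *(4) ab(2) by blast
        then have "generic n (\<beta> t)" using *(5) by (simp add: critical_moments_generic)
        then have "?o t \<noteq> 0" using genericD ijk(1,2) by blast
        then have Wt: "W (\<beta> t) = (if 0 < ?o t then v else v \<otimes>\<^bsub>G3 n\<^esub> w)" using * by (simp add: w_def)
        have "t \<noteq> t0" using True *(5) by blast
        then consider "t < t0" | "t0 < t" by linarith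
        then show "W (\<beta> t) \<otimes>\<^bsub>G3 n\<^esub> inv\<^bsub>G3 n\<^esub> ?r t = y"
        proof cases
          case 1
          then have "t \<in> {t0 - \<delta><..<t0} \<inter> {0..1}" using *(3) t01' by auto
          then have "0 < ?o t \<longleftrightarrow> 0 < ?o s1" by (rule left)
          then show ?thesis unfolding Wt r_before[OF *(2) 1] y_def by (simp only:)
        next
          case 2
          then have "t \<in> {t0<..<t0 + \<delta>} \<inter> {0..1}" using *(3) t01' by auto
          then have "0 < ?o t \<longleftrightarrow> \<not> 0 < ?o s1" by (rule right)
          then have "W (\<beta> t) = (if 0 < ?o s1 then v \<otimes>\<^bsub>G3 n\<^esub> w else v)" unfolding Wt by simp
          then show ?thesis unfolding r_after[OF *(2) less_imp_le[OF 2]] using y' by (simp only:)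
        qed
      qed
      then show ?thesis ..
    qed
  qed
  then show ?thesis
    by (intro transition_eq closed reading_upto_closed)
qed

end


section \<open>Homotopy invariance of the reading\<close>

text \<open>The argument for the Lebesgue number of an open cover.\<close>

lemma compact_uniform_radius:
  assumes "compact S"
    and loc: "\<And>p. p \<in> S \<Longrightarrow> \<exists>e>0. eventually (\<lambda>q. Q q e) (inf (nhds p) (principal S))"
    and mono: "\<And>q e e'. Q q e \<Longrightarrow> e' \<le> e \<Longrightarrow> Q q e'"
  obtains e :: real where "e > 0" "\<And>q. q \<in> S \<Longrightarrow> Q q e"
proof -
  have "\<exists>e T. e > 0 \<and> open T \<and> p \<in> T \<and> (\<forall>q\<in>T. q \<in> S \<longrightarrow> Q q e)" if "p \<in> S" for p
    using loc[OF that] unfolding eventually_inf_principal eventually_nhds by metis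
  then obtain e T where eT: "\<And>p. p \<in> S \<Longrightarrow> e p > 0 \<and> open (T p) \<and> p \<in> T p \<and> (\<forall>q\<in>T p. q \<in> S \<longrightarrow> Q q (e p))"
    by metis
  obtain C where C: "C \<subseteq> S" "finite C" "S \<subseteq> (\<Union>c\<in>C. T c)"
    by (rule compactE_image[OF assms(1), of S T]) (use eT in auto)
  define e0 where "e0 = Min (insert 1 (e ` C))"
  have "e0 > 0" unfolding e0_def using C(1,2) eT by (subst Min_gr_iff) auto
  moreover have "Q q e0" if "q \<in> S" for q
  proof -
    obtain c where c: "c \<in> C" "q \<in> T c" using C(3) \<open>q \<in> S\<close> by blast
    then have "Q q (e c)" using eT C(1) that by blast
    moreover have "e0 \<le> e c" unfolding e0_def using C(2) c by (intro Min_le) auto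
    ultimately show ?thesis by (rule mono)
  qed
  ultimately show ?thesis by (rule that)
qed

definition polydisc :: "nat \<Rightarrow> (nat \<Rightarrow> complex) \<Rightarrow> real \<Rightarrow> (nat \<Rightarrow> complex) set" where
  "polydisc n c e = {c'. \<forall>k\<in>{1..n}. dist (c' k) (c k) < e}"

lemma eventually_near_polydisc: "eventually P (near n c) \<longleftrightarrow> (\<exists>e>0. \<forall>c'\<in>polydisc n c e. P c')"
  by (simp add: eventually_near polydisc_def)

text \<open>Along a compact family of configurations, open conditions hold in boxes of a uniform size.\<close>

lemma uniform_polydisc:
  fixes J :: "'a::topological_space \<Rightarrow> nat \<Rightarrow> complex"
  assumes "compact S"
    and lim: "\<And>p. p \<in> S \<Longrightarrow> filterlim J (near n (J p)) (inf (nhds p) (principal S))"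
    and P: "\<And>p. p \<in> S \<Longrightarrow> \<exists>x. R x \<and> eventually (P x) (near n (J p))"
  shows "\<exists>e>0. \<forall>p\<in>S. \<exists>x. R x \<and> (\<forall>c\<in>polydisc n (J p) e. P x c)"
proof -
  have loc: "\<exists>e>0. eventually (\<lambda>q. \<exists>x. R x \<and> (\<forall>c\<in>polydisc n (J q) e. P x c)) (inf (nhds p) (principal S))"
    if p: "p \<in> S" for p
  proof -
    obtain x where x: "R x" "eventually (P x) (near n (J p))" using P[OF p] by blast
    then obtain r where r: "r > 0" "\<And>c. c \<in> polydisc n (J p) r \<Longrightarrow> P x c"
      unfolding eventually_near_polydisc by blast
    have "eventually (\<lambda>c. c \<in> polydisc n (J p) (r / 2)) (near n (J p))"
      unfolding eventually_near_polydisc using r(1) by (intro exI[of _ "r / 2"]) simp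
    from eventually_compose_filterlim[OF this lim[OF p]]
    have "eventually (\<lambda>q. \<exists>x. R x \<and> (\<forall>c\<in>polydisc n (J q) (r / 2). P x c)) (inf (nhds p) (principal S))"
    proof (rule eventually_mono)
      fix q assume q: "J q \<in> polydisc n (J p) (r / 2)"
      have "P x c" if c: "c \<in> polydisc n (J q) (r / 2)" for c
      proof (rule r(2))
        have "dist (c k) (J p k) < r" if "k \<in> {1..n}" for k
        proof -
          have "dist (c k) (J p k) \<le> dist (c k) (J q k) + dist (J q k) (J p k)" by (rule dist_triangle)
          also have "\<dots> < r / 2 + r / 2" using c q that unfolding polydisc_def by (intro add_strict_mono) simp_all
          finally show ?thesis by simp
        qed
        then show "c \<in> polydisc n (J p) r" by (simp add: polydisc_def)
      qed
      then show "\<exists>x. R x \<and> (\<forall>c\<in>polydisc n (J q) (r / 2). P x c)" using x(1) by blast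
    qed
    then show ?thesis using r(1) by (intro exI[of _ "r / 2"]) simp
  qed
  have mono: "\<exists>x. R x \<and> (\<forall>c\<in>polydisc n (J q) e'. P x c)"
    if "\<exists>x. R x \<and> (\<forall>c\<in>polydisc n (J q) e. P x c)" "e' \<le> e" for q and e e' :: real
  proof -
    have "polydisc n (J q) e' \<subseteq> polydisc n (J q) e" using that(2) by (force simp: polydisc_def)
    then show ?thesis using that(1) by blast
  qed
  show ?thesis
  proof (rule compact_uniform_radius[OF \<open>compact S\<close>, where Q = "\<lambda>q e. \<exists>x. R x \<and> (\<forall>c\<in>polydisc n (J q) e. P x c)"])
    fix e :: real assume "e > 0" "\<And>q. q \<in> S \<Longrightarrow> \<exists>x. R x \<and> (\<forall>c\<in>polydisc n (J q) e. P x c)"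
    then show ?thesis by blast
  qed (use loc mono in blast)+
qed

lemma partition_avoiding:
  fixes F :: "real set"
  assumes "finite F" "0 \<notin> F" "1 \<notin> F" "\<delta> > 0"
  obtains N :: nat and t :: "nat \<Rightarrow> real" where "N > 0" "t 0 = 0" "t N = 1"
    "\<And>j. j \<le> N \<Longrightarrow> t j \<notin> F \<and> t j \<in> {0..1}" "\<And>j. j < N \<Longrightarrow> t j \<le> t (Suc j) \<and> t (Suc j) - t j < \<delta>"
proof -
  obtain N :: nat where N: "2 / \<delta> < real N" using reals_Archimedean2 by blast
  have "0 < 2 / \<delta>" using \<open>\<delta> > 0\<close> by simp
  then have N0: "real N > 0" using N by linarith
  have N2: "2 / real N < \<delta>" using N N0 \<open>\<delta> > 0\<close> by (simp add: field_simps)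
  have "\<exists>x. x \<in> {real j / N<..<(real j + 1) / N} \<and> x \<notin> F" for j :: nat
  proof -
    have "real j / N < (real j + 1) / N" using N0 by (simp add: divide_strict_right_mono)
    then have "infinite {real j / N<..<(real j + 1) / N}" by (rule infinite_Ioo)
    then have "\<not> {real j / N<..<(real j + 1) / N} \<subseteq> F" using assms(1) finite_subset by metis
    then show ?thesis by (meson subsetI)
  qed
  then obtain x where x: "\<And>j::nat. x j \<in> {real j / N<..<(real j + 1) / N}" "\<And>j. x j \<notin> F" by metis
  define t where "t j = (if j = 0 then 0 else if N \<le> j then 1 else x j)" for j
  have lo: "real j / N \<le> t j" if "j \<le> N" for j
    using x(1)[of j] that N0 by (auto simp: t_def)
  have hi: "t j \<le> (real j + 1) / N" "t j \<le> 1" if "j \<le> N" for j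
  proof -
    show "t j \<le> 1"
    proof (cases "j < N")
      case True
      then have "(real j + 1) / N \<le> 1" using N0 by simp
      then show ?thesis using x(1)[of j] by (simp add: t_def)
    qed (simp add: t_def)
    show "t j \<le> (real j + 1) / N"
      using x(1)[of j] that N0 by (auto simp: t_def divide_simps)
  qed
  show ?thesis
  proof
    show "N > 0" "t 0 = 0" "t N = 1" using N0 by (auto simp: t_def)
    show "t j \<notin> F \<and> t j \<in> {0..1}" if "j \<le> N" for j
    proof
      show "t j \<notin> F" using x(2) assms(2,3) by (simp add: t_def)
      have "0 \<le> real j / N" by simp
      then have "0 \<le> t j" using lo[OF that] by linarith
      then show "t j \<in> {0..1}" using hi(2)[OF that] by simp
    qed
    show "t j \<le> t (Suc j) \<and> t (Suc j) - t j < \<delta>" if "j < N" for j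
    proof -
      have s: "real (Suc j) / N \<le> t (Suc j)" "t (Suc j) \<le> (real (Suc j) + 1) / N"
        using lo[of "Suc j"] hi(1)[of "Suc j"] that by auto
      have "t j \<le> real (Suc j) / N" using hi(1)[of j] that by (simp add: add.commute)
      moreover have "(real (Suc j) + 1) / N - real j / N = 2 / N" by (simp add: diff_divide_distrib[symmetric])
      ultimately show ?thesis using s lo[of j] that N2 by linarith
    qed
  qed
qed

lemma (in group) transition_mult:
  assumes "x \<in> carrier G" "y \<in> carrier G" "z \<in> carrier G"
  shows "(inv x \<otimes> y) \<otimes> (inv y \<otimes> z) = inv x \<otimes> z"
proof -
  have "y \<otimes> (inv y \<otimes> z) = z" using assms by (simp flip: m_assoc)
  then show ?thesis using assms by (simp add: m_assoc)
qed

lemma (in group) list_prod_telescope: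
  assumes "\<And>j. j \<le> m \<Longrightarrow> r j \<in> carrier G"
  shows "list_prod (\<lambda>j. inv r j \<otimes> r (Suc j)) [0..<m] = inv r 0 \<otimes> r m"
  using assms
proof (induction m)
  case (Suc m)
  have c: "\<And>j. j \<le> Suc m \<Longrightarrow> r j \<in> carrier G" by (rule Suc.prems)
  have "list_prod (\<lambda>j. inv r j \<otimes> r (Suc j)) ([0..<m] @ [m])
      = list_prod (\<lambda>j. inv r j \<otimes> r (Suc j)) [0..<m] \<otimes> list_prod (\<lambda>j. inv r j \<otimes> r (Suc j)) [m]"
    using c by (intro list_prod_append) auto
  also have "\<dots> = (inv r 0 \<otimes> r m) \<otimes> (inv r m \<otimes> r (Suc m))" using Suc.IH c by simp
  also have "\<dots> = inv r 0 \<otimes> r (Suc m)" using c by (intro transition_mult) simp_all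
  finally show ?case by simp
qed simp

text \<open>A discrete homotopy: the two rows are the sides of a ladder with commuting cells, and the rungs
  \<open>e j\<close> slide along it from one end to the other.\<close>

lemma (in group) list_prod_ladder:
  assumes "\<And>j. j < N \<Longrightarrow> x j \<in> carrier G \<and> y j \<in> carrier G" "\<And>j. j \<le> N \<Longrightarrow> e j \<in> carrier G"
    and "\<And>j. j < N \<Longrightarrow> x j \<otimes> e (Suc j) = e j \<otimes> y j" and "e 0 = \<one>" "e N = \<one>"
  shows "list_prod x [0..<N] = list_prod y [0..<N]"
proof -
  have cl: "list_prod x [0..<m] \<in> carrier G" "list_prod y [0..<m] \<in> carrier G" if "m \<le> N" for m
    using assms(1) that by (intro list_prod_closed; auto)+
  have "list_prod x [0..<m] \<otimes> e m = list_prod y [0..<m]" if "m \<le> N" for m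
    using that
  proof (induction m)
    case 0
    then show ?case using assms(4) by simp
  next
    case (Suc m)
    have m: "m < N" "m \<le> N" using Suc.prems by auto
    have app: "list_prod z ([0..<m] @ [m]) = list_prod z [0..<m] \<otimes> z m" if "\<And>j. j < N \<Longrightarrow> z j \<in> carrier G" for z
    proof -
      have "list_prod z ([0..<m] @ [m]) = list_prod z [0..<m] \<otimes> list_prod z [m]"
        using that m by (intro list_prod_append) auto
      then show ?thesis using that m by simp
    qed
    have "list_prod x [0..<Suc m] \<otimes> e (Suc m) = list_prod x [0..<m] \<otimes> (x m \<otimes> e (Suc m))"
      using app[of x] assms(1,2) cl m Suc.prems by (simp add: m_assoc)
    also have "\<dots> = (list_prod x [0..<m] \<otimes> e m) \<otimes> y m"
      using assms(1,2,3) cl m by (simp add: m_assoc)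
    also have "\<dots> = list_prod y [0..<Suc m]"
      using Suc.IH[OF m(2)] app[of y] assms(1) by simp
    finally show ?case .
  qed
  from this[of N] show ?thesis using assms(5) cl(1)[of N] by simp
qed

text \<open>The square is divided into small cells, each of which is mapped into a single chart. The vertices
  are moved to generic configurations, and an edge is given the change of the potential of a chart along
  it, which by \<open>potentials_agree\<close> is the same for the charts of both adjacent cells. Around a cell these
  changes multiply to \<open>\<one>\<close>, so all rows of the grid have the same product. The products of the first and
  the last row are the readings of the two paths, by \<open>potential_reading\<close>.\<close>

theorem reading_homotopy_invariant:
  fixes H :: "real \<times> real \<Rightarrow> nat \<Rightarrow> complex"
  assumes \<beta>: "tame n \<beta>" and \<gamma>: "tame n \<gamma>"
    and cont: "\<And>k. k \<in> {1..n} \<Longrightarrow> continuous_on ({0..1} \<times> {0..1}) (\<lambda>p. H p k)"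
    and inj: "\<And>p. p \<in> {0..1} \<times> {0..1} \<Longrightarrow> inj_on (H p) {1..n}"
    and H0: "\<And>t. t \<in> {0..1} \<Longrightarrow> H (0, t) = \<beta> t" and H1: "\<And>t. t \<in> {0..1} \<Longrightarrow> H (1, t) = \<gamma> t"
    and Hl: "\<And>s. s \<in> {0..1} \<Longrightarrow> H (s, 0) = \<beta> 0" and Hr: "\<And>s. s \<in> {0..1} \<Longrightarrow> H (s, 1) = \<beta> 1"
  shows "braid_reading n \<beta> = braid_reading n \<gamma>"
proof -
  interpret group "G3 n" by (rule group_G3)
  let ?Sq = "{0..1::real} \<times> {0..1::real}"
  have compact: "compact ?Sq" by (intro compact_Times compact_Icc)
  have lim: "filterlim H (near n (H p)) (inf (nhds p) (principal ?Sq))" if "p \<in> ?Sq" for p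
    by (rule filterlim_near) (rule tendsto_nhds_within[OF cont that])
  \<comment> \<open>a radius for which the polydisc around every value of the homotopy lies in some chart\<close>
  have charts: "\<exists>x. is_potential n (fst x) (snd x) \<and> eventually (\<lambda>c. c \<in> fst x) (near n (H p))"
    if p: "p \<in> ?Sq" for p
  proof -
    obtain U W where U: "is_potential n U W" "eventually (\<lambda>c. c \<in> U) (near n (H p))"
      using potentials_cover[OF inj[OF p]] .
    then show ?thesis by (intro exI[of _ "(U, W)"]) simp
  qed
  have "\<exists>e>0. \<forall>p\<in>?Sq. \<exists>x. is_potential n (fst x) (snd x) \<and> (\<forall>c\<in>polydisc n (H p) e. c \<in> fst x)"
    by (rule uniform_polydisc[OF compact lim charts])
  then obtain e where e: "e > 0"
    "\<And>p. p \<in> ?Sq \<Longrightarrow> \<exists>x. is_potential n (fst x) (snd x) \<and> (\<forall>c\<in>polydisc n (H p) e. c \<in> fst x)"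
    by blast
  have "\<exists>U W. is_potential n U W \<and> polydisc n (H p) e \<subseteq> U" if "p \<in> ?Sq" for p
    using e(2)[OF that] by blast
  then obtain UU WW where UW: "\<And>p. p \<in> ?Sq \<Longrightarrow> is_potential n (UU p) (WW p)" "\<And>p. p \<in> ?Sq \<Longrightarrow> polydisc n (H p) e \<subseteq> UU p"
    by metis
  obtain \<delta> where \<delta>: "\<delta> > 0" "\<And>p q k. p \<in> ?Sq \<Longrightarrow> q \<in> ?Sq \<Longrightarrow> dist q p < \<delta> \<Longrightarrow> k \<in> {1..n} \<Longrightarrow> dist (H q k) (H p k) < e / 4"
  proof -
    have "\<exists>d>0. \<forall>p\<in>?Sq. \<forall>q\<in>?Sq. dist q p < d \<longrightarrow> dist (H q k) (H p k) < e / 4" if "k \<in> {1..n}" for k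
    proof -
      have "uniformly_continuous_on ?Sq (\<lambda>p. H p k)"
        using compact_uniformly_continuous[OF cont[OF that] compact] .
      moreover have "e / 4 > 0" using e(1) by simp
      ultimately show ?thesis unfolding uniformly_continuous_on_def by blast
    qed
    then obtain D where D: "\<And>k. k \<in> {1..n} \<Longrightarrow> D k > 0 \<and> (\<forall>p\<in>?Sq. \<forall>q\<in>?Sq. dist q p < D k \<longrightarrow> dist (H q k) (H p k) < e / 4)"
      by metis
    define d where "d = Min (insert 1 (D ` {1..n}))"
    have "d > 0" unfolding d_def using D by (subst Min_gr_iff) auto
    moreover have "d \<le> D k" if "k \<in> {1..n}" for k unfolding d_def using that by (intro Min_le) auto
    ultimately show ?thesis using that[of d] D by (meson less_le_trans)
  qed
  let ?F = "critical_moments n \<beta> \<union> critical_moments n \<gamma>"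
  have "finite ?F" "0 \<notin> ?F" "1 \<notin> ?F" "\<delta> / 2 > 0"
    using \<beta> \<gamma> \<delta>(1) by (simp_all add: tame_def critical_moments_generic)
  from partition_avoiding[OF this]
  obtain N :: nat and t where N: "N > 0" "t 0 = 0" "t N = 1" "\<And>j. j \<le> N \<Longrightarrow> t j \<notin> ?F \<and> t j \<in> {0..1}"
    "\<And>j. j < N \<Longrightarrow> t j \<le> t (Suc j) \<and> t (Suc j) - t j < \<delta> / 2" by metis
  have t01: "t j \<in> {0..1}" if "j \<le> N" for j using N(4)[OF that] by blast
  define p where "p i j = (t i, t j)" for i j
  have p_Sq: "p i j \<in> ?Sq" if "i \<le> N" "j \<le> N" for i j using t01 that by (simp add: p_def)
  have dist_pair: "dist (s, u) (s', u') < \<delta>" if "\<bar>s - s'\<bar> < \<delta> / 2" "\<bar>u - u'\<bar> < \<delta> / 2" for s u s' u' :: real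
  proof -
    have "dist (s, u) (s', u') \<le> dist (s, u) (s, u') + dist (s, u') (s', u')" by (rule dist_triangle)
    also have "\<dots> = \<bar>u - u'\<bar> + \<bar>s - s'\<bar>" by (simp add: dist_Pair_Pair dist_real_def)
    finally show ?thesis using that by simp
  qed
  have step: "\<bar>t a - t i\<bar> < \<delta> / 2" if "i < N" "a \<in> {i, Suc i}" for a i
    using N(5)[OF that(1)] that(2) \<delta>(1) by auto
  \<comment> \<open>generic configurations close to the values of the homotopy at the vertices of the grid\<close>
  \<comment> \<open>Values that are generic already are kept, so that the boundary of the grid stays on the given paths.\<close>
  define v where "v i j = (if generic n (H (p i j)) then H (p i j) else
      (SOME c. generic n c \<and> (\<forall>k\<in>{1..n}. dist (c k) (H (p i j) k) < e / 4)))" for i j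
  have v: "generic n (v i j) \<and> (\<forall>k\<in>{1..n}. dist (v i j k) (H (p i j) k) < e / 4)" for i j
  proof (cases "generic n (H (p i j))")
    case True
    then show ?thesis using e(1) by (simp add: v_def)
  next
    case False
    have "e / 4 > 0" using e(1) by simp
    from generic_dense[OF this, of n "H (p i j)"]
    have "\<exists>c. generic n c \<and> (\<forall>k\<in>{1..n}. dist (c k) (H (p i j) k) < e / 4)" by metis
    from someI_ex[OF this] show ?thesis using False by (simp add: v_def)
  qed
  have gen\<beta>: "generic n (\<beta> (t j))" and gen\<gamma>: "generic n (\<gamma> (t j))" if "j \<le> N" for j
    using N(4)[OF that] by (simp_all add: critical_moments_generic)
  have v_bot: "v 0 j = \<beta> (t j)" if "j \<le> N" for j
    using gen\<beta>[OF that] H0[OF t01[OF that]] by (simp add: v_def p_def N(2))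
  have v_top: "v N j = \<gamma> (t j)" if "j \<le> N" for j
    using gen\<gamma>[OF that] H1[OF t01[OF that]] by (simp add: v_def p_def N(3))
  have v_left: "v i 0 = \<beta> 0" if "i \<le> N" for i
    using \<beta> Hl[OF t01[OF that]] by (simp add: v_def p_def N(2) tame_def)
  have v_right: "v i N = \<beta> 1" if "i \<le> N" for i
    using \<beta> Hr[OF t01[OF that]] by (simp add: v_def p_def N(3) tame_def)
  have v_box: "v a b k \<in> ball (H (p i j) k) e"
    if "i < N" "j < N" "a \<in> {i, Suc i}" "b \<in> {j, Suc j}" "k \<in> {1..n}" for i j a b k
  proof -
    have "dist (p a b) (p i j) < \<delta>" unfolding p_def by (intro dist_pair step that)
    then have "dist (H (p a b) k) (H (p i j) k) < e / 4"
      using that by (intro \<delta>(2) p_Sq) auto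
    moreover have "dist (v a b k) (H (p a b) k) < e / 4" using v that(5) by blast
    moreover have "dist (v a b k) (H (p i j) k) \<le> dist (v a b k) (H (p a b) k) + dist (H (p a b) k) (H (p i j) k)"
      by (rule dist_triangle)
    ultimately have "dist (v a b k) (H (p i j) k) < e" using e(1) by linarith
    then show ?thesis by (simp add: dist_commute)
  qed
  define g where "g i j x y = inv\<^bsub>G3 n\<^esub> WW (p i j) x \<otimes>\<^bsub>G3 n\<^esub> WW (p i j) y" for i j x y
  have W_closed: "WW (p i j) x \<in> carrier (G3 n)" if "i < N" "j < N" for i j x
    using is_potential_closed[OF UW(1)[OF p_Sq]] that by simp
  have g_closed: "g i j x y \<in> carrier (G3 n)" if "i < N" "j < N" for i j x y
    unfolding g_def using W_closed[OF that] by simp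
  have g_mult: "g i j x y \<otimes>\<^bsub>G3 n\<^esub> g i j y z = g i j x z" if "i < N" "j < N" for i j x y z
    unfolding g_def using W_closed[OF that] by (intro transition_mult)
  have g_refl: "g i j x x = \<one>\<^bsub>G3 n\<^esub>" if "i < N" "j < N" for i j x
    unfolding g_def using W_closed[OF that] by simp
  have overlap: "g i j (v a b) (v a' b') = g i' j' (v a b) (v a' b')"
    if ij: "i < N" "j < N" "i' < N" "j' < N" and a: "a \<in> {i, Suc i}" "a \<in> {i', Suc i'}" "a' \<in> {i, Suc i}" "a' \<in> {i', Suc i'}"
      and b: "b \<in> {j, Suc j}" "b \<in> {j', Suc j'}" "b' \<in> {j, Suc j}" "b' \<in> {j', Suc j'}"
    for i j i' j' a b a' b'
    unfolding g_def
  proof (rule potentials_agree[where C = "\<lambda>k. ball (H (p i j) k) e \<inter> ball (H (p i' j') k) e"])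
    have Sq: "p i j \<in> ?Sq" "p i' j' \<in> ?Sq" using ij by (intro p_Sq; simp)+
    show "is_potential n (UU (p i j)) (WW (p i j))" "is_potential n (UU (p i' j')) (WW (p i' j'))"
      by (rule UW(1)[OF Sq(1)], rule UW(1)[OF Sq(2)])
    show "open (ball (H (p i j) k) e \<inter> ball (H (p i' j') k) e) \<and> convex (ball (H (p i j) k) e \<inter> ball (H (p i' j') k) e)" for k
      by (intro conjI open_Int convex_Int open_ball convex_ball)
    show "c \<in> UU (p i j) \<inter> UU (p i' j')"
      if c: "\<And>k. k \<in> {1..n} \<Longrightarrow> c k \<in> ball (H (p i j) k) e \<inter> ball (H (p i' j') k) e" for c
    proof -
      have "dist (c k) (H (p i j) k) < e" "dist (c k) (H (p i' j') k) < e" if "k \<in> {1..n}" for k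
        using c[OF that] by (simp_all add: dist_commute)
      then have "c \<in> polydisc n (H (p i j)) e" "c \<in> polydisc n (H (p i' j')) e"
        unfolding polydisc_def by blast+
      then show ?thesis using UW(2)[OF Sq(1)] UW(2)[OF Sq(2)] by blast
    qed
    show "generic n (v a b)" "generic n (v a' b')" using v by blast+
    show "v a b k \<in> ball (H (p i j) k) e \<inter> ball (H (p i' j') k) e" if "k \<in> {1..n}" for k
      by (intro IntI v_box ij a b that)
    show "v a' b' k \<in> ball (H (p i j) k) e \<inter> ball (H (p i' j') k) e" if "k \<in> {1..n}" for k
      by (intro IntI v_box ij a b that)
  qed
  define lower where "lower i = list_prod (\<lambda>j. g i j (v i j) (v i (Suc j))) [0..<N]" for i
  define upper where "upper i = list_prod (\<lambda>j. g i j (v (Suc i) j) (v (Suc i) (Suc j))) [0..<N]" for i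
  \<comment> \<open>Rung \<open>j\<close> is measured in the chart of cell \<open>j\<close>, and the rung at the right end in the chart of the last cell.\<close>
  have row: "lower i = upper i" if i: "i < N" for i
    unfolding lower_def upper_def
  proof (rule list_prod_ladder[where e = "\<lambda>m. g i (min m (N - 1)) (v i m) (v (Suc i) m)"])
    have mN: "min m (N - 1) < N" for m using N(1) by auto
    show "g i j (v i j) (v i (Suc j)) \<in> carrier (G3 n) \<and> g i j (v (Suc i) j) (v (Suc i) (Suc j)) \<in> carrier (G3 n)"
      if "j < N" for j using g_closed[OF i that] by blast
    show "g i (min m (N - 1)) (v i m) (v (Suc i) m) \<in> carrier (G3 n)" for m by (rule g_closed[OF i mN])
    show "g i (min 0 (N - 1)) (v i 0) (v (Suc i) 0) = \<one>\<^bsub>G3 n\<^esub>"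
      unfolding v_left[OF less_imp_le[OF i]] v_left[OF Suc_leI[OF i]] by (rule g_refl[OF i mN])
    show "g i (min N (N - 1)) (v i N) (v (Suc i) N) = \<one>\<^bsub>G3 n\<^esub>"
      unfolding v_right[OF less_imp_le[OF i]] v_right[OF Suc_leI[OF i]] by (rule g_refl[OF i mN])
    fix j assume j: "j < N"
    have "g i (min (Suc j) (N - 1)) (v i (Suc j)) (v (Suc i) (Suc j)) = g i j (v i (Suc j)) (v (Suc i) (Suc j))"
      by (rule overlap[OF i mN i j]) (use j in auto)
    moreover have "min j (N - 1) = j" using j by simp
    ultimately show "g i j (v i j) (v i (Suc j)) \<otimes>\<^bsub>G3 n\<^esub> g i (min (Suc j) (N - 1)) (v i (Suc j)) (v (Suc i) (Suc j))
        = g i (min j (N - 1)) (v i j) (v (Suc i) j) \<otimes>\<^bsub>G3 n\<^esub> g i j (v (Suc i) j) (v (Suc i) (Suc j))"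
      using g_mult[OF i j] by simp
  qed
  have next_row: "upper i = lower (Suc i)" if "Suc i < N" for i
    unfolding lower_def upper_def
    by (rule list_prod_cong, rule overlap) (use that in auto)
  have rows: "lower 0 = upper i" if "i < N" for i
    using that
  proof (induction i)
    case 0
    then show ?case using row by simp
  next
    case (Suc i)
    then show ?case using next_row[OF Suc.prems] row[OF Suc.prems] by simp
  qed
  have inU: "H (s, u) \<in> UU (p i j)"
    if "i < N" "j < N" "s \<in> {t i..t (Suc i)}" "u \<in> {t j..t (Suc j)}" for s u i j
  proof -
    have s: "s \<in> {0..1}" "u \<in> {0..1}"
      using that t01[of i] t01[of "Suc i"] t01[of j] t01[of "Suc j"] by auto
    have "dist (s, u) (p i j) < \<delta>"
      unfolding p_def using that N(5)[OF that(1)] N(5)[OF that(2)] by (intro dist_pair) auto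
    then have "dist (H (s, u) k) (H (p i j) k) < e" if "k \<in> {1..n}" for k
      using \<delta>(2)[OF p_Sq[of i j], of "(s, u)" k] s that \<open>i < N\<close> \<open>j < N\<close> e(1) by force
    then have "H (s, u) \<in> polydisc n (H (p i j)) e" by (simp add: polydisc_def)
    then show ?thesis using UW(2)[OF p_Sq[of i j]] that by auto
  qed
  have "lower 0 = list_prod (\<lambda>j. inv\<^bsub>G3 n\<^esub> reading_upto n \<beta> (t j) \<otimes>\<^bsub>G3 n\<^esub> reading_upto n \<beta> (t (Suc j))) [0..<N]"
    unfolding lower_def
  proof (rule list_prod_cong)
    fix j assume "j \<in> set [0..<N]"
    then have j: "j < N" "j \<le> N" "Suc j \<le> N" by auto
    have sub: "{t j..t (Suc j)} \<subseteq> {0..1}" using t01[OF j(2)] t01[OF j(3)] by auto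
    show "g 0 j (v 0 j) (v 0 (Suc j)) = inv\<^bsub>G3 n\<^esub> reading_upto n \<beta> (t j) \<otimes>\<^bsub>G3 n\<^esub> reading_upto n \<beta> (t (Suc j))"
      unfolding g_def v_bot[OF j(2)] v_bot[OF j(3)]
    proof (rule potential_reading[OF \<beta> UW(1)[OF p_Sq] _ sub gen\<beta>[OF j(2)] gen\<beta>[OF j(3)]])
      fix u assume u: "u \<in> {t j..t (Suc j)}"
      have "0 \<in> {t 0..t (Suc 0)}" using N(2) N(5)[OF N(1)] by simp
      then show "\<beta> u \<in> UU (p 0 j)" using inU[OF N(1) j(1) _ u] H0 sub u by (metis subsetD)
    qed (use N(5) j in auto)
  qed
  also have "\<dots> = inv\<^bsub>G3 n\<^esub> reading_upto n \<beta> (t 0) \<otimes>\<^bsub>G3 n\<^esub> reading_upto n \<beta> (t N)"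
    using reading_upto_closed[OF \<beta>] by (intro list_prod_telescope)
  finally have L: "lower 0 = braid_reading n \<beta>"
    using reading_upto_0[OF \<beta>] reading_upto_1[OF \<beta>] reading_upto_closed[OF \<beta>, of 1] by (simp add: N(2,3))
  let ?i = "N - 1"
  have Ni: "?i < N" "Suc ?i = N" using N(1) by auto
  have "upper ?i = list_prod (\<lambda>j. inv\<^bsub>G3 n\<^esub> reading_upto n \<gamma> (t j) \<otimes>\<^bsub>G3 n\<^esub> reading_upto n \<gamma> (t (Suc j))) [0..<N]"
    unfolding upper_def
  proof (rule list_prod_cong)
    fix j assume "j \<in> set [0..<N]"
    then have j: "j < N" "j \<le> N" "Suc j \<le> N" by auto
    have sub: "{t j..t (Suc j)} \<subseteq> {0..1}" using t01[OF j(2)] t01[OF j(3)] by auto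
    show "g ?i j (v (Suc ?i) j) (v (Suc ?i) (Suc j)) = inv\<^bsub>G3 n\<^esub> reading_upto n \<gamma> (t j) \<otimes>\<^bsub>G3 n\<^esub> reading_upto n \<gamma> (t (Suc j))"
      unfolding g_def Ni(2) v_top[OF j(2)] v_top[OF j(3)]
    proof (rule potential_reading[OF \<gamma> UW(1)[OF p_Sq] _ sub gen\<gamma>[OF j(2)] gen\<gamma>[OF j(3)]])
      fix u assume u: "u \<in> {t j..t (Suc j)}"
      have "1 \<in> {t ?i..t (Suc ?i)}" using N(3) N(5)[OF Ni(1)] Ni(2) by simp
      then show "\<gamma> u \<in> UU (p ?i j)" using inU[OF Ni(1) j(1) _ u] H1 sub u by (metis subsetD)
    qed (use N(5) j in auto)
  qed
  also have "\<dots> = inv\<^bsub>G3 n\<^esub> reading_upto n \<gamma> (t 0) \<otimes>\<^bsub>G3 n\<^esub> reading_upto n \<gamma> (t N)"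
    using reading_upto_closed[OF \<gamma>] by (intro list_prod_telescope)
  finally have "upper ?i = braid_reading n \<gamma>"
    using reading_upto_0[OF \<gamma>] reading_upto_1[OF \<gamma>] reading_upto_closed[OF \<gamma>, of 1] by (simp add: N(2,3))
  with L rows[OF Ni(1)] show ?thesis by simp
qed


section \<open>Iterated derivatives on the unit interval\<close>

lemma deriv01_eq:
  assumes "t \<in> {0..1}" "(g has_vector_derivative d) (at t within {0..1})"
  shows "deriv01 g t = d"
  unfolding deriv01_def using assms by (intro vector_derivative_within_closed_interval) auto

lemma deriv01_cong:
  assumes "\<And>u. u \<in> {0..1} \<Longrightarrow> g u = h u" "t \<in> {0..1}"
  shows "deriv01 g t = deriv01 h t"
  unfolding deriv01_def by (rule vector_derivative_cong_eq) (use assms in \<open>auto intro: always_eventually\<close>)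

lemma deriv01_pow_cong:
  assumes "\<And>u. u \<in> {0..1} \<Longrightarrow> g u = h u" "t \<in> {0..1}"
  shows "(deriv01 ^^ m) g t = (deriv01 ^^ m) h t"
  using assms(2)
proof (induction m arbitrary: t)
  case 0
  then show ?case using assms(1) by simp
next
  case (Suc m)
  then show ?case by (auto intro: deriv01_cong)
qed

lemma differentiable_on_transform:
  assumes "f differentiable_on S" "\<And>x. x \<in> S \<Longrightarrow> f x = g x"
  shows "g differentiable_on S"
  unfolding differentiable_on_def
proof
  fix x assume x: "x \<in> S"
  then obtain D where "(f has_derivative D) (at x within S)"
    using assms(1) unfolding differentiable_on_def differentiable_def by blast
  then have "(g has_derivative D) (at x within S)"
    using has_derivative_transform[OF x] assms(2) by metis
  then show "g differentiable at x within S" unfolding differentiable_def by blast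
qed

lemma smooth01_cong:
  assumes "smooth01 g" "\<And>u. u \<in> {0..1} \<Longrightarrow> g u = h u"
  shows "smooth01 h"
  unfolding smooth01_def
proof
  fix m show "(deriv01 ^^ m) h differentiable_on {0..1}"
    by (rule differentiable_on_transform[of "(deriv01 ^^ m) g"])
      (use assms deriv01_pow_cong[of g h] in \<open>auto simp: smooth01_def\<close>)
qed

lemma smooth01_has_vector_derivative:
  assumes "smooth01 g" "t \<in> {0..1}"
  shows "((deriv01 ^^ m) g has_vector_derivative (deriv01 ^^ Suc m) g t) (at t within {0..1})"
proof -
  have "(deriv01 ^^ m) g differentiable (at t within {0..1})"
    using assms by (simp add: smooth01_def differentiable_on_def)
  then show ?thesis by (simp add: deriv01_def flip: vector_derivative_works)
qed

lemma smooth01_continuous: "smooth01 g \<Longrightarrow> continuous_on {0..1} ((deriv01 ^^ m) g)"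
  by (simp add: smooth01_def differentiable_imp_continuous_on)

lemma deriv01_pow_add_scale:
  assumes "smooth01 g" "smooth01 h" "t \<in> {0..1}"
  shows "(deriv01 ^^ m) (\<lambda>u. g u + of_real x * h u) t = (deriv01 ^^ m) g t + of_real x * (deriv01 ^^ m) h t"
  using assms(3)
proof (induction m arbitrary: t)
  case 0
  then show ?case by simp
next
  case (Suc m)
  have "deriv01 ((deriv01 ^^ m) (\<lambda>u. g u + of_real x * h u)) t
      = deriv01 (\<lambda>t. (deriv01 ^^ m) g t + of_real x * (deriv01 ^^ m) h t) t"
    by (rule deriv01_cong) (use Suc in auto)
  also have "\<dots> = (deriv01 ^^ Suc m) g t + of_real x * (deriv01 ^^ Suc m) h t"
    by (rule deriv01_eq[OF Suc.prems])
      (intro has_vector_derivative_add has_vector_derivative_mult_right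
        smooth01_has_vector_derivative assms(1,2) Suc.prems)
  finally show ?case by simp
qed

lemma smooth01_add_scale:
  assumes "smooth01 g" "smooth01 h"
  shows "smooth01 (\<lambda>u. g u + of_real x * h u)"
  unfolding smooth01_def
proof
  fix m
  have "(\<lambda>t. (deriv01 ^^ m) g t + of_real x * (deriv01 ^^ m) h t) differentiable_on {0..1}"
    using assms by (intro differentiable_on_add differentiable_on_mult differentiable_on_const)
      (simp_all add: smooth01_def)
  then show "(deriv01 ^^ m) (\<lambda>u. g u + of_real x * h u) differentiable_on {0..1}"
    by (rule differentiable_on_transform) (simp add: deriv01_pow_add_scale[OF assms])
qed

text \<open>The iterated derivatives relative to the interval are again polynomials on it, which makes
  polynomials smooth.\<close>

lemma polynomial_deriv01_pow:
  fixes p :: "real \<Rightarrow> complex"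
  assumes "polynomial_function p"
  shows "\<exists>q. polynomial_function q \<and> (\<forall>t\<in>{0..1}. (deriv01 ^^ m) p t = q t)"
proof (induction m)
  case 0
  then show ?case using assms by (intro exI[of _ p]) simp
next
  case (Suc m)
  then obtain q where q: "polynomial_function q" "\<And>t. t \<in> {0..1} \<Longrightarrow> (deriv01 ^^ m) p t = q t" by blast
  obtain q' where q': "polynomial_function q'" "\<And>x. (q has_vector_derivative q' x) (at x)"
    using has_vector_derivative_polynomial_function[OF q(1)] by blast
  have "(deriv01 ^^ Suc m) p t = q' t" if "t \<in> {0..1}" for t
  proof -
    have "deriv01 ((deriv01 ^^ m) p) t = deriv01 q t" by (rule deriv01_cong) (use q(2) that in auto)
    also have "\<dots> = q' t" by (rule deriv01_eq[OF that]) (rule has_vector_derivative_at_within[OF q'(2)])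
    finally show ?thesis by simp
  qed
  then show ?case using q'(1) by blast
qed

lemma smooth01_polynomial:
  fixes p :: "real \<Rightarrow> complex"
  assumes "polynomial_function p"
  shows "smooth01 p"
  unfolding smooth01_def
proof
  fix m
  obtain q where q: "polynomial_function q" "\<And>t. t \<in> {0..1} \<Longrightarrow> (deriv01 ^^ m) p t = q t"
    using polynomial_deriv01_pow[OF assms, of m] by blast
  have "q differentiable_on {0..1}"
    using differentiable_at_polynomial_function[OF q(1)] by (simp add: differentiable_on_def)
  then show "(deriv01 ^^ m) p differentiable_on {0..1}"
    by (rule differentiable_on_transform) (simp add: q(2))
qed

text \<open>Lagrange interpolation.\<close>

lemma polynomial_interpolation:
  fixes f :: "real \<Rightarrow> complex"
  assumes "finite S"
  obtains p where "polynomial_function p" "\<And>x. x \<in> S \<Longrightarrow> p x = f x"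
proof -
  have "\<exists>p. polynomial_function p \<and> (\<forall>x\<in>S. p x = f x)"
    using assms
  proof (induction S rule: finite_induct)
    case empty
    show ?case by (intro exI[of _ "\<lambda>_. 0"]) simp
  next
    case (insert a S)
    then obtain p where p: "polynomial_function p" "\<And>x. x \<in> S \<Longrightarrow> p x = f x" by blast
    define q where "q t = (\<Prod>s\<in>S. t - s)" for t :: real
    have "real_polynomial_function (\<lambda>t. t - s)" for s :: real
      unfolding real_polynomial_function_eq by (intro polynomial_function_diff) simp_all
    then have "real_polynomial_function q"
      unfolding q_def using insert.hyps(1) by (intro real_polynomial_function_prod)
    then have "polynomial_function q" by (simp add: real_polynomial_function_eq)
    then have "polynomial_function (\<lambda>t. p t + q t *\<^sub>R ((f a - p a) / of_real (q a)))"
      using p(1) by (intro polynomial_function_add polynomial_function_mult) simp_all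
    moreover have "q a \<noteq> 0" using insert.hyps by (auto simp: q_def)
    moreover have "q x = 0" if "x \<in> S" for x using that insert.hyps(1) by (auto simp: q_def)
    ultimately show ?case
      using p(2) by (intro exI[of _ "\<lambda>t. p t + q t *\<^sub>R ((f a - p a) / of_real (q a))"])
        (auto simp: scaleR_conv_of_real)
  qed
  then show ?thesis using that by blast
qed


section \<open>Pure braids\<close>

lemma conf_iff: "z \<in> conf n \<longleftrightarrow> z \<in> extensional {1..n} \<and> inj_on z {1..n}"
  by (simp add: conf_def)

lemma norm_base_pt: "j \<in> {1..n} \<Longrightarrow> cmod (base_pt n j) = 1"
  by (simp add: base_pt_def)

lemma inj_base_pt: "inj_on (base_pt n) {1..n}"
proof (rule inj_onI)
  fix j k assume *: "j \<in> {1..n}" "k \<in> {1..n}" "base_pt n j = base_pt n k"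
  then have "1 \<le> n" by simp
  from * have "j mod n = k mod n"
    using complex_root_unity_eq[OF \<open>1 \<le> n\<close>, of j k] by (simp add: base_pt_def)
  then show "j = k"
    using * by (cases "j = n"; cases "k = n") auto
qed

lemma base_pt_conf: "base_pt n \<in> conf n"
  unfolding conf_iff using inj_base_pt by (intro conjI) (simp add: base_pt_def)

lemma circle_between:
  assumes "cmod a = 1" "cmod b = 1" "cmod c = 1" "between (a, c) b"
  shows "a = c \<or> b = a \<or> b = c"
proof -
  obtain u where u: "0 \<le> u" "u \<le> 1" "b = (1 - u) *\<^sub>R a + u *\<^sub>R c"
    using assms(4) by (auto simp: between_mem_segment in_segment)
  have n: "(Re a)\<^sup>2 + (Im a)\<^sup>2 = 1" "(Re c)\<^sup>2 + (Im c)\<^sup>2 = 1" "(Re b)\<^sup>2 + (Im b)\<^sup>2 = 1"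
    using assms(1-3) by (simp_all flip: cmod_power2)
  have "(Re b)\<^sup>2 + (Im b)\<^sup>2 = (1 - u)\<^sup>2 * ((Re a)\<^sup>2 + (Im a)\<^sup>2) + u\<^sup>2 * ((Re c)\<^sup>2 + (Im c)\<^sup>2)
      + u * (1 - u) * (((Re a)\<^sup>2 + (Im a)\<^sup>2) + ((Re c)\<^sup>2 + (Im c)\<^sup>2) - ((Re a - Re c)\<^sup>2 + (Im a - Im c)\<^sup>2))"
    unfolding u(3) by (simp add: power2_eq_square algebra_simps)
  then have "u * (1 - u) * ((Re a - Re c)\<^sup>2 + (Im a - Im c)\<^sup>2) = 0"
    unfolding n by (simp add: power2_eq_square algebra_simps)
  then have "u = 0 \<or> u = 1 \<or> (Re a - Re c)\<^sup>2 + (Im a - Im c)\<^sup>2 = 0" by auto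
  then show ?thesis
    using u(3) by (auto simp: sum_power2_eq_zero_iff complex_eq_iff)
qed

text \<open>No three points of a circle are collinear.\<close>

lemma generic_base_pt: "generic n (base_pt n)"
  unfolding generic_def
proof (intro allI impI notI)
  fix i j k assume ijk: "{i, j, k} \<subseteq> {1..n}" "distinct [i, j, k]"
    "orient (base_pt n i) (base_pt n j) (base_pt n k) = 0"
  have m: "i \<in> {1..n}" "j \<in> {1..n}" "k \<in> {1..n}" using ijk(1) by blast+
  have ne: "base_pt n i \<noteq> base_pt n j" "base_pt n i \<noteq> base_pt n k" "base_pt n j \<noteq> base_pt n k"
    using inj_on_eq_iff[OF inj_base_pt] m ijk(2) by simp_all
  note b = circle_between[OF norm_base_pt norm_base_pt norm_base_pt]
  show False
    using ijk(3) b[OF m(2,1,3)] b[OF m(3,2,1)] b[OF m(1,3,2)] ne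
    unfolding orient_eq_0_iff_collinear collinear_between_cases by metis
qed

lemma pure_braid_continuous:
  assumes "pure_braid n \<beta>" "j \<in> {1..n}"
  shows "continuous_on {0..1} (\<lambda>t. \<beta> t j)"
  using smooth01_continuous[of "\<lambda>t. \<beta> t j" 0] assms by (simp add: pure_braid_def)

lemma pure_braid_inj: "pure_braid n \<beta> \<Longrightarrow> t \<in> {0..1} \<Longrightarrow> inj_on (\<beta> t) {1..n}"
  by (simp add: pure_braid_def conf_iff)

lemma pure_braid_ends:
  assumes "pure_braid n \<beta>"
  shows "\<beta> 0 = base_pt n" "\<beta> 1 = base_pt n" "generic n (\<beta> 0)" "generic n (\<beta> 1)"
  using assms generic_base_pt by (simp_all add: pure_braid_def pathstart_def pathfinish_def)

lemma pure_braid_filterlim: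
  assumes "\<And>j. j \<in> {1..n} \<Longrightarrow> continuous_on {0..1} (\<lambda>t. \<beta> t j)" "t \<in> {0..1::real}"
  shows "filterlim \<beta> (near n (\<beta> t)) (inf (nhds t) (principal {0..1}))"
  by (rule filterlim_near) (rule tendsto_nhds_within[OF assms])

lemma eventually_near_inj:
  assumes "inj_on c {1..n}"
  shows "eventually (\<lambda>c'. inj_on c' {1..n}) (near n c)"
proof -
  have "eventually (\<lambda>c'. i \<noteq> j \<longrightarrow> c' i \<noteq> c' j) (near n c)" if ij: "i \<in> {1..n}" "j \<in> {1..n}" for i j
  proof (cases "i = j")
    case False
    have "((\<lambda>c'. c' i - c' j) \<longlongrightarrow> c i - c j) (near n c)"
      by (intro tendsto_diff tendsto_near ij)
    moreover have "c i - c j \<noteq> 0" using inj_on_eq_iff[OF assms ij] False by simp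
    ultimately have "eventually (\<lambda>c'. c' i - c' j \<noteq> 0) (near n c)" by (rule tendsto_imp_eventually_ne)
    then show ?thesis by (rule eventually_mono) auto
  qed simp
  then have "eventually (\<lambda>c'. \<forall>i\<in>{1..n}. \<forall>j\<in>{1..n}. i \<noteq> j \<longrightarrow> c' i \<noteq> c' j) (near n c)"
    by (intro eventually_ball_finite ballI) auto
  then show ?thesis by (rule eventually_mono) (auto simp: inj_on_def)
qed

text \<open>This radius keeps the points of a perturbed path apart at all times.\<close>

lemma uniformly_inj:
  fixes \<beta> :: "real \<Rightarrow> nat \<Rightarrow> complex"
  assumes "\<And>j. j \<in> {1..n} \<Longrightarrow> continuous_on {0..1} (\<lambda>t. \<beta> t j)" "\<And>t. t \<in> {0..1} \<Longrightarrow> inj_on (\<beta> t) {1..n}"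
  obtains e where "e > 0" "\<And>t c. t \<in> {0..1} \<Longrightarrow> c \<in> polydisc n (\<beta> t) e \<Longrightarrow> inj_on c {1..n}"
proof -
  have inj: "\<exists>x. x = () \<and> eventually (\<lambda>c. inj_on c {1..n}) (near n (\<beta> t))" if "t \<in> {0..1}" for t
    using eventually_near_inj[OF assms(2)[OF that]] by simp
  have "\<exists>e>0. \<forall>t\<in>{0..1}. \<exists>x. x = () \<and> (\<forall>c\<in>polydisc n (\<beta> t) e. inj_on c {1..n})"
    by (rule uniform_polydisc[OF compact_Icc pure_braid_filterlim[OF assms(1)] inj])
  then show ?thesis using that by blast
qed


section \<open>Stable braids cross the walls\<close>

lemma sign_change_zero:
  fixes f :: "real \<Rightarrow> real"
  assumes "a < b" "continuous_on {a..b} f" "f a * f b < 0"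
  obtains z where "z \<in> {a<..<b}" "f z = 0"
proof -
  have "\<exists>z\<ge>a. z \<le> b \<and> f z = 0"
  proof (cases "f a < 0")
    case True
    then have "f a \<le> 0" "0 \<le> f b" using assms(3) by (auto simp: mult_less_0_iff)
    then show ?thesis using IVT'[of f a 0 b] assms(1,2) by auto
  next
    case False
    then have "0 \<le> f a" "f b \<le> 0" using assms(3) by (auto simp: mult_less_0_iff)
    then show ?thesis using IVT2'[of f b 0 a] assms(1,2) by auto
  qed
  then obtain z where z: "a \<le> z" "z \<le> b" "f z = 0" by blast
  moreover have "z \<noteq> a" "z \<noteq> b" using z(3) assms(3) by auto
  ultimately show ?thesis using that[of z] by simp
qed

lemma eventually_separated:
  fixes K :: "real set"
  assumes fin: "finite K" and K: "\<And>t. t \<in> K \<Longrightarrow> 0 < t \<and> t < 1"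
  shows "eventually (\<lambda>\<delta>. \<forall>t\<in>K. \<delta> < t \<and> t + \<delta> < 1 \<and> (\<forall>t'\<in>K. t \<noteq> t' \<longrightarrow> 2 * \<delta> < \<bar>t - t'\<bar>)) (at_right (0::real))"
proof -
  have small: "eventually (\<lambda>x. x < y) (at_right 0)" if "y > 0" for y :: real
    using order_tendstoD(2)[OF tendsto_ident_at that] .
  have "eventually (\<lambda>x. t \<noteq> t' \<longrightarrow> 2 * x < \<bar>t - t'\<bar>) (at_right 0)" for t t' :: real
  proof (cases "t = t'")
    case False
    then have "eventually (\<lambda>x. x < \<bar>t - t'\<bar> / 2) (at_right 0)" by (intro small) simp
    then show ?thesis by (rule eventually_mono) (simp add: field_simps)
  qed simp
  then have gaps: "eventually (\<lambda>x. \<forall>t'\<in>K. t \<noteq> t' \<longrightarrow> 2 * x < \<bar>t - t'\<bar>) (at_right 0)" for t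
    by (intro eventually_ball_finite ballI fin)
  have ends: "eventually (\<lambda>x. x < t \<and> t + x < 1) (at_right 0)" if "t \<in> K" for t
  proof -
    have "eventually (\<lambda>x. x < t) (at_right 0)" "eventually (\<lambda>x. x < 1 - t) (at_right 0)"
      using K[OF that] by (intro small; simp)+
    then show ?thesis by eventually_elim simp
  qed
  have "eventually (\<lambda>x. (x < t \<and> t + x < 1) \<and> (\<forall>t'\<in>K. t \<noteq> t' \<longrightarrow> 2 * x < \<bar>t - t'\<bar>)) (at_right 0)"
    if "t \<in> K" for t
    by (rule eventually_conj[OF ends[OF that] gaps])
  then show ?thesis by (intro eventually_ball_finite ballI fin) simp
qed

definition perturbed :: "nat \<Rightarrow> (real \<Rightarrow> nat \<Rightarrow> complex) \<Rightarrow> (nat \<Rightarrow> real \<Rightarrow> complex) \<Rightarrow> real \<Rightarrow> real \<Rightarrow> nat \<Rightarrow> complex" where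
  "perturbed n \<beta> p x = (\<lambda>t. \<lambda>j\<in>{1..n}. \<beta> t j + of_real x * p j t)"

text \<open>The derivatives of a polynomial are bounded on the interval, so a small multiple of it is small
  together with any number of derivatives.\<close>

lemma perturbed_braid:
  assumes \<beta>: "pure_braid n \<beta>" and p: "\<And>j. j \<in> {1..n} \<Longrightarrow> polynomial_function (p j)"
    and p01: "\<And>j. j \<in> {1..n} \<Longrightarrow> p j 0 = 0 \<and> p j 1 = 0" and "\<epsilon> > 0"
  shows "eventually (\<lambda>x. pure_braid n (perturbed n \<beta> p x) \<and> braid_close n r \<epsilon> \<beta> (perturbed n \<beta> p x)) (at_right 0)"
proof -
  have smooth: "smooth01 (\<lambda>t. \<beta> t j)" "smooth01 (p j)" if "j \<in> {1..n}" for j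
    using \<beta> that smooth01_polynomial[OF p[OF that]] by (simp_all add: pure_braid_def)
  have eq: "(\<lambda>u. perturbed n \<beta> p x u j) = (\<lambda>u. \<beta> u j + of_real x * p j u)" if "j \<in> {1..n}" for j x
    using that by (simp add: perturbed_def)
  obtain e where e: "e > 0" "\<And>t c. t \<in> {0..1} \<Longrightarrow> c \<in> polydisc n (\<beta> t) e \<Longrightarrow> inj_on c {1..n}"
    using uniformly_inj[OF pure_braid_continuous[OF \<beta>] pure_braid_inj[OF \<beta>]] by blast
  have small: "eventually (\<lambda>x. \<forall>t\<in>{0..1}. cmod (of_real x * (deriv01 ^^ m) (p j) t) < d) (at_right 0)"
    if j: "j \<in> {1..n}" and d: "d > 0" for j m d
  proof -
    have "compact ((deriv01 ^^ m) (p j) ` {0..1})"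
      using smooth01_continuous[OF smooth(2)[OF j]] by (rule compact_continuous_image) simp
    then have "bounded ((deriv01 ^^ m) (p j) ` {0..1})" by (rule compact_imp_bounded)
    then obtain B where B: "B > 0" "\<And>t. t \<in> {0..1} \<Longrightarrow> cmod ((deriv01 ^^ m) (p j) t) \<le> B"
      unfolding bounded_pos by auto
    have "((\<lambda>x. x) \<longlongrightarrow> 0) (at_right (0::real))" by (rule tendsto_ident_at)
    moreover have "d / B > 0" using d B(1) by simp
    ultimately have "eventually (\<lambda>x. x < d / B) (at_right 0)" by (rule order_tendstoD(2))
    with eventually_at_right_less[of "0::real"] show ?thesis
    proof (eventually_elim, intro ballI)
      fix x t :: real assume x: "0 < x" "x < d / B" and t: "t \<in> {0..1}"
      have "cmod (of_real x * (deriv01 ^^ m) (p j) t) \<le> x * B"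
        using x(1) B(2)[OF t] by (simp add: norm_mult mult_left_mono)
      also have "\<dots> < d" using x(2) B(1) by (simp add: field_simps)
      finally show "cmod (of_real x * (deriv01 ^^ m) (p j) t) < d" .
    qed
  qed
  have "eventually (\<lambda>x. \<forall>m\<in>{..r}. \<forall>j\<in>{1..n}. \<forall>t\<in>{0..1}. cmod (of_real x * (deriv01 ^^ m) (p j) t) < \<epsilon>) (at_right 0)"
    by (intro small[OF _ \<open>\<epsilon> > 0\<close>] eventually_ball_finite ballI finite_atMost finite_atLeastAtMost)
  moreover have "eventually (\<lambda>x. \<forall>j\<in>{1..n}. \<forall>t\<in>{0..1}. cmod (of_real x * (deriv01 ^^ 0) (p j) t) < e) (at_right 0)"
    by (intro small[OF _ e(1)] eventually_ball_finite ballI finite_atLeastAtMost)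
  ultimately show ?thesis
  proof eventually_elim
    fix x assume *: "\<forall>m\<in>{..r}. \<forall>j\<in>{1..n}. \<forall>t\<in>{0..1}. cmod (of_real x * (deriv01 ^^ m) (p j) t) < \<epsilon>"
      "\<forall>j\<in>{1..n}. \<forall>t\<in>{0..1}. cmod (of_real x * (deriv01 ^^ 0) (p j) t) < e"
    let ?\<gamma> = "perturbed n \<beta> p x"
    have "?\<gamma> t \<in> polydisc n (\<beta> t) e" if "t \<in> {0..1}" for t
      using *(2) that by (simp add: polydisc_def perturbed_def dist_norm)
    then have inj: "inj_on (?\<gamma> t) {1..n}" if "t \<in> {0..1}" for t using e(2) that by blast
    have ext: "?\<gamma> t \<in> extensional {1..n}" for t by (simp add: perturbed_def)
    have base: "?\<gamma> t = base_pt n" if t: "t = 0 \<or> t = 1" for t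
    proof (rule extensionalityI[OF ext])
      show "base_pt n \<in> extensional {1..n}" by (simp add: base_pt_def)
      show "?\<gamma> t j = base_pt n j" if "j \<in> {1..n}" for j
        using t p01[OF that] that pure_braid_ends(1,2)[OF \<beta>] by (auto simp: perturbed_def)
    qed
    have "pure_braid n ?\<gamma>"
      unfolding pure_braid_def conf_iff pathstart_def pathfinish_def
      using smooth eq inj ext base by (simp add: smooth01_add_scale)
    moreover have "braid_close n r \<epsilon> \<beta> ?\<gamma>"
      unfolding braid_close_def
    proof (intro allI impI ballI)
      fix m j and t :: real assume "m \<le> r" "j \<in> {1..n}" "t \<in> {0..1}"
      then show "cmod ((deriv01 ^^ m) (\<lambda>u. ?\<gamma> u j) t - (deriv01 ^^ m) (\<lambda>u. \<beta> u j) t) < \<epsilon>"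
        unfolding eq[OF \<open>j \<in> {1..n}\<close>]
        using *(1) deriv01_pow_add_scale[OF smooth[OF \<open>j \<in> {1..n}\<close>] \<open>t \<in> {0..1}\<close>, of m x] by simp
    qed
    ultimately show "pure_braid n ?\<gamma> \<and> braid_close n r \<epsilon> \<beta> ?\<gamma>" ..
  qed
qed

lemma unique_triple_only_wall:
  assumes uniq: "\<exists>!T. T \<subseteq> {1..n} \<and> card T = 3 \<and> collinear (c ` T)"
  shows "\<exists>T. only_wall n c T"
proof -
  define P where "P = (\<lambda>T. T \<subseteq> {1..n} \<and> card T = 3 \<and> collinear (c ` T))"
  from uniq obtain T where T: "\<And>T'. P T' \<Longrightarrow> T' = T" unfolding P_def[symmetric] by metis
  have "only_wall n c T"
    unfolding only_wall_def
  proof (intro allI impI notI)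
    fix i j k assume *: "{i, j, k} \<subseteq> {1..n}" "distinct [i, j, k]" "{i, j, k} \<noteq> T" "orient (c i) (c j) (c k) = 0"
    have "card {i, j, k} = 3" using *(2) by simp
    moreover have "collinear (c ` {i, j, k})" using *(4) by (simp add: orient_eq_0_iff_collinear)
    ultimately have "P {i, j, k}" unfolding P_def using *(1) by (intro conjI)
    with *(3) T show False by metis
  qed
  then show ?thesis ..
qed

text \<open>The middle point is shifted along the normal of the common line.\<close>

lemma orient_middle_shift:
  assumes "orient a b c = 0"
  shows "orient a (b + of_real x * Complex (y * Im (c - a)) (- y * Re (c - a))) c = x * y * (cmod (c - a))\<^sup>2"
proof -
  have "orient a (b + of_real x * Complex (y * Im (c - a)) (- y * Re (c - a))) c
      = orient a b c + x * y * ((Re (c - a))\<^sup>2 + (Im (c - a))\<^sup>2)"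
    by (simp add: orient_def power2_eq_square algebra_simps)
  then show ?thesis using assms by (simp add: cmod_power2)
qed

text \<open>If the sign of the orientation of a collinear triple does not change at a critical moment, then
  the braid is not stable: a perturbation that pushes the middle point of every collinear triple to
  the opposite side produces a critical moment just before every given one, and another one just
  after the given one without a sign change.\<close>

theorem good_stable_imp_tame:
  assumes "good_stable n \<beta>"
  shows "tame n \<beta>"
proof -
  let ?K = "critical_moments n \<beta>"
  have \<beta>: "pure_braid n \<beta>" and fin: "finite ?K"
    and uniq: "\<And>t. t \<in> ?K \<Longrightarrow> \<exists>!T. T \<subseteq> {1..n} \<and> card T = 3 \<and> collinear (\<beta> t ` T)"
    using assms unfolding good_stable_def by blast+
  obtain r \<epsilon> where \<epsilon>: "\<epsilon> > 0" and stable: "\<And>\<gamma>. pure_braid n \<gamma> \<Longrightarrow> braid_close n r \<epsilon> \<beta> \<gamma> \<Longrightarrow>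
      finite (critical_moments n \<gamma>) \<and> card (critical_moments n \<gamma>) = card ?K"
    using assms unfolding good_stable_def by blast
  have K01: "0 < t" "t < 1" if "t \<in> ?K" for t
    using that pure_braid_ends(3,4)[OF \<beta>] unfolding critical_moments_generic
    by (auto simp: order_le_less)
  have wit: "\<exists>q. {fst q, fst (snd q), snd (snd q)} \<subseteq> {1..n} \<and> distinct [fst q, fst (snd q), snd (snd q)] \<and>
      between (\<beta> t (fst q), \<beta> t (snd (snd q))) (\<beta> t (fst (snd q))) \<and> only_wall n (\<beta> t) {fst q, fst (snd q), snd (snd q)}"
    if t: "t \<in> ?K" for t
  proof -
    obtain T where "only_wall n (\<beta> t) T" using unique_triple_only_wall[OF uniq[OF t]] by blast
    moreover have "\<not> generic n (\<beta> t)" using t by (simp add: critical_moments_generic)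
    ultimately obtain i j k where "{i, j, k} \<subseteq> {1..n}" "distinct [i, j, k]" "between (\<beta> t i, \<beta> t k) (\<beta> t j)"
      "only_wall n (\<beta> t) {i, j, k}" by (rule only_wall_between)
    then show ?thesis by (intro exI[of _ "(i, j, k)"]) simp
  qed
  obtain Q where Q: "\<And>t. t \<in> ?K \<Longrightarrow> {fst (Q t), fst (snd (Q t)), snd (snd (Q t))} \<subseteq> {1..n} \<and>
      distinct [fst (Q t), fst (snd (Q t)), snd (snd (Q t))] \<and>
      between (\<beta> t (fst (Q t)), \<beta> t (snd (snd (Q t)))) (\<beta> t (fst (snd (Q t)))) \<and>
      only_wall n (\<beta> t) {fst (Q t), fst (snd (Q t)), snd (snd (Q t))}"
    using wit by metis
  define I where "I t = fst (Q t)" for t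
  define J where "J t = fst (snd (Q t))" for t
  define L where "L t = snd (snd (Q t))" for t
  have IJL: "{I t, J t, L t} \<subseteq> {1..n}" "distinct [I t, J t, L t]" "between (\<beta> t (I t), \<beta> t (L t)) (\<beta> t (J t))"
    "only_wall n (\<beta> t) {I t, J t, L t}" if "t \<in> ?K" for t
    using Q[OF that] unfolding I_def J_def L_def by blast+
  have IJL': "I t \<in> {1..n}" "J t \<in> {1..n}" "L t \<in> {1..n}" "I t \<noteq> J t" "I t \<noteq> L t" "J t \<noteq> L t" if "t \<in> ?K" for t
    using IJL(1,2)[OF that] by auto
  define ori where "ori \<gamma> t s = orient (\<gamma> s (I t)) (\<gamma> s (J t)) (\<gamma> s (L t))"
    for \<gamma> :: "real \<Rightarrow> nat \<Rightarrow> complex" and t s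
  have ori_crit: "s \<in> critical_moments n \<gamma>" if "t \<in> ?K" "ori \<gamma> t s = 0" "s \<in> {0..1}" for \<gamma> t s
    using that IJL(1,2)[OF that(1)] unfolding critical_moments_generic generic_def ori_def by blast
  \<comment> \<open>critical moments are more than \<open>2\<delta>\<close> apart and more than \<open>\<delta>\<close> away from the ends\<close>
  obtain \<delta> where \<delta>: "\<delta> > 0" "\<And>t. t \<in> ?K \<Longrightarrow> \<delta> < t \<and> t + \<delta> < 1"
    "\<And>t t'. t \<in> ?K \<Longrightarrow> t' \<in> ?K \<Longrightarrow> t \<noteq> t' \<Longrightarrow> 2 * \<delta> < \<bar>t - t'\<bar>"
  proof -
    have "eventually (\<lambda>\<delta>. \<forall>t\<in>?K. \<delta> < t \<and> t + \<delta> < 1 \<and> (\<forall>t'\<in>?K. t \<noteq> t' \<longrightarrow> 2 * \<delta> < \<bar>t - t'\<bar>)) (at_right (0::real))"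
      by (rule eventually_separated[OF fin]) (use K01 in blast)
    then have "eventually (\<lambda>\<delta>. 0 < \<delta> \<and> (\<forall>t\<in>?K. \<delta> < t \<and> t + \<delta> < 1 \<and> (\<forall>t'\<in>?K. t \<noteq> t' \<longrightarrow> 2 * \<delta> < \<bar>t - t'\<bar>))) (at_right (0::real))"
      using eventually_at_right_less[of "0::real"] by eventually_elim blast
    from eventually_happens'[OF trivial_limit_at_right_real this] show ?thesis using that by blast
  qed
  have off_K: "s \<notin> ?K" if "t \<in> ?K" "s \<in> {t - \<delta><..<t} \<union> {t<..<t + \<delta>}" for t s
    using \<delta>(3)[OF that(1), of s] that(2) \<delta>(1) by (force simp: abs_if)
  have in01: "s \<in> {0..1}" if "t \<in> ?K" "s \<in> {t - \<delta>..t + \<delta>}" for t s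
    using \<delta>(2)[OF that(1)] that(2) by auto
  have "crosses n \<beta> t0 (I t0) (J t0) (L t0)" if t0: "t0 \<in> ?K" for t0
  proof (rule ccontr)
    assume "\<not> crosses n \<beta> t0 (I t0) (J t0) (L t0)"
    then have "\<not> (\<forall>s\<in>{t0 - \<delta><..<t0} \<inter> {0..1}. \<forall>s'\<in>{t0<..<t0 + \<delta>} \<inter> {0..1}. ori \<beta> t0 s * ori \<beta> t0 s' < 0)"
      unfolding crosses_def ori_def using IJL[OF t0] \<delta>(1) by blast
    then obtain s s' where s: "s \<in> {t0 - \<delta><..<t0}" "s' \<in> {t0<..<t0 + \<delta>}" "\<not> ori \<beta> t0 s * ori \<beta> t0 s' < 0"
      by blast
    have s_in: "s \<in> {t0 - \<delta>..t0 + \<delta>}" "s' \<in> {t0 - \<delta>..t0 + \<delta>}" using s(1,2) \<delta>(1) by auto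
    have nz: "ori \<beta> t0 s \<noteq> 0" "ori \<beta> t0 s' \<noteq> 0"
      using off_K[OF t0, of s] off_K[OF t0, of s'] s(1,2) ori_crit[OF t0] in01[OF t0] s_in by blast+
    \<comment> \<open>a moment just before each critical moment; at \<open>t0\<close> the one that witnesses the missing sign change\<close>
    define a where "a t = (if t = t0 then s else t - \<delta> / 2)" for t
    have a: "a t \<in> {t - \<delta><..<t}" for t using s(1) \<delta>(1) by (simp add: a_def)
    have a_in: "a t \<in> {t - \<delta>..t + \<delta>}" for t using a[of t] \<delta>(1) by auto
    have oa: "ori \<beta> t (a t) \<noteq> 0" if "t \<in> ?K" for t
      using off_K[OF that, of "a t"] a[of t] ori_crit[OF that] in01[OF that a_in] by blast
    define \<sigma> where "\<sigma> t = sgn (ori \<beta> t (a t))" for t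
    have \<sigma>: "\<sigma> t * ori \<beta> t (a t) > 0" if "t \<in> ?K" for t
      using oa[OF that] by (simp add: \<sigma>_def sgn_if)
    have \<sigma>0: "\<sigma> t0 * ori \<beta> t0 s' > 0"
    proof -
      have "ori \<beta> t0 s * ori \<beta> t0 s' \<noteq> 0" using nz by simp
      then have "0 < ori \<beta> t0 s * ori \<beta> t0 s'" using s(3) by linarith
      then show ?thesis by (auto simp: \<sigma>_def a_def sgn_if zero_less_mult_iff)
    qed
    \<comment> \<open>the normal direction that pushes the middle point to the side opposite to the one where it was before \<open>t\<close>\<close>
    define \<nu> where "\<nu> t = Complex (- \<sigma> t * Im (\<beta> t (L t) - \<beta> t (I t))) (- (- \<sigma> t) * Re (\<beta> t (L t) - \<beta> t (I t)))" for t
    have "\<exists>p. polynomial_function p \<and> (\<forall>t\<in>insert 0 (insert 1 ?K). p t = (if t \<in> ?K \<and> j = J t then \<nu> t else 0))" for j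
      using polynomial_interpolation[of "insert 0 (insert 1 ?K)" "\<lambda>t. if t \<in> ?K \<and> j = J t then \<nu> t else 0"] fin
      by (metis finite_insert)
    then obtain p where p: "\<And>j. polynomial_function (p j)"
      "\<And>j t. t \<in> insert 0 (insert 1 ?K) \<Longrightarrow> p j t = (if t \<in> ?K \<and> j = J t then \<nu> t else 0)" by metis
    have "0 \<notin> ?K" "1 \<notin> ?K" using K01 by force+
    then have p01: "p j 0 = 0 \<and> p j 1 = 0" for j using p(2)[of 0 j] p(2)[of 1 j] by simp
    have lim: "((\<lambda>x. ori (perturbed n \<beta> p x) t u) \<longlongrightarrow> ori \<beta> t u) (at_right 0)" if t: "t \<in> ?K" for t u
    proof -
      have "((\<lambda>x. perturbed n \<beta> p x u j) \<longlongrightarrow> \<beta> u j + of_real 0 * p j u) (at_right 0)" if "j \<in> {1..n}" for j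
        unfolding perturbed_def restrict_def using that
        by (simp only: if_True) (intro tendsto_intros)
      then show ?thesis
        unfolding ori_def using IJL'[OF t] by (intro tendsto_orient) simp_all
    qed
    have "eventually (\<lambda>x. \<forall>t\<in>?K. 0 < \<sigma> t * ori (perturbed n \<beta> p x) t (a t)) (at_right 0)"
      using fin \<sigma> by (intro eventually_ball_finite ballI)
        (auto intro!: order_tendstoD(1)[OF tendsto_mult_left[OF lim]])
    moreover have "eventually (\<lambda>x. 0 < \<sigma> t0 * ori (perturbed n \<beta> p x) t0 s') (at_right 0)"
      by (rule order_tendstoD(1)[OF tendsto_mult_left[OF lim[OF t0]] \<sigma>0])
    moreover have "eventually (\<lambda>x. pure_braid n (perturbed n \<beta> p x) \<and> braid_close n r \<epsilon> \<beta> (perturbed n \<beta> p x)) (at_right 0)"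
      by (rule perturbed_braid[OF \<beta> p(1) p01 \<epsilon>])
    ultimately have "eventually (\<lambda>x. 0 < x \<and> (\<forall>t\<in>?K. 0 < \<sigma> t * ori (perturbed n \<beta> p x) t (a t)) \<and>
        0 < \<sigma> t0 * ori (perturbed n \<beta> p x) t0 s' \<and> pure_braid n (perturbed n \<beta> p x) \<and>
        braid_close n r \<epsilon> \<beta> (perturbed n \<beta> p x)) (at_right 0)"
      using eventually_at_right_less[of "0::real"] by eventually_elim blast
    from eventually_happens'[OF trivial_limit_at_right_real this]
    obtain x where x: "0 < x" "\<And>t. t \<in> ?K \<Longrightarrow> 0 < \<sigma> t * ori (perturbed n \<beta> p x) t (a t)"
        "0 < \<sigma> t0 * ori (perturbed n \<beta> p x) t0 s'" "pure_braid n (perturbed n \<beta> p x)"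
        "braid_close n r \<epsilon> \<beta> (perturbed n \<beta> p x)" by blast
    define \<gamma> where "\<gamma> = perturbed n \<beta> p x"
    have \<gamma>: "pure_braid n \<gamma>" using x(4) by (simp add: \<gamma>_def)
    have mid: "\<sigma> t * ori \<gamma> t t < 0" if t: "t \<in> ?K" for t
    proof -
      have "\<gamma> t (I t) = \<beta> t (I t)" "\<gamma> t (L t) = \<beta> t (L t)" "\<gamma> t (J t) = \<beta> t (J t) + of_real x * \<nu> t"
        using IJL'[OF t] t p(2)[of t] by (simp_all add: \<gamma>_def perturbed_def)
      then have "ori \<gamma> t t = orient (\<beta> t (I t)) (\<beta> t (J t) + of_real x * \<nu> t) (\<beta> t (L t))"
        by (simp add: ori_def)
      also have "\<dots> = x * (- \<sigma> t) * (cmod (\<beta> t (L t) - \<beta> t (I t)))\<^sup>2"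
        unfolding \<nu>_def by (rule orient_middle_shift[OF between_imp_orient_eq_0[OF IJL(3)[OF t]]])
      finally have e: "\<sigma> t * ori \<gamma> t t = - (x * (\<sigma> t)\<^sup>2 * (cmod (\<beta> t (L t) - \<beta> t (I t)))\<^sup>2)"
        by (simp add: power2_eq_square)
      have "t \<in> {0..1}" using t by (simp add: critical_moments_generic)
      then have "\<beta> t (L t) \<noteq> \<beta> t (I t)"
        using inj_on_eq_iff[OF pure_braid_inj[OF \<beta>]] IJL'[OF t] by metis
      moreover have "\<sigma> t \<noteq> 0" using \<sigma>[OF t] by auto
      ultimately show ?thesis unfolding e using x(1) by simp
    qed
    have cont: "continuous_on {u..u'} (\<lambda>s. \<sigma> t * ori \<gamma> t s)" if t: "t \<in> ?K" "{u..u'} \<subseteq> {0..1}" for t u u'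
    proof -
      have c: "continuous_on {u..u'} (\<lambda>s. \<gamma> s j)" if j: "j \<in> {1..n}" for j
        by (rule continuous_on_subset[OF pure_braid_continuous[OF \<gamma> j] t(2)])
      note cs = c[OF IJL'(1)[OF t(1)]] c[OF IJL'(2)[OF t(1)]] c[OF IJL'(3)[OF t(1)]]
      show ?thesis
        unfolding ori_def orient_def by (intro continuous_intros cs)
    qed
    have "\<exists>z. z \<in> {t - \<delta><..<t} \<and> z \<in> critical_moments n \<gamma>" if t: "t \<in> ?K" for t
    proof -
      have lt: "a t < t" using a[of t] by simp
      have sub: "{a t..t} \<subseteq> {0..1}" using \<delta>(2)[OF t] a[of t] by auto
      have "(\<sigma> t * ori \<gamma> t (a t)) * (\<sigma> t * ori \<gamma> t t) < 0"
        using x(2)[OF t] mid[OF t] by (simp add: \<gamma>_def mult_pos_neg)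
      from sign_change_zero[OF lt cont[OF t sub] this]
      obtain z where z: "z \<in> {a t<..<t}" "\<sigma> t * ori \<gamma> t z = 0" .
      have "\<sigma> t \<noteq> 0" using \<sigma>[OF t] by auto
      then have "ori \<gamma> t z = 0" using z(2) by simp
      moreover have "z \<in> {0..1}" using z(1) sub by auto
      ultimately have "z \<in> critical_moments n \<gamma>" by (rule ori_crit[OF t])
      moreover have "z \<in> {t - \<delta><..<t}" using z(1) a[of t] by auto
      ultimately show ?thesis by blast
    qed
    then obtain z where z: "\<And>t. t \<in> ?K \<Longrightarrow> z t \<in> {t - \<delta><..<t} \<and> z t \<in> critical_moments n \<gamma>" by metis
    obtain z' where z': "z' \<in> {t0<..<t0 + \<delta>}" "z' \<in> critical_moments n \<gamma>"
    proof -
      have lt: "t0 < s'" using s(2) by simp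
      have sub: "{t0..s'} \<subseteq> {0..1}" using \<delta>(2)[OF t0] s(2) by auto
      have "(\<sigma> t0 * ori \<gamma> t0 t0) * (\<sigma> t0 * ori \<gamma> t0 s') < 0"
        using x(3) mid[OF t0] by (simp add: \<gamma>_def mult_neg_pos)
      from sign_change_zero[OF lt cont[OF t0 sub] this]
      obtain u where u: "u \<in> {t0<..<s'}" "\<sigma> t0 * ori \<gamma> t0 u = 0" .
      have "\<sigma> t0 \<noteq> 0" using \<sigma>[OF t0] by auto
      then have "ori \<gamma> t0 u = 0" using u(2) by simp
      moreover have "u \<in> {0..1}" using u(1) sub by auto
      ultimately have "u \<in> critical_moments n \<gamma>" by (rule ori_crit[OF t0])
      moreover have "u \<in> {t0<..<t0 + \<delta>}" using u(1) s(2) by auto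
      ultimately show ?thesis using that by blast
    qed
    have "inj_on z ?K"
    proof (rule inj_onI, rule ccontr)
      fix t t' assume *: "t \<in> ?K" "t' \<in> ?K" "z t = z t'" "t \<noteq> t'"
      have "z t \<in> {t - \<delta><..<t}" "z t \<in> {t' - \<delta><..<t'}" using z *(1-3) by metis+
      then show False using \<delta>(3)[OF *(1,2,4)] \<delta>(1) unfolding greaterThanLessThan_iff by arith
    qed
    then have "card (z ` ?K) = card ?K" by (rule card_image)
    moreover have "z' \<notin> z ` ?K"
    proof
      assume "z' \<in> z ` ?K"
      then obtain t where t: "t \<in> ?K" "z' = z t" by blast
      have "z' \<in> {t - \<delta><..<t}" "z' \<in> {t0<..<t0 + \<delta>}" using t(2) z[OF t(1)] z'(1) by simp_all
      then show False using \<delta>(3)[OF t(1) t0] \<delta>(1) unfolding greaterThanLessThan_iff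
        by (cases "t = t0") arith+
    qed
    ultimately have "card (insert z' (z ` ?K)) = Suc (card ?K)" using fin by simp
    moreover have "insert z' (z ` ?K) \<subseteq> critical_moments n \<gamma>" using z z'(2) by blast
    moreover have "finite (critical_moments n \<gamma>)" "card (critical_moments n \<gamma>) = card ?K"
      using stable[OF \<gamma>] x(5) by (simp_all add: \<gamma>_def)
    ultimately show False by (metis card_mono Suc_n_not_le_n)
  qed
  then show ?thesis
    unfolding tame_def
    using pure_braid_continuous[OF \<beta>] pure_braid_inj[OF \<beta>] pure_braid_ends(3,4)[OF \<beta>] fin by blast
qed


section \<open>Transversal braids are stable\<close>

text \<open>The derivative of the orientation of three moving points.\<close>

definition dorient :: "complex \<Rightarrow> complex \<Rightarrow> complex \<Rightarrow> complex \<Rightarrow> complex \<Rightarrow> complex \<Rightarrow> real" where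
  "dorient a b c a' b' c' =
    (Re b' - Re a') * (Im c - Im a) + (Re b - Re a) * (Im c' - Im a')
    - (Im b' - Im a') * (Re c - Re a) - (Im b - Im a) * (Re c' - Re a')"

lemma has_real_derivative_orient:
  assumes "(a has_vector_derivative a') (at t within S)" "(b has_vector_derivative b') (at t within S)"
    "(c has_vector_derivative c') (at t within S)"
  shows "((\<lambda>s. orient (a s) (b s) (c s)) has_real_derivative dorient (a t) (b t) (c t) a' b' c') (at t within S)"
  unfolding orient_def dorient_def
  by (rule derivative_eq_intros has_field_derivative_Re has_field_derivative_Im assms HOL.refl
      | simp add: algebra_simps)+

lemma tendsto_dorient:
  assumes "(a \<longlongrightarrow> a0) F" "(b \<longlongrightarrow> b0) F" "(c \<longlongrightarrow> c0) F" "(a' \<longlongrightarrow> a0') F" "(b' \<longlongrightarrow> b0') F" "(c' \<longlongrightarrow> c0') F"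
  shows "((\<lambda>s. dorient (a s) (b s) (c s) (a' s) (b' s) (c' s)) \<longlongrightarrow> dorient a0 b0 c0 a0' b0' c0') F"
  unfolding dorient_def using assms by (intro tendsto_intros)

text \<open>Positions and velocities of the points, with the indices of the velocities shifted by \<open>n\<close>.\<close>

definition jet :: "nat \<Rightarrow> (real \<Rightarrow> nat \<Rightarrow> complex) \<Rightarrow> real \<Rightarrow> nat \<Rightarrow> complex" where
  "jet n \<beta> t = (\<lambda>k. if k \<le> n then \<beta> t k else deriv01 (\<lambda>u. \<beta> u (k - n)) t)"

definition jet_dorient :: "nat \<Rightarrow> nat \<Rightarrow> nat \<Rightarrow> nat \<Rightarrow> (nat \<Rightarrow> complex) \<Rightarrow> real" where
  "jet_dorient n i j k c = dorient (c i) (c j) (c k) (c (n + i)) (c (n + j)) (c (n + k))"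

lemma jet_simps:
  "i \<in> {1..n} \<Longrightarrow> jet n \<beta> t i = \<beta> t i" "i \<in> {1..n} \<Longrightarrow> jet n \<beta> t (n + i) = deriv01 (\<lambda>u. \<beta> u i) t"
  by (simp_all add: jet_def)

lemma jet_filterlim:
  assumes "pure_braid n \<beta>" "t \<in> {0..1}"
  shows "filterlim (jet n \<beta>) (near (2 * n) (jet n \<beta> t)) (inf (nhds t) (principal {0..1}))"
proof (rule filterlim_near)
  fix k assume k: "k \<in> {1..2 * n}"
  have "continuous_on {0..1} (\<lambda>t. jet n \<beta> t k)"
  proof (cases "k \<le> n")
    case True
    then show ?thesis using pure_braid_continuous[OF assms(1), of k] k by (simp add: jet_def)
  next
    case False
    then have "k - n \<in> {1..n}" using k by auto
    then have "smooth01 (\<lambda>u. \<beta> u (k - n))" using assms(1) unfolding pure_braid_def by blast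
    from smooth01_continuous[OF this, of 1] show ?thesis using False by (simp add: jet_def)
  qed
  from tendsto_nhds_within[OF this assms(2)]
  show "((\<lambda>t. jet n \<beta> t k) \<longlongrightarrow> jet n \<beta> t k) (inf (nhds t) (principal {0..1}))" .
qed

lemma jet_close:
  assumes "braid_close n 1 \<epsilon> \<beta> \<gamma>" "t \<in> {0..1}"
  shows "jet n \<gamma> t \<in> polydisc (2 * n) (jet n \<beta> t) \<epsilon>"
  unfolding polydisc_def
proof (intro CollectI ballI)
  fix k assume k: "k \<in> {1..2 * n}"
  show "dist (jet n \<gamma> t k) (jet n \<beta> t k) < \<epsilon>"
  proof (cases "k \<le> n")
    case True
    then have "cmod ((deriv01 ^^ 0) (\<lambda>u. \<gamma> u k) t - (deriv01 ^^ 0) (\<lambda>u. \<beta> u k) t) < \<epsilon>"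
      using assms k unfolding braid_close_def by (metis atLeastAtMost_iff zero_le)
    then show ?thesis using True by (simp add: jet_def dist_norm)
  next
    case False
    then have "k - n \<in> {1..n}" using k by auto
    then have "cmod ((deriv01 ^^ 1) (\<lambda>u. \<gamma> u (k - n)) t - (deriv01 ^^ 1) (\<lambda>u. \<beta> u (k - n)) t) < \<epsilon>"
      using assms unfolding braid_close_def by blast
    then show ?thesis using False by (simp add: jet_def dist_norm)
  qed
qed

lemma eventually_near_only_wall:
  assumes "n \<le> N" "only_wall n c0 T"
  shows "eventually (\<lambda>c. only_wall n c T) (near N c0)"
proof -
  define I where "I = {(i, j, k). {i, j, k} \<subseteq> {1..n} \<and> distinct [i, j, k] \<and> {i, j, k} \<noteq> T}"
  have "finite I"
    by (rule finite_subset[of _ "{1..n} \<times> {1..n} \<times> {1..n}"]) (auto simp: I_def)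
  have "eventually (\<lambda>c. \<forall>q\<in>I. orient (c (fst q)) (c (fst (snd q))) (c (snd (snd q))) \<noteq> 0) (near N c0)"
  proof (intro eventually_ball_finite ballI \<open>finite I\<close>)
    fix q assume "q \<in> I"
    then obtain i j k where q: "q = (i, j, k)" "{i, j, k} \<subseteq> {1..n}" "distinct [i, j, k]" "{i, j, k} \<noteq> T"
      unfolding I_def by blast
    have "i \<in> {1..N}" "j \<in> {1..N}" "k \<in> {1..N}" using q(2) assms(1) by auto
    then have "((\<lambda>c. orient (c i) (c j) (c k)) \<longlongrightarrow> orient (c0 i) (c0 j) (c0 k)) (near N c0)"
      by (intro tendsto_orient tendsto_near)
    from tendsto_imp_eventually_ne[OF this only_wallD[OF assms(2) q(2-4)]]
    show "eventually (\<lambda>c. orient (c (fst q)) (c (fst (snd q))) (c (snd (snd q))) \<noteq> 0) (near N c0)"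
      by (simp add: q(1))
  qed
  then show ?thesis
  proof (rule eventually_mono)
    fix c assume c: "\<forall>q\<in>I. orient (c (fst q)) (c (fst (snd q))) (c (snd (snd q))) \<noteq> 0"
    show "only_wall n c T"
      unfolding only_wall_def
    proof (intro allI impI)
      fix i j k assume "{i, j, k} \<subseteq> {1..n}" "distinct [i, j, k]" "{i, j, k} \<noteq> T"
      then have "(i, j, k) \<in> I" unfolding I_def by blast
      from bspec[OF c this] show "orient (c i) (c j) (c k) \<noteq> 0" by simp
    qed
  qed
qed

lemma generic_iff_only_wall: "generic n c \<longleftrightarrow> only_wall n c {}"
  unfolding generic_def only_wall_def by blast

lemma finite_uniform:
  fixes Q :: "'a \<Rightarrow> real \<Rightarrow> bool"
  assumes "finite K" "\<And>t. t \<in> K \<Longrightarrow> \<exists>e>0. Q t e" "\<And>t e e'. t \<in> K \<Longrightarrow> Q t e \<Longrightarrow> 0 < e' \<Longrightarrow> e' \<le> e \<Longrightarrow> Q t e'"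
  shows "\<exists>e>0. \<forall>t\<in>K. Q t e"
proof -
  obtain E where E: "\<And>t. t \<in> K \<Longrightarrow> E t > 0 \<and> Q t (E t)" using assms(2) by metis
  define e where "e = Min (insert 1 (E ` K))"
  have "e > 0" unfolding e_def using assms(1) E by (subst Min_gr_iff) auto
  moreover have "e \<le> E t" if "t \<in> K" for t unfolding e_def using assms(1) that by (intro Min_le) auto
  ultimately show ?thesis using E assms(3) by (intro exI[of _ e]) metis
qed

lemma polydisc_mono: "e' \<le> e \<Longrightarrow> polydisc n c e' \<subseteq> polydisc n c e"
  unfolding polydisc_def by fastforce

lemma orient_increasing:
  assumes \<gamma>: "pure_braid n \<gamma>" and ijk: "i \<in> {1..n}" "j \<in> {1..n}" "k \<in> {1..n}"
    and uv: "0 < u" "u < v" "v < 1"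
    and pos: "\<And>s. s \<in> {u..v} \<Longrightarrow> 0 < \<sigma> * jet_dorient n i j k (jet n \<gamma> s)"
  shows "\<sigma> * orient (\<gamma> u i) (\<gamma> u j) (\<gamma> u k) < \<sigma> * orient (\<gamma> v i) (\<gamma> v j) (\<gamma> v k)"
proof (rule DERIV_pos_imp_increasing[OF uv(2)])
  fix s assume s: "u \<le> s" "s \<le> v"
  have s01: "s \<in> {0..1}" "s \<in> interior {0..1}" using s uv by auto
  have d: "((\<lambda>u. \<gamma> u l) has_vector_derivative deriv01 (\<lambda>u. \<gamma> u l) s) (at s)" if "l \<in> {1..n}" for l
  proof -
    have "smooth01 (\<lambda>u. \<gamma> u l)" using \<gamma> that by (simp add: pure_braid_def)
    from smooth01_has_vector_derivative[OF this s01(1), of 0]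
    show ?thesis by (simp add: at_within_interior[OF s01(2)])
  qed
  have "((\<lambda>s. \<sigma> * orient (\<gamma> s i) (\<gamma> s j) (\<gamma> s k)) has_real_derivative \<sigma> * jet_dorient n i j k (jet n \<gamma> s)) (at s)"
    unfolding jet_dorient_def jet_simps(1)[OF ijk(1)] jet_simps(1)[OF ijk(2)] jet_simps(1)[OF ijk(3)]
      jet_simps(2)[OF ijk(1)] jet_simps(2)[OF ijk(2)] jet_simps(2)[OF ijk(3)]
    by (intro DERIV_cmult has_real_derivative_orient d ijk)
  then show "\<exists>y. ((\<lambda>s. \<sigma> * orient (\<gamma> s i) (\<gamma> s j) (\<gamma> s k)) has_real_derivative y) (at s) \<and> 0 < y"
    using pos[of s] s by auto
qed

text \<open>If the orientations of the collinear triples vanish only to first order and one at a time, then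
  near each critical moment the orientation remains monotone under perturbations that are small
  together with their first derivatives, so that it still has exactly one zero.\<close>

theorem transversal_imp_good_stable:
  assumes \<beta>: "pure_braid n \<beta>" and fin: "finite (critical_moments n \<beta>)"
    and wall: "\<And>t. t \<in> {0..1} \<Longrightarrow> \<exists>T. only_wall n (\<beta> t) T"
    and simple: "\<And>t i j k. t \<in> {0..1} \<Longrightarrow> {i, j, k} \<subseteq> {1..n} \<Longrightarrow> distinct [i, j, k] \<Longrightarrow>
      orient (\<beta> t i) (\<beta> t j) (\<beta> t k) = 0 \<Longrightarrow> jet_dorient n i j k (jet n \<beta> t) \<noteq> 0"
  shows "good_stable n \<beta>"
proof -
  let ?K = "critical_moments n \<beta>"
  have K01: "t \<in> {0..1}" "0 < t" "t < 1" if "t \<in> ?K" for t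
    using that pure_braid_ends(3,4)[OF \<beta>] unfolding critical_moments_generic
    by (auto simp: order_le_less)
  have wit: "\<exists>q. {fst q, fst (snd q), snd (snd q)} \<subseteq> {1..n} \<and> distinct [fst q, fst (snd q), snd (snd q)] \<and>
      orient (\<beta> t (fst q)) (\<beta> t (fst (snd q))) (\<beta> t (snd (snd q))) = 0 \<and> only_wall n (\<beta> t) {fst q, fst (snd q), snd (snd q)}"
    if t: "t \<in> ?K" for t
  proof -
    obtain T where "only_wall n (\<beta> t) T" using wall[OF K01(1)[OF t]] by blast
    moreover have "\<not> generic n (\<beta> t)" using t by (simp add: critical_moments_generic)
    ultimately obtain i j k where "{i, j, k} \<subseteq> {1..n}" "distinct [i, j, k]" "between (\<beta> t i, \<beta> t k) (\<beta> t j)"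
      "only_wall n (\<beta> t) {i, j, k}" by (rule only_wall_between)
    then show ?thesis by (intro exI[of _ "(i, j, k)"]) (simp add: between_imp_orient_eq_0)
  qed
  obtain Q where Q: "\<And>t. t \<in> ?K \<Longrightarrow> {fst (Q t), fst (snd (Q t)), snd (snd (Q t))} \<subseteq> {1..n} \<and>
      distinct [fst (Q t), fst (snd (Q t)), snd (snd (Q t))] \<and>
      orient (\<beta> t (fst (Q t))) (\<beta> t (fst (snd (Q t)))) (\<beta> t (snd (snd (Q t)))) = 0 \<and>
      only_wall n (\<beta> t) {fst (Q t), fst (snd (Q t)), snd (snd (Q t))}"
    using wit by metis
  define I where "I t = fst (Q t)" for t
  define J where "J t = fst (snd (Q t))" for t
  define L where "L t = snd (snd (Q t))" for t
  have IJL: "{I t, J t, L t} \<subseteq> {1..n}" "distinct [I t, J t, L t]" "orient (\<beta> t (I t)) (\<beta> t (J t)) (\<beta> t (L t)) = 0"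
    "only_wall n (\<beta> t) {I t, J t, L t}" if "t \<in> ?K" for t
    using Q[OF that] unfolding I_def J_def L_def by blast+
  have IJL': "I t \<in> {1..n}" "J t \<in> {1..n}" "L t \<in> {1..n}" if "t \<in> ?K" for t
    using IJL(1)[OF that] by auto
  define \<sigma> where "\<sigma> t = sgn (jet_dorient n (I t) (J t) (L t) (jet n \<beta> t))" for t
  \<comment> \<open>the open condition on jets that holds near the critical moment \<open>t\<close>\<close>
  define \<Phi> where "\<Phi> t c \<longleftrightarrow> only_wall n c {I t, J t, L t} \<and> 0 < \<sigma> t * jet_dorient n (I t) (J t) (L t) c" for t c
  have \<Phi>_open: "eventually (\<Phi> t) (near (2 * n) c0)" if t: "t \<in> ?K" "\<Phi> t c0" for t c0
  proof -
    have "eventually (\<lambda>c. only_wall n c {I t, J t, L t}) (near (2 * n) c0)"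
      using t(2) by (intro eventually_near_only_wall) (simp_all add: \<Phi>_def)
    moreover have "((\<lambda>c. \<sigma> t * jet_dorient n (I t) (J t) (L t) c) \<longlongrightarrow> \<sigma> t * jet_dorient n (I t) (J t) (L t) c0) (near (2 * n) c0)"
      unfolding jet_dorient_def using IJL'[OF t(1)]
      by (intro tendsto_mult_left tendsto_dorient tendsto_near) simp_all
    then have "eventually (\<lambda>c. 0 < \<sigma> t * jet_dorient n (I t) (J t) (L t) c) (near (2 * n) c0)"
      by (rule order_tendstoD) (use t(2) in \<open>simp add: \<Phi>_def\<close>)
    ultimately show ?thesis unfolding \<Phi>_def by (rule eventually_conj)
  qed
  have only_wall_jet: "only_wall n (jet n \<gamma> t) T \<longleftrightarrow> only_wall n (\<gamma> t) T" for \<gamma> t T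
    unfolding only_wall_def by (intro iff_allI imp_cong HOL.refl) (simp add: jet_def)
  have \<Phi>0: "\<Phi> t (jet n \<beta> t)" if t: "t \<in> ?K" for t
    using IJL(4)[OF t] simple[OF K01(1)[OF t] IJL(1-3)[OF t]]
    by (simp add: \<Phi>_def only_wall_jet \<sigma>_def sgn_if)
  have time_nbhd: "\<exists>d>0. \<forall>s. \<bar>s - t\<bar> \<le> d \<longrightarrow> s \<in> {0..1} \<longrightarrow> \<Phi> t (jet n \<beta> s)" if t: "t \<in> ?K" for t
  proof -
    have "eventually (\<lambda>s. \<Phi> t (jet n \<beta> s)) (inf (nhds t) (principal {0..1}))"
      using eventually_compose_filterlim[OF \<Phi>_open[OF t \<Phi>0[OF t]] jet_filterlim[OF \<beta> K01(1)[OF t]]] .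
    then obtain d where d: "d > 0" "\<And>s. dist s t < d \<Longrightarrow> s \<in> {0..1} \<Longrightarrow> \<Phi> t (jet n \<beta> s)"
      unfolding eventually_inf_principal eventually_nhds_metric by blast
    then show ?thesis by (intro exI[of _ "d / 2"]) (auto simp: dist_real_def)
  qed
  have "\<exists>d>0. \<forall>t\<in>?K. \<forall>s. \<bar>s - t\<bar> \<le> d \<longrightarrow> s \<in> {0..1} \<longrightarrow> \<Phi> t (jet n \<beta> s)"
    by (rule finite_uniform[OF fin time_nbhd]) auto
  then obtain d0 where d0: "d0 > 0" "\<And>t. t \<in> ?K \<Longrightarrow> \<forall>s. \<bar>s - t\<bar> \<le> d0 \<longrightarrow> s \<in> {0..1} \<longrightarrow> \<Phi> t (jet n \<beta> s)"
    by blast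
  have "eventually (\<lambda>x. x < d0) (at_right (0::real))"
    using order_tendstoD(2)[OF tendsto_ident_at d0(1)] .
  moreover have "eventually (\<lambda>\<delta>. \<forall>t\<in>?K. \<delta> < t \<and> t + \<delta> < 1 \<and> (\<forall>t'\<in>?K. t \<noteq> t' \<longrightarrow> 2 * \<delta> < \<bar>t - t'\<bar>)) (at_right (0::real))"
    by (rule eventually_separated[OF fin]) (use K01 in blast)
  ultimately have "eventually (\<lambda>\<delta>. 0 < \<delta> \<and> \<delta> < d0 \<and> (\<forall>t\<in>?K. \<delta> < t \<and> t + \<delta> < 1 \<and> (\<forall>t'\<in>?K. t \<noteq> t' \<longrightarrow> 2 * \<delta> < \<bar>t - t'\<bar>)))
      (at_right (0::real))"
    using eventually_at_right_less[of "0::real"] by eventually_elim blast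
  from eventually_happens'[OF trivial_limit_at_right_real this]
  obtain \<delta> where \<delta>: "\<delta> > 0" "\<delta> < d0" "\<And>t. t \<in> ?K \<Longrightarrow> \<delta> < t \<and> t + \<delta> < 1"
    "\<And>t t'. t \<in> ?K \<Longrightarrow> t' \<in> ?K \<Longrightarrow> t \<noteq> t' \<Longrightarrow> 2 * \<delta> < \<bar>t - t'\<bar>" by blast
  define N where "N t = {t - \<delta>..t + \<delta>}" for t
  have N01: "N t \<subseteq> {0<..<1}" if "t \<in> ?K" for t using \<delta>(3)[OF that] by (auto simp: N_def)
  have \<Phi>N: "\<Phi> t (jet n \<beta> s)" if "t \<in> ?K" "s \<in> N t" for t s
    using d0(2)[OF that(1)] \<delta>(2) N01[OF that(1)] that(2) by (force simp: N_def abs_if)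
  define ori where "ori \<gamma> t s = orient (\<gamma> s (I t)) (\<gamma> s (J t)) (\<gamma> s (L t))"
    for \<gamma> :: "real \<Rightarrow> nat \<Rightarrow> complex" and t s
  have mono: "\<sigma> t * ori \<gamma> t u < \<sigma> t * ori \<gamma> t v"
    if "t \<in> ?K" "pure_braid n \<gamma>" "\<And>s. s \<in> N t \<Longrightarrow> \<Phi> t (jet n \<gamma> s)" "u \<in> N t" "v \<in> N t" "u < v" for \<gamma> t u v
    unfolding ori_def
  proof (rule orient_increasing[OF that(2) IJL'[OF that(1)]])
    show "0 < u" "v < 1" using N01[OF that(1)] that(4,5) by auto
    fix s assume "s \<in> {u..v}"
    then have "s \<in> N t" using that(4,5) by (auto simp: N_def)
    from that(3)[OF this] show "0 < \<sigma> t * jet_dorient n (I t) (J t) (L t) (jet n \<gamma> s)" by (simp add: \<Phi>_def)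
  qed (rule that(6))
  have ends: "t - \<delta> \<in> N t" "t + \<delta> \<in> N t" "t \<in> N t" for t using \<delta>(1) by (simp_all add: N_def)
  \<comment> \<open>radii for the open conditions: near the critical moments, at the ends of the intervals around
    them, and away from them\<close>
  have near_crit: "\<exists>e>0. \<forall>s\<in>N t. \<forall>c\<in>polydisc (2 * n) (jet n \<beta> s) e. \<Phi> t c" if t: "t \<in> ?K" for t
  proof -
    have sub: "N t \<subseteq> {0..1}" using N01[OF t] by force
    have "\<exists>e>0. \<forall>s\<in>N t. \<exists>x. x = () \<and> (\<forall>c\<in>polydisc (2 * n) (jet n \<beta> s) e. \<Phi> t c)"
    proof (rule uniform_polydisc)
      show "compact (N t)" by (simp add: N_def)
      fix s assume s: "s \<in> N t"
      then have "s \<in> {0..1}" using sub by blast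
      have "inf (nhds s) (principal (N t)) \<le> inf (nhds s) (principal {0..1})"
        using sub by (intro inf_mono) simp_all
      then show "filterlim (jet n \<beta>) (near (2 * n) (jet n \<beta> s)) (inf (nhds s) (principal (N t)))"
        using jet_filterlim[OF \<beta> \<open>s \<in> {0..1}\<close>] filterlim_mono order_refl by blast
      show "\<exists>x. x = () \<and> eventually (\<Phi> t) (near (2 * n) (jet n \<beta> s))"
        using \<Phi>_open[OF t \<Phi>N[OF t s]] by simp
    qed
    then show ?thesis by blast
  qed
  have "\<exists>e>0. \<forall>t\<in>?K. \<forall>s\<in>N t. \<forall>c\<in>polydisc (2 * n) (jet n \<beta> s) e. \<Phi> t c"
  proof (rule finite_uniform[OF fin near_crit])
    fix t and e e' :: real
    assume "\<forall>s\<in>N t. \<forall>c\<in>polydisc (2 * n) (jet n \<beta> s) e. \<Phi> t c" "e' \<le> e"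
    then show "\<forall>s\<in>N t. \<forall>c\<in>polydisc (2 * n) (jet n \<beta> s) e'. \<Phi> t c" using polydisc_mono by blast
  qed
  then obtain e1 where e1: "e1 > 0" "\<And>t. t \<in> ?K \<Longrightarrow> \<forall>s\<in>N t. \<forall>c\<in>polydisc (2 * n) (jet n \<beta> s) e1. \<Phi> t c"
    by blast
  define ori' where "ori' t c = orient (c (I t)) (c (J t)) (c (L t))" for t and c :: "nat \<Rightarrow> complex"
  have ori'_jet: "ori' t (jet n \<gamma> s) = ori \<gamma> t s" if "t \<in> ?K" for t s \<gamma>
    unfolding ori'_def ori_def using IJL'[OF that] by (simp add: jet_def)
  have sign_ends: "\<sigma> t * ori \<beta> t (t - \<delta>) < 0" "0 < \<sigma> t * ori \<beta> t (t + \<delta>)" if t: "t \<in> ?K" for t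
  proof -
    have "ori \<beta> t t = 0" using IJL(3)[OF t] by (simp add: ori_def)
    then show "\<sigma> t * ori \<beta> t (t - \<delta>) < 0" "0 < \<sigma> t * ori \<beta> t (t + \<delta>)"
      using mono[OF t \<beta> \<Phi>N[OF t] ends(1,3)] mono[OF t \<beta> \<Phi>N[OF t] ends(3,2)] \<delta>(1) by auto
  qed
  have lim_ori': "((\<lambda>c. \<sigma> t * ori' t c) \<longlongrightarrow> \<sigma> t * ori' t c0) (near (2 * n) c0)" if "t \<in> ?K" for t c0
    unfolding ori'_def using IJL'[OF that] by (intro tendsto_mult_left tendsto_orient tendsto_near) simp_all
  have end_signs: "\<exists>e>0. (\<forall>c\<in>polydisc (2 * n) (jet n \<beta> (t - \<delta>)) e. \<sigma> t * ori' t c < 0) \<and>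
      (\<forall>c\<in>polydisc (2 * n) (jet n \<beta> (t + \<delta>)) e. 0 < \<sigma> t * ori' t c)" if t: "t \<in> ?K" for t
  proof -
    have "eventually (\<lambda>c. \<sigma> t * ori' t c < 0) (near (2 * n) (jet n \<beta> (t - \<delta>)))"
      by (rule order_tendstoD(2)[OF lim_ori'[OF t]]) (use sign_ends[OF t] ori'_jet[OF t] in simp)
    then obtain a where a: "a > 0" "\<forall>c\<in>polydisc (2 * n) (jet n \<beta> (t - \<delta>)) a. \<sigma> t * ori' t c < 0"
      unfolding eventually_near_polydisc by blast
    have "eventually (\<lambda>c. 0 < \<sigma> t * ori' t c) (near (2 * n) (jet n \<beta> (t + \<delta>)))"
      by (rule order_tendstoD(1)[OF lim_ori'[OF t]]) (use sign_ends[OF t] ori'_jet[OF t] in simp)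
    then obtain b where b: "b > 0" "\<forall>c\<in>polydisc (2 * n) (jet n \<beta> (t + \<delta>)) b. 0 < \<sigma> t * ori' t c"
      unfolding eventually_near_polydisc by blast
    show ?thesis
      using a b polydisc_mono[of "min a b" a] polydisc_mono[of "min a b" b]
      by (intro exI[of _ "min a b"]) (auto simp: subset_iff)
  qed
  have "\<exists>e>0. \<forall>t\<in>?K. (\<forall>c\<in>polydisc (2 * n) (jet n \<beta> (t - \<delta>)) e. \<sigma> t * ori' t c < 0) \<and>
      (\<forall>c\<in>polydisc (2 * n) (jet n \<beta> (t + \<delta>)) e. 0 < \<sigma> t * ori' t c)"
  proof (rule finite_uniform[OF fin end_signs])
    fix t and e e' :: real
    assume "(\<forall>c\<in>polydisc (2 * n) (jet n \<beta> (t - \<delta>)) e. \<sigma> t * ori' t c < 0) \<and>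
      (\<forall>c\<in>polydisc (2 * n) (jet n \<beta> (t + \<delta>)) e. 0 < \<sigma> t * ori' t c)" "e' \<le> e"
    then show "(\<forall>c\<in>polydisc (2 * n) (jet n \<beta> (t - \<delta>)) e'. \<sigma> t * ori' t c < 0) \<and>
      (\<forall>c\<in>polydisc (2 * n) (jet n \<beta> (t + \<delta>)) e'. 0 < \<sigma> t * ori' t c)" using polydisc_mono by blast
  qed
  then obtain e2 where e2: "e2 > 0" "\<And>t. t \<in> ?K \<Longrightarrow> (\<forall>c\<in>polydisc (2 * n) (jet n \<beta> (t - \<delta>)) e2. \<sigma> t * ori' t c < 0) \<and>
      (\<forall>c\<in>polydisc (2 * n) (jet n \<beta> (t + \<delta>)) e2. 0 < \<sigma> t * ori' t c)"
    by blast
  define S where "S = {0..1} - (\<Union>t\<in>?K. {t - \<delta><..<t + \<delta>})"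
  have genS: "generic n (\<beta> s)" if "s \<in> S" for s
  proof (rule ccontr)
    assume "\<not> generic n (\<beta> s)"
    then have "s \<in> ?K" using that by (simp add: S_def critical_moments_generic)
    moreover have "s \<in> {s - \<delta><..<s + \<delta>}" using \<delta>(1) by simp
    ultimately show False using that unfolding S_def by blast
  qed
  obtain e3 where e3: "e3 > 0" "\<And>s c. s \<in> S \<Longrightarrow> c \<in> polydisc (2 * n) (jet n \<beta> s) e3 \<Longrightarrow> generic n c"
  proof -
    have "\<exists>e>0. \<forall>s\<in>S. \<exists>x. x = () \<and> (\<forall>c\<in>polydisc (2 * n) (jet n \<beta> s) e. generic n c)"
    proof (rule uniform_polydisc)
      show "compact S" unfolding S_def by (intro compact_diff compact_Icc open_UN ballI open_greaterThanLessThan)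
      fix s assume s: "s \<in> S"
      then have "s \<in> {0..1}" by (simp add: S_def)
      have "inf (nhds s) (principal S) \<le> inf (nhds s) (principal {0..1})"
        by (intro inf_mono) (auto simp: S_def)
      then show "filterlim (jet n \<beta>) (near (2 * n) (jet n \<beta> s)) (inf (nhds s) (principal S))"
        using jet_filterlim[OF \<beta> \<open>s \<in> {0..1}\<close>] filterlim_mono order_refl by blast
      have "only_wall n (jet n \<beta> s) {}" using genS[OF s] by (simp add: generic_iff_only_wall only_wall_jet)
      then have "eventually (\<lambda>c. only_wall n c {}) (near (2 * n) (jet n \<beta> s))"
        by (intro eventually_near_only_wall) simp_all
      then show "\<exists>x. x = () \<and> eventually (generic n) (near (2 * n) (jet n \<beta> s))"
        by (simp add: generic_iff_only_wall[abs_def])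
    qed
    then show ?thesis using that by blast
  qed
  define \<epsilon> where "\<epsilon> = min e1 (min e2 e3)"
  have \<epsilon>: "\<epsilon> > 0" "\<epsilon> \<le> e1" "\<epsilon> \<le> e2" "\<epsilon> \<le> e3" using e1(1) e2(1) e3(1) by (auto simp: \<epsilon>_def)
  have stable: "finite (critical_moments n \<gamma>) \<and> card (critical_moments n \<gamma>) = card ?K"
    if \<gamma>: "pure_braid n \<gamma>" "braid_close n 1 \<epsilon> \<beta> \<gamma>" for \<gamma>
  proof -
    have close: "jet n \<gamma> s \<in> polydisc (2 * n) (jet n \<beta> s) e" if "s \<in> {0..1}" "\<epsilon> \<le> e" for s e
      using jet_close[OF \<gamma>(2) that(1)] polydisc_mono[OF that(2)] by blast
    have \<Phi>\<gamma>: "\<Phi> t (jet n \<gamma> s)" if "t \<in> ?K" "s \<in> N t" for t s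
    proof -
      have "s \<in> {0..1}" using N01[OF that(1)] that(2) by force
      from close[OF this \<epsilon>(2)] show ?thesis using e1(2)[OF that(1)] that(2) by blast
    qed
    have crit_iff: "s \<in> critical_moments n \<gamma> \<longleftrightarrow> ori \<gamma> t s = 0" if t: "t \<in> ?K" "s \<in> N t" for t s
    proof -
      have s: "s \<in> {0..1}" using N01[OF t(1)] t(2) by force
      have ow: "only_wall n (\<gamma> s) {I t, J t, L t}"
        using \<Phi>\<gamma>[OF t] by (simp add: \<Phi>_def only_wall_jet)
      have "generic n (\<gamma> s)" if nz: "ori \<gamma> t s \<noteq> 0"
        unfolding generic_def
      proof (intro allI impI notI)
        fix i j k assume *: "{i, j, k} \<subseteq> {1..n}" "distinct [i, j, k]" "orient (\<gamma> s i) (\<gamma> s j) (\<gamma> s k) = 0"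
        then have "{I t, J t, L t} = {i, j, k}" using only_wallD[OF ow] by blast
        then show False
          using orient_zero_triple[OF *(3) _ *(2) IJL(2)[OF t(1)]] nz by (simp add: ori_def)
      qed
      moreover have "\<not> generic n (\<gamma> s)" if "ori \<gamma> t s = 0"
        using that genericD[OF _ IJL(1,2)[OF t(1)]] unfolding ori_def by blast
      ultimately show ?thesis using s unfolding critical_moments_generic by blast
    qed
    have "\<exists>z. z \<in> {t - \<delta><..<t + \<delta>} \<and> ori \<gamma> t z = 0" if t: "t \<in> ?K" for t
    proof -
      have sub: "{t - \<delta>..t + \<delta>} \<subseteq> {0..1}" using N01[OF t] by (force simp: N_def)
      have "\<sigma> t * ori \<gamma> t (t - \<delta>) < 0" "0 < \<sigma> t * ori \<gamma> t (t + \<delta>)"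
        using e2(2)[OF t] close[OF _ \<epsilon>(3), of "t - \<delta>"] close[OF _ \<epsilon>(3), of "t + \<delta>"] sub \<delta>(1)
        by (auto simp flip: ori'_jet[OF t])
      then have s: "(\<sigma> t * ori \<gamma> t (t - \<delta>)) * (\<sigma> t * ori \<gamma> t (t + \<delta>)) < 0" by (rule mult_neg_pos)
      have "continuous_on {t - \<delta>..t + \<delta>} (\<lambda>s. \<gamma> s j)" if "j \<in> {1..n}" for j
        by (rule continuous_on_subset[OF pure_braid_continuous[OF \<gamma>(1) that] sub])
      then have "continuous_on {t - \<delta>..t + \<delta>} (\<lambda>s. \<sigma> t * ori \<gamma> t s)"
        unfolding ori_def orient_def using IJL'[OF t] by (intro continuous_intros)
      moreover have "t - \<delta> < t + \<delta>" using \<delta>(1) by simp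
      ultimately obtain z where z: "z \<in> {t - \<delta><..<t + \<delta>}" "\<sigma> t * ori \<gamma> t z = 0"
        using sign_change_zero s by blast
      have "\<sigma> t \<noteq> 0" using \<Phi>0[OF t] by (auto simp: \<Phi>_def)
      then show ?thesis using z by auto
    qed
    then obtain z where z: "\<And>t. t \<in> ?K \<Longrightarrow> z t \<in> {t - \<delta><..<t + \<delta>} \<and> ori \<gamma> t (z t) = 0" by metis
    have zN: "z t \<in> N t" if "t \<in> ?K" for t using z[OF that] by (auto simp: N_def)
    have "critical_moments n \<gamma> = z ` ?K"
    proof
      show "z ` ?K \<subseteq> critical_moments n \<gamma>" using crit_iff zN z by blast
      show "critical_moments n \<gamma> \<subseteq> z ` ?K"
      proof
        fix s assume s: "s \<in> critical_moments n \<gamma>"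
        then have s01: "s \<in> {0..1}" "\<not> generic n (\<gamma> s)" by (simp_all add: critical_moments_generic)
        have "s \<notin> S"
        proof
          assume "s \<in> S"
          then have "generic n (jet n \<gamma> s)" using e3(2) close[OF s01(1) \<epsilon>(4)] by blast
          then show False using s01(2) by (simp add: generic_iff_only_wall only_wall_jet)
        qed
        then obtain t where t: "t \<in> ?K" "s \<in> {t - \<delta><..<t + \<delta>}" using s01(1) unfolding S_def by blast
        then have sN: "s \<in> N t" by (auto simp: N_def)
        have "ori \<gamma> t s = 0" using crit_iff[OF t(1) sN] s by blast
        moreover have "ori \<gamma> t (z t) = 0" using z[OF t(1)] by blast
        ultimately have "s = z t"
          using mono[OF t(1) \<gamma>(1) \<Phi>\<gamma>[OF t(1)] sN zN[OF t(1)]] mono[OF t(1) \<gamma>(1) \<Phi>\<gamma>[OF t(1)] zN[OF t(1)] sN]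
          by (metis linorder_neqE_linordered_idom mult_zero_right order_less_irrefl)
        then show "s \<in> z ` ?K" using t(1) by blast
      qed
    qed
    moreover have "inj_on z ?K"
    proof (rule inj_onI, rule ccontr)
      fix t t' assume *: "t \<in> ?K" "t' \<in> ?K" "z t = z t'" "t \<noteq> t'"
      show False using \<delta>(4)[OF *(1,2,4)] z[OF *(1)] z[OF *(2)] *(3) by (auto simp: abs_if split: if_splits)
    qed
    ultimately show ?thesis using fin by (simp add: card_image)
  qed
  have "\<exists>!T. T \<subseteq> {1..n} \<and> card T = 3 \<and> collinear (\<beta> t ` T)" if t: "t \<in> ?K" for t
  proof (rule ex1I[of _ "{I t, J t, L t}"])
    show "{I t, J t, L t} \<subseteq> {1..n} \<and> card {I t, J t, L t} = 3 \<and> collinear (\<beta> t ` {I t, J t, L t})"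
      using IJL[OF t] by (simp add: orient_eq_0_iff_collinear)
    fix T assume T: "T \<subseteq> {1..n} \<and> card T = 3 \<and> collinear (\<beta> t ` T)"
    then obtain i j k where ijk: "T = {i, j, k}" "i \<noteq> j" "j \<noteq> k" "i \<noteq> k"
      using card_3_iff by metis
    show "T = {I t, J t, L t}"
    proof (rule ccontr)
      assume "T \<noteq> {I t, J t, L t}"
      then have "orient (\<beta> t i) (\<beta> t j) (\<beta> t k) \<noteq> 0"
        using T ijk by (intro only_wallD[OF IJL(4)[OF t]]) auto
      then show False using T ijk(1) by (simp add: orient_eq_0_iff_collinear)
    qed
  qed
  moreover have "\<exists>r. \<exists>\<epsilon>>0. \<forall>\<gamma>. pure_braid n \<gamma> \<and> braid_close n r \<epsilon> \<beta> \<gamma> \<longrightarrow>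
      finite (critical_moments n \<gamma>) \<and> card (critical_moments n \<gamma>) = card ?K"
    using stable \<epsilon>(1) by (intro exI[of _ 1] exI[of _ \<epsilon>] conjI allI impI) simp_all
  ultimately show ?thesis
    unfolding good_stable_def using \<beta> fin by (intro conjI ballI)
qed


section \<open>Every pure braid is isotopic to a good and stable one\<close>

lemma real_polynomial_function_Re_Im:
  assumes "polynomial_function f"
  shows "real_polynomial_function (\<lambda>t. Re (f t))" "real_polynomial_function (\<lambda>t. Im (f t))"
  using assms bounded_linear_Re bounded_linear_Im unfolding polynomial_function_def o_def by blast+

lemma real_polynomial_function_finite_zeros:
  fixes f :: "real \<Rightarrow> real"
  assumes "real_polynomial_function f" "f a \<noteq> 0"
  shows "finite {t. f t = 0}"
proof -
  obtain c n where f: "f = (\<lambda>x. \<Sum>i\<le>n. c i * x ^ i)"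
    using real_polynomial_function_imp_sum[OF assms(1)] by blast
  have "\<exists>i\<le>n. c i \<noteq> 0"
  proof (rule ccontr)
    assume "\<not> ?thesis"
    then have "f a = 0" unfolding f by simp
    then show False using assms(2) by simp
  qed
  then show ?thesis unfolding f by (simp add: polyfun_finite_roots)
qed

lemma real_polynomial_function_orient:
  assumes "polynomial_function a" "polynomial_function b" "polynomial_function c"
  shows "real_polynomial_function (\<lambda>t. orient (a t) (b t) (c t))"
  unfolding orient_def
  by (intro real_polynomial_function_diff real_polynomial_function.intros(4) real_polynomial_function_Re_Im assms)

lemma dorient_swap:
  "dorient b a c b' a' c' = - dorient a b c a' b' c'" "dorient a c b a' c' b' = - dorient a b c a' b' c'"
  "dorient c b a c' b' a' = - dorient a b c a' b' c'" "dorient b c a b' c' a' = dorient a b c a' b' c'"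
  "dorient c a b c' a' b' = dorient a b c a' b' c'"
  by (simp_all add: dorient_def algebra_simps)

lemma dorient_zero_triple:
  assumes "dorient (f i) (f j) (f k) (g i) (g j) (g k) = 0" "{i', j', k'} = {i, j, k}" "distinct [i, j, k]" "distinct [i', j', k']"
  shows "dorient (f i') (f j') (f k') (g i') (g j') (g k') = 0"
proof -
  have "i' = i \<or> i' = j \<or> i' = k" "j' = i \<or> j' = j \<or> j' = k" "k' = i \<or> k' = j \<or> k' = k"
    using assms(2) by blast+
  moreover note assms(1,4) dorient_swap[where a = "f i" and b = "f j" and c = "f k" and a' = "g i" and b' = "g j" and c' = "g k"]
  ultimately show ?thesis by (elim disjE) simp_all
qed

text \<open>Polynomial strands \<open>p j\<close> with fixed ends, and the family of strands obtained by adding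
  multiples of the bump \<open>t (1 - t)\<close>.\<close>

locale polynomial_strands =
  fixes n :: nat and p p' :: "nat \<Rightarrow> real \<Rightarrow> complex"
  assumes poly: "j \<in> {1..n} \<Longrightarrow> polynomial_function (p j)"
    and poly': "j \<in> {1..n} \<Longrightarrow> polynomial_function (p' j)"
    and deriv: "j \<in> {1..n} \<Longrightarrow> (p j has_vector_derivative p' j t) (at t)"
    and ends: "generic n (\<lambda>j. p j 0)" "generic n (\<lambda>j. p j 1)"
    and inj_ends: "inj_on (\<lambda>j. p j 0) {1..n}"
begin

definition strand :: "complex \<Rightarrow> nat \<Rightarrow> real \<Rightarrow> complex" where
  "strand x j t = p j t + (t * (1 - t)) *\<^sub>R x"

definition strand' :: "complex \<Rightarrow> nat \<Rightarrow> real \<Rightarrow> complex" where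
  "strand' x j t = p' j t + (1 - 2 * t) *\<^sub>R x"

lemma poly_bump: "polynomial_function (\<lambda>t::real. t * (1 - t))" "polynomial_function (\<lambda>t::real. 1 - 2 * t)"
proof -
  have "real_polynomial_function (\<lambda>t::real. t)" "real_polynomial_function (\<lambda>t::real. c)" for c
    by (simp_all add: real_polynomial_function_eq)
  then show "polynomial_function (\<lambda>t::real. t * (1 - t))" "polynomial_function (\<lambda>t::real. 1 - 2 * t)"
    unfolding real_polynomial_function_eq[symmetric]
    by (intro real_polynomial_function.intros(4) real_polynomial_function_diff; blast)+
qed

lemma strand_poly: "j \<in> {1..n} \<Longrightarrow> polynomial_function (strand x j)"
  unfolding strand_def by (intro polynomial_function_add polynomial_function_mult poly poly_bump polynomial_function_const)

lemma strand'_poly: "j \<in> {1..n} \<Longrightarrow> polynomial_function (strand' x j)"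
  unfolding strand'_def by (intro polynomial_function_add polynomial_function_mult poly' poly_bump polynomial_function_const)

lemma strand_deriv:
  assumes "j \<in> {1..n}"
  shows "(strand x j has_vector_derivative strand' x j t) (at t)"
proof -
  have "((\<lambda>t. t * (1 - t)) has_real_derivative 1 - 2 * t) (at t)"
    by (auto intro!: derivative_eq_intros)
  then have "((\<lambda>t. (t * (1 - t)) *\<^sub>R x) has_vector_derivative (1 - 2 * t) *\<^sub>R x) (at t)"
    by (auto intro!: derivative_eq_intros)
  then show ?thesis
    unfolding strand_def strand'_def by (intro has_vector_derivative_add deriv assms)
qed

lemma strand_ends: "strand x j 0 = p j 0" "strand x j 1 = p j 1"
  by (simp_all add: strand_def)

text \<open>The cross product of the difference of two strands with its velocity, which is the squared distance
  times the angular velocity of the direction from one strand to the other.\<close>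

definition cross :: "(nat \<Rightarrow> complex) \<Rightarrow> nat \<Rightarrow> nat \<Rightarrow> real \<Rightarrow> real" where
  "cross x i j t =
    (Re (strand (x j) j t) - Re (strand (x i) i t)) * (Im (strand' (x j) j t) - Im (strand' (x i) i t)) -
    (Im (strand (x j) j t) - Im (strand (x i) i t)) * (Re (strand' (x j) j t) - Re (strand' (x i) i t))"

text \<open>The condition on the first \<open>m\<close> strands that is established one strand at a time. The first
  clause makes the direction from one strand to another vary with time.\<close>

definition general_position :: "nat \<Rightarrow> (nat \<Rightarrow> complex) \<Rightarrow> bool" where
  "general_position m x \<longleftrightarrow>
    (\<forall>i\<in>{1..m}. \<forall>j\<in>{1..m}. i \<noteq> j \<longrightarrow> cross x i j 0 \<noteq> 0) \<and>
    (\<forall>t\<in>{0..1}. (\<exists>T. only_wall m (\<lambda>k. strand (x k) k t) T) \<and>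
      (\<forall>i j k. {i, j, k} \<subseteq> {1..m} \<longrightarrow> distinct [i, j, k] \<longrightarrow>
         orient (strand (x i) i t) (strand (x j) j t) (strand (x k) k t) = 0 \<longrightarrow>
         dorient (strand (x i) i t) (strand (x j) j t) (strand (x k) k t)
           (strand' (x i) i t) (strand' (x j) j t) (strand' (x k) k t) \<noteq> 0))"

lemma cross_flip: "cross x j i t = cross x i j t"
  by (simp add: cross_def algebra_simps)

text \<open>For given earlier strands, the condition that the new strand meets a line through two of them at
  time \<open>t\<close> is a linear equation \<open>B r t \<bullet> z = A r t\<close> for the parameter \<open>z\<close>. The parameters to be avoided are the
  points of finitely many fixed lines, the intersections of two moving lines, where two collinear triples
  occur at once, and the intersections of a moving line with its derivative, where the contact is not
  transversal. All of these are negligible.\<close>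

lemma general_position_step:
  assumes m: "Suc m \<le> n" and gp: "general_position m x" and "\<eta> > 0"
    and inj: "\<And>t. t \<in> {0..1} \<Longrightarrow> inj_on (\<lambda>k. strand (x k) k t) {1..m}"
  obtains z where "cmod z < \<eta>" "general_position (Suc m) (x(Suc m := z))"
proof -
  let ?q = "Suc m"
  have q: "?q \<in> {1..n}" using m by simp
  have le: "i \<in> {1..n}" "i \<noteq> ?q" if "i \<in> {1..m}" for i using that m by auto
  define y where "y t i = strand (x i) i t" for t i
  define y' where "y' t i = strand' (x i) i t" for t i
  define Pm where "Pm = {(i, j). i \<in> {1..m} \<and> j \<in> {1..m} \<and> i \<noteq> j}"
  have finP: "finite Pm" by (rule finite_subset[of _ "{1..m} \<times> {1..m}"]) (auto simp: Pm_def)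
  define V where "V r t = \<i> * (y t (snd r) - y t (fst r))" for r t
  define V' where "V' r t = \<i> * (y' t (snd r) - y' t (fst r))" for r t
  define A where "A r t = - (V r t \<bullet> (p ?q t - y t (fst r)))" for r t
  define B where "B r t = (t * (1 - t)) *\<^sub>R V r t" for r t
  define A' where "A' r t = - (V' r t \<bullet> (p ?q t - y t (fst r)) + V r t \<bullet> (p' ?q t - y' t (fst r)))" for r t
  define B' where "B' r t = (1 - 2 * t) *\<^sub>R V r t + (t * (1 - t)) *\<^sub>R V' r t" for r t
  have o_new: "orient (y t i) (y t j) (strand z ?q t) = B (i, j) t \<bullet> z - A (i, j) t" for t i j z
    by (simp add: orient_def B_def A_def V_def strand_def inner_complex_def algebra_simps)
  have d_new: "dorient (y t i) (y t j) (strand z ?q t) (y' t i) (y' t j) (strand' z ?q t) = B' (i, j) t \<bullet> z - A' (i, j) t" for t i j z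
    by (simp add: dorient_def B'_def A'_def V_def V'_def strand_def strand'_def inner_complex_def algebra_simps)
  \<comment> \<open>the moments at which the earlier strands alone are special\<close>
  define F where "F = {t \<in> {0<..<1}. (\<exists>i j k. {i, j, k} \<subseteq> {1..m} \<and> distinct [i, j, k] \<and> orient (y t i) (y t j) (y t k) = 0) \<or>
      (\<exists>i\<in>{1..m}. \<exists>j\<in>{1..m}. i \<noteq> j \<and> cross x i j t = 0)}"
  have finF: "finite F"
  proof -
    define I where "I = {(i, j, k). {i, j, k} \<subseteq> {1..m} \<and> distinct [i, j, k]}"
    have finI: "finite I"
      by (rule finite_subset[of _ "{1..m} \<times> {1..m} \<times> {1..m}"]) (auto simp: I_def)
    have "finite {t. orient (y t i) (y t j) (y t k) = 0}" if ijk: "(i, j, k) \<in> I" for i j k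
    proof -
      have *: "i \<in> {1..n}" "j \<in> {1..n}" "k \<in> {1..n}" "distinct [i, j, k]" using ijk le by (auto simp: I_def)
      have "orient (y 0 i) (y 0 j) (y 0 k) \<noteq> 0"
        using genericD[OF ends(1), of i j k] * by (simp add: y_def strand_ends)
      moreover have "real_polynomial_function (\<lambda>t. orient (y t i) (y t j) (y t k))"
        unfolding y_def by (intro real_polynomial_function_orient strand_poly *)
      ultimately show ?thesis by (intro real_polynomial_function_finite_zeros[where a = 0])
    qed
    then have f1: "finite (\<Union>(i, j, k)\<in>I. {t. orient (y t i) (y t j) (y t k) = 0})"
      using finI by (intro finite_UN_I) auto
    have "finite {t. cross x i j t = 0}" if ij: "(i, j) \<in> Pm" for i j
    proof -
      have *: "i \<in> {1..n}" "j \<in> {1..n}" using ij le by (auto simp: Pm_def)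
      have "cross x i j 0 \<noteq> 0" using gp ij unfolding general_position_def Pm_def by blast
      moreover have "real_polynomial_function (cross x i j)"
        unfolding cross_def
        by (intro real_polynomial_function_diff real_polynomial_function.intros(4) real_polynomial_function_Re_Im strand_poly strand'_poly *)
      ultimately show ?thesis by (intro real_polynomial_function_finite_zeros[where a = 0])
    qed
    then have f2: "finite (\<Union>(i, j)\<in>Pm. {t. cross x i j t = 0})"
      using finP by (intro finite_UN_I) auto
    have "F \<subseteq> (\<Union>(i, j, k)\<in>I. {t. orient (y t i) (y t j) (y t k) = 0}) \<union> (\<Union>(i, j)\<in>Pm. {t. cross x i j t = 0})"
      unfolding F_def I_def Pm_def by blast
    then show ?thesis using f1 f2 finite_subset by blast
  qed
  have F01: "0 < t" "t < 1" if "t \<in> F" for t using that by (auto simp: F_def)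
  \<comment> \<open>\<open>N1\<close>: the direction to an old strand is stationary at the start; \<open>N2\<close>: the new strand meets a line at a special
    moment of the old ones; \<open>N3\<close>: it meets two lines at once; \<open>N4\<close>: it touches a line.\<close>
  define N1 where "N1 i = {z. (\<i> * (p ?q 0 - p i 0)) \<bullet> z = - ((\<i> * (p ?q 0 - p i 0)) \<bullet> (p' ?q 0 - y' 0 i))}" for i
  define N2 where "N2 r t = {z. B r t \<bullet> z = A r t}" for r t
  define N3 where "N3 r s = {z. \<exists>t\<in>UNIV. Re (B r t) * Im (B s t) - Im (B r t) * Re (B s t) \<noteq> 0 \<and>
      B r t \<bullet> z = A r t \<and> B s t \<bullet> z = A s t}" for r s
  define N4 where "N4 r = {z. \<exists>t\<in>UNIV. Re (B r t) * Im (B' r t) - Im (B r t) * Re (B' r t) \<noteq> 0 \<and>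
      B r t \<bullet> z = A r t \<and> B' r t \<bullet> z = A' r t}" for r
  have n1: "negligible (N1 i)" if i: "i \<in> {1..m}" for i
  proof -
    have "p ?q 0 \<noteq> p i 0" using inj_on_eq_iff[OF inj_ends q le(1)[OF i]] le(2)[OF i] by simp
    then show ?thesis unfolding N1_def by (intro negligible_line) simp
  qed
  have n2: "negligible (N2 r t)" if r: "r \<in> Pm" and t: "t \<in> F" for r t
  proof -
    have "fst r \<in> {1..m}" "snd r \<in> {1..m}" "fst r \<noteq> snd r" using r by (auto simp: Pm_def)
    moreover have "t \<in> {0..1}" using F01[OF t] by simp
    ultimately have "y t (snd r) \<noteq> y t (fst r)" using inj_on_eq_iff[OF inj] unfolding y_def by metis
    then have "B r t \<noteq> 0" using F01[OF t] by (simp add: B_def V_def)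
    then show ?thesis unfolding N2_def by (rule negligible_line)
  qed
  have dy: "(\<lambda>t. y t i) differentiable at t" "(\<lambda>t. y' t i) differentiable at t" if "i \<in> {1..m}" for i t
    unfolding y_def y'_def
    by (intro differentiable_at_polynomial_function strand_poly strand'_poly le(1)[OF that])+
  have dp: "p ?q differentiable at t" "p' ?q differentiable at t" for t
    by (intro differentiable_at_polynomial_function poly poly' q)+
  have db: "(\<lambda>t::real. t * (1 - t)) differentiable at t" "(\<lambda>t::real. 1 - 2 * t) differentiable at t" for t
    by (intro differentiable_at_polynomial_function poly_bump)+
  have diff: "A r differentiable_on UNIV" "B r differentiable_on UNIV" "A' r differentiable_on UNIV" "B' r differentiable_on UNIV"
    if r: "r \<in> Pm" for r
  proof -
    have rm: "fst r \<in> {1..m}" "snd r \<in> {1..m}" using r by (auto simp: Pm_def)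
    have dV: "V r differentiable at t" "V' r differentiable at t" for t
      unfolding V_def V'_def
      by (intro differentiable_mult differentiable_const differentiable_diff dy rm)+
    have "A r differentiable at t" "B r differentiable at t" "A' r differentiable at t" "B' r differentiable at t" for t
      unfolding A_def B_def A'_def B'_def
      by (intro differentiable_minus differentiable_inner differentiable_diff differentiable_add
          differentiable_scaleR dV dy dp db rm)+
    then show "A r differentiable_on UNIV" "B r differentiable_on UNIV" "A' r differentiable_on UNIV" "B' r differentiable_on UNIV"
      by (simp_all add: differentiable_on_def)
  qed
  have n3: "negligible (N3 r s)" if "r \<in> Pm" "s \<in> Pm" for r s
    unfolding N3_def by (rule negligible_moving_lines) (rule diff that)+
  have n4: "negligible (N4 r)" if "r \<in> Pm" for r
    unfolding N4_def by (rule negligible_moving_lines) (rule diff that)+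
  have "negligible ((\<Union>i\<in>{1..m}. N1 i) \<union> (\<Union>r\<in>Pm. \<Union>t\<in>F. N2 r t) \<union> (\<Union>r\<in>Pm. \<Union>s\<in>Pm. N3 r s) \<union> (\<Union>r\<in>Pm. N4 r))"
    by (intro negligible_Un negligible_UN_finite n1 n2 n3 n4 finP finF finite_atLeastAtMost)
  then obtain z where z: "dist z 0 < \<eta>"
    "z \<notin> (\<Union>i\<in>{1..m}. N1 i) \<union> (\<Union>r\<in>Pm. \<Union>t\<in>F. N2 r t) \<union> (\<Union>r\<in>Pm. \<Union>s\<in>Pm. N3 r s) \<union> (\<Union>r\<in>Pm. N4 r)"
    using exists_near_not_negligible[OF _ \<open>\<eta> > 0\<close>] by metis
  have z1: "z \<notin> N1 i" if "i \<in> {1..m}" for i using z(2) that by blast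
  have z2: "z \<notin> N2 r t" if "r \<in> Pm" "t \<in> F" for r t using z(2) that by blast
  have z3: "z \<notin> N3 r s" if "r \<in> Pm" "s \<in> Pm" for r s using z(2) that by blast
  have z4: "z \<notin> N4 r" if "r \<in> Pm" for r using z(2) that by blast
  let ?x = "x(?q := z)"
  have old: "?x i = x i" if "i \<in> {1..m}" for i using that by simp
  define Y where "Y t i = strand (?x i) i t" for t i
  define Y' where "Y' t i = strand' (?x i) i t" for t i
  have Y_old: "Y t i = y t i" "Y' t i = y' t i" if "i \<in> {1..m}" for t i
    unfolding Y_def Y'_def y_def y'_def old[OF that] by simp_all
  have Y_new: "Y t ?q = strand z ?q t" "Y' t ?q = strand' z ?q t" for t by (simp_all add: Y_def Y'_def)
  have PmD: "fst r \<in> {1..m}" "snd r \<in> {1..m}" "fst r \<noteq> snd r" if "r \<in> Pm" for r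
    using that by (auto simp: Pm_def)
  have o_Y: "orient (Y t (fst r)) (Y t (snd r)) (Y t ?q) = B r t \<bullet> z - A r t" if "r \<in> Pm" for r t
    using o_new[of t "fst r" "snd r" z] Y_old(1)[OF PmD(1)[OF that]] Y_old(1)[OF PmD(2)[OF that]] Y_new(1) by simp
  have d_Y: "dorient (Y t (fst r)) (Y t (snd r)) (Y t ?q) (Y' t (fst r)) (Y' t (snd r)) (Y' t ?q) = B' r t \<bullet> z - A' r t"
    if "r \<in> Pm" for r t
    using d_new[of t "fst r" "snd r" z] Y_old[OF PmD(1)[OF that]] Y_old[OF PmD(2)[OF that]] Y_new by simp
  have new_time: "t \<in> {0<..<1} \<and> t \<notin> F" if r: "r \<in> Pm" and t: "t \<in> {0..1}" "orient (Y t (fst r)) (Y t (snd r)) (Y t ?q) = 0" for r t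
  proof -
    have trip: "{fst r, snd r, ?q} \<subseteq> {1..n}" "distinct [fst r, snd r, ?q]"
      using le[OF PmD(1)[OF r]] le[OF PmD(2)[OF r]] q PmD(3)[OF r] by simp_all
    have "t \<noteq> 0" "t \<noteq> 1"
      using t(2) genericD[OF ends(1) trip] genericD[OF ends(2) trip] by (auto simp: Y_def strand_ends)
    moreover have "t \<notin> F" using z2[OF r] o_Y[OF r] t(2) by (auto simp: N2_def)
    ultimately show ?thesis using t(1) by auto
  qed
  \<comment> \<open>A collinear triple of the new configuration is an old one or contains the new point.\<close>
  have tri: "{i, j, k} \<subseteq> {1..m} \<or> (\<exists>r\<in>Pm. {i, j, k} = {fst r, snd r, ?q} \<and> orient (Y t (fst r)) (Y t (snd r)) (Y t ?q) = 0)"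
    if ijk: "{i, j, k} \<subseteq> {1..?q}" "distinct [i, j, k]" "orient (Y t i) (Y t j) (Y t k) = 0" for i j k t
  proof -
    have mem: "l \<in> {1..m}" if "l \<in> {i, j, k}" "l \<noteq> ?q" for l
    proof -
      have "l \<in> {1..?q}" using ijk(1) that(1) by blast
      then show ?thesis using that(2) by simp
    qed
    consider "i = ?q" | "j = ?q" | "k = ?q" | "?q \<notin> {i, j, k}" by blast
    then show ?thesis
    proof cases
      case 1
      then have "(j, k) \<in> Pm" using mem[of j] mem[of k] ijk(2) by (simp add: Pm_def)
      then show ?thesis using 1 ijk(3)
        by (intro disjI2 bexI[of _ "(j, k)"]) (auto simp: orient_zero_perm)
    next
      case 2
      then have "(i, k) \<in> Pm" using mem[of i] mem[of k] ijk(2) by (simp add: Pm_def)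
      then show ?thesis using 2 ijk(3)
        by (intro disjI2 bexI[of _ "(i, k)"]) (auto simp: orient_zero_perm)
    next
      case 3
      then have "(i, j) \<in> Pm" using mem[of i] mem[of j] ijk(2) by (simp add: Pm_def)
      then show ?thesis using 3 ijk(3)
        by (intro disjI2 bexI[of _ "(i, j)"]) (auto simp: orient_zero_perm)
    next
      case 4
      then show ?thesis using mem by blast
    qed
  qed
  have old_time: "t \<in> F" if ijk: "{i, j, k} \<subseteq> {1..m}" "distinct [i, j, k]" "orient (y t i) (y t j) (y t k) = 0" and t: "t \<in> {0<..<1}" for i j k t
    unfolding F_def using that by blast
  have cond1: "cross ?x i j 0 \<noteq> 0" if ij: "i \<in> {1..?q}" "j \<in> {1..?q}" "i \<noteq> j" for i j
  proof -
    have new: "cross ?x i ?q 0 \<noteq> 0" if i: "i \<in> {1..m}" for i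
    proof
      assume c: "cross ?x i ?q 0 = 0"
      have xi: "?x i = x i" using i by simp
      have "cross ?x i ?q 0 = (\<i> * (p ?q 0 - p i 0)) \<bullet> z + (\<i> * (p ?q 0 - p i 0)) \<bullet> (p' ?q 0 - y' 0 i)"
        unfolding cross_def xi strand_ends y'_def
        by (simp add: strand'_def inner_complex_def algebra_simps)
      then have "z \<in> N1 i" using c by (simp add: N1_def)
      then show False using z1[OF i] by blast
    qed
    consider "i \<in> {1..m}" "j \<in> {1..m}" | "i \<in> {1..m}" "j = ?q" | "j \<in> {1..m}" "i = ?q"
      using ij by (auto simp: le_Suc_eq)
    then show ?thesis
    proof cases
      case 1
      then have "cross ?x i j 0 = cross x i j 0" unfolding cross_def using old by simp
      then show ?thesis using gp 1 ij(3) unfolding general_position_def by simp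
    next
      case 2 then show ?thesis using new by simp
    next
      case 3 then show ?thesis using new[of j] cross_flip by metis
    qed
  qed
  have cond2: "dorient (Y t i) (Y t j) (Y t k) (Y' t i) (Y' t j) (Y' t k) \<noteq> 0"
    if t: "t \<in> {0..1}" and ijk: "{i, j, k} \<subseteq> {1..?q}" "distinct [i, j, k]" "orient (Y t i) (Y t j) (Y t k) = 0" for t i j k
    using tri[OF ijk]
  proof (elim disjE bexE conjE)
    assume sub: "{i, j, k} \<subseteq> {1..m}"
    then have "i \<in> {1..m}" "j \<in> {1..m}" "k \<in> {1..m}" by blast+
    note Yo = Y_old[OF this(1)] Y_old[OF this(2)] Y_old[OF this(3)]
    show ?thesis
      using gp t sub ijk(2,3) unfolding general_position_def Yo y_def y'_def by blast
  next
    fix r assume r: "r \<in> Pm" "{i, j, k} = {fst r, snd r, ?q}" "orient (Y t (fst r)) (Y t (snd r)) (Y t ?q) = 0"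
    show ?thesis
    proof
      assume d: "dorient (Y t i) (Y t j) (Y t k) (Y' t i) (Y' t j) (Y' t k) = 0"
      have dist: "distinct [fst r, snd r, ?q]" using PmD[OF r(1)] by auto
      have "dorient (Y t (fst r)) (Y t (snd r)) (Y t ?q) (Y' t (fst r)) (Y' t (snd r)) (Y' t ?q) = 0"
        by (rule dorient_zero_triple[OF d r(2)[symmetric] ijk(2) dist])
      then have e: "B r t \<bullet> z = A r t" "B' r t \<bullet> z = A' r t" using d_Y[OF r(1)] o_Y[OF r(1)] r(3) by simp_all
      have nt: "t \<in> {0<..<1}" "t \<notin> F" using new_time[OF r(1) t r(3)] by simp_all
      then have "cross x (fst r) (snd r) t \<noteq> 0" using PmD[OF r(1)] unfolding F_def by blast
      moreover have "Re (B r t) * Im (B' r t) - Im (B r t) * Re (B' r t) = (t * (1 - t))\<^sup>2 * cross x (fst r) (snd r) t"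
        unfolding B_def B'_def V_def V'_def cross_def y_def y'_def by (simp add: power2_eq_square algebra_simps)
      ultimately have "Re (B r t) * Im (B' r t) - Im (B r t) * Re (B' r t) \<noteq> 0" using nt(1) by simp
      then have "z \<in> N4 r" unfolding N4_def using e by blast
      then show False using z4[OF r(1)] by blast
    qed
  qed
  have cond3: "\<exists>T. only_wall ?q (Y t) T" if t: "t \<in> {0..1}" for t
  proof (cases "generic ?q (Y t)")
    case True
    then show ?thesis by (auto simp: generic_iff_only_wall)
  next
    case False
    then obtain i j k where ijk: "{i, j, k} \<subseteq> {1..?q}" "distinct [i, j, k]" "orient (Y t i) (Y t j) (Y t k) = 0"
      unfolding generic_def by blast
    have old_orient: "orient (y t a) (y t b) (y t c) = 0" if "{a, b, c} \<subseteq> {1..m}" "orient (Y t a) (Y t b) (Y t c) = 0" for a b c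
    proof -
      have "a \<in> {1..m}" "b \<in> {1..m}" "c \<in> {1..m}" using that(1) by blast+
      then show ?thesis using that(2) Y_old(1) by simp
    qed
    have same: "{a, b, c} = {i, j, k}" if abc: "{a, b, c} \<subseteq> {1..?q}" "distinct [a, b, c]" "orient (Y t a) (Y t b) (Y t c) = 0" for a b c
    proof (cases "?q \<in> {a, b, c} \<or> ?q \<in> {i, j, k}")
      case False
      have q_notin: "?q \<notin> {1..m}" by simp
      have "{a, b, c} \<subseteq> {1..m}" using tri[OF abc] False by blast
      moreover have "{i, j, k} \<subseteq> {1..m}" using tri[OF ijk] False by blast
      moreover obtain T where T: "only_wall m (y t) T"
        using gp t unfolding general_position_def y_def by blast
      ultimately show ?thesis
        using only_wallD[OF T _ abc(2)] only_wallD[OF T _ ijk(2)] old_orient abc(3) ijk(3) by metis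
    next
      case True
      have not_old_new: False
        if o: "{a, b, c} \<subseteq> {1..m}" "distinct [a, b, c]" "orient (Y t a) (Y t b) (Y t c) = 0" and r: "r \<in> Pm" "orient (Y t (fst r)) (Y t (snd r)) (Y t ?q) = 0" for a b c r
        using new_time[OF r(1) t r(2)] old_time[OF o(1,2) old_orient[OF o(1,3)]] by blast
      have "\<not> ({a, b, c} \<subseteq> {1..m} \<and> {i, j, k} \<subseteq> {1..m})" using True by auto
      then obtain r s where r: "r \<in> Pm" "{a, b, c} = {fst r, snd r, ?q}" "orient (Y t (fst r)) (Y t (snd r)) (Y t ?q) = 0"
        and s: "s \<in> Pm" "{i, j, k} = {fst s, snd s, ?q}" "orient (Y t (fst s)) (Y t (snd s)) (Y t ?q) = 0"
        using tri[OF abc] tri[OF ijk] not_old_new[OF _ abc(2,3)] not_old_new[OF _ ijk(2,3)] by metis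
      have "{fst r, snd r} = {fst s, snd s}"
      proof (rule ccontr)
        assume neq: "{fst r, snd r} \<noteq> {fst s, snd s}"
        have nt: "t \<in> {0<..<1}" "t \<notin> F" using new_time[OF r(1) t r(3)] by simp_all
        have e: "B r t \<bullet> z = A r t" "B s t \<bullet> z = A s t" using o_Y[OF r(1)] o_Y[OF s(1)] r(3) s(3) by simp_all
        then have "Re (B r t) * Im (B s t) - Im (B r t) * Re (B s t) = 0"
          using z3[OF r(1) s(1)] unfolding N3_def by blast
        then have "(t * (1 - t))\<^sup>2 * (Re (V r t) * Im (V s t) - Im (V r t) * Re (V s t)) = 0"
          by (simp add: B_def power2_eq_square algebra_simps)
        then have par: "Re (V r t) * Im (V s t) - Im (V r t) * Re (V s t) = 0" using nt(1) by simp
        have par': "(Re (y t (snd r)) - Re (y t (fst r))) * (Im (y t b) - Im (y t a)) - (Im (y t (snd r)) - Im (y t (fst r))) * (Re (y t b) - Re (y t a)) = 0"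
          if "(a, b) = (fst s, snd s) \<or> (a, b) = (snd s, fst s)" for a b
          using par that by (auto simp: V_def algebra_simps)
        obtain a b where ab: "(a, b) = (fst s, snd s) \<or> (a, b) = (snd s, fst s)" "a \<notin> {fst r, snd r}"
        proof -
          have "\<not> {fst s, snd s} \<subseteq> {fst r, snd r}"
          proof
            assume sub: "{fst s, snd s} \<subseteq> {fst r, snd r}"
            have "card {fst s, snd s} = card {fst r, snd r}" using PmD(3)[OF r(1)] PmD(3)[OF s(1)] by simp
            then have "{fst s, snd s} = {fst r, snd r}" using sub by (intro card_subset_eq) auto
            then show False using neq by simp
          qed
          then consider "fst s \<notin> {fst r, snd r}" | "snd s \<notin> {fst r, snd r}" by blast
          then show ?thesis using that by cases blast+
        qed
        have abm: "a \<in> {1..m}" "b \<in> {1..m}" "a \<noteq> b" using ab(1) PmD[OF s(1)] by auto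
        have ne: "y t a \<noteq> y t b"
          using inj_on_eq_iff[OF inj[OF t] abm(1,2)] abm(3) by (simp add: y_def)
        have oz: "orient (y t (fst r)) (y t (snd r)) (Y t ?q) = 0" "orient (y t a) (y t b) (Y t ?q) = 0"
          using r(3) s(3) Y_old(1) PmD[OF r(1)] PmD[OF s(1)] ab(1) by (auto simp: orient_zero_perm)
        have "orient (y t (fst r)) (y t (snd r)) (y t a) = 0"
          by (rule parallel_lines_meet[OF par'[OF ab(1)] ne oz])
        moreover have "{fst r, snd r, a} \<subseteq> {1..m}" "distinct [fst r, snd r, a]"
          using PmD[OF r(1)] abm(1) ab(2) by auto
        ultimately show False using old_time[OF _ _ _ nt(1)] nt(2) by blast
      qed
      then show ?thesis unfolding r(2) s(2) by blast
    qed
    have "only_wall ?q (Y t) {i, j, k}" unfolding only_wall_def using same by blast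
    then show ?thesis ..
  qed
  have "general_position ?q ?x"
    unfolding general_position_def
  proof (intro conjI ballI impI allI)
    fix i j assume "i \<in> {1..?q}" "j \<in> {1..?q}" "i \<noteq> j"
    then show "cross ?x i j 0 \<noteq> 0" by (rule cond1)
  next
    fix t :: real assume "t \<in> {0..1}"
    then show "\<exists>T. only_wall ?q (\<lambda>k. strand (?x k) k t) T" using cond3 unfolding Y_def by blast
  next
    fix t i j k assume "t \<in> {0..1}" "{i, j, k} \<subseteq> {1..?q}" "distinct [i, j, k]"
      "orient (strand (?x i) i t) (strand (?x j) j t) (strand (?x k) k t) = 0"
    then show "dorient (strand (?x i) i t) (strand (?x j) j t) (strand (?x k) k t)
           (strand' (?x i) i t) (strand' (?x j) j t) (strand' (?x k) k t) \<noteq> 0"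
      using cond2 unfolding Y_def Y'_def by blast
  qed
  then show ?thesis using that z(1) by simp
qed

lemma general_position_exists:
  assumes "\<eta> > 0"
    and inj: "\<And>x t. (\<And>j. j \<in> {1..n} \<Longrightarrow> cmod (x j) < \<eta>) \<Longrightarrow> t \<in> {0..1} \<Longrightarrow> inj_on (\<lambda>k. strand (x k) k t) {1..n}"
  obtains x where "\<And>j. cmod (x j) < \<eta>" "general_position n x"
proof -
  have "\<exists>x. (\<forall>j. cmod (x j) < \<eta>) \<and> general_position m x" if "m \<le> n" for m
    using that
  proof (induction m)
    case 0
    show ?case using \<open>\<eta> > 0\<close>
      by (intro exI[of _ "\<lambda>_. 0"]) (auto simp: general_position_def only_wall_def)
  next
    case (Suc m)
    then obtain x where x: "\<And>j. cmod (x j) < \<eta>" "general_position m x" by auto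
    have "inj_on (\<lambda>k. strand (x k) k t) {1..m}" if "t \<in> {0..1}" for t
      by (rule inj_on_subset[OF inj[OF x(1) that]]) (use Suc.prems in auto)
    then obtain z where z: "cmod z < \<eta>" "general_position (Suc m) (x(Suc m := z))"
      using general_position_step[OF Suc.prems x(2) \<open>\<eta> > 0\<close>] by blast
    have "\<forall>j. cmod ((x(Suc m := z)) j) < \<eta>" using x(1) z(1) by simp
    then show ?case using z(2) by blast
  qed
  then show ?thesis using that by blast
qed

end

text \<open>The loop is approximated by polynomial strands, which small multiples of a bump bring into general
  position one after the other.\<close>

theorem good_stable_dense:
  assumes cont: "\<And>j. j \<in> {1..n} \<Longrightarrow> continuous_on {0..1} (\<lambda>t. \<alpha> t j)"
    and inj: "\<And>t. t \<in> {0..1} \<Longrightarrow> inj_on (\<alpha> t) {1..n}"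
    and ends: "\<alpha> 0 = base_pt n" "\<alpha> 1 = base_pt n" and "e > 0"
  obtains \<beta> where "good_stable n \<beta>" "\<And>t. t \<in> {0..1::real} \<Longrightarrow> \<beta> t \<in> polydisc n (\<alpha> t) e"
proof -
  obtain e0 where e0: "e0 > 0" "\<And>t c. t \<in> {0..1} \<Longrightarrow> c \<in> polydisc n (\<alpha> t) e0 \<Longrightarrow> inj_on c {1..n}"
    using uniformly_inj[of n \<alpha>, OF cont inj] by blast
  define e1 where "e1 = min e e0"
  have e1: "e1 > 0" "e1 \<le> e" "e1 \<le> e0" using \<open>e > 0\<close> e0(1) by (simp_all add: e1_def)
  have "\<exists>p. polynomial_function p \<and> p 0 = base_pt n j \<and> p 1 = base_pt n j \<and> (\<forall>t\<in>{0..1}. cmod (p t - \<alpha> t j) < e1 / 2)"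
    if j: "j \<in> {1..n}" for j
  proof -
    have "path (\<lambda>t. \<alpha> t j)" using cont[OF j] by (simp add: path_def)
    moreover have "e1 / 2 > 0" using e1(1) by simp
    ultimately obtain p where "polynomial_function p" "pathstart p = \<alpha> 0 j" "pathfinish p = \<alpha> 1 j"
      "\<And>t. t \<in> {0..1} \<Longrightarrow> cmod (p t - \<alpha> t j) < e1 / 2"
      using path_approx_polynomial_function[of "\<lambda>t. \<alpha> t j" "e1 / 2"] unfolding pathstart_def pathfinish_def by metis
    then show ?thesis unfolding pathstart_def pathfinish_def ends by blast
  qed
  then obtain p where p: "\<And>j. j \<in> {1..n} \<Longrightarrow> polynomial_function (p j) \<and> p j 0 = base_pt n j \<and> p j 1 = base_pt n j \<and>
      (\<forall>t\<in>{0..1}. cmod (p j t - \<alpha> t j) < e1 / 2)" by metis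
  have "\<exists>p'. polynomial_function p' \<and> (\<forall>t. (p j has_vector_derivative p' t) (at t))" if "j \<in> {1..n}" for j
    using has_vector_derivative_polynomial_function[of "p j"] p[OF that] by metis
  then obtain p' where p': "\<And>j. j \<in> {1..n} \<Longrightarrow> polynomial_function (p' j) \<and> (\<forall>t. (p j has_vector_derivative p' j t) (at t))"
    by metis
  have gen: "generic n c" if "\<And>j. j \<in> {1..n} \<Longrightarrow> c j = base_pt n j" for c
    unfolding generic_def
  proof (intro allI impI)
    fix i j k assume *: "{i, j, k} \<subseteq> {1..n}" "distinct [i, j, k]"
    then have "i \<in> {1..n}" "j \<in> {1..n}" "k \<in> {1..n}" by blast+
    then show "orient (c i) (c j) (c k) \<noteq> 0" using that genericD[OF generic_base_pt *] by simp
  qed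
  interpret polynomial_strands n p p'
  proof
    show "generic n (\<lambda>j. p j 0)" "generic n (\<lambda>j. p j 1)" using p by (intro gen; simp)+
    show "inj_on (\<lambda>j. p j 0) {1..n}"
      using inj_base_pt[of n] inj_on_cong[of "{1..n}" "\<lambda>j. p j 0" "base_pt n"] p by simp
  qed (use p p' in auto)
  have close: "cmod (strand x j t - \<alpha> t j) < e1" if "j \<in> {1..n}" "t \<in> {0..1}" "cmod x < e1 / 2" for x j t
  proof -
    have t: "0 \<le> t * (1 - t)" "t * (1 - t) \<le> 1" using that(2) mult_le_one[of t "1 - t"] by auto
    have "cmod (strand x j t - \<alpha> t j) \<le> cmod (p j t - \<alpha> t j) + cmod ((t * (1 - t)) *\<^sub>R x)"
      unfolding strand_def using norm_triangle_ineq[of "p j t - \<alpha> t j" "(t * (1 - t)) *\<^sub>R x"] by (simp add: algebra_simps)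
    moreover have "cmod ((t * (1 - t)) *\<^sub>R x) \<le> cmod x"
      unfolding norm_scaleR using t mult_right_mono[OF t(2), of "cmod x"] by simp
    moreover have "cmod (p j t - \<alpha> t j) < e1 / 2" using p[OF that(1)] that(2) by blast
    ultimately show ?thesis using that(3) by linarith
  qed
  have strand_inj: "inj_on (\<lambda>k. strand (x k) k t) {1..n}"
    if "\<And>j. j \<in> {1..n} \<Longrightarrow> cmod (x j) < e1 / 2" "t \<in> {0..1}" for x t
  proof (rule e0(2)[OF that(2)])
    have "cmod (strand (x j) j t - \<alpha> t j) < e0" if "j \<in> {1..n}" for j
      using close[OF that \<open>t \<in> {0..1}\<close>, of "x j"] \<open>\<And>j. j \<in> {1..n} \<Longrightarrow> cmod (x j) < e1 / 2\<close>[OF that] e1(3) by linarith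
    then show "(\<lambda>k. strand (x k) k t) \<in> polydisc n (\<alpha> t) e0" by (simp add: polydisc_def dist_norm)
  qed
  have "e1 / 2 > 0" using e1(1) by simp
  then obtain x where x: "\<And>j. cmod (x j) < e1 / 2" "general_position n x"
    using general_position_exists[of "e1 / 2"] strand_inj by metis
  define \<beta> where "\<beta> t = (\<lambda>j\<in>{1..n}. strand (x j) j t)" for t
  have \<beta>j: "\<beta> t j = strand (x j) j t" if "j \<in> {1..n}" for t j using that by (simp add: \<beta>_def)
  have ext: "\<beta> t \<in> extensional {1..n}" for t by (simp add: \<beta>_def)
  have base: "\<beta> t = base_pt n" if t: "t = 0 \<or> t = 1" for t
  proof (rule extensionalityI[OF ext])
    show "base_pt n \<in> extensional {1..n}" by (simp add: base_pt_def)
    show "\<beta> t j = base_pt n j" if "j \<in> {1..n}" for j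
      using t p[OF that] \<beta>j[OF that] strand_ends by auto
  qed
  have \<beta>_inj: "inj_on (\<beta> t) {1..n}" if "t \<in> {0..1}" for t
    using strand_inj[of x, OF x(1) that] inj_on_cong[of "{1..n}" "\<beta> t" "\<lambda>k. strand (x k) k t"] \<beta>j by simp
  have "smooth01 (\<lambda>t. \<beta> t j)" if j: "j \<in> {1..n}" for j
    by (rule smooth01_cong[OF smooth01_polynomial[OF strand_poly[OF j, of "x j"]]]) (simp add: \<beta>j[OF j])
  then have \<beta>: "pure_braid n \<beta>"
    unfolding pure_braid_def conf_iff pathstart_def pathfinish_def using \<beta>_inj ext base by blast
  have d: "deriv01 (\<lambda>u. \<beta> u j) t = strand' (x j) j t" if j: "j \<in> {1..n}" and t: "t \<in> {0..1}" for j t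
  proof -
    have "(\<lambda>u. \<beta> u j) = strand (x j) j" using \<beta>j[OF j] by auto
    then show ?thesis
      using deriv01_eq[OF t has_vector_derivative_at_within[OF strand_deriv[OF j]]] by simp
  qed
  have ow: "only_wall n (\<beta> t) T \<longleftrightarrow> only_wall n (\<lambda>k. strand (x k) k t) T" for t T
    unfolding only_wall_def by (intro iff_allI imp_cong HOL.refl) (simp add: \<beta>j)
  have "good_stable n \<beta>"
  proof (rule transversal_imp_good_stable[OF \<beta>])
    define I where "I = {(i, j, k). {i, j, k} \<subseteq> {1..n} \<and> distinct [i, j, k]}"
    have finI: "finite I"
      by (rule finite_subset[of _ "{1..n} \<times> {1..n} \<times> {1..n}"]) (auto simp: I_def)
    have "finite {t. orient (strand (x i) i t) (strand (x j) j t) (strand (x k) k t) = 0}" if ijk: "(i, j, k) \<in> I" for i j k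
    proof -
      have *: "i \<in> {1..n}" "j \<in> {1..n}" "k \<in> {1..n}" "{i, j, k} \<subseteq> {1..n}" "distinct [i, j, k]" using ijk by (auto simp: I_def)
      have "orient (strand (x i) i 0) (strand (x j) j 0) (strand (x k) k 0) \<noteq> 0"
        using genericD[OF polynomial_strands.ends(1)[OF polynomial_strands_axioms] *(4,5)] by (simp add: strand_ends)
      moreover have "real_polynomial_function (\<lambda>t. orient (strand (x i) i t) (strand (x j) j t) (strand (x k) k t))"
        by (intro real_polynomial_function_orient strand_poly *)
      ultimately show ?thesis by (intro real_polynomial_function_finite_zeros[where a = 0])
    qed
    then have "finite (\<Union>(i, j, k)\<in>I. {t. orient (strand (x i) i t) (strand (x j) j t) (strand (x k) k t) = 0})"
      using finI by (intro finite_UN_I) auto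
    moreover have "critical_moments n \<beta> \<subseteq> (\<Union>(i, j, k)\<in>I. {t. orient (strand (x i) i t) (strand (x j) j t) (strand (x k) k t) = 0})"
    proof
      fix t assume "t \<in> critical_moments n \<beta>"
      then obtain i j k where ijk: "{i, j, k} \<subseteq> {1..n}" "distinct [i, j, k]" "orient (\<beta> t i) (\<beta> t j) (\<beta> t k) = 0"
        unfolding critical_moments_generic generic_def by blast
      have "i \<in> {1..n}" "j \<in> {1..n}" "k \<in> {1..n}" using ijk(1) by blast+
      then have "orient (strand (x i) i t) (strand (x j) j t) (strand (x k) k t) = 0" using ijk(3) \<beta>j by simp
      moreover have "(i, j, k) \<in> I" using ijk(1,2) by (simp add: I_def)
      ultimately show "t \<in> (\<Union>(i, j, k)\<in>I. {t. orient (strand (x i) i t) (strand (x j) j t) (strand (x k) k t) = 0})" by blast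
    qed
    ultimately show "finite (critical_moments n \<beta>)" by (rule finite_subset[rotated])
  next
    show "\<exists>T. only_wall n (\<beta> t) T" if "t \<in> {0..1}" for t
      using x(2) that unfolding general_position_def ow by blast
  next
    fix t i j k
    assume t: "t \<in> {0..1::real}" and ijk: "{i, j, k} \<subseteq> {1..n}" "distinct [i, j, k]" "orient (\<beta> t i) (\<beta> t j) (\<beta> t k) = 0"
    have m: "i \<in> {1..n}" "j \<in> {1..n}" "k \<in> {1..n}" using ijk(1) by blast+
    have "orient (strand (x i) i t) (strand (x j) j t) (strand (x k) k t) = 0" using ijk(3) \<beta>j m by simp
    then have "dorient (strand (x i) i t) (strand (x j) j t) (strand (x k) k t)
           (strand' (x i) i t) (strand' (x j) j t) (strand' (x k) k t) \<noteq> 0"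
      using x(2) t ijk(1,2) unfolding general_position_def by blast
    then show "jet_dorient n i j k (jet n \<beta> t) \<noteq> 0"
      unfolding jet_dorient_def jet_simps(1)[OF m(1)] jet_simps(1)[OF m(2)] jet_simps(1)[OF m(3)]
        jet_simps(2)[OF m(1)] jet_simps(2)[OF m(2)] jet_simps(2)[OF m(3)]
      unfolding d[OF m(1) t] d[OF m(2) t] d[OF m(3) t]
      unfolding \<beta>j[OF m(1)] \<beta>j[OF m(2)] \<beta>j[OF m(3)] .
  qed
  moreover have "\<beta> t \<in> polydisc n (\<alpha> t) e" if "t \<in> {0..1}" for t
  proof -
    have "cmod (\<beta> t j - \<alpha> t j) < e" if "j \<in> {1..n}" for j
      using close[OF that \<open>t \<in> {0..1}\<close> x(1)[of j]] e1(2) unfolding \<beta>j[OF that] by linarith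
    then show ?thesis by (simp add: polydisc_def dist_norm)
  qed
  ultimately show ?thesis using that by blast
qed


section \<open>The pure braid group\<close>

definition braid_loop :: "nat \<Rightarrow> (real \<Rightarrow> nat \<Rightarrow> complex) \<Rightarrow> bool" where
  "braid_loop n \<gamma> \<longleftrightarrow> path \<gamma> \<and> path_image \<gamma> \<subseteq> conf n \<and> pathstart \<gamma> = base_pt n \<and> pathfinish \<gamma> = base_pt n"

lemma braid_loop_conf: "braid_loop n \<gamma> \<Longrightarrow> t \<in> {0..1} \<Longrightarrow> \<gamma> t \<in> conf n"
  unfolding braid_loop_def path_image_def by blast

lemma continuous_on_coordinate:
  fixes f :: "'a::topological_space \<Rightarrow> 'b \<Rightarrow> 'c::topological_space"
  assumes "continuous_on S f"
  shows "continuous_on S (\<lambda>x. f x i)"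
  by (rule continuous_on_compose2[OF continuous_on_product_coordinates assms subset_UNIV])

lemma braid_loop_continuous: "braid_loop n \<gamma> \<Longrightarrow> continuous_on {0..1} (\<lambda>t. \<gamma> t j)"
  by (rule continuous_on_coordinate) (simp add: braid_loop_def path_def)

lemma continuous_on_conf:
  assumes "\<And>j. j \<in> {1..n} \<Longrightarrow> continuous_on S (\<lambda>x. f x j)" "\<And>x. x \<in> S \<Longrightarrow> f x \<in> extensional {1..n}"
  shows "continuous_on S f"
proof (rule continuous_on_coordinatewise_then_product)
  fix j show "continuous_on S (\<lambda>x. f x j)"
  proof (cases "j \<in> {1..n}")
    case False
    have "undefined = f x j" if "x \<in> S" for x
      using extensional_arb[OF assms(2)[OF that] False] by simp
    then show ?thesis by (rule continuous_on_eq[OF continuous_on_const])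
  qed (rule assms(1))
qed

lemma pure_braid_imp_loop:
  assumes "pure_braid n \<beta>"
  shows "braid_loop n \<beta>"
proof -
  have "\<And>t. t \<in> {0..1} \<Longrightarrow> \<beta> t \<in> conf n" using assms by (simp add: pure_braid_def)
  moreover from this have "path \<beta>"
    unfolding path_def using pure_braid_continuous[OF assms]
    by (intro continuous_on_conf[of n]) (auto simp: conf_iff)
  ultimately show ?thesis
    using assms unfolding braid_loop_def path_image_def pure_braid_def by blast
qed

text \<open>A braid that is uniformly close to a loop is homotopic to it along straight lines.\<close>

lemma close_homotopic:
  assumes \<alpha>: "braid_loop n \<alpha>" and \<beta>: "braid_loop n \<beta>"
    and inj: "\<And>t c. t \<in> {0..1} \<Longrightarrow> c \<in> polydisc n (\<alpha> t) e \<Longrightarrow> inj_on c {1..n}"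
    and close: "\<And>t. t \<in> {0..1} \<Longrightarrow> \<beta> t \<in> polydisc n (\<alpha> t) e"
  shows "homotopic_paths (conf n) \<alpha> \<beta>"
proof -
  define h where "h p = (\<lambda>j\<in>{1..n}. (1 - fst p) *\<^sub>R \<alpha> (snd p) j + fst p *\<^sub>R \<beta> (snd p) j)" for p :: "real \<times> real"
  have h: "h p j = (1 - fst p) *\<^sub>R \<alpha> (snd p) j + fst p *\<^sub>R \<beta> (snd p) j" if "j \<in> {1..n}" for p j
    using that by (simp add: h_def)
  have ext: "h p \<in> extensional {1..n}" for p by (simp add: h_def)
  have "continuous_on ({0..1} \<times> {0..1}) h"
  proof (rule continuous_on_conf[of n])
    fix j assume j: "j \<in> {1..n}"
    have "continuous_on ({0..1} \<times> {0..1}) (\<lambda>p::real \<times> real. \<gamma> (snd p) j)" if "braid_loop n \<gamma>" for \<gamma>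
      by (rule continuous_on_compose2[OF braid_loop_continuous[OF that]]) (auto intro: continuous_intros)
    then show "continuous_on ({0..1} \<times> {0..1}) (\<lambda>p. h p j)"
      unfolding h[OF j] using \<alpha> \<beta> by (intro continuous_intros) auto
  qed (rule ext)
  moreover have "h p \<in> conf n" if "p \<in> {0..1} \<times> {0..1}" for p
  proof -
    have p: "0 \<le> fst p" "fst p \<le> 1" "snd p \<in> {0..1}" using that by auto
    have "h p \<in> polydisc n (\<alpha> (snd p)) e"
      unfolding polydisc_def
    proof (intro CollectI ballI)
      fix j assume j: "j \<in> {1..n}"
      have d: "dist (\<beta> (snd p) j) (\<alpha> (snd p) j) < e" using close[OF p(3)] j unfolding polydisc_def by blast
      have "dist (h p j) (\<alpha> (snd p) j) = fst p * dist (\<beta> (snd p) j) (\<alpha> (snd p) j)"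
      proof -
        have "h p j - \<alpha> (snd p) j = fst p *\<^sub>R (\<beta> (snd p) j - \<alpha> (snd p) j)"
          unfolding h[OF j] by (simp add: algebra_simps)
        then show ?thesis using p(1) by (simp add: dist_norm)
      qed
      also have "\<dots> \<le> dist (\<beta> (snd p) j) (\<alpha> (snd p) j)" using p by (simp add: mult_left_le_one_le)
      finally show "dist (h p j) (\<alpha> (snd p) j) < e" using d by linarith
    qed
    then show ?thesis using inj[OF p(3)] ext by (simp add: conf_iff)
  qed
  moreover have "h (0, t) = \<alpha> t" "h (1, t) = \<beta> t" if "t \<in> {0..1}" for t
  proof -
    have "\<alpha> t \<in> extensional {1..n}" "\<beta> t \<in> extensional {1..n}"
      using braid_loop_conf[OF \<alpha> that] braid_loop_conf[OF \<beta> that] by (simp_all add: conf_iff)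
    then show "h (0, t) = \<alpha> t" "h (1, t) = \<beta> t"
      by (auto intro!: extensionalityI[OF ext] simp: h simp del: atLeastAtMost_iff)
  qed
  moreover have "h (s, 0) = base_pt n" "h (s, 1) = base_pt n" for s
  proof -
    have e: "base_pt n \<in> extensional {1..n}" by (simp add: base_pt_def)
    have "\<alpha> 0 = base_pt n" "\<beta> 0 = base_pt n" "\<alpha> 1 = base_pt n" "\<beta> 1 = base_pt n"
      using \<alpha> \<beta> by (simp_all add: braid_loop_def pathstart_def pathfinish_def)
    then show "h (s, 0) = base_pt n" "h (s, 1) = base_pt n"
      by (auto intro!: extensionalityI[OF ext e] simp: h simp flip: scaleR_left.add simp del: atLeastAtMost_iff)
  qed
  moreover have "pathstart \<alpha> = base_pt n" "pathfinish \<alpha> = base_pt n" using \<alpha> by (simp_all add: braid_loop_def)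
  ultimately show ?thesis
    unfolding homotopic_paths by (intro exI[of _ h]) (auto simp: pathstart_def pathfinish_def)
qed

lemma loop_has_good_stable:
  assumes "braid_loop n \<alpha>"
  obtains \<beta> where "good_stable n \<beta>" "homotopic_paths (conf n) \<alpha> \<beta>"
proof -
  have inj: "inj_on (\<alpha> t) {1..n}" if "t \<in> {0..1}" for t
    using braid_loop_conf[OF assms that] by (simp add: conf_iff)
  obtain e where e: "e > 0" "\<And>t c. t \<in> {0..1} \<Longrightarrow> c \<in> polydisc n (\<alpha> t) e \<Longrightarrow> inj_on c {1..n}"
    using uniformly_inj[of n \<alpha>, OF braid_loop_continuous[OF assms] inj] by blast
  have "\<alpha> 0 = base_pt n" "\<alpha> 1 = base_pt n"
    using assms by (simp_all add: braid_loop_def pathstart_def pathfinish_def)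
  from good_stable_dense[OF braid_loop_continuous[OF assms] inj this e(1)]
  obtain \<beta> where \<beta>: "good_stable n \<beta>" "\<And>t. t \<in> {0..1} \<Longrightarrow> \<beta> t \<in> polydisc n (\<alpha> t) e" by metis
  have "braid_loop n \<beta>" using \<beta>(1) by (intro pure_braid_imp_loop) (simp add: good_stable_def)
  then have "homotopic_paths (conf n) \<alpha> \<beta>"
    by (rule close_homotopic[OF assms, where e = e]) (fact e(2), fact \<beta>(2))
  then show ?thesis by (rule that[OF \<beta>(1)])
qed

lemma braid_class_mem: "\<beta> \<in> braid_class n \<alpha> \<longleftrightarrow> pure_braid n \<beta> \<and> homotopic_paths (conf n) \<alpha> \<beta>"
  by (simp add: braid_class_def)

lemma braid_class_cong:
  assumes "homotopic_paths (conf n) \<alpha> \<beta>"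
  shows "braid_class n \<alpha> = braid_class n \<beta>"
  using assms homotopic_paths_trans homotopic_paths_sym unfolding braid_class_def by blast

text \<open>This covers concatenations that fail to be smooth at the junction, so the product of two
  classes is non-empty.\<close>

lemma braid_class_has_good_stable:
  assumes "braid_loop n \<alpha>"
  obtains \<beta> where "good_stable n \<beta>" "pure_braid n \<beta>" "\<beta> \<in> braid_class n \<alpha>" "braid_class n \<alpha> = braid_class n \<beta>"
proof -
  obtain \<beta> where \<beta>: "good_stable n \<beta>" "homotopic_paths (conf n) \<alpha> \<beta>" using loop_has_good_stable[OF assms] .
  have "pure_braid n \<beta>" using \<beta>(1) by (simp add: good_stable_def)
  then show ?thesis
    by (intro that[OF \<beta>(1) _ _ braid_class_cong[OF \<beta>(2)]]) (simp_all add: braid_class_mem \<beta>(2))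
qed

lemma PB_carrier: "carrier (PB n) = braid_class n ` {\<gamma>. braid_loop n \<gamma>}"
proof
  show "carrier (PB n) \<subseteq> braid_class n ` {\<gamma>. braid_loop n \<gamma>}"
    unfolding PB_def using pure_braid_imp_loop by auto
  show "braid_class n ` {\<gamma>. braid_loop n \<gamma>} \<subseteq> carrier (PB n)"
  proof (rule image_subsetI)
    fix \<gamma> assume "\<gamma> \<in> {\<gamma>. braid_loop n \<gamma>}"
    then obtain \<beta> where "pure_braid n \<beta>" "braid_class n \<gamma> = braid_class n \<beta>"
      using braid_class_has_good_stable[of n \<gamma>] by blast
    then show "braid_class n \<gamma> \<in> carrier (PB n)" by (simp add: PB_def)
  qed
qed

lemma braid_loop_join: "braid_loop n \<alpha> \<Longrightarrow> braid_loop n \<beta> \<Longrightarrow> braid_loop n (\<alpha> +++ \<beta>)"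
  using path_image_join_subset[of \<alpha> \<beta>] unfolding braid_loop_def by auto

lemma PB_mult:
  assumes "braid_loop n \<alpha>" "braid_loop n \<beta>"
  shows "braid_class n \<alpha> \<otimes>\<^bsub>PB n\<^esub> braid_class n \<beta> = braid_class n (\<alpha> +++ \<beta>)"
proof -
  have "(\<Union>\<alpha>'\<in>braid_class n \<alpha>. \<Union>\<beta>'\<in>braid_class n \<beta>. braid_class n (\<alpha>' +++ \<beta>'))
      = (\<Union>\<alpha>'\<in>braid_class n \<alpha>. \<Union>\<beta>'\<in>braid_class n \<beta>. braid_class n (\<alpha> +++ \<beta>))"
  proof (intro SUP_cong HOL.refl)
    fix \<alpha>' \<beta>' assume "\<alpha>' \<in> braid_class n \<alpha>" "\<beta>' \<in> braid_class n \<beta>"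
    then have "homotopic_paths (conf n) (\<alpha> +++ \<beta>) (\<alpha>' +++ \<beta>')"
      using assms by (intro homotopic_paths_join) (simp_all add: braid_class_mem braid_loop_def)
    from braid_class_cong[OF this] show "braid_class n (\<alpha>' +++ \<beta>') = braid_class n (\<alpha> +++ \<beta>)" ..
  qed
  moreover have "braid_class n \<gamma> \<noteq> {}" if "braid_loop n \<gamma>" for \<gamma>
    using that by (rule braid_class_has_good_stable) blast
  then have "braid_class n \<alpha> \<noteq> {}" "braid_class n \<beta> \<noteq> {}" using assms by simp_all
  ultimately show ?thesis by (simp add: PB_def)
qed

text \<open>The group laws for paths in a space without a linear structure follow from those for paths
  in the unit interval, of which every path is an image.\<close>

lemma homotopic_paths_interval_image:
  fixes p :: "real \<Rightarrow> 'a::topological_space"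
  assumes "homotopic_paths {0..1} a b" "path p" "path_image p \<subseteq> S"
  shows "homotopic_paths S (p \<circ> a) (p \<circ> b)"
  using assms by (intro homotopic_paths_continuous_image[where S = "{0..1}"]) (auto simp: path_def path_image_def)

lemma identity_path: "path (linepath 0 (1::real))" "path_image (linepath 0 (1::real)) \<subseteq> {0..1}"
  by (simp_all add: closed_segment_eq_real_ivl)

lemma homotopic_paths_const_left:
  fixes p :: "real \<Rightarrow> 'a::topological_space"
  assumes "path p" "path_image p \<subseteq> S"
  shows "homotopic_paths S ((\<lambda>_. pathstart p) +++ p) p"
proof -
  have "homotopic_paths {0..1} (linepath 0 0 +++ linepath 0 (1::real)) (linepath 0 1)"
    using homotopic_paths_lid[OF identity_path] by simp
  from homotopic_paths_interval_image[OF this assms]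
  have "homotopic_paths S (p \<circ> (linepath 0 0 +++ linepath 0 1)) (p \<circ> linepath 0 1)" .
  moreover have "p \<circ> (linepath 0 0 +++ linepath 0 (1::real)) = (\<lambda>_. pathstart p) +++ p"
    by (auto simp: fun_eq_iff joinpaths_def linepath_def pathstart_def)
  moreover have "p \<circ> linepath 0 1 = p" by (simp add: fun_eq_iff linepath_def)
  ultimately show ?thesis by simp
qed

lemma homotopic_paths_reverse_left:
  fixes p :: "real \<Rightarrow> 'a::topological_space"
  assumes "path p" "path_image p \<subseteq> S"
  shows "homotopic_paths S (reversepath p +++ p) (\<lambda>_. pathfinish p)"
proof -
  have "homotopic_paths {0..1} (reversepath (linepath 0 1) +++ linepath 0 (1::real)) (linepath 1 1)"
    using homotopic_paths_linv[OF identity_path] by simp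
  from homotopic_paths_interval_image[OF this assms]
  have "homotopic_paths S (p \<circ> (reversepath (linepath 0 1) +++ linepath 0 1)) (p \<circ> linepath 1 1)" .
  moreover have "p \<circ> (reversepath (linepath 0 1) +++ linepath 0 (1::real)) = reversepath p +++ p"
    by (auto simp: fun_eq_iff joinpaths_def linepath_def reversepath_def)
  moreover have "p \<circ> linepath 1 1 = (\<lambda>_. pathfinish p)" by (simp add: fun_eq_iff linepath_def pathfinish_def)
  ultimately show ?thesis by simp
qed

lemma braid_loop_const: "braid_loop n (\<lambda>_. base_pt n)"
  using base_pt_conf by (auto simp: braid_loop_def path_def path_image_def pathstart_def pathfinish_def)

lemma group_PB: "group (PB n)"
proof (rule groupI)
  have one: "\<one>\<^bsub>PB n\<^esub> = braid_class n (\<lambda>_. base_pt n)" by (simp add: PB_def)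
  show "\<one>\<^bsub>PB n\<^esub> \<in> carrier (PB n)"
    unfolding one PB_carrier using braid_loop_const by blast
  fix A assume "A \<in> carrier (PB n)"
  then obtain \<alpha> where \<alpha>: "braid_loop n \<alpha>" "A = braid_class n \<alpha>" unfolding PB_carrier by blast
  have \<alpha>': "path \<alpha>" "path_image \<alpha> \<subseteq> conf n" "pathstart \<alpha> = base_pt n" "pathfinish \<alpha> = base_pt n"
    using \<alpha>(1) by (simp_all add: braid_loop_def)
  show "\<one>\<^bsub>PB n\<^esub> \<otimes>\<^bsub>PB n\<^esub> A = A"
    unfolding one \<alpha>(2) PB_mult[OF braid_loop_const \<alpha>(1)]
    using homotopic_paths_const_left[OF \<alpha>'(1,2)] by (intro braid_class_cong) (simp add: \<alpha>'(3))
  have rev: "braid_loop n (reversepath \<alpha>)" using \<alpha>' by (simp add: braid_loop_def)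
  have "braid_class n (reversepath \<alpha>) \<otimes>\<^bsub>PB n\<^esub> A = \<one>\<^bsub>PB n\<^esub>"
    unfolding one \<alpha>(2) PB_mult[OF rev \<alpha>(1)]
    using homotopic_paths_reverse_left[OF \<alpha>'(1,2)] by (intro braid_class_cong) (simp add: \<alpha>'(4))
  then show "\<exists>B\<in>carrier (PB n). B \<otimes>\<^bsub>PB n\<^esub> A = \<one>\<^bsub>PB n\<^esub>"
    unfolding PB_carrier using rev by blast
  fix B assume "B \<in> carrier (PB n)"
  then obtain \<beta> where \<beta>: "braid_loop n \<beta>" "B = braid_class n \<beta>" unfolding PB_carrier by blast
  show "A \<otimes>\<^bsub>PB n\<^esub> B \<in> carrier (PB n)"
    unfolding \<alpha>(2) \<beta>(2) PB_mult[OF \<alpha>(1) \<beta>(1)] PB_carrier using braid_loop_join[OF \<alpha>(1) \<beta>(1)] by blast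
  fix C assume "C \<in> carrier (PB n)"
  then obtain \<gamma> where \<gamma>: "braid_loop n \<gamma>" "C = braid_class n \<gamma>" unfolding PB_carrier by blast
  have "homotopic_paths (conf n) (\<alpha> +++ (\<beta> +++ \<gamma>)) ((\<alpha> +++ \<beta>) +++ \<gamma>)"
    using \<alpha>' \<beta>(1) \<gamma>(1) by (intro homotopic_paths_assoc) (simp_all add: braid_loop_def)
  from braid_class_cong[OF this]
  show "A \<otimes>\<^bsub>PB n\<^esub> B \<otimes>\<^bsub>PB n\<^esub> C = A \<otimes>\<^bsub>PB n\<^esub> (B \<otimes>\<^bsub>PB n\<^esub> C)"
    unfolding \<alpha>(2) \<beta>(2) \<gamma>(2) PB_mult[OF \<alpha>(1) \<beta>(1)] PB_mult[OF \<beta>(1) \<gamma>(1)]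
      PB_mult[OF braid_loop_join[OF \<alpha>(1) \<beta>(1)] \<gamma>(1)] PB_mult[OF \<alpha>(1) braid_loop_join[OF \<beta>(1) \<gamma>(1)]] ..
qed


section \<open>The reading map\<close>

lemma reading_homotopic:
  assumes \<alpha>: "tame n \<alpha>" and \<beta>: "tame n \<beta>" and hom: "homotopic_paths (conf n) \<alpha> \<beta>"
  shows "braid_reading n \<alpha> = braid_reading n \<beta>"
proof -
  obtain h where h: "continuous_on ({0..1} \<times> {0..1}) h" "h \<in> ({0..1} \<times> {0..1}) \<rightarrow> conf n"
    "\<And>t. t \<in> {0..1} \<Longrightarrow> h (0, t) = \<alpha> t" "\<And>t. t \<in> {0..1} \<Longrightarrow> h (1, t) = \<beta> t"
    "\<And>s. s \<in> {0..1::real} \<Longrightarrow> pathstart (h \<circ> Pair s) = pathstart \<alpha> \<and> pathfinish (h \<circ> Pair s) = pathfinish \<alpha>"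
    using hom unfolding homotopic_paths by blast
  show ?thesis
  proof (rule reading_homotopy_invariant[OF \<alpha> \<beta>, of h])
    show "continuous_on ({0..1} \<times> {0..1}) (\<lambda>p. h p k)" for k by (rule continuous_on_coordinate[OF h(1)])
    show "inj_on (h p) {1..n}" if "p \<in> {0..1} \<times> {0..1}" for p
      using h(2) that by (auto simp: conf_iff Pi_iff)
    show "h (s, 0) = \<alpha> 0" "h (s, 1) = \<alpha> 1" if "s \<in> {0..1}" for s
      using h(5)[OF that] by (simp_all add: pathstart_def pathfinish_def)
  qed (use h(3,4) in auto)
qed

lemma critical_gen_cong: "\<beta> t = \<gamma> s \<Longrightarrow> critical_gen n \<beta> t = critical_gen n \<gamma> s"
  by (simp add: critical_gen_def)

text \<open>Crossing a wall is a local condition that is preserved under an affine change of time.\<close>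

lemma crosses_affine:
  assumes cr: "crosses n \<beta> t i j k" and a: "a > 0"
    and eq: "\<And>s. s \<in> {0..1} \<Longrightarrow> \<gamma> (a * s + b) = \<beta> s" and t: "0 < t" "t < 1"
  shows "crosses n \<gamma> (a * t + b) i j k"
proof -
  obtain \<delta> where \<delta>: "\<delta> > 0" "\<And>s s'. s \<in> {t - \<delta><..<t} \<inter> {0..1} \<Longrightarrow> s' \<in> {t<..<t + \<delta>} \<inter> {0..1} \<Longrightarrow>
      orient (\<beta> s i) (\<beta> s j) (\<beta> s k) * orient (\<beta> s' i) (\<beta> s' j) (\<beta> s' k) < 0"
    using cr unfolding crosses_def by blast
  have \<gamma>t: "\<gamma> (a * t + b) = \<beta> t" using eq t by simp
  define d where "d = a * min \<delta> (min t (1 - t))"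
  have d: "d > 0" using \<delta>(1) t a by (simp add: d_def)
  have time: "\<exists>u. s = a * u + b \<and> \<bar>u - t\<bar> < \<delta> \<and> u \<in> {0..1} \<and> (s < a * t + b \<longrightarrow> u < t) \<and> (a * t + b < s \<longrightarrow> t < u)"
    if "\<bar>s - (a * t + b)\<bar> < d" for s
  proof (intro exI conjI impI)
    let ?u = "(s - b) / a"
    show s: "s = a * ?u + b" using a by simp
    have "a * \<bar>?u - t\<bar> = \<bar>a * (?u - t)\<bar>" using a by (simp add: abs_mult)
    also have "a * (?u - t) = s - (a * t + b)" using a by (simp add: field_simps)
    finally have "a * \<bar>?u - t\<bar> < a * min \<delta> (min t (1 - t))" using that by (simp add: d_def)
    then have u: "\<bar>?u - t\<bar> < min \<delta> (min t (1 - t))" using a by simp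
    then show "\<bar>?u - t\<bar> < \<delta>" "?u \<in> {0..1}" by auto
    show "?u < t" if "s < a * t + b" using that a by (simp add: field_simps)
    show "t < ?u" if "a * t + b < s" using that a by (simp add: field_simps)
  qed
  have "orient (\<gamma> s i) (\<gamma> s j) (\<gamma> s k) * orient (\<gamma> s' i) (\<gamma> s' j) (\<gamma> s' k) < 0"
    if s: "s \<in> {a * t + b - d<..<a * t + b}" and s': "s' \<in> {a * t + b<..<a * t + b + d}" for s s'
  proof -
    have ds: "\<bar>s - (a * t + b)\<bar> < d" "s < a * t + b" "\<bar>s' - (a * t + b)\<bar> < d" "a * t + b < s'"
      using s s' by auto
    obtain u where u: "s = a * u + b" "\<bar>u - t\<bar> < \<delta>" "u \<in> {0..1}" "u < t"
      using time[OF ds(1)] ds(2) by blast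
    obtain u' where u': "s' = a * u' + b" "\<bar>u' - t\<bar> < \<delta>" "u' \<in> {0..1}" "t < u'"
      using time[OF ds(3)] ds(4) by blast
    have "u \<in> {t - \<delta><..<t} \<inter> {0..1}" "u' \<in> {t<..<t + \<delta>} \<inter> {0..1}" using u u' by auto
    from \<delta>(2)[OF this] show ?thesis unfolding u(1) u'(1) eq[OF u(3)] eq[OF u'(3)] .
  qed
  then show ?thesis
    using cr d unfolding crosses_def \<gamma>t by blast
qed

text \<open>The critical moments of the concatenation are those of the two parts, moved into the two halves of
  the interval.\<close>

lemma reading_join:
  assumes \<alpha>: "tame n \<alpha>" and \<beta>: "tame n \<beta>" and la: "braid_loop n \<alpha>" and lb: "braid_loop n \<beta>"
  shows "tame n (\<alpha> +++ \<beta>)"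
    and "braid_reading n (\<alpha> +++ \<beta>) = braid_reading n \<alpha> \<otimes>\<^bsub>G3 n\<^esub> braid_reading n \<beta>"
proof -
  let ?\<gamma> = "\<alpha> +++ \<beta>"
  let ?Ka = "critical_moments n \<alpha>" and ?Kb = "critical_moments n \<beta>"
  let ?f = "\<lambda>t. 1 / 2 * t + 0 :: real" and ?g = "\<lambda>t. 1 / 2 * t + 1 / 2 :: real"
  have ends: "\<alpha> 1 = base_pt n" "\<beta> 0 = base_pt n"
    using la lb by (simp_all add: braid_loop_def pathstart_def pathfinish_def)
  have f: "?\<gamma> (?f t) = \<alpha> t" if "t \<in> {0..1}" for t using that by (simp add: joinpaths_def)
  have g: "?\<gamma> (?g t) = \<beta> t" if "t \<in> {0..1}" for t
  proof (cases "t = 0")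
    case True
    then show ?thesis using ends by (simp add: joinpaths_def)
  next
    case False
    then show ?thesis using that by (simp add: joinpaths_def)
  qed
  have K01: "0 < t \<and> t < 1" if "t \<in> ?Ka \<or> t \<in> ?Kb" for t
  proof -
    have "t \<noteq> 0" "t \<noteq> 1" "t \<in> {0..1}"
      using that \<alpha> \<beta> unfolding critical_moments_generic tame_def by auto
    then show ?thesis by auto
  qed
  have K: "critical_moments n ?\<gamma> = ?f ` ?Ka \<union> ?g ` ?Kb"
  proof
    show "?f ` ?Ka \<union> ?g ` ?Kb \<subseteq> critical_moments n ?\<gamma>"
    proof (rule Un_least; rule image_subsetI)
      fix t assume t: "t \<in> ?Ka"
      then have "t \<in> {0..1}" "\<not> generic n (\<alpha> t)" by (simp_all add: critical_moments_generic)
      then show "?f t \<in> critical_moments n ?\<gamma>" unfolding critical_moments_generic mem_Collect_eq f[OF \<open>t \<in> {0..1}\<close>] by auto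
    next
      fix t assume t: "t \<in> ?Kb"
      then have "t \<in> {0..1}" "\<not> generic n (\<beta> t)" by (simp_all add: critical_moments_generic)
      then show "?g t \<in> critical_moments n ?\<gamma>" unfolding critical_moments_generic mem_Collect_eq g[OF \<open>t \<in> {0..1}\<close>] by auto
    qed
    show "critical_moments n ?\<gamma> \<subseteq> ?f ` ?Ka \<union> ?g ` ?Kb"
    proof
      fix s assume "s \<in> critical_moments n ?\<gamma>"
      then have s: "s \<in> {0..1}" "\<not> generic n (?\<gamma> s)" by (simp_all add: critical_moments_generic)
      show "s \<in> ?f ` ?Ka \<union> ?g ` ?Kb"
      proof (cases "s \<le> 1 / 2")
        case True
        then have "2 * s \<in> {0..1}" "s = ?f (2 * s)" using s(1) by auto
        then have "2 * s \<in> ?Ka" using f[of "2 * s"] s(2) by (simp add: critical_moments_generic)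
        then show ?thesis using \<open>s = ?f (2 * s)\<close> by blast
      next
        case False
        then have "2 * s - 1 \<in> {0..1}" "s = ?g (2 * s - 1)" using s(1) by (auto simp: field_simps)
        then have "2 * s - 1 \<in> ?Kb" using g[of "2 * s - 1"] s(2) by (simp add: critical_moments_generic)
        then show ?thesis using \<open>s = ?g (2 * s - 1)\<close> by blast
      qed
    qed
  qed
  have fin: "finite ?Ka" "finite ?Kb" using \<alpha> \<beta> by (simp_all add: tame_def)
  have loop: "braid_loop n ?\<gamma>" by (rule braid_loop_join[OF la lb])
  have "?\<gamma> 0 = \<alpha> 0" "?\<gamma> 1 = \<beta> 1" using f[of 0] g[of 1] by simp_all
  then have gen: "generic n (?\<gamma> 0)" "generic n (?\<gamma> 1)" using \<alpha> \<beta> by (simp_all add: tame_def)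
  have cross: "\<exists>i j k. crosses n ?\<gamma> s i j k" if "s \<in> critical_moments n ?\<gamma>" for s
  proof -
    from that consider t where "t \<in> ?Ka" "s = ?f t" | t where "t \<in> ?Kb" "s = ?g t" unfolding K by blast
    then show ?thesis
    proof cases
      case 1
      then obtain i j k where "crosses n \<alpha> t i j k" using \<alpha> unfolding tame_def by blast
      then have "crosses n ?\<gamma> (?f t) i j k"
        by (rule crosses_affine) (simp, rule f, assumption, insert K01[of t] 1, simp_all)
      then show ?thesis using 1(2) by blast
    next
      case 2
      then obtain i j k where "crosses n \<beta> t i j k" using \<beta> unfolding tame_def by blast
      then have "crosses n ?\<gamma> (?g t) i j k"
        by (rule crosses_affine) (simp, rule g, assumption, insert K01[of t] 2, simp_all)
      then show ?thesis using 2(2) by blast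
    qed
  qed
  show tame: "tame n ?\<gamma>"
    unfolding tame_def
  proof (intro conjI ballI)
    show "continuous_on {0..1} (\<lambda>t. ?\<gamma> t j)" for j by (rule braid_loop_continuous[OF loop])
    show "inj_on (?\<gamma> t) {1..n}" if "t \<in> {0..1}" for t
      using braid_loop_conf[OF loop that] by (simp add: conf_iff)
    show "finite (critical_moments n ?\<gamma>)" unfolding K using fin by simp
  qed (use gen cross in blast)+
  have sorted: "sorted_list_of_set (critical_moments n ?\<gamma>)
      = map ?f (sorted_list_of_set ?Ka) @ map ?g (sorted_list_of_set ?Kb)"
  proof -
    have "sorted_wrt (<) (map ?f (sorted_list_of_set ?Ka) @ map ?g (sorted_list_of_set ?Kb))"
    proof -
      have "sorted_wrt (<) (sorted_list_of_set ?Ka)" "sorted_wrt (<) (sorted_list_of_set ?Kb)"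
        by (simp_all add: strict_sorted_list_of_set)
      moreover have "?f s < ?g t" if "s \<in> ?Ka" "t \<in> ?Kb" for s t
        using K01[of s] K01[of t] that by auto
      ultimately show ?thesis using fin by (auto simp: sorted_wrt_append sorted_wrt_map)
    qed
    moreover have "set (map ?f (sorted_list_of_set ?Ka) @ map ?g (sorted_list_of_set ?Kb)) = critical_moments n ?\<gamma>"
      unfolding K using fin by simp
    ultimately show ?thesis using sorted_list_of_set.idem_if_sorted_distinct strict_sorted_iff by metis
  qed
  have "map (critical_gen n ?\<gamma>) (sorted_list_of_set (critical_moments n ?\<gamma>))
      = map (critical_gen n \<alpha>) (sorted_list_of_set ?Ka) @ map (critical_gen n \<beta>) (sorted_list_of_set ?Kb)"
  proof -
    have "critical_gen n ?\<gamma> (?f t) = critical_gen n \<alpha> t" if "t \<in> ?Ka" for t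
      using f that by (intro critical_gen_cong) (simp add: critical_moments_generic)
    moreover have "critical_gen n ?\<gamma> (?g t) = critical_gen n \<beta> t" if "t \<in> ?Kb" for t
      using g that by (intro critical_gen_cong) (simp add: critical_moments_generic)
    ultimately show ?thesis unfolding sorted using fin by simp
  qed
  then show "braid_reading n ?\<gamma> = braid_reading n \<alpha> \<otimes>\<^bsub>G3 n\<^esub> braid_reading n \<beta>"
    unfolding braid_reading_def
    using tame_critical_gens[OF \<alpha>] tame_critical_gens[OF \<beta>] fin
    by (simp add: G3_class_append)
qed

theorem corollary1:
  fixes n :: nat
  assumes "n \<ge> 3"
  shows "\<exists>f \<phi>. is_reading_map n f \<and> is_phi n \<phi> \<and> group_hom (PB n) (G2 n) (\<phi> \<circ> f)"
proof -
  obtain \<phi> where \<phi>: "is_phi n \<phi>" using is_phi_exists by blast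
  define f where "f C = braid_reading n (SOME \<beta>. \<beta> \<in> C \<and> good_stable n \<beta>)" for C
  have f: "f (braid_class n \<gamma>) = braid_reading n \<beta>"
    if \<gamma>: "braid_loop n \<gamma>" and \<beta>: "tame n \<beta>" "homotopic_paths (conf n) \<gamma> \<beta>" for \<gamma> \<beta>
  proof -
    obtain \<beta>0 where "\<beta>0 \<in> braid_class n \<gamma>" "good_stable n \<beta>0"
      using braid_class_has_good_stable[OF \<gamma>] by blast
    then have "\<exists>\<beta>. \<beta> \<in> braid_class n \<gamma> \<and> good_stable n \<beta>" by blast
    from someI_ex[OF this]
    have s: "(SOME \<beta>. \<beta> \<in> braid_class n \<gamma> \<and> good_stable n \<beta>) \<in> braid_class n \<gamma>"
      "good_stable n (SOME \<beta>. \<beta> \<in> braid_class n \<gamma> \<and> good_stable n \<beta>)" by blast+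
    then have "homotopic_paths (conf n) (SOME \<beta>. \<beta> \<in> braid_class n \<gamma> \<and> good_stable n \<beta>) \<beta>"
      using \<beta>(2) homotopic_paths_sym homotopic_paths_trans unfolding braid_class_mem by blast
    then show ?thesis
      unfolding f_def by (rule reading_homotopic[OF good_stable_imp_tame[OF s(2)] \<beta>(1)])
  qed
  have tame: "tame n \<beta>" "homotopic_paths (conf n) \<gamma> \<beta>" if "good_stable n \<beta>" "\<beta> \<in> braid_class n \<gamma>" for \<beta> \<gamma>
    using good_stable_imp_tame[OF that(1)] that(2) by (simp_all add: braid_class_mem)
  have rep: "\<exists>\<beta>. good_stable n \<beta> \<and> \<beta> \<in> C \<and> tame n \<beta> \<and> braid_loop n \<beta> \<and> C = braid_class n \<beta> \<and> f C = braid_reading n \<beta>"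
    if C: "C \<in> carrier (PB n)" for C
  proof -
    obtain \<gamma> where \<gamma>: "braid_loop n \<gamma>" "C = braid_class n \<gamma>" using C unfolding PB_carrier by blast
    obtain \<beta> where \<beta>: "good_stable n \<beta>" "pure_braid n \<beta>" "\<beta> \<in> braid_class n \<gamma>" "braid_class n \<gamma> = braid_class n \<beta>"
      by (rule braid_class_has_good_stable[OF \<gamma>(1)])
    note t = tame[OF \<beta>(1,3)]
    show ?thesis
      unfolding \<gamma>(2) using \<beta> t(1) pure_braid_imp_loop[OF \<beta>(2)] f[OF \<gamma>(1) t]
      by (intro exI[of _ \<beta>] conjI)
  qed
  have reading: "is_reading_map n f"
    unfolding is_reading_map_def
  proof (intro conjI ballI impI Pi_I)
    fix C assume C: "C \<in> carrier (PB n)"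
    obtain \<beta> where \<beta>: "good_stable n \<beta>" "\<beta> \<in> C" "tame n \<beta>" "f C = braid_reading n \<beta>" using rep[OF C] by blast
    show "f C \<in> carrier (G3 n)"
      using reading_upto_closed[OF \<beta>(3), of 1] reading_upto_1[OF \<beta>(3)] \<beta>(4) by simp
    show "\<exists>\<beta>\<in>C. good_stable n \<beta>" using \<beta> by blast
    fix \<beta>' assume \<beta>': "\<beta>' \<in> C" "good_stable n \<beta>'"
    obtain \<gamma> where \<gamma>: "braid_loop n \<gamma>" "C = braid_class n \<gamma>" using C unfolding PB_carrier by blast
    show "f C = braid_reading n \<beta>'"
      using f[OF \<gamma>(1) tame[OF \<beta>'(2), of \<gamma>]] \<beta>'(1) \<gamma>(2) by simp
  qed
  interpret P: group "PB n" by (rule group_PB)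
  have "group_hom (PB n) (G3 n) f"
    unfolding group_hom_def group_hom_axioms_def
  proof (intro conjI group_PB group_G3 homI)
    show "f C \<in> carrier (G3 n)" if "C \<in> carrier (PB n)" for C
      using reading that unfolding is_reading_map_def by blast
    fix A B assume "A \<in> carrier (PB n)" "B \<in> carrier (PB n)"
    then obtain \<alpha> \<beta> where \<alpha>: "tame n \<alpha>" "braid_loop n \<alpha>" "A = braid_class n \<alpha>" "f A = braid_reading n \<alpha>"
      and \<beta>: "tame n \<beta>" "braid_loop n \<beta>" "B = braid_class n \<beta>" "f B = braid_reading n \<beta>"
      using rep by metis
    have loop: "braid_loop n (\<alpha> +++ \<beta>)" by (rule braid_loop_join[OF \<alpha>(2) \<beta>(2)])
    then have "homotopic_paths (conf n) (\<alpha> +++ \<beta>) (\<alpha> +++ \<beta>)" by (simp add: braid_loop_def)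
    then have "f (braid_class n (\<alpha> +++ \<beta>)) = braid_reading n (\<alpha> +++ \<beta>)"
      by (rule f[OF loop reading_join(1)[OF \<alpha>(1) \<beta>(1) \<alpha>(2) \<beta>(2)]])
    then show "f (A \<otimes>\<^bsub>PB n\<^esub> B) = f A \<otimes>\<^bsub>G3 n\<^esub> f B"
      unfolding \<alpha>(4) \<beta>(4) reading_join(2)[OF \<alpha>(1) \<beta>(1) \<alpha>(2) \<beta>(2)] unfolding \<alpha>(3) \<beta>(3) PB_mult[OF \<alpha>(2) \<beta>(2)] .
  qed
  moreover have "group_hom (G3 n) (G2 n) \<phi>" using \<phi> by (simp add: is_phi_def)
  ultimately have "group_hom (PB n) (G2 n) (\<phi> \<circ> f)"
    unfolding group_hom_def group_hom_axioms_def by (blast intro: Group.hom_compose)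
  then show ?thesis using reading \<phi> by blast
qed

end
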